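(* One has $\overline{V E(\mathcal{S}_{\le1})}\subset\mathbb{H}^2$ (closure in $L^2((0,\infty),du)$), with equality if and only if the Riemann Hypothesis holds.
   Context: $\mathcal{S}_{\le1}$ is the vector space of smooth even functions on $\mathbb{R}$ with support in $[-1,1]$. For an even Schwartz function $\varphi$ on $\mathbb{R}$ and $u>0$, $E(\varphi)(u)=\sum_{n\ge1}\varphi(nu)-\frac{\int_0^\infty\varphi(x)\,dx}{u}$, an element of $L^2((0,\infty),du)$. $V$ is the unitary operator on $L^2((0,\infty),du)$ given by $(Vf)(u)=f(u)-\int_u^\infty\frac{f(v)}{v}\,dv$ (acting as multiplication by $\frac{s-1}{s}$ under the Mellin transform on $\mathrm{Re}(s)=\frac12$). $\mathbb{H}^2$ denotes $L^2((0,1),du)$, viewed as the subspace of $L^2((0,\infty),du)$ of functions vanishing a.e. on $(1,\infty)$. The Riemann Hypothesis asserts that the Riemann zeta function has no zeros with $\mathrm{Re}(s)>\frac12$. *)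

theory Defs
  imports "HOL-Complex_Analysis.Complex_Analysis"
begin

definition smooth :: "(real \<Rightarrow> complex) \<Rightarrow> bool" where
  "smooth \<phi> \<longleftrightarrow> (\<exists>D :: nat \<Rightarrow> real \<Rightarrow> complex. D 0 = \<phi> \<and>
     (\<forall>k x. (D k has_vector_derivative D (Suc k) x) (at x)))"

definition S_le1 :: "(real \<Rightarrow> complex) set" where
  "S_le1 = {\<phi>. smooth \<phi> \<and> (\<forall>x. \<phi> (- x) = \<phi> x) \<and> closure {x. \<phi> x \<noteq> 0} \<subseteq> {-1..1}}"

text \<open>
  The summation index is shifted by one: the sum runs over the positive integers.
  Only values at positive arguments of the maps E and V below are meaningful.
\<close>

definition E_map :: "(real \<Rightarrow> complex) \<Rightarrow> real \<Rightarrow> complex" where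
  "E_map \<phi> u = (\<Sum>n. \<phi> (real (Suc n) * u)) - (LINT x:{0<..}|lborel. \<phi> x) / complex_of_real u"

definition V_op :: "(real \<Rightarrow> complex) \<Rightarrow> real \<Rightarrow> complex" where
  "V_op f u = f u - (LINT v:{u<..}|lborel. f v / complex_of_real v)"

text \<open>
  Elements of \<open>L\<^sup>2((0,\<infinity>), du)\<close> are represented by Borel functions instead of classes modulo
  almost everywhere equality. A subspace of \<open>L\<^sup>2\<close> corresponds to the set of all representatives
  of its elements; \<open>H2\<close> and \<open>L2_closure S\<close> below are closed under almost everywhere equality,
  so inclusion and equality between them mean the same as for the sets of classes.
\<close>

definition pos_measure :: "real measure" where
  "pos_measure = restrict_space lborel {0<..}"

definition L2 :: "(real \<Rightarrow> complex) set" where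
  "L2 = {f \<in> borel_measurable pos_measure. integrable pos_measure (\<lambda>u. (cmod (f u))\<^sup>2)}"

text \<open>
  The squared distance is an extended nonnegative integral, so that it is infinite,
  not zero, when the difference is not square integrable.
\<close>

definition L2_dist_sq :: "(real \<Rightarrow> complex) \<Rightarrow> (real \<Rightarrow> complex) \<Rightarrow> ennreal" where
  "L2_dist_sq f g = (\<integral>\<^sup>+ u. ennreal ((cmod (f u - g u))\<^sup>2) \<partial>pos_measure)"

definition L2_closure :: "(real \<Rightarrow> complex) set \<Rightarrow> (real \<Rightarrow> complex) set" where
  "L2_closure S = {f \<in> L2. \<forall>\<epsilon>>0. \<exists>g\<in>S. L2_dist_sq f g < ennreal (\<epsilon>\<^sup>2)}"

definition H2 :: "(real \<Rightarrow> complex) set" where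
  "H2 = {f \<in> L2. AE u in pos_measure. 1 < u \<longrightarrow> f u = 0}"

text \<open>
  The analytic continuation of the Dirichlet series to the plane without the pole \<open>1\<close>.
  The value \<open>0\<close> at the pole is a dummy that makes the function unique.
\<close>

definition riemann_zeta :: "complex \<Rightarrow> complex" where
  "riemann_zeta = (THE f. f holomorphic_on (- {1}) \<and>
     (\<forall>s. Re s > 1 \<longrightarrow> f s = (\<Sum>n. 1 / of_nat (Suc n) powr s)) \<and> f 1 = 0)"

definition Riemann_Hypothesis :: bool where
  "Riemann_Hypothesis \<longleftrightarrow> (\<forall>s. Re s > 1/2 \<and> s \<noteq> 1 \<longrightarrow> riemann_zeta s \<noteq> 0)"

end

theory Submission
  imports Defs "HOL-Probability.Probability"
begin

text \<open>
  The Mellin transform turns \<open>V (E \<phi>)\<close> into \<open>(s - 1) \<zeta>(s) / s\<close> times the transform of \<open>\<phi>\<close>, and a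
  dilation \<open>u \<mapsto> n u\<close> of \<open>\<phi>\<close> into multiplication by \<open>n powr - s\<close>. So \<open>V \<phi>\<close> lies in the closure of the range
  as soon as Dirichlet polynomials \<open>D\<close> make \<open>\<zeta> D - 1\<close> small on the critical line in \<open>L\<^sup>2\<close> with the
  rapidly decreasing weight given by the transform of \<open>\<phi>\<close>. Under the Riemann Hypothesis this is done in three
  steps: \<open>\<zeta>(s) / \<zeta>(s + \<epsilon>)\<close> tends to \<open>1\<close> and is bounded polynomially in \<open>Im s\<close>, uniformly in \<open>\<epsilon>\<close>,
  because all zeros are to the left; \<open>1 / \<zeta>(s + \<epsilon>)\<close> is a limit of its Gaussian averages along
  the line; and such an average is an everywhere convergent Dirichlet series. For smooth cutoffs
  of \<open>u ^ (2 * m)\<close>, the limits of \<open>V \<phi>\<close> are the even polynomials of mean zero on \<open>(0,1)\<close>; together with one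
  element of the range of nonzero mean they give all even polynomials, which are dense in \<open>H2\<close>.

  Conversely, if \<open>\<zeta>(\<rho>) = 0\<close> and \<open>Re \<rho> > 1/2\<close>, then the conjugate of \<open>u powr (\<rho> - 1)\<close> on \<open>(0,1)\<close> is a
  nonzero element of \<open>H2\<close> orthogonal to the range.
\<close>

section \<open>Analytic continuation of the zeta function\<close>

text \<open>\<open>V\<close> annihilates \<open>1 / u\<close>. The correction term of
  \<open>E\<close> therefore disappears, and \<open>V (E \<phi>)\<close> at \<open>u\<close> is a
  finite sum of values of \<open>V \<phi>\<close> at multiples of \<open>u\<close>; this explains
  the support in \<open>(0, 1)\<close>. On the Mellin side the factor \<open>s - 1\<close> cancels
  the pole of zeta, so the argument runs with the regular function \<open>zeta_reg\<close>, that is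
  \<open>(s - 1) \<zeta>(s)\<close>. The same factor vanishes at \<open>s = 1\<close>, which is why
  every \<open>V \<phi>\<close> has mean zero. In the hard direction the obstacle is that zeros on
  the critical line remain possible. All discs are centred at \<open>4 + i t\<close>: there the
  Dirichlet series of \<open>1 / \<zeta>\<close> converges absolutely and bounds zeta from below,
  and a radius between \<open>7/2\<close> and \<open>4\<close> passes the critical line without
  leaving \<open>Re s > 0\<close>. The resulting powers of \<open>Im s\<close> are enormous but
  harmless, because the transform of a smooth \<open>\<phi>\<close> decays faster than every
  power.\<close>

lemma holomorphic_on_lebesgue_integral:
  fixes f :: "complex \<Rightarrow> 'a \<Rightarrow> complex"
  assumes S: "open S" and meas: "\<And>z. z \<in> S \<Longrightarrow> f z \<in> borel_measurable M"
    and hol: "\<And>x. x \<in> space M \<Longrightarrow> (\<lambda>z. f z x) holomorphic_on S"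
    and g: "integrable M g" and le: "\<And>z x. z \<in> S \<Longrightarrow> x \<in> space M \<Longrightarrow> cmod (f z x) \<le> g x"
  shows "(\<lambda>z. \<integral>x. f z x \<partial>M) holomorphic_on S"
proof (unfold holomorphic_on_open[OF S], intro ballI)
  fix z0 assume z0: "z0 \<in> S"
  obtain e where e: "e > 0" "cball z0 e \<subseteq> S"
    using S z0 open_contains_cball_eq by blast
  define r where "r = e / 2"
  have r: "r > 0" using e by (simp add: r_def)
  have sub: "cball w r \<subseteq> S" if "w \<in> ball z0 r" for w
  proof
    fix v assume "v \<in> cball w r"
    hence "dist z0 v \<le> e" using that dist_triangle[of z0 v w] by (simp add: r_def)
    thus "v \<in> S" using e by auto
  qed
  have int: "integrable M (f z)" if "z \<in> S" for z
    by (rule Bochner_Integration.integrable_bound[OF g meas[OF that]])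
      (use le[OF that] in \<open>auto intro!: AE_I2 intro: order_trans[OF _ abs_ge_self]\<close>)
  \<comment> \<open>Cauchy's inequality on discs of radius \<open>r\<close> bounds the derivative in
    \<open>z\<close> by \<open>g x / r\<close>. The difference quotients thus share an integrable
    majorant, and dominated convergence along sequences yields the complex derivative.\<close>
  have lip: "cmod (f z x - f z0 x) \<le> g x / r * cmod (z - z0)" if z: "z \<in> ball z0 r" and x: "x \<in> space M" for z x
  proof (rule field_differentiable_bound[where S = "ball z0 r" and f' = "deriv (\<lambda>z. f z x)"])
    show "((\<lambda>z. f z x) has_field_derivative deriv (\<lambda>z. f z x) w) (at w within ball z0 r)" if "w \<in> ball z0 r" for w
      by (metis S centre_in_cball has_field_derivative_at_within hol holomorphic_derivI less_imp_le r sub subsetD that x)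
    show "cmod (deriv (\<lambda>z. f z x) w) \<le> g x / r" if w: "w \<in> ball z0 r" for w
    proof -
      have "cmod ((deriv ^^ 1) (\<lambda>z. f z x) w) \<le> fact 1 * g x / r ^ 1"
      proof (rule Cauchy_inequality)
        show "(\<lambda>z. f z x) holomorphic_on ball w r"
          using hol[OF x] sub[OF w] ball_subset_cball by (meson holomorphic_on_subset order_trans)
        show "continuous_on (cball w r) (\<lambda>z. f z x)"
          using hol[OF x] sub[OF w] by (meson holomorphic_on_imp_continuous_on holomorphic_on_subset)
        show "cmod (f v x) \<le> g x" if "cmod (w - v) = r" for v
          using sub[OF w] that x by (intro le) (auto simp: dist_norm)
      qed (use r in auto)
      thus ?thesis by simp
    qed
  qed (use z r in auto)
  define D where "D x = deriv (\<lambda>z. f z x) z0" for x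
  have Dlim: "((\<lambda>z. (f z x - f z0 x) / (z - z0)) \<longlongrightarrow> D x) (at z0)" if "x \<in> space M" for x
    using holomorphic_derivI[OF hol[OF that] S z0] unfolding D_def has_field_derivative_iff by simp
  have "((\<lambda>z. ((\<integral>x. f z x \<partial>M) - (\<integral>x. f z0 x \<partial>M)) / (z - z0)) \<longlongrightarrow> (\<integral>x. D x \<partial>M)) (at z0)"
  proof (unfold tendsto_at_iff_sequentially comp_def, intro allI impI)
    fix X :: "nat \<Rightarrow> complex" assume X: "\<forall>i. X i \<in> UNIV - {z0}" "X \<longlonglongrightarrow> z0"
    from X(2) r obtain N where N: "\<And>n. n \<ge> N \<Longrightarrow> X n \<in> ball z0 r"
      by (metis lim_sequentially dist_commute mem_ball)
    define Y where "Y n = X (n + N)" for n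
    have Y: "Y n \<in> ball z0 r" "Y n \<noteq> z0" "Y n \<in> S" for n
      using N[of "n + N"] X(1) sub[of "Y n"] r by (auto simp: Y_def)
    have Ylim: "Y \<longlonglongrightarrow> z0" unfolding Y_def using X(2) by (rule LIMSEQ_ignore_initial_segment)
    have q: "(\<lambda>n. (f (Y n) x - f z0 x) / (Y n - z0)) \<longlonglongrightarrow> D x" if "x \<in> space M" for x
      using Dlim[OF that] Ylim Y(2) unfolding tendsto_at_iff_sequentially comp_def by blast
    have mq: "(\<lambda>x. (f (Y n) x - f z0 x) / (Y n - z0)) \<in> borel_measurable M" for n
      using meas[OF Y(3)] meas[OF z0] by measurable
    have "(\<lambda>n. \<integral>x. (f (Y n) x - f z0 x) / (Y n - z0) \<partial>M) \<longlonglongrightarrow> (\<integral>x. D x \<partial>M)"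
    proof (rule integral_dominated_convergence[where w = "\<lambda>x. g x / r"])
      show "D \<in> borel_measurable M"
        by (rule borel_measurable_LIMSEQ_metric[OF mq q])
      show "AE x in M. cmod ((f (Y n) x - f z0 x) / (Y n - z0)) \<le> g x / r" for n
        using lip[OF Y(1)[of n]] Y(2)[of n] by (auto simp: norm_divide divide_simps mult.commute)
      show "AE x in M. (\<lambda>n. (f (Y n) x - f z0 x) / (Y n - z0)) \<longlonglongrightarrow> D x"
        using q by auto
    qed (use mq g in auto)
    hence "(\<lambda>n. ((\<integral>x. f (Y n) x \<partial>M) - (\<integral>x. f z0 x \<partial>M)) / (Y n - z0)) \<longlonglongrightarrow> (\<integral>x. D x \<partial>M)"
      using int Y(3) z0 by simp
    thus "(\<lambda>n. ((\<integral>x. f (X n) x \<partial>M) - (\<integral>x. f z0 x \<partial>M)) / (X n - z0)) \<longlonglongrightarrow> (\<integral>x. D x \<partial>M)"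
      unfolding Y_def by (rule LIMSEQ_offset)
  qed
  thus "\<exists>f'. ((\<lambda>z. \<integral>x. f z x \<partial>M) has_field_derivative f') (at z0)"
    unfolding has_field_derivative_iff by blast
qed

text \<open>The integral of \<open>p({x}) x powr - s\<close> over \<open>x \<ge> 1\<close>, where
  \<open>{x}\<close> is the fractional part, cut at the integers into integrals over the unit
  interval.\<close>

definition periodic_mellin :: "(real \<Rightarrow> real) \<Rightarrow> complex \<Rightarrow> complex" where
  "periodic_mellin p s = (\<Sum>n. integral {0..1} (\<lambda>x. of_real (p x) * of_real (real (Suc n) + x) powr - s))"

lemma summable_Suc_powr: "a > 1 \<Longrightarrow> summable (\<lambda>n. real (Suc n) powr - a)"
  using summable_Suc_iff[of "\<lambda>n. real n powr - a"] summable_real_powr_iff[of "-a"] by simp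

lemma continuous_on_shift_powr:
  "continuous_on {0..1} p \<Longrightarrow> continuous_on {0..1} (\<lambda>x. complex_of_real (p x) * of_real (real (Suc n) + x) powr s)"
  by (intro continuous_intros) (auto simp: complex_eq_iff)

lemma integral_term_bound:
  assumes p: "continuous_on {0..1} p" and B: "\<And>x. x \<in> {0..1} \<Longrightarrow> \<bar>p x\<bar> \<le> B" and a: "Re s \<ge> a" "a \<ge> 0"
  shows "cmod (integral {0..1} (\<lambda>x. of_real (p x) * of_real (real (Suc n) + x) powr - s)) \<le> B * real (Suc n) powr - a"
proof -
  have "cmod (integral {0..1} (\<lambda>x. of_real (p x) * of_real (real (Suc n) + x) powr - s)) \<le> B * real (Suc n) powr - a * (1 - 0)"
  proof (rule integral_bound)
    fix x :: real assume x: "x \<in> {0..1}"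
    have "cmod (of_real (p x) * of_real (real (Suc n) + x) powr - s) = \<bar>p x\<bar> * (real (Suc n) + x) powr - Re s"
      using x by (simp add: norm_mult norm_powr_real_powr)
    also have "\<dots> \<le> B * (real (Suc n)) powr - a"
    proof (rule mult_mono)
      have "(real (Suc n) + x) powr - Re s \<le> (real (Suc n) + x) powr - a"
        using a x by (intro powr_mono) auto
      also have "\<dots> \<le> real (Suc n) powr - a"
        using a x by (intro powr_mono2') auto
      finally show "(real (Suc n) + x) powr - Re s \<le> real (Suc n) powr - a" .
    qed (use B[OF x] in auto)
    finally show "cmod (of_real (p x) * of_real (real (Suc n) + x) powr - s) \<le> B * (real (Suc n)) powr - a" .
  qed (use continuous_on_shift_powr[OF p] in auto)
  thus ?thesis by simp
qed

lemma continuous_bounded_01: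
  fixes p :: "real \<Rightarrow> real"
  assumes "continuous_on {0..1} p"
  obtains B where "B \<ge> 0" "\<And>x. x \<in> {0..1} \<Longrightarrow> \<bar>p x\<bar> \<le> B"
proof -
  have "compact (p ` {0..1})" by (rule compact_continuous_image[OF assms]) simp
  then obtain B where "\<forall>x\<in>p ` {0..1}. norm x \<le> B" using compact_imp_bounded bounded_iff by metis
  thus ?thesis by (intro that[of "max B 0"]) force+
qed

lemma periodic_mellin_bound:
  assumes p: "continuous_on {0..1} p" and B: "\<And>x. x \<in> {0..1} \<Longrightarrow> \<bar>p x\<bar> \<le> B" and a: "Re s \<ge> a" "a > 1"
  shows "summable (\<lambda>n. integral {0..1} (\<lambda>x. of_real (p x) * of_real (real (Suc n) + x) powr - s))"
    and "cmod (periodic_mellin p s) \<le> B * (\<Sum>n. real (Suc n) powr - a)"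
proof -
  let ?t = "\<lambda>n. integral {0..1} (\<lambda>x. of_real (p x) * of_real (real (Suc n) + x) powr - s)"
  have le: "cmod (?t n) \<le> B * real (Suc n) powr - a" for n
    by (rule integral_term_bound[OF p B]) (use a in auto)
  have sm: "summable (\<lambda>n. B * real (Suc n) powr - a)"
    using summable_Suc_powr[OF a(2)] by (rule summable_mult)
  show "summable ?t" by (rule summable_comparison_test'[OF sm, of 0]) (use le in auto)
  have sn: "summable (\<lambda>n. cmod (?t n))" by (rule summable_comparison_test'[OF sm, of 0]) (use le in auto)
  have "cmod (periodic_mellin p s) \<le> (\<Sum>n. cmod (?t n))" unfolding periodic_mellin_def by (rule summable_norm[OF sn])
  also have "\<dots> \<le> (\<Sum>n. B * real (Suc n) powr - a)" by (rule suminf_le[OF le sn sm])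
  finally show "cmod (periodic_mellin p s) \<le> B * (\<Sum>n. real (Suc n) powr - a)"
    using suminf_mult[OF summable_Suc_powr[OF a(2)]] by simp
qed

lemma holomorphic_integral_term:
  assumes p: "continuous_on {0..1} p"
  shows "(\<lambda>s. integral {0..1} (\<lambda>x. of_real (p x) * of_real (real (Suc n) + x) powr - s)) holomorphic_on UNIV"
proof -
  have "(\<lambda>s. integral (cbox 0 1) (\<lambda>x. of_real (p x) * of_real (real (Suc n) + x) powr - s)) holomorphic_on UNIV"
  proof (rule leibniz_rule_holomorphic)
    fix s :: complex and x :: real assume x: "x \<in> cbox 0 1"
    show "((\<lambda>s. of_real (p x) * of_real (real (Suc n) + x) powr - s) has_field_derivative
        - (of_real (p x) * Ln (of_real (real (Suc n) + x)) * of_real (real (Suc n) + x) powr - s)) (at s within UNIV)"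
      using x by (auto intro!: derivative_eq_intros simp: powr_def complex_eq_iff algebra_simps)
  next
    show "(\<lambda>x. of_real (p x) * of_real (real (Suc n) + x) powr - s) integrable_on cbox 0 1" for s :: complex
      unfolding cbox_interval by (intro integrable_continuous_real continuous_on_shift_powr p)
  next
    have [continuous_intros]: "continuous_on (UNIV \<times> {0..1}) (\<lambda>x::complex \<times> real. p (snd x))"
      by (rule continuous_on_compose2[OF p]) (auto intro!: continuous_intros)
    show "continuous_on (UNIV \<times> cbox 0 1) (\<lambda>(s, x). - (of_real (p x) * Ln (of_real (real (Suc n) + x)) * of_real (real (Suc n) + x) powr - s))"
      unfolding cbox_interval case_prod_unfold
      by (intro continuous_intros) (auto simp: complex_eq_iff complex_nonpos_Reals_iff)
  qed auto
  thus ?thesis by (simp add: cbox_interval)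
qed

lemma holomorphic_periodic_mellin:
  assumes p: "continuous_on {0..1} p"
  shows "periodic_mellin p holomorphic_on {s. Re s > 1}"
proof -
  obtain B where B: "B \<ge> 0" "\<And>x. x \<in> {0..1} \<Longrightarrow> \<bar>p x\<bar> \<le> B" using continuous_bounded_01[OF p] by blast
  let ?t = "\<lambda>n s. integral {0..1} (\<lambda>x. of_real (p x) * of_real (real (Suc n) + x) powr - s)"
  show ?thesis
  proof (rule holomorphic_uniform_sequence[where f = "\<lambda>N s. \<Sum>n<N. ?t n s"])
    show "open {s. Re s > 1}" by (rule open_halfspace_Re_gt)
    show "(\<lambda>s. \<Sum>n<N. ?t n s) holomorphic_on {s. Re s > 1}" for N
      by (intro holomorphic_on_sum) (use holomorphic_integral_term[OF p] in \<open>blast intro: holomorphic_on_subset\<close>)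
    fix s assume s: "s \<in> {s. Re s > 1}"
    define d where "d = (Re s - 1) / 2"
    have d: "d > 0" using s by (simp add: d_def)
    have re: "Re w \<ge> 1 + d" if "w \<in> cball s d" for w
    proof -
      have "Re s - Re w \<le> d" using that abs_Re_le_cmod[of "s - w"] by (auto simp: dist_norm)
      thus ?thesis unfolding d_def by (simp add: field_simps)
    qed
    have "uniform_limit (cball s d) (\<lambda>N s. \<Sum>n<N. ?t n s) (\<lambda>s. \<Sum>n. ?t n s) sequentially"
    proof (rule Weierstrass_m_test)
      show "cmod (?t n w) \<le> B * real (Suc n) powr - (1 + d)" if "w \<in> cball s d" for n w
        by (rule integral_term_bound[OF p B(2)]) (use re[OF that] d in auto)
      show "summable (\<lambda>n. B * real (Suc n) powr - (1 + d))"
        using d by (intro summable_mult summable_Suc_powr) auto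
    qed
    thus "\<exists>d>0. cball s d \<subseteq> {s. Re s > 1} \<and> uniform_limit (cball s d) (\<lambda>N s. \<Sum>n<N. ?t n s) (periodic_mellin p) sequentially"
      using d re by (intro exI[of _ d]) (force simp: periodic_mellin_def[abs_def])
  qed
qed

lemma telescope_powr_sums:
  fixes s :: complex
  assumes "Re s > 0"
  shows "(\<lambda>n. of_real (real (Suc (Suc n))) powr - s - of_real (real (Suc n)) powr - s) sums (- 1 :: complex)"
proof -
  have "((\<lambda>n. cmod (of_real (real (Suc n)) powr - s)) \<longlonglongrightarrow> 0)"
  proof -
    have "(\<lambda>n. real (Suc n) powr - Re s) \<longlonglongrightarrow> 0"
      using assms by (intro tendsto_neg_powr filterlim_compose[OF filterlim_real_sequentially filterlim_Suc]) auto
    thus ?thesis by (simp add: norm_powr_real_powr del: of_nat_Suc)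
  qed
  hence "(\<lambda>n. of_real (real (Suc n)) powr - s :: complex) \<longlonglongrightarrow> 0" by (simp only: tendsto_norm_zero_iff)
  from telescope_sums[OF this] show ?thesis by simp
qed

lemma integral_term_by_parts:
  fixes s :: complex
  assumes q: "\<And>x. x \<in> {0..1} \<Longrightarrow> (q has_real_derivative p x) (at x within {0..1})"
    and p: "continuous_on {0..1} p"
  shows "integral {0..1} (\<lambda>x. of_real (p x) * of_real (real (Suc n) + x) powr - s) =
    of_real (q 1) * of_real (real (Suc (Suc n))) powr - s - of_real (q 0) * of_real (real (Suc n)) powr - s
    + s * integral {0..1} (\<lambda>x. of_real (q x) * of_real (real (Suc n) + x) powr - (s + 1))"
proof -
  have cq: "continuous_on {0..1} q" using q DERIV_continuous_on by blast
  let ?F = "\<lambda>x. of_real (q x) * of_real (real (Suc n) + x) powr - s"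
  let ?f = "\<lambda>x. of_real (p x) * of_real (real (Suc n) + x) powr - s - s * (of_real (q x) * of_real (real (Suc n) + x) powr - (s + 1))"
  have "(?f has_integral ?F 1 - ?F 0) {0..1}"
  proof (rule fundamental_theorem_of_calculus)
    fix x :: real assume x: "x \<in> {0..1}"
    have c: "complex_of_real (real (Suc n) + x) \<notin> \<real>\<^sub>\<le>\<^sub>0" using x by (simp add: complex_nonpos_Reals_iff del: of_nat_Suc)
    have 1: "((\<lambda>x. complex_of_real (real (Suc n) + x)) has_vector_derivative 1) (at x within {0..1})"
      by (auto intro!: derivative_eq_intros)
    have 2: "((\<lambda>z. z powr - s) has_field_derivative (- s * complex_of_real (real (Suc n) + x) powr (- s - 1))) (at (complex_of_real (real (Suc n) + x)))"
      using has_field_derivative_powr[OF c, of "-s"] by simp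
    have 3: "((\<lambda>x. complex_of_real (real (Suc n) + x) powr - s) has_vector_derivative (- s * complex_of_real (real (Suc n) + x) powr (- s - 1))) (at x within {0..1})"
      using field_vector_diff_chain_within[OF 1 has_field_derivative_at_within[OF 2]] by (simp add: o_def)
    have e: "- s - 1 = - (s + 1)" by simp
    have 4: "((\<lambda>x. complex_of_real (q x)) has_vector_derivative of_real (p x)) (at x within {0..1})"
      using has_vector_derivative_of_real[of q "p x"] q[OF x] by (simp add: has_real_derivative_iff_has_vector_derivative)
    show "(?F has_vector_derivative ?f x) (at x within {0..1})"
      using has_vector_derivative_mult[OF 4 3[unfolded e]] by (rule back_subst[of "\<lambda>d. (_ has_vector_derivative d) _"]) (simp add: algebra_simps)
  qed simp
  moreover have "(?f has_integral integral {0..1} (\<lambda>x. of_real (p x) * of_real (real (Suc n) + x) powr - s)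
      - s * integral {0..1} (\<lambda>x. of_real (q x) * of_real (real (Suc n) + x) powr - (s + 1))) {0..1}"
    by (intro has_integral_diff has_integral_mult_right integrable_integral integrable_continuous_real continuous_on_shift_powr p cq)
  ultimately have "?F 1 - ?F 0 = integral {0..1} (\<lambda>x. of_real (p x) * of_real (real (Suc n) + x) powr - s)
      - s * integral {0..1} (\<lambda>x. of_real (q x) * of_real (real (Suc n) + x) powr - (s + 1))"
    by (rule has_integral_unique)
  thus ?thesis by (simp add: algebra_simps)
qed

text \<open>Integration by parts on every unit interval: since \<open>q 0 = q 1\<close>, the
  boundary terms telescope, and the remaining integrals have the exponent raised by one. The
  right-hand side therefore makes sense one unit further to the left.\<close>

lemma periodic_mellin_step:
  fixes s :: complex
  assumes q: "\<And>x. x \<in> {0..1} \<Longrightarrow> (q has_real_derivative p x) (at x within {0..1})"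
    and p: "continuous_on {0..1} p" and q01: "q 0 = q 1" and s: "Re s > 1"
  shows "periodic_mellin p s = - of_real (q 0) + s * periodic_mellin q (s + 1)"
proof -
  have cq: "continuous_on {0..1} q" using q DERIV_continuous_on by blast
  obtain B where B: "B \<ge> 0" "\<And>x. x \<in> {0..1} \<Longrightarrow> \<bar>q x\<bar> \<le> B" using continuous_bounded_01[OF cq] by blast
  have "(\<lambda>n. integral {0..1} (\<lambda>x. of_real (q x) * of_real (real (Suc n) + x) powr - (s + 1))) sums periodic_mellin q (s + 1)"
    unfolding periodic_mellin_def by (rule summable_sums, rule periodic_mellin_bound(1)[OF cq B(2), of "Re s + 1"]) (use s in auto)
  note S = sums_add[OF sums_mult[OF telescope_powr_sums[of s], of "of_real (q 0)"] sums_mult[OF this, of s]]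
  have "(\<lambda>n. integral {0..1} (\<lambda>x. of_real (p x) * of_real (real (Suc n) + x) powr - s)) =
      (\<lambda>n. of_real (q 0) * (of_real (real (Suc (Suc n))) powr - s - of_real (real (Suc n)) powr - s)
        + s * integral {0..1} (\<lambda>x. of_real (q x) * of_real (real (Suc n) + x) powr - (s + 1)))"
    by (rule ext, subst integral_term_by_parts[OF q p]) (simp_all add: q01 right_diff_distrib)
  with S s have "(\<lambda>n. integral {0..1} (\<lambda>x. of_real (p x) * of_real (real (Suc n) + x) powr - s)) sums (of_real (q 0) * - 1 + s * periodic_mellin q (s + 1))"
    by (simp only:)
  thus ?thesis unfolding periodic_mellin_def by (simp add: sums_iff)
qed

lemma periodic_mellin_halfplane_extension:
  assumes "continuous_on {0..1} p" "integral {0..1} p = 0"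
  shows "\<exists>g. g holomorphic_on {s. Re s > 1 - real k} \<and> (\<forall>s. Re s > 1 \<longrightarrow> g s = periodic_mellin p s)"
  using assms
proof (induction k arbitrary: p)
  case 0
  thus ?case using holomorphic_periodic_mellin[of p] by auto
next
  case (Suc k)
  define q0 where "q0 x = integral {0..x} p" for x
  \<comment> \<open>Mean zero of \<open>p\<close> makes the antiderivative periodic,
    \<open>q 0 = q 1\<close>. The constant of integration is chosen so that \<open>q\<close> has
    mean zero again and the induction hypothesis applies to it.\<close>
  define q where "q x = q0 x - integral {0..1} q0" for x
  have d0: "(q0 has_real_derivative p x) (at x within {0..1})" if "x \<in> {0..1}" for x
    using integral_has_vector_derivative[OF Suc.prems(1) that] unfolding q0_def by (simp add: has_real_derivative_iff_has_vector_derivative)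
  have c0: "continuous_on {0..1} q0" using d0 DERIV_continuous_on by blast
  have d: "(q has_real_derivative p x) (at x within {0..1})" if "x \<in> {0..1}" for x
    unfolding q_def using d0[OF that] by (auto intro!: derivative_eq_intros)
  have c: "continuous_on {0..1} q" using d DERIV_continuous_on by blast
  have q01: "q 0 = q 1" unfolding q_def q0_def using Suc.prems(2) by simp
  have "integral {0..1} q = 0"
    unfolding q_def using integral_diff[OF integrable_continuous_real[OF c0] integrable_const_ivl[of "integral {0..1} q0" 0 1]] by simp
  from Suc.IH[OF c this] obtain g where g: "g holomorphic_on {s. Re s > 1 - real k}"
    "\<And>s. Re s > 1 \<Longrightarrow> g s = periodic_mellin q s" by blast
  define h where "h s = - of_real (q 0) + s * g (s + 1)" for s
  have "g \<circ> (\<lambda>s. s + 1) holomorphic_on {s. Re s > 1 - real (Suc k)}"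
    by (rule holomorphic_on_compose_gen[OF _ g(1)]) (auto intro!: holomorphic_intros)
  hence "h holomorphic_on {s. Re s > 1 - real (Suc k)}" unfolding h_def o_def by (intro holomorphic_intros)
  moreover have "h s = periodic_mellin p s" if "Re s > 1" for s
    using periodic_mellin_step[OF d Suc.prems(1) q01 that] g(2)[of "s + 1"] that by (simp add: h_def)
  ultimately show ?case by blast
qed

text \<open>The extensions to the various half-planes agree by the identity theorem, so they glue to
  an entire function; \<open>K s\<close> picks a half-plane that contains \<open>s\<close>.\<close>

lemma periodic_mellin_extension:
  assumes "continuous_on {0..1} p" "integral {0..1} p = 0"
  obtains G where "G holomorphic_on UNIV" "\<And>s. Re s > 1 \<Longrightarrow> G s = periodic_mellin p s"
proof -
  obtain g where g: "\<And>k. g k holomorphic_on {s. Re s > 1 - real k}" "\<And>k s. Re s > 1 \<Longrightarrow> g k s = periodic_mellin p s"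
    using periodic_mellin_halfplane_extension[OF assms] by metis
  have eq: "g j s = g k s" if "Re s > 1 - real j" "j \<le> k" for j k s
  proof (rule analytic_continuation_open[of "{s. Re s > 1}" "{s. Re s > 1 - real j}" "g j" "g k" s])
    show "{s. 1 < Re s} \<noteq> {}" by (auto intro!: exI[of _ 2])
    show "g k holomorphic_on {s. Re s > 1 - real j}" using that by (intro holomorphic_on_subset[OF g(1)]) auto
  qed (use g that in \<open>auto simp: open_halfspace_Re_gt intro!: convex_connected convex_halfspace_Re_gt\<close>)
  define K where "K s = nat \<lceil>2 - Re s\<rceil>" for s
  have K: "Re s > 1 - real (K s)" for s unfolding K_def by linarith
  define G where "G s = g (K s) s" for s
  have Gk: "G s = g k s" if "Re s > 1 - real k" for s k
    unfolding G_def using eq[OF that, of "K s"] eq[OF K, of s k] by (metis nle_le)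
  have "G holomorphic_on {s. Re s > 1 - real k}" for k
    by (rule holomorphic_transform[OF g(1)[of k]]) (simp add: Gk)
  moreover have "(\<Union>k. {s. Re s > 1 - real k}) = UNIV" using K by blast
  ultimately have "G holomorphic_on UNIV"
    by (metis holomorphic_on_UN_open open_halfspace_Re_gt)
  moreover have "G s = periodic_mellin p s" if "Re s > 1" for s unfolding G_def by (rule g(2)[OF that])
  ultimately show ?thesis by (rule that)
qed

lemma periodic_mellin_const:
  assumes "Re s > 1"
  shows "periodic_mellin (\<lambda>x. c) s = of_real c / (s - 1)"
proof -
  have s: "s \<noteq> 1" using assms by auto
  have *: "integral {0..1} (\<lambda>x. of_real c * of_real (real (Suc n) + x) powr - s) =
     of_real c / (1 - s) * (of_real (real (Suc (Suc n))) powr - (s - 1) - of_real (real (Suc n)) powr - (s - 1))" for n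
  proof -
    have e: "- (s - 1) = 1 - s" by simp
    \<comment> \<open>Integration by parts with the constant \<open>1\<close> as antiderivative of
      \<open>0\<close>, at \<open>s - 1\<close>, evaluates the integral of the power.\<close>
    have "0 = of_real (real (Suc (Suc n))) powr - (s - 1) - of_real (real (Suc n)) powr - (s - 1)
        + (s - 1) * integral {0..1} (\<lambda>x. of_real (real (Suc n) + x) powr - s)"
      using integral_term_by_parts[of "\<lambda>x. 1" "\<lambda>x. 0" n "s - 1"] by simp
    hence "integral {0..1} (\<lambda>x. of_real (real (Suc n) + x) powr - s) =
       (of_real (real (Suc (Suc n))) powr - (s - 1) - of_real (real (Suc n)) powr - (s - 1)) / (1 - s)"
      using s unfolding e by (simp add: divide_simps) (simp add: algebra_simps)
    thus ?thesis by simp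
  qed
  show ?thesis unfolding periodic_mellin_def *
    using sums_unique[OF sums_mult[OF telescope_powr_sums[of "s - 1"], of "of_real c / (1 - s)"]] assms s by (simp add: field_simps)
qed

lemma periodic_mellin_add:
  assumes "continuous_on {0..1} p" "continuous_on {0..1} q" "Re s > 1"
  shows "periodic_mellin (\<lambda>x. p x + q x) s = periodic_mellin p s + periodic_mellin q s"
proof -
  obtain B where B: "\<And>x. x \<in> {0..1} \<Longrightarrow> \<bar>p x\<bar> \<le> B" using continuous_bounded_01[OF assms(1)] by blast
  obtain C where C: "\<And>x. x \<in> {0..1} \<Longrightarrow> \<bar>q x\<bar> \<le> C" using continuous_bounded_01[OF assms(2)] by blast
  have "integral {0..1} (\<lambda>x. of_real (p x + q x) * of_real (real (Suc n) + x) powr - s) =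
    integral {0..1} (\<lambda>x. of_real (p x) * of_real (real (Suc n) + x) powr - s) +
    integral {0..1} (\<lambda>x. of_real (q x) * of_real (real (Suc n) + x) powr - s)" for n
    by (subst integral_add[symmetric])
       (auto simp: algebra_simps simp del: of_nat_Suc intro!: integrable_continuous_real continuous_on_shift_powr[simplified] assms)
  thus ?thesis unfolding periodic_mellin_def
    using suminf_add[OF periodic_mellin_bound(1)[OF assms(1) B order_refl assms(3)] periodic_mellin_bound(1)[OF assms(2) C order_refl assms(3)]] by simp
qed

text \<open>The integral of \<open>(1 - {x}) x powr - (s + 1)\<close> over \<open>x \<ge> 1\<close>.
  It converges absolutely for \<open>Re s > 0\<close> and carries zeta to that half-plane.\<close>

definition zeta_kernel :: "complex \<Rightarrow> complex" where
  "zeta_kernel s = periodic_mellin (\<lambda>x. 1 - x) (s + 1)"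

text \<open>Summation by parts: with \<open>x - 1\<close> as antiderivative of \<open>1\<close>,
  only the boundary term at the left end of each unit interval survives, and this is the term of the
  Dirichlet series. The integrals of the bare powers add up to the pole
  \<open>1 / (s - 1)\<close>.\<close>

lemma dirichlet_series_eq:
  assumes s: "Re s > 1"
  shows "(\<lambda>n. 1 / of_nat (Suc n) powr s) sums (1 / (s - 1) + s * zeta_kernel s)"
proof -
  have c: "continuous_on {0..1} (\<lambda>x::real. 1 - x)" "continuous_on {0..1} (\<lambda>x::real. 1)" by (intro continuous_intros)+
  have *: "1 / of_nat (Suc n) powr s = integral {0..1} (\<lambda>x. of_real 1 * of_real (real (Suc n) + x) powr - s)
     + s * integral {0..1} (\<lambda>x. of_real (1 - x) * of_real (real (Suc n) + x) powr - (s + 1))" for n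
  proof -
    have d: "((\<lambda>x::real. x - 1) has_real_derivative 1) (at x within {0..1})" for x
      by (auto intro!: derivative_eq_intros)
    have i: "integral {0..1} (\<lambda>x. of_real (x - 1) * of_real (real (Suc n) + x) powr - (s + 1)) =
       - integral {0..1} (\<lambda>x. of_real (1 - x) * of_real (real (Suc n) + x) powr - (s + 1))"
      by (subst integral_neg[symmetric]) (simp add: left_diff_distrib)
    have e: "complex_of_real (real (Suc n)) = of_nat (Suc n)" by (rule of_real_of_nat_eq)
    have "integral {0..1} (\<lambda>x. of_real 1 * of_real (real (Suc n) + x) powr - s) =
        of_nat (Suc n) powr - s - s * integral {0..1} (\<lambda>x. of_real (1 - x) * of_real (real (Suc n) + x) powr - (s + 1))"
      unfolding integral_term_by_parts[OF d c(2), of n s] i e by simp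
    thus ?thesis by (simp only: powr_minus inverse_eq_divide) simp
  qed
  have 1: "(\<lambda>n. integral {0..1} (\<lambda>x. of_real 1 * of_real (real (Suc n) + x) powr - s)) sums (1 / (s - 1))"
    using summable_sums[OF periodic_mellin_bound(1)[OF c(2), of 1 "Re s" s]] periodic_mellin_const[OF s, of 1] s
    unfolding periodic_mellin_def by simp
  have 2: "(\<lambda>n. integral {0..1} (\<lambda>x. of_real (1 - x) * of_real (real (Suc n) + x) powr - (s + 1))) sums zeta_kernel s"
    unfolding zeta_kernel_def periodic_mellin_def
    by (rule summable_sums, rule periodic_mellin_bound(1)[OF c(1), of 1 "Re s + 1"]) (use s in auto)
  show ?thesis unfolding * by (intro sums_add sums_mult 1 2)
qed

text \<open>\<open>riemann_zeta\<close> is a definite description, so a continuation to the whole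
  punctured plane has to exist, and be unique, before anything can be said about it. The kernel
  \<open>1 - x\<close> is split into its mean \<open>1/2\<close> and the mean-zero part
  \<open>1/2 - x\<close>; the latter has an entire extension, the former contributes an explicit
  term.\<close>

lemma riemann_zeta_properties:
  "riemann_zeta holomorphic_on (- {1}) \<and> (\<forall>s. Re s > 1 \<longrightarrow> riemann_zeta s = (\<Sum>n. 1 / of_nat (Suc n) powr s)) \<and> riemann_zeta 1 = 0"
  "Re s > 0 \<Longrightarrow> s \<noteq> 1 \<Longrightarrow> riemann_zeta s = 1 / (s - 1) + s * zeta_kernel s"
proof -
  let ?P = "\<lambda>f. f holomorphic_on (- {1}) \<and> (\<forall>s. Re s > 1 \<longrightarrow> f s = (\<Sum>n. 1 / of_nat (Suc n) powr s)) \<and> f 1 = 0"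
  have c: "continuous_on {0..1} (\<lambda>x::real. 1/2 - x)" "continuous_on {0..1} (\<lambda>x::real. 1/2)" by (intro continuous_intros)+
  have int0: "integral {0..1} (\<lambda>x::real. 1/2 - x) = 0"
  proof -
    have "((\<lambda>x::real. 1/2 - x) has_integral (1/2 * 1 - 1\<^sup>2/2) - (1/2 * 0 - 0\<^sup>2/2)) {0..1}"
      by (rule fundamental_theorem_of_calculus)
        (auto intro!: derivative_eq_intros simp: has_real_derivative_iff_has_vector_derivative[symmetric])
    thus ?thesis by (simp add: has_integral_iff)
  qed
  obtain G where G: "G holomorphic_on UNIV" "\<And>s. Re s > 1 \<Longrightarrow> G s = periodic_mellin (\<lambda>x. 1/2 - x) s"
    using periodic_mellin_extension[OF c(1) int0] by blast
  define f where "f s = (if s = 1 then 0 else 1 / (s - 1) + 1/2 + s * G (s + 1))" for s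
  have fk: "f s = 1 / (s - 1) + s * zeta_kernel s" if "Re s > 0" "s \<noteq> 1" for s
  proof -
    have r: "(\<lambda>x::real. 1/2 + (1/2 - x)) = (\<lambda>x. 1 - x)" by auto
    have "zeta_kernel s = 1 / (2 * s) + G (s + 1)"
      using periodic_mellin_add[OF c(2) c(1), of "s + 1"] periodic_mellin_const[of "s + 1" "1/2"] that G(2)[of "s + 1"]
      unfolding r by (simp add: zeta_kernel_def)
    moreover have "s \<noteq> 0" using that by auto
    ultimately show ?thesis using that by (simp add: f_def field_simps)
  qed
  have "G \<circ> (\<lambda>s. s + 1) holomorphic_on (- {1})"
    by (rule holomorphic_on_compose_gen[OF _ G(1)]) (auto intro!: holomorphic_intros)
  hence "(\<lambda>s. 1 / (s - 1) + 1/2 + s * G (s + 1)) holomorphic_on (- {1})" unfolding o_def by (intro holomorphic_intros) auto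
  hence "f holomorphic_on (- {1})" by (rule holomorphic_transform) (auto simp: f_def)
  moreover have "f s = (\<Sum>n. 1 / of_nat (Suc n) powr s)" if "Re s > 1" for s
  proof -
    have s: "Re s > 0" "s \<noteq> 1" using that by auto
    show ?thesis unfolding fk[OF s] by (rule sums_unique[OF dirichlet_series_eq[OF that]])
  qed
  ultimately have f: "?P f" by (auto simp: f_def)
  have uniq: "g = f" if g: "?P g" for g
  proof
    fix s
    show "g s = f s"
    proof (cases "s = 1")
      case True
      thus ?thesis using f g by metis
    next
      case False
      show ?thesis
      proof (rule analytic_continuation_open[of "{s. Re s > 1}" "- {1}" g f s])
        show "{s. 1 < Re s} \<noteq> {}" by (auto intro!: exI[of _ 2])
        show "connected (- {1 :: complex})" by (simp add: connected_punctured_universe)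
        show "open {s. 1 < Re s}" by (rule open_halfspace_Re_gt)
        show "open (- {1 :: complex})" by (rule open_Compl) simp
        show "{s. 1 < Re s} \<subseteq> - {1}" by auto
        show "g holomorphic_on - {1}" "f holomorphic_on - {1}" using f g by blast+
        show "g z = f z" if "z \<in> {s. 1 < Re s}" for z
        proof -
          have "1 < Re z" using that by simp
          thus ?thesis using f g by metis
        qed
      qed (use False in simp)
    qed
  qed
  have z: "riemann_zeta = f" unfolding riemann_zeta_def by (rule the_equality[of ?P f, OF f uniq])
  show "?P riemann_zeta" unfolding z by (rule f)
  show "Re s > 0 \<Longrightarrow> s \<noteq> 1 \<Longrightarrow> riemann_zeta s = 1 / (s - 1) + s * zeta_kernel s" unfolding z by (rule fk)
qed

text \<open>On \<open>Re s > 0\<close> this is \<open>(s - 1) \<zeta>(s)\<close>, written so that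
  holomorphy and the value \<open>1\<close> at \<open>s = 1\<close> are immediate.\<close>

definition zeta_reg :: "complex \<Rightarrow> complex" where
  "zeta_reg s = 1 + (s - 1) * s * zeta_kernel s"

lemma zeta_reg_1 [simp]: "zeta_reg 1 = 1" by (simp add: zeta_reg_def)

lemma zeta_reg_eq: "Re s > 0 \<Longrightarrow> s \<noteq> 1 \<Longrightarrow> zeta_reg s = (s - 1) * riemann_zeta s"
  by (simp add: zeta_reg_def riemann_zeta_properties(2) field_simps)

lemma zeta_reg_sums:
  assumes "Re s > 1"
  shows "(\<lambda>n. of_nat (Suc n) powr - s) sums (zeta_reg s / (s - 1))"
proof -
  have "s \<noteq> 1" using assms by auto
  thus ?thesis using dirichlet_series_eq[OF assms] by (simp add: zeta_reg_def powr_minus field_simps)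
qed

lemma holomorphic_zeta_reg: "zeta_reg holomorphic_on {s. Re s > 0}"
proof -
  have "periodic_mellin (\<lambda>x. 1 - x) holomorphic_on {s. Re s > 1}"
    by (intro holomorphic_periodic_mellin continuous_intros)
  hence "periodic_mellin (\<lambda>x. 1 - x) \<circ> (\<lambda>s. s + 1) holomorphic_on {s. Re s > 0}"
    by (rule holomorphic_on_compose_gen[rotated]) (auto intro!: holomorphic_intros)
  hence "zeta_kernel holomorphic_on {s. Re s > 0}" by (simp add: o_def zeta_kernel_def[abs_def])
  thus ?thesis unfolding zeta_reg_def[abs_def] by (intro holomorphic_intros)
qed

text \<open>The kernel is bounded on \<open>Re s \<ge> 1/8\<close>, so only the two factors in front
  of it grow. The abscissa \<open>1/8\<close> is the leftmost one reached by discs of radius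
  \<open>31/8\<close> around \<open>4 + i t\<close>.\<close>

lemma zeta_reg_growth:
  obtains C where "C \<ge> 1" "\<And>s. Re s \<ge> 1/8 \<Longrightarrow> cmod (zeta_reg s) \<le> C * (2 + cmod s)\<^sup>2"
proof -
  define C where "C = (\<Sum>n. real (Suc n) powr - (9/8))"
  have C0: "C \<ge> 0" unfolding C_def by (intro suminf_nonneg summable_Suc_powr) auto
  have "cmod (zeta_reg s) \<le> (1 + C) * (2 + cmod s)\<^sup>2" if "Re s \<ge> 1/8" for s
  proof -
    have "cmod (zeta_kernel s) \<le> 1 * C" unfolding zeta_kernel_def C_def
      by (rule periodic_mellin_bound(2)) (use that in \<open>auto intro!: continuous_intros\<close>)
    hence "cmod ((s - 1) * s * zeta_kernel s) \<le> (2 + cmod s) * (2 + cmod s) * C"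
      unfolding norm_mult using norm_triangle_ineq4[of s 1] C0 by (intro mult_mono) auto
    moreover have "1 \<le> (2 + cmod s)\<^sup>2" by (rule one_le_power) simp
    ultimately have "cmod (zeta_reg s) \<le> (2 + cmod s)\<^sup>2 + (2 + cmod s) * (2 + cmod s) * C"
      unfolding zeta_reg_def using norm_triangle_ineq[of 1 "(s - 1) * s * zeta_kernel s"] unfolding norm_one by linarith
    thus ?thesis by (simp add: power2_eq_square algebra_simps)
  qed
  thus ?thesis using C0 by (intro that[of "1 + C"]) auto
qed

section \<open>Comparison of values of a holomorphic function along a horizontal line\<close>

text \<open>The Borel-Caratheodory inequality. The map \<open>u\<close> to
  \<open>u / (2 A - u)\<close> takes the half-plane \<open>Re u < A\<close> into the unit disc and
  fixes \<open>0\<close>, so Schwarz's lemma applies to its composition with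
  \<open>h\<close>.\<close>

lemma borel_caratheodory_strict:
  assumes hol: "h holomorphic_on ball 0 R" and R: "R > 0" and h0: "h 0 = 0" and A: "\<And>z. z \<in> ball 0 R \<Longrightarrow> Re (h z) < A"
    and z: "cmod z < R"
  shows "cmod (h z) \<le> 2 * A * cmod z / (R - cmod z)"
proof -
  have A0: "A > 0" using A[of 0] R h0 by simp
  define \<phi> where "\<phi> w = h (of_real R * w) / (2 * of_real A - h (of_real R * w))" for w
  have sub: "(\<lambda>w::complex. of_real R * w) ` ball 0 1 \<subseteq> ball 0 R" using R by (auto simp: norm_mult dist_norm)
  have lt: "cmod u < cmod (2 * of_real A - u)" if "Re u < A" for u
  proof (rule power2_less_imp_less)
    have "(cmod (2 * of_real A - u))\<^sup>2 - (cmod u)\<^sup>2 = (2 * A - Re u)\<^sup>2 + (Im u)\<^sup>2 - ((Re u)\<^sup>2 + (Im u)\<^sup>2)"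
      by (simp add: cmod_power2)
    also have "\<dots> = 4 * A * (A - Re u)" by (simp add: power2_eq_square algebra_simps)
    also have "\<dots> > 0" using A0 that by simp
    finally show "(cmod u)\<^sup>2 < (cmod (2 * of_real A - u))\<^sup>2" by simp
  qed simp
  have ReA: "Re (h (of_real R * w)) < A" if "cmod w < 1" for w
    using that R by (intro A) (auto simp: norm_mult)
  have "cmod (\<phi> (z / R)) \<le> cmod (z / R)"
  proof (rule Schwarz_Lemma(1))
    have "h \<circ> (\<lambda>w. of_real R * w) holomorphic_on ball 0 1"
      by (rule holomorphic_on_compose_gen[OF _ hol sub]) (intro holomorphic_intros)
    moreover have "2 * of_real A - h (of_real R * w) \<noteq> 0" if "w \<in> ball 0 1" for w
      using lt[OF ReA[of w]] that by auto
    ultimately show "\<phi> holomorphic_on ball 0 1" unfolding \<phi>_def[abs_def] o_def by (intro holomorphic_intros) auto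
    show "cmod (\<phi> w) < 1" if "cmod w < 1" for w
      using lt[OF ReA[OF that]] by (auto simp: \<phi>_def norm_divide divide_simps)
    show "cmod (z / complex_of_real R) < 1" using z R by (simp add: norm_divide)
  qed (simp add: \<phi>_def h0)
  hence "cmod (h z) / cmod (2 * of_real A - h z) \<le> cmod z / R"
    using R by (simp add: \<phi>_def norm_divide)
  moreover have "cmod (2 * of_real A - h z) > 0" using lt[of "h z"] A[of z] z by auto
  ultimately have "R * cmod (h z) \<le> cmod z * cmod (2 * of_real A - h z)"
    using R by (simp add: divide_simps mult.commute)
  also have "\<dots> \<le> cmod z * (2 * A + cmod (h z))"
    using norm_triangle_ineq4[of "2 * of_real A" "h z"] A0 by (intro mult_left_mono) (auto simp: norm_mult)
  finally have "(R - cmod z) * cmod (h z) \<le> 2 * A * cmod z" by (simp add: algebra_simps)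
  thus ?thesis using z by (simp add: field_simps)
qed

text \<open>A zero-free \<open>f\<close> has a logarithm on the disc. Relative to the centre its
  real part stays below \<open>ln M\<close>, hence Borel-Caratheodory bounds its variation;
  comparing two points costs this bound twice, which gives the exponent.\<close>

lemma zero_free_comparison:
  assumes hol: "f holomorphic_on ball 0 R" and r: "0 < r" "r < R" and nz: "\<And>z. z \<in> ball 0 R \<Longrightarrow> f z \<noteq> 0"
    and M: "\<And>z. z \<in> ball 0 R \<Longrightarrow> cmod (f z) < M * cmod (f 0)" and z: "cmod z \<le> r" "cmod w \<le> r"
  shows "cmod (f z) \<le> M powr (4 * r / (R - r)) * cmod (f w)"
proof -
  obtain g where g: "g holomorphic_on ball 0 R" "\<And>z. z \<in> ball 0 R \<Longrightarrow> f z = exp (g z)"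
    using contractible_imp_holomorphic_log[OF hol _ nz] convex_imp_contractible[of "ball 0 R"] by (metis convex_ball)
  have R0: "0 \<in> ball 0 R" using r by simp
  have f0: "cmod (f 0) > 0" using nz[OF R0] by simp
  have M0: "M > 1" using M[OF R0] f0 by simp
  have Re: "Re (g u - g 0) < ln M" if "u \<in> ball 0 R" for u
  proof -
    have "exp (Re (g u - g 0)) < M"
      using M[OF that] f0 unfolding g(2)[OF that] g(2)[OF R0] by (simp add: exp_diff divide_simps)
    thus ?thesis using M0 by (metis exp_less_cancel_iff exp_ln less_trans zero_less_one)
  qed
  have bd: "cmod (g u - g 0) \<le> 2 * ln M * r / (R - r)" if u: "cmod u \<le> r" for u
  proof -
    have "cmod (g u - g 0) \<le> 2 * ln M * cmod u / (R - cmod u)"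
      by (rule borel_caratheodory_strict[where h = "\<lambda>z. g z - g 0"])
         (use g(1) r Re u in \<open>auto intro!: holomorphic_intros\<close>)
    also have "\<dots> \<le> 2 * ln M * r / (R - r)"
      using u r M0 by (intro frac_le mult_left_mono) auto
    finally show ?thesis .
  qed
  have "Re (g z - g w) \<le> cmod (g z - g 0) + cmod (g w - g 0)"
    using complex_Re_le_cmod[of "g z - g w"] norm_triangle_ineq4[of "g z - g 0" "g w - g 0"] by simp
  also have "\<dots> \<le> 2 * (2 * ln M * r / (R - r))" using bd[OF z(1)] bd[OF z(2)] by linarith
  also have "\<dots> = 4 * r / (R - r) * ln M" by simp
  finally have "exp (Re (g z)) \<le> exp (4 * r / (R - r) * ln M) * exp (Re (g w))"
    by (simp add: exp_add[symmetric])
  thus ?thesis using g(2)[of z] g(2)[of w] z r M0 by (simp add: powr_def)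
qed

lemma maximum_modulus_cball:
  assumes "f holomorphic_on S" "cball 0 R \<subseteq> S" "R > 0"
    and "\<And>u. cmod u = R \<Longrightarrow> cmod (f u) \<le> B" and "cmod z \<le> R"
  shows "cmod (f z) \<le> B"
proof (rule maximum_modulus_frontier[of f "cball 0 R"])
  show "f holomorphic_on interior (cball 0 R)"
    using assms(1) by (rule holomorphic_on_subset) (use assms(2) interior_subset in blast)
  show "continuous_on (closure (cball 0 R)) f"
    using holomorphic_on_imp_continuous_on[OF assms(1)] assms(2) by (simp add: continuous_on_subset)
  show "cmod (f u) \<le> B" if "u \<in> frontier (cball 0 R)" for u
  proof -
    have "cmod u = R" using that by (simp add: frontier_cball)
    thus ?thesis by (rule assms(4))
  qed
  show "z \<in> cball 0 R" using assms(5) by simp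
qed simp

text \<open>
  The zeros are divided out one by one by Blaschke factors of the disc of radius \<open>R\<close>, each of which lowers
  \<open>M\<close> by the factor \<open>R / R1\<close>. As every zero \<open>a\<close> lies to the left of \<open>z\<close>, the factor \<open>z - a\<close> only grows in
  modulus when \<open>z\<close> moves to the right; the second condition on \<open>A\<close> pays for the denominators of the factors.
\<close>

lemma horizontal_comparison:
  assumes r: "0 < r" "r < R1" "R1 < R" and S: "open S" "cball 0 R \<subseteq> S"
    and A: "A \<ge> 4 * r / (R1 - r)" "(R / R1) powr A \<ge> 1 + 2 * r / (R - r)"
    and z: "cmod z \<le> r" "cmod (z + of_real e) \<le> r" "e \<ge> 0" "Re z \<ge> c"
  shows "f holomorphic_on S \<Longrightarrow> f 0 \<noteq> 0 \<Longrightarrow> (\<And>u. cmod u = R \<Longrightarrow> cmod (f u) \<le> M * cmod (f 0)) \<Longrightarrow>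
    (\<And>u. cmod u \<le> R1 \<Longrightarrow> f u = 0 \<Longrightarrow> Re u \<le> c) \<Longrightarrow> M < (R / R1) ^ n \<Longrightarrow>
    cmod (f z) \<le> (2 * M) powr A * cmod (f (z + of_real e))"
proof (induction n arbitrary: f M)
  \<comment> \<open>Here \<open>M < 1\<close>, in conflict with the maximum principle at the centre.
    So \<open>n\<close> limits how many zeros can be divided out.\<close>
  case (0 f M)
  have "cmod (f 0) \<le> M * cmod (f 0)"
    by (rule maximum_modulus_cball[OF 0(1) S(2) _ 0(3)]) (use r in auto)
  thus ?case using 0(2,5) by (simp add: mult_le_cancel_right1)
next
  case (Suc n f M)
  have max: "cmod (f u) \<le> M * cmod (f 0)" if "cmod u \<le> R" for u
    by (rule maximum_modulus_cball[OF Suc(2) S(2) _ Suc(4) that]) (use r in auto)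
  have f0: "cmod (f 0) > 0" using Suc(3) by simp
  have M1: "M \<ge> 1" using max[of 0] f0 r by (simp add: mult_le_cancel_right1)
  show ?case
  proof (cases "\<exists>a. cmod a \<le> R1 \<and> f a = 0")
    \<comment> \<open>Without zeros in the disc of radius \<open>R1\<close> the zero-free comparison
      applies, with \<open>2 * M\<close> because it asks for a strict bound.\<close>
    case False
    have "cmod (f z) \<le> (2 * M) powr (4 * r / (R1 - r)) * cmod (f (z + of_real e))"
    proof (rule zero_free_comparison[where f = f and R = R1 and r = r])
      show "f holomorphic_on ball 0 R1" using Suc(2)
      proof (rule holomorphic_on_subset)
        show "ball 0 R1 \<subseteq> S" using S(2) r(3) by (meson ball_subset_cball less_imp_le order_trans subset_ball)
      qed
      show "cmod (f u) < 2 * M * cmod (f 0)" if "u \<in> ball 0 R1" for u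
      proof -
        have "M * cmod (f 0) > 0" using M1 f0 by simp
        thus ?thesis using max[of u] that r by (simp add: algebra_simps)
      qed
    qed (use False r z in auto)
    also have "\<dots> \<le> (2 * M) powr A * cmod (f (z + of_real e))"
      using A(1) M1 by (intro mult_right_mono powr_mono) auto
    finally show ?thesis .
  next
    case True
    then obtain a where a: "cmod a \<le> R1" "f a = 0" by blast
    have a0: "a \<noteq> 0" using a Suc(3) by auto
    \<comment> \<open>\<open>k\<close> is the denominator of the Blaschke factor for
      \<open>a\<close>. On the circle of radius \<open>R\<close> it has the modulus of
      \<open>u - a\<close>, and it has no zero in the disc. Replacing the factor
      \<open>u - a\<close> of \<open>f\<close> by \<open>k u\<close> therefore keeps the moduli on
      the circle and creates no zeros, while the modulus at \<open>0\<close> grows by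
      \<open>R / cmod a\<close>.\<close>
    define k where "k u = (of_real (R\<^sup>2) - cnj a * u) / of_real R" for u
    define q where "q u = (if u = a then deriv f a else (f u - f a) / (u - a))" for u
    define g where "g u = q u * k u" for u
    have aR: "cmod a < R" using a r by simp
    have fq: "f u = q u * (u - a)" for u by (auto simp: q_def a)
    have kle: "R - cmod u \<le> cmod (k u)" if "cmod u \<le> R" for u
    proof -
      have "cmod (cnj a * u) \<le> R * cmod u" using aR by (simp add: norm_mult mult_right_mono)
      hence "R * R - R * cmod u \<le> cmod (of_real (R\<^sup>2) - cnj a * u)"
        using norm_triangle_ineq2[of "of_real (R\<^sup>2)" "cnj a * u"] r unfolding norm_of_real by (simp add: power2_eq_square)
      thus ?thesis unfolding k_def using r by (simp add: norm_divide field_simps)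
    qed
    have kR: "cmod (k u) = cmod (u - a)" if "cmod u = R" for u
    proof -
      have "of_real (R\<^sup>2) - cnj a * u = u * cnj (u - a)"
        using that complex_norm_square[of u] by (simp add: algebra_simps)
      hence "cmod (of_real (R\<^sup>2) - cnj a * u) = R * cmod (u - a)" using that by (simp only: norm_mult complex_mod_cnj)
      thus ?thesis unfolding k_def norm_divide using r by simp
    qed
    define M' where "M' = M * (cmod a / R)"
    have g0: "cmod (g 0) = cmod (f 0) * (R / cmod a)"
      using a0 r by (simp add: g_def fq norm_mult k_def norm_divide power2_eq_square)
    have "cmod (g z) \<le> (2 * M') powr A * cmod (g (z + of_real e))"
    proof (rule Suc.IH[of g M'])
      have "q holomorphic_on S" unfolding q_def[abs_def] by (rule pole_lemma_open[OF Suc(2) S(1)])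
      moreover have "k holomorphic_on S" unfolding k_def[abs_def] using r by (intro holomorphic_intros) auto
      ultimately show "g holomorphic_on S" unfolding g_def[abs_def] by (intro holomorphic_intros)
      show "g 0 \<noteq> 0" using g0 f0 a0 r by auto
      show "cmod (g u) \<le> M' * cmod (g 0)" if "cmod u = R" for u
      proof -
        have "cmod (g u) = cmod (f u)" unfolding g_def fq[of u] norm_mult kR[OF that] ..
        also have "\<dots> \<le> M' * cmod (g 0)" using Suc(4)[OF that] a0 r unfolding g0 M'_def by simp
        finally show ?thesis .
      qed
      show "Re u \<le> c" if "cmod u \<le> R1" "g u = 0" for u
      proof -
        have "k u \<noteq> 0" using kle[of u] that r by auto
        hence "f u = 0" using that(2) by (simp add: g_def fq)
        thus ?thesis using Suc(5) that by blast
      qed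
      have "M' \<le> M * (R1 / R)" unfolding M'_def using M1 a r by (intro mult_left_mono divide_right_mono) auto
      also have "\<dots> < (R / R1) ^ Suc n * (R1 / R)" using Suc(6) r by (intro mult_strict_right_mono) auto
      also have "\<dots> = (R / R1) ^ n" using r by simp
      finally show "M' < (R / R1) ^ n" .
    qed
    also have "(2 * M') powr A = (2 * M) powr A * (cmod a / R) powr A"
      unfolding M'_def using M1 r by (subst powr_mult[symmetric]) (auto simp: mult.assoc)
    finally have 1: "cmod (g z) \<le> (2 * M) powr A * (cmod a / R) powr A * cmod (g (z + of_real e))" .
    have zR: "cmod z \<le> R" "cmod (z + of_real e) \<le> R" using z r by auto
    have kz: "cmod (k z) > 0" using kle[OF zR(1)] z r by auto
    have "Re a \<le> c" using Suc(5) a by blast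
    hence za: "cmod (z - a) \<le> cmod (z + of_real e - a)"
    proof -
      have "(Re z - Re a)\<^sup>2 \<le> (Re z + e - Re a)\<^sup>2" using \<open>Re a \<le> c\<close> z by (intro power_mono) auto
      thus ?thesis by (simp add: cmod_def)
    qed
    have e: "e \<le> 2 * r" using norm_triangle_ineq4[of "z + of_real e" z] z by simp
    have kk: "cmod (k (z + of_real e)) \<le> (R / R1) powr A * cmod (k z)"
    proof -
      have "k (z + of_real e) = k z - cnj a * of_real e / of_real R" by (simp add: k_def diff_divide_distrib add_divide_distrib distrib_left)
      hence "cmod (k (z + of_real e)) \<le> cmod (k z) + cmod a * e / R"
        using norm_triangle_ineq4[of "k z" "cnj a * of_real e / of_real R"] r z by (simp add: norm_mult norm_divide)
      also have "cmod a * e / R \<le> e" using mult_right_mono[of "cmod a" R e] aR r z by (simp add: divide_simps mult.commute)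
      also have "e \<le> 2 * r / (R - r) * cmod (k z)"
      proof -
        have "R - r \<le> cmod (k z)" using kle[OF zR(1)] z by simp
        hence "2 * r * (R - r) \<le> 2 * r * cmod (k z)" using r by simp
        moreover have "e * (R - r) \<le> 2 * r * (R - r)" using e r by (intro mult_right_mono) auto
        ultimately have "e * (R - r) \<le> 2 * r * cmod (k z)" by linarith
        thus ?thesis using r by (simp add: field_simps)
      qed
      finally have "cmod (k (z + of_real e)) \<le> (1 + 2 * r / (R - r)) * cmod (k z)" by (simp add: algebra_simps)
      also have "\<dots> \<le> (R / R1) powr A * cmod (k z)" by (intro mult_right_mono A) auto
      finally show ?thesis .
    qed
    \<comment> \<open>The gain \<open>(cmod a / R) powr A\<close> from the smaller \<open>M'\<close>
      pays for the loss \<open>(R / R1) powr A\<close> from \<open>k\<close>, because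
      \<open>cmod a \<le> R1\<close>.\<close>
    have aa: "(cmod a / R) powr A * (R / R1) powr A \<le> 1"
    proof -
      have "(cmod a / R) powr A * (R / R1) powr A = (cmod a / R1) powr A"
        using a r by (subst powr_mult[symmetric]) auto
      also have "\<dots> \<le> 1"
      proof -
        have "A \<ge> 0" using A(1) r by (meson divide_nonneg_nonneg less_eq_real_def mult_nonneg_nonneg order_trans zero_le_numeral diff_ge_0_iff_ge)
        thus ?thesis using a r by (intro powr_le1) auto
      qed
      finally show ?thesis .
    qed
    have "cmod (f z) * cmod (k z) = cmod (g z) * cmod (z - a)" by (simp add: g_def fq[of z] norm_mult)
    also have "\<dots> \<le> ((2 * M) powr A * (cmod a / R) powr A * cmod (g (z + of_real e))) * cmod (z + of_real e - a)"
      by (intro mult_mono 1 za) auto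
    also have "\<dots> = (2 * M) powr A * (cmod a / R) powr A * (cmod (f (z + of_real e)) * cmod (k (z + of_real e)))"
      by (simp add: g_def fq[of "z + of_real e"] norm_mult)
    also have "\<dots> \<le> (2 * M) powr A * (cmod a / R) powr A * (cmod (f (z + of_real e)) * ((R / R1) powr A * cmod (k z)))"
      by (intro mult_left_mono kk) auto
    also have "\<dots> = (2 * M) powr A * ((cmod a / R) powr A * (R / R1) powr A) * cmod (f (z + of_real e)) * cmod (k z)"
      by (simp only: mult_ac)
    also have "\<dots> \<le> (2 * M) powr A * 1 * cmod (f (z + of_real e)) * cmod (k z)"
      by (intro mult_right_mono mult_left_mono aa) auto
    finally show ?thesis using kz by simp
  qed
qed

section \<open>The Dirichlet series of the reciprocal of zeta\<close>

text \<open>The Moebius function, as the Dirichlet inverse of the constant \<open>1\<close>: the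
  recursion solves the condition that its sums over all divisors vanish for
  \<open>n > 1\<close>.\<close>

function dirichlet_inv :: "nat \<Rightarrow> real" where
  "dirichlet_inv n = (if n = 1 then 1 else - (\<Sum>d\<in>{d. d dvd n \<and> d < n}. dirichlet_inv d))"
  by auto
termination by (relation "Wellfounded.measure id") auto

declare dirichlet_inv.simps [simp del]

lemma dirichlet_inv_sum:
  assumes "n > 0"
  shows "(\<Sum>d\<in>{d. d dvd n}. dirichlet_inv d) = (if n = 1 then 1 else 0)"
proof (cases "n = 1")
  case True
  thus ?thesis using dirichlet_inv.simps[of 1] by simp
next
  case False
  have "{d. d dvd n} = insert n {d. d dvd n \<and> d < n}" using assms by (auto dest: dvd_imp_le)
  moreover have "finite {d. d dvd n \<and> d < n}" by simp
  ultimately show ?thesis using False by (simp add: dirichlet_inv.simps[of n])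
qed

lemma sum_inverse_squares_le: "(\<Sum>k=2..n. 1 / (real k)\<^sup>2) \<le> 1"
proof -
  have "(\<Sum>k=2..n. 1 / (real k)\<^sup>2) \<le> 1 - 1 / real n" if "n \<ge> 1"
    using that
  proof (induction n rule: dec_induct)
    case (step m)
    have "1 / (real (Suc m))\<^sup>2 \<le> 1 / real m - 1 / real (Suc m)"
      using step by (simp add: divide_simps power2_eq_square)
    thus ?case using step by (simp add: sum.atLeast_Suc_atMost_Suc_shift[symmetric])
  qed simp
  thus ?thesis by (cases "n = 0") (auto intro: order_trans)
qed

text \<open>Proper divisors are written as \<open>n\<close> over \<open>k\<close> with
  \<open>k \<ge> 2\<close>. Their squares add up to at most \<open>(real n)\<^sup>2\<close> times
  the sum of \<open>1 / (real k)\<^sup>2\<close> over \<open>k \<ge> 2\<close>, which is at most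
  \<open>1\<close>, so the induction closes.\<close>

lemma dirichlet_inv_bound: "\<bar>dirichlet_inv n\<bar> \<le> (real n)\<^sup>2"
proof (induction n rule: less_induct)
  case (less n)
  consider "n = 0" | "n = 1" | "n > 1" by linarith
  thus ?case
  proof cases
    case 3
    let ?S = "{d. d dvd n \<and> d < n}"
    have inj: "inj_on (\<lambda>d. n div d) ?S"
    proof (rule inj_onI)
      fix x y assume xy: "x \<in> ?S" "y \<in> ?S" "n div x = n div y"
      have "x * (n div x) = n" "y * (n div y) = n" using xy by auto
      moreover have "n div x \<noteq> 0" using calculation 3 by (metis mult_0_right not_less_zero)
      ultimately show "x = y" using xy(3) by (metis mult_cancel2)
    qed
    have img: "(\<lambda>d. n div d) ` ?S \<subseteq> {2..n}"
    proof
      fix k assume "k \<in> (\<lambda>d. n div d) ` ?S"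
      then obtain d where d: "d dvd n" "d < n" "k = n div d" by auto
      have "d * k = n" using d by simp
      hence "k \<noteq> 0" "k \<noteq> 1" using d 3 by auto
      thus "k \<in> {2..n}" using d(3) div_le_dividend[of n d] by auto
    qed
    have "\<bar>dirichlet_inv n\<bar> \<le> (\<Sum>d\<in>?S. \<bar>dirichlet_inv d\<bar>)"
      using 3 by (simp add: dirichlet_inv.simps[of n] sum_abs)
    also have "\<dots> \<le> (\<Sum>d\<in>?S. (real d)\<^sup>2)" using less by (intro sum_mono) auto
    also have "\<dots> = (\<Sum>d\<in>?S. (real n)\<^sup>2 * (1 / (real (n div d))\<^sup>2))"
    proof (intro sum.cong refl)
      fix d assume d: "d \<in> ?S"
      then obtain k where k: "n = d * k" by auto
      have "d \<noteq> 0" using d 3 k by auto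
      moreover have "k \<noteq> 0" using 3 k by (cases k) auto
      ultimately show "(real d)\<^sup>2 = (real n)\<^sup>2 * (1 / (real (n div d))\<^sup>2)"
        by (simp add: k power_mult_distrib)
    qed
    also have "\<dots> = (real n)\<^sup>2 * (\<Sum>k\<in>(\<lambda>d. n div d) ` ?S. 1 / (real k)\<^sup>2)"
      by (subst sum.reindex[OF inj]) (simp add: sum_distrib_left o_def)
    also have "\<dots> \<le> (real n)\<^sup>2 * (\<Sum>k=2..n. 1 / (real k)\<^sup>2)"
      using img by (intro mult_left_mono sum_mono2) auto
    also have "\<dots> \<le> (real n)\<^sup>2 * 1" by (intro mult_left_mono sum_inverse_squares_le) auto
    finally show ?thesis by simp
  qed (simp_all add: dirichlet_inv.simps)
qed

lemma dirichlet_inv_term_bound: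
  "cmod (of_real (dirichlet_inv (Suc n)) * of_nat (Suc n) powr - s) \<le> real (Suc n) powr - (Re s - 2)"
proof -
  have "cmod (of_real (dirichlet_inv (Suc n)) * of_nat (Suc n) powr - s) = \<bar>dirichlet_inv (Suc n)\<bar> * real (Suc n) powr - Re s"
    using norm_powr_real_powr[of "of_nat (Suc n)" "-s"] by (simp add: norm_mult del: of_nat_Suc)
  also have "\<dots> \<le> (real (Suc n))\<^sup>2 * real (Suc n) powr - Re s"
    by (intro mult_right_mono dirichlet_inv_bound) auto
  also have "\<dots> = real (Suc n) powr (2 + - Re s)"
    by (subst powr_add) (simp add: powr_numeral del: of_nat_Suc)
  finally show ?thesis by (simp add: algebra_simps)
qed

lemma dirichlet_inv_summable:
  assumes "Re s > 3"
  shows "summable (\<lambda>n. norm (of_real (dirichlet_inv (Suc n)) * of_nat (Suc n) powr - s))"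
  by (rule summable_comparison_test'[OF summable_Suc_powr[of "Re s - 2"], of 0])
    (use assms dirichlet_inv_term_bound[of _ s] in \<open>auto simp del: of_nat_Suc\<close>)

lemma powr_of_nat_mult: "(of_nat (d * n) :: complex) powr s = of_nat d powr s * of_nat n powr s"
  unfolding of_nat_mult by (rule powr_times_real) auto

text \<open>The two absolutely convergent series are multiplied and the pairs \<open>(d, n)\<close>
  collected by their product \<open>N\<close>; the divisor sums vanish except for
  \<open>N = 1\<close>. The quadratic bound on the coefficients places this in
  \<open>Re s > 3\<close>.\<close>

lemma dirichlet_inv_suminf:
  assumes s: "Re s > 3"
  shows "(\<lambda>n. of_real (dirichlet_inv (Suc n)) * of_nat (Suc n) powr - s) sums ((s - 1) / zeta_reg s)"
    and "zeta_reg s \<noteq> 0"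
proof -
  define a where "a d = (of_real (dirichlet_inv d) * of_nat d powr - s :: complex)" for d
  define b where "b d = (of_nat d powr - s :: complex)" for d
  have s1: "s \<noteq> 1" using s by auto
  have bij: "bij_betw Suc UNIV {1..}" by (rule bij_betwI[where g = "\<lambda>n. n - 1"]) auto
  have an: "summable (\<lambda>n. norm (a (Suc n)))" unfolding a_def by (rule dirichlet_inv_summable[OF s])
  have nb: "norm (b (Suc n)) = real (Suc n) powr - Re s" for n
    unfolding b_def using norm_powr_real_powr[of "of_nat (Suc n)" "-s"] by (simp del: of_nat_Suc)
  have bn: "summable (\<lambda>n. norm (b (Suc n)))" unfolding nb by (rule summable_Suc_powr) (use s in simp)
  have reindex: "(\<lambda>n. norm (c n)) summable_on {1..}" "infsum c {1..} = C"
    if "summable (\<lambda>n. norm (c (Suc n)))" "(\<lambda>n. c (Suc n)) sums C" for c :: "nat \<Rightarrow> complex" and C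
  proof -
    have "(\<lambda>n. norm (c (Suc n))) summable_on UNIV"
      by (rule norm_summable_imp_summable_on) (use that(1) in simp)
    thus "(\<lambda>n. norm (c n)) summable_on {1..}"
      by (rule summable_on_reindex_bij_betw[OF bij, of "\<lambda>n. norm (c n)", THEN iffD1])
    have "((\<lambda>n. c (Suc n)) has_sum C) UNIV" by (rule norm_summable_imp_has_sum[OF that])
    hence "(c has_sum C) {1..}" by (rule has_sum_reindex_bij_betw[OF bij, of c C, THEN iffD1])
    thus "infsum c {1..} = C" by (rule infsumI)
  qed
  define A where "A = (\<Sum>n. a (Suc n))"
  have As: "(\<lambda>n. a (Suc n)) sums A" unfolding A_def by (rule summable_sums, rule summable_norm_cancel[OF an])
  have Bs: "(\<lambda>n. b (Suc n)) sums (zeta_reg s / (s - 1))" unfolding b_def by (rule zeta_reg_sums) (use s in auto)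
  note infa = reindex(2)[OF an As] and infb = reindex(2)[OF bn Bs]
  note anA = reindex(1)[OF an As] reindex(1)[OF bn Bs]
  have prod: "(\<lambda>p. norm (case p of (d, n) \<Rightarrow> a d * b n)) summable_on {1..} \<times> {1..}"
  proof (rule summable_on_SigmaI)
    show "((\<lambda>n. norm (case (d, n) of (d, n) \<Rightarrow> a d * b n)) has_sum norm (a d) * infsum (\<lambda>n. norm (b n)) {1..}) {1..}" for d
      unfolding case_prod_conv norm_mult by (intro has_sum_cmult_right has_sum_infsum anA)
    show "(\<lambda>d. norm (a d) * infsum (\<lambda>n. norm (b n)) {1..}) summable_on {1..}"
      by (intro summable_on_cmult_left anA)
  qed simp
  have "A * (zeta_reg s / (s - 1)) = infsum (\<lambda>d. infsum (\<lambda>n. a d * b n) {1..}) {1..}"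
    unfolding infsum_cmult_right' infsum_cmult_left' infa infb ..
  also have "\<dots> = infsum (\<lambda>(d, n). a d * b n) ({1..} \<times> {1..})"
    using infsum_Sigma_banach[OF abs_summable_summable[OF prod]] by simp
  \<comment> \<open>Since \<open>powr\<close> is multiplicative on natural numbers, the powers of
    \<open>d\<close> and \<open>n\<close> merge into \<open>b N\<close>, and only the coefficient at
    \<open>d\<close> remains.\<close>
  also have "\<dots> = infsum (\<lambda>(N, d). of_real (dirichlet_inv d) * b N) (Sigma {1..} (\<lambda>N. {d. d dvd N}))"
  proof (rule infsum_reindex_bij_witness[where j = "\<lambda>(d, n). (d * n, d)" and i = "\<lambda>(N, d). (d, N div d)"], goal_cases)
    case (4 p)
    then obtain N d where p: "p = (N, d)" "N \<ge> 1" "d dvd N" by auto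
    hence "d > 0" "N div d > 0" by (auto intro!: Nat.gr0I simp: dvd_div_eq_0_iff)
    thus ?case by (auto simp: p)
  next
    case (5 p)
    show ?case
      by (cases p) (simp add: a_def b_def powr_of_nat_mult del: of_nat_mult)
  qed auto
  also have "\<dots> = infsum (\<lambda>N. infsum (\<lambda>d. of_real (dirichlet_inv d) * b N) {d. d dvd N}) {1..}"
  proof (subst infsum_Sigma_banach[symmetric])
    show "(\<lambda>(N, d). of_real (dirichlet_inv d) * b N) summable_on Sigma {1..} (\<lambda>N. {d. d dvd N})"
    proof (subst summable_on_reindex_bij_witness[where j = "\<lambda>(N, d). (d, N div d)" and i = "\<lambda>(d, n). (d * n, d)" and T = "{1..} \<times> {1..}" and h = "\<lambda>(d, n). a d * b n"], goal_cases)
      case (2 p)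
      then obtain N d where p: "p = (N, d)" "N \<ge> 1" "d dvd N" by auto
      hence "d > 0" "N div d > 0" by (auto intro!: Nat.gr0I simp: dvd_div_eq_0_iff)
      thus ?case by (auto simp: p)
    next
      case (5 p)
      then obtain N d where p: "p = (N, d)" "N \<ge> 1" "d dvd N" by auto
      then obtain n where n: "N = d * n" by auto
      have "d \<noteq> 0" using p n by auto
      thus ?case by (simp add: p(1) n a_def b_def powr_of_nat_mult del: of_nat_mult)
    next
      case 6 show ?case using abs_summable_summable[OF prod] by simp
    qed auto
  qed simp
  also have "\<dots> = infsum (\<lambda>N::nat. if N = 1 then 1 else 0) {1..}"
  proof (rule infsum_cong)
    fix N :: nat assume N: "N \<in> {1..}"
    hence fin: "finite {d. d dvd N}" by simp
    have "infsum (\<lambda>d. of_real (dirichlet_inv d) * b N) {d. d dvd N} = (\<Sum>d\<in>{d. d dvd N}. of_real (dirichlet_inv d) * b N)"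
      by (rule infsum_finite[OF fin])
    also have "\<dots> = of_real (\<Sum>d\<in>{d. d dvd N}. dirichlet_inv d) * b N"
      by (simp only: of_real_sum sum_distrib_right)
    also have "(\<Sum>d\<in>{d. d dvd N}. dirichlet_inv d) = (if N = 1 then 1 else 0)"
      by (rule dirichlet_inv_sum) (use N in simp)
    finally show "infsum (\<lambda>d. of_real (dirichlet_inv d) * b N) {d. d dvd N} = (if N = 1 then 1 else 0)"
      by (simp add: b_def)
  qed
  also have "\<dots> = infsum (\<lambda>N. 1) {1::nat}" by (rule infsum_cong_neutral) auto
  finally have 1: "A * (zeta_reg s / (s - 1)) = 1" by simp
  show "zeta_reg s \<noteq> 0" using 1 by auto
  with 1 s1 have "A = (s - 1) / zeta_reg s" by (simp add: field_simps)
  thus "(\<lambda>n. of_real (dirichlet_inv (Suc n)) * of_nat (Suc n) powr - s) sums ((s - 1) / zeta_reg s)"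
    using As by (simp add: a_def)
qed

section \<open>Polynomial bounds for zeta and its reciprocal\<close>

text \<open>On this line the terms of the reciprocal series are at most
  \<open>real (Suc n) powr - 2\<close>, so \<open>1 / \<zeta>\<close> is bounded there. The line
  carries the centres of all later discs.\<close>

lemma zeta_reg_lower_bound:
  obtains c where "c > 0" "\<And>t. cmod (zeta_reg (Complex 4 t)) \<ge> c"
proof -
  define K where "K = (\<Sum>n. real (Suc n) powr - 2)"
  have Ks: "summable (\<lambda>n. real (Suc n) powr - 2)" by (rule summable_Suc_powr) simp
  have K: "K > 0" unfolding K_def using Ks by (intro suminf_pos) auto
  have "cmod (zeta_reg (Complex 4 t)) \<ge> 3 / K" for t
  proof -
    define s where "s = Complex 4 t"
    have s: "Re s > 3" by (simp add: s_def)
    have "cmod ((s - 1) / zeta_reg s) = cmod (\<Sum>n. of_real (dirichlet_inv (Suc n)) * of_nat (Suc n) powr - s)"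
      using sums_unique[OF dirichlet_inv_suminf(1)[OF s]] by simp
    also have "\<dots> \<le> (\<Sum>n. norm (of_real (dirichlet_inv (Suc n)) * of_nat (Suc n) powr - s))"
      by (rule summable_norm[OF dirichlet_inv_summable[OF s]])
    also have "\<dots> \<le> K" unfolding K_def
      using dirichlet_inv_term_bound[of _ s] by (intro suminf_le dirichlet_inv_summable[OF s] Ks) (simp add: s_def)
    finally have "cmod (s - 1) \<le> K * cmod (zeta_reg s)"
      using dirichlet_inv_suminf(2)[OF s] by (simp add: norm_divide divide_simps)
    moreover have "cmod (s - 1) \<ge> 3" using abs_Re_le_cmod[of "s - 1"] by (simp add: s_def)
    ultimately show ?thesis using K by (simp add: s_def field_simps)
  qed
  thus ?thesis using K by (intro that[of "3 / K"]) auto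
qed

text \<open>The disc stays in \<open>Re s \<ge> 1/8\<close>, where the growth is known; the lower
  bound at the centre turns growth into the ratio that the comparison lemmas ask for.\<close>

lemma zeta_reg_disc:
  obtains K where "K \<ge> 1" "\<And>t u. cmod u \<le> 31/8 \<Longrightarrow> cmod (zeta_reg (Complex 4 t + u)) \<le> K * (10 + \<bar>t\<bar>)\<^sup>2 * cmod (zeta_reg (Complex 4 t))"
proof -
  obtain c where c: "c > 0" "\<And>t. cmod (zeta_reg (Complex 4 t)) \<ge> c" using zeta_reg_lower_bound by blast
  obtain C where C: "C \<ge> 1" "\<And>s. Re s \<ge> 1/8 \<Longrightarrow> cmod (zeta_reg s) \<le> C * (2 + cmod s)\<^sup>2" using zeta_reg_growth by blast
  show ?thesis
  proof (rule that[of "max 1 (C / c)"])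
    fix t u assume u: "cmod u \<le> 31/8"
    have "Re u \<ge> - 31/8" using u abs_Re_le_cmod[of u] by linarith
    hence "cmod (zeta_reg (Complex 4 t + u)) \<le> C * (2 + cmod (Complex 4 t + u))\<^sup>2" by (intro C(2)) simp
    also have "\<dots> \<le> C * (10 + \<bar>t\<bar>)\<^sup>2"
    proof (intro mult_left_mono power_mono)
      have "cmod (Complex 4 t) \<le> 4 + \<bar>t\<bar>" using cmod_le[of "Complex 4 t"] by simp
      thus "2 + cmod (Complex 4 t + u) \<le> 10 + \<bar>t\<bar>" using norm_triangle_ineq[of "Complex 4 t" u] u by linarith
    qed (use C in auto)
    also have "\<dots> \<le> C * (10 + \<bar>t\<bar>)\<^sup>2 * (cmod (zeta_reg (Complex 4 t)) / c)"
      using c C by (intro mult_right_mono[of 1, simplified] mult_le_cancel_left1[THEN iffD2]) (auto simp: divide_simps mult_less_0_iff)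
    also have "\<dots> = (C / c) * (10 + \<bar>t\<bar>)\<^sup>2 * cmod (zeta_reg (Complex 4 t))" by simp
    also have "\<dots> \<le> max 1 (C / c) * (10 + \<bar>t\<bar>)\<^sup>2 * cmod (zeta_reg (Complex 4 t))"
      by (intro mult_right_mono) auto
    finally show "cmod (zeta_reg (Complex 4 t + u)) \<le> max 1 (C / c) * (10 + \<bar>t\<bar>)\<^sup>2 * cmod (zeta_reg (Complex 4 t))" .
  qed simp
qed

definition zeta_zero_free :: bool where
  "zeta_zero_free \<longleftrightarrow> (\<forall>s. Re s > 1/2 \<longrightarrow> zeta_reg s \<noteq> 0)"

text \<open>The point \<open>1\<close>, which the hypothesis excludes because of the dummy value,
  causes no trouble for \<open>zeta_reg\<close>, which is \<open>1\<close> there.\<close>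

lemma Riemann_Hypothesis_iff: "Riemann_Hypothesis \<longleftrightarrow> zeta_zero_free"
proof -
  have "zeta_reg s \<noteq> 0 \<longleftrightarrow> s = 1 \<or> riemann_zeta s \<noteq> 0" if "Re s > 1/2" for s
    using zeta_reg_eq[of s] that by (cases "s = 1") auto
  thus ?thesis unfolding Riemann_Hypothesis_def zeta_zero_free_def by blast
qed

lemma holomorphic_zeta_reg_shift: "(\<lambda>u. zeta_reg (Complex 4 t + u)) holomorphic_on {u. Re u > - 4}"
proof -
  have "zeta_reg \<circ> (\<lambda>u. Complex 4 t + u) holomorphic_on {u. Re u > - 4}"
    by (rule holomorphic_on_compose_gen[OF _ holomorphic_zeta_reg]) (auto intro!: holomorphic_intros)
  thus ?thesis by (simp add: o_def)
qed

lemma cball_subset_halfplane: "R < 4 \<Longrightarrow> cball 0 R \<subseteq> {u. Re u > - 4}"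
proof
  fix u :: complex assume "R < 4" "u \<in> cball 0 R"
  thus "u \<in> {u. Re u > - 4}" using abs_Re_le_cmod[of u] by simp
qed

text \<open>Discs around \<open>4 + i t\<close> with the radii \<open>7/2 < 15/4 < 31/8 < 4\<close>:
  the first just touches the critical line, the last stays in \<open>Re s > 0\<close>. All zeros in
  them lie on or to the left of that line, where the Blaschke comparison admits them. The exponent
  \<open>150\<close> must dominate \<open>4 * r / (R1 - r) = 56\<close> and satisfy
  \<open>pow\<close>; with the quadratic growth of \<open>M\<close> it becomes
  \<open>300\<close>.\<close>

lemma zeta_reg_ratio_bound:
  assumes zeta_zero_free
  obtains K k where "K \<ge> 1" "\<And>t e. 0 \<le> e \<Longrightarrow> e \<le> 1 \<Longrightarrow>
    cmod (zeta_reg (Complex (1/2) t)) \<le> K * (10 + \<bar>t\<bar>) ^ k * cmod (zeta_reg (Complex (1/2 + e) t))"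
proof -
  obtain K where K: "K \<ge> 1" "\<And>t u. cmod u \<le> 31/8 \<Longrightarrow> cmod (zeta_reg (Complex 4 t + u)) \<le> K * (10 + \<bar>t\<bar>)\<^sup>2 * cmod (zeta_reg (Complex 4 t))"
    using zeta_reg_disc by blast
  \<comment> \<open>The ratio is \<open>31/30\<close>. By Bernoulli every 30 factors give at least
    \<open>2\<close>, and \<open>2 ^ 5 = 32\<close> exceeds the right-hand side, which is
    \<open>59/3\<close>.\<close>
  have pow: "((31/8) / (15/4)) powr 150 \<ge> 1 + 2 * (7/2) / ((31/8) - (7/2 :: real))"
  proof -
    have "2 \<le> (31/30 :: real) ^ 30" using Bernoulli_inequality[of "1/30::real" 30] by simp
    hence "2 ^ 5 \<le> ((31/30 :: real) ^ 30) ^ 5" by (intro power_mono) auto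
    also have "\<dots> = (31/30) ^ 150" by (simp only: power_mult[symmetric]) simp
    finally show ?thesis by (simp add: powr_numeral)
  qed
  have main: "cmod (zeta_reg (Complex (1/2) t)) \<le> (2 * K) ^ 150 * (10 + \<bar>t\<bar>) ^ 300 * cmod (zeta_reg (Complex (1/2 + e) t))"
    if e: "0 \<le> e" "e \<le> 1" for t e
  proof -
    define M where "M = K * (10 + \<bar>t\<bar>)\<^sup>2"
    have M: "M > 0" unfolding M_def using K by (intro mult_pos_pos zero_less_power) auto
    obtain n where n: "M < (31/30) ^ n" using real_arch_pow[of "31/30" M] by auto
    have c: "Complex 4 t + of_real (-7/2) = Complex (1/2) t" "Complex 4 t + (of_real (-7/2) + of_real e) = Complex (1/2 + e) t"
      by (simp_all add: complex_eq_iff)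
    have "cmod (zeta_reg (Complex 4 t + of_real (-7/2))) \<le> (2 * M) powr 150 * cmod (zeta_reg (Complex 4 t + (of_real (-7/2) + of_real e)))"
    proof (rule horizontal_comparison[where f = "\<lambda>u. zeta_reg (Complex 4 t + u)" and R = "31/8" and ?R1.0 = "15/4" and r = "7/2"
        and S = "{u. Re u > - 4}" and c = "-7/2" and n = n and z = "of_real (-7/2)"])
      show "open {u. - 4 < Re u}" by (rule open_halfspace_Re_gt)
      show "cball 0 (31 / 8) \<subseteq> {u. - 4 < Re u}" by (rule cball_subset_halfplane) simp
      show "(\<lambda>u. zeta_reg (Complex 4 t + u)) holomorphic_on {u. - 4 < Re u}" by (rule holomorphic_zeta_reg_shift)
      show "zeta_reg (Complex 4 t + 0) \<noteq> 0" using assms by (simp add: zeta_zero_free_def)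
      show "cmod (zeta_reg (Complex 4 t + u)) \<le> M * cmod (zeta_reg (Complex 4 t + 0))" if "cmod u = 31/8" for u
        using K(2)[of u t] that unfolding M_def by simp
      show "Re u \<le> - 7 / 2" if "zeta_reg (Complex 4 t + u) = 0" for u
        using assms that unfolding zeta_zero_free_def by (force simp: not_less)
      show "cmod (of_real (- 7 / 2) + complex_of_real e) \<le> 7 / 2"
        using e by (simp only: of_real_add[symmetric] norm_of_real)
    qed (use pow n e in simp_all)
    also have "(2 * M) powr 150 = (2 * K) ^ 150 * (10 + \<bar>t\<bar>) ^ 300"
    proof -
      have "(2 * M) powr 150 = (2 * M) ^ 150" using M by (simp add: powr_numeral)
      also have "\<dots> = (2 * K) ^ 150 * ((10 + \<bar>t\<bar>)\<^sup>2) ^ 150" by (simp only: M_def mult.assoc[symmetric] power_mult_distrib)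
      also have "((10 + \<bar>t\<bar>)\<^sup>2) ^ 150 = (10 + \<bar>t\<bar>) ^ 300" by (simp only: power_mult[symmetric]) simp
      finally show ?thesis .
    qed
    finally show ?thesis unfolding c .
  qed
  have "(2 * K) ^ 150 \<ge> 1" using K by (intro one_le_power) auto
  from that[OF this main] show ?thesis by blast
qed

text \<open>Strictly to the right of the critical line the zero-free comparison is enough, since the
  radius \<open>7/2 - \<delta>/2\<close> keeps the disc in \<open>Re s > 1/2\<close>. The exponent
  \<open>4 * r / (R - r)\<close> grows like \<open>1 / \<delta>\<close>, so this bound is only good
  for a fixed distance from the line and cannot replace the uniform bound for the ratio.\<close>

lemma zeta_reg_inverse_bound:
  assumes zeta_zero_free and \<delta>: "0 < \<delta>" "\<delta> < 1"
  obtains K k where "K \<ge> 1" "\<And>s. 1/2 + \<delta> \<le> Re s \<Longrightarrow> Re s \<le> 6 \<Longrightarrow> cmod (1 / zeta_reg s) \<le> K * (10 + \<bar>Im s\<bar>) ^ k"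
proof -
  obtain c where c: "c > 0" "\<And>t. cmod (zeta_reg (Complex 4 t)) \<ge> c" using zeta_reg_lower_bound by blast
  obtain K where K: "K \<ge> 1" "\<And>t u. cmod u \<le> 31/8 \<Longrightarrow> cmod (zeta_reg (Complex 4 t + u)) \<le> K * (10 + \<bar>t\<bar>)\<^sup>2 * cmod (zeta_reg (Complex 4 t))"
    using zeta_reg_disc by blast
  define R where "R = 7/2 - \<delta>/2"
  define r where "r = 7/2 - \<delta>"
  define B where "B = nat \<lceil>4 * r / (R - r)\<rceil>"
  have rR: "0 < r" "r < R" using \<delta> by (auto simp: r_def R_def)
  have main: "cmod (1 / zeta_reg s) \<le> max 1 ((2 * K) ^ B / c) * (10 + \<bar>Im s\<bar>) ^ (2 * B)" if s: "1/2 + \<delta> \<le> Re s" "Re s \<le> 6" for s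
  proof -
    define t where "t = Im s"
    \<comment> \<open>The factor \<open>2\<close> provides the strict inequality that the comparison
      wants.\<close>
    define M where "M = 2 * (K * (10 + \<bar>t\<bar>)\<^sup>2)"
    have "1 * 1 \<le> K * (10 + \<bar>t\<bar>)\<^sup>2" using K by (intro mult_mono one_le_power) auto
    hence M: "M > 1" unfolding M_def by simp
    define u where "u = complex_of_real (Re s - 4)"
    have su: "s = Complex 4 t + u" by (simp add: complex_eq_iff u_def t_def)
    have u: "cmod u \<le> r" unfolding u_def norm_of_real using s \<delta> by (simp add: r_def)
    have nz: "zeta_reg (Complex 4 t + v) \<noteq> 0" if "v \<in> ball 0 R" for v
      using assms that abs_Re_le_cmod[of v] \<delta> unfolding zeta_zero_free_def by (auto simp: R_def)
    have "cmod (zeta_reg (Complex 4 t + 0)) \<le> M powr (4 * r / (R - r)) * cmod (zeta_reg (Complex 4 t + u))"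
    proof (rule zero_free_comparison[where f = "\<lambda>v. zeta_reg (Complex 4 t + v)" and R = R and r = r])
      show "(\<lambda>v. zeta_reg (Complex 4 t + v)) holomorphic_on ball 0 R"
        by (rule holomorphic_on_subset[OF holomorphic_zeta_reg_shift])
           (use cball_subset_halfplane[of R] ball_subset_cball[of 0 R] \<delta> in \<open>auto simp: R_def subset_iff\<close>)
      show "cmod (zeta_reg (Complex 4 t + v)) < M * cmod (zeta_reg (Complex 4 t + 0))" if "v \<in> ball 0 R" for v
      proof -
        have "cmod (zeta_reg (Complex 4 t)) > 0" using c(1) c(2)[of t] by linarith
        hence "M * cmod (zeta_reg (Complex 4 t)) > 0" using M by simp
        moreover have "cmod (zeta_reg (Complex 4 t + v)) \<le> M / 2 * cmod (zeta_reg (Complex 4 t))"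
          using K(2)[of v t] that \<delta> unfolding M_def by (simp add: R_def)
        ultimately show ?thesis by simp
      qed
    qed (use nz rR u in auto)
    also have "\<dots> \<le> M ^ B * cmod (zeta_reg (Complex 4 t + u))"
    proof (rule mult_right_mono)
      have "M powr (4 * r / (R - r)) \<le> M powr real B"
        using M unfolding B_def by (intro powr_mono real_nat_ceiling_ge) auto
      thus "M powr (4 * r / (R - r)) \<le> M ^ B" using M by (simp add: powr_realpow)
    qed simp
    finally have "c \<le> M ^ B * cmod (zeta_reg s)" using c(2)[of t] unfolding su by simp
    moreover have "cmod (zeta_reg s) > 0" using assms s \<delta> by (simp add: zeta_zero_free_def)
    ultimately have "cmod (1 / zeta_reg s) \<le> M ^ B / c" using c(1) by (simp add: norm_divide divide_simps mult.commute)
    also have "M ^ B / c = (2 * K) ^ B / c * (10 + \<bar>t\<bar>) ^ (2 * B)"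
      by (simp add: M_def power_mult_distrib power_mult mult.assoc)
    also have "\<dots> \<le> max 1 ((2 * K) ^ B / c) * (10 + \<bar>t\<bar>) ^ (2 * B)" by (intro mult_right_mono) auto
    finally show ?thesis by (simp add: t_def)
  qed
  show ?thesis by (rule that[OF _ main]) auto
qed

section \<open>Approximation of the reciprocal of zeta by Dirichlet polynomials\<close>

definition gauss :: "real measure" where
  "gauss = density lborel (\<lambda>x. ennreal (std_normal_density x))"

interpretation gauss: prob_space gauss
  unfolding gauss_def by (rule prob_space_normal_density) simp

lemma sets_gauss [measurable_cong, simp]: "sets gauss = sets borel" by (simp add: gauss_def)
lemma space_gauss [simp]: "space gauss = UNIV" by (simp add: gauss_def)

lemma measure_gauss_UNIV [simp]: "measure gauss UNIV = 1"
  using gauss.prob_space unfolding space_gauss .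

lemma integrable_gauss_moment: "integrable gauss (\<lambda>y. (a + \<bar>y\<bar>) ^ k)"
proof -
  have "integrable gauss (\<lambda>y. \<bar>y\<bar> ^ i)" for i
    unfolding gauss_def by (subst integrable_density) (auto simp: integrable_std_normal_moment_abs)
  thus ?thesis unfolding binomial_ring by (intro Bochner_Integration.integrable_sum integrable_mult_right) (simp_all add: mult.assoc)
qed

text \<open>The characteristic function of the normal law. It turns the average of
  \<open>n powr - (i h y)\<close> over \<open>y\<close> into the damping factor in
  \<open>gdirichlet_term\<close>.\<close>

lemma integral_gauss_exp: "(\<integral>y. exp (- (\<i> * of_real (y * x))) \<partial>gauss) = of_real (exp (- x\<^sup>2 / 2))"
proof -
  have "(\<integral>y. exp (- (\<i> * of_real (y * x))) \<partial>gauss) = char gauss (- x)"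
    unfolding char_def by (intro Bochner_Integration.integral_cong) (simp_all add: mult.commute)
  also have "\<dots> = of_real (exp (- x\<^sup>2 / 2))"
    using char_std_normal_distribution unfolding gauss_def by (simp add: fun_eq_iff)
  finally show ?thesis .
qed

text \<open>A term of the series of \<open>1 / \<zeta>\<close>, damped by a factor that decays
  faster than every power of the index. This factor is the one produced by Gaussian averaging at
  scale \<open>h\<close> along vertical lines.\<close>

definition gdirichlet_term :: "real \<Rightarrow> nat \<Rightarrow> complex \<Rightarrow> complex" where
  "gdirichlet_term h n w = of_real (dirichlet_inv (Suc n) * exp (- (h * ln (real (Suc n)))\<^sup>2 / 2)) * of_nat (Suc n) powr - w"

lemma gdirichlet_term_bound:
  assumes h: "h > 0" and w: "Re w \<ge> 0"
  shows "cmod (gdirichlet_term h n w) \<le> exp (8 / h\<^sup>2) * real (Suc n) powr - 2"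
proof -
  define x where "x = ln (real (Suc n))"
  have N: "real (Suc n) powr a = exp (a * x)" for a by (simp add: powr_def x_def mult.commute del: of_nat_Suc)
  \<comment> \<open>Completing the square shows that the damping is at most a constant times the
    power \<open>- 4\<close> of the index. Two of these powers pay for the coefficient, the other
    two remain for summability.\<close>
  have e: "exp (- (h * x)\<^sup>2 / 2) \<le> exp (8 / h\<^sup>2 - 4 * x)"
  proof -
    have hh: "h * (4 / h) = 4" using h by simp
    have "0 \<le> (h * x - 4 / h)\<^sup>2" by simp
    also have "(h * x - 4 / h)\<^sup>2 = (h * x)\<^sup>2 - 2 * x * (h * (4 / h)) + (4 / h)\<^sup>2"
      by (simp only: power2_diff) (simp only: mult_ac)
    also have "\<dots> = (h * x)\<^sup>2 - 8 * x + 16 / h\<^sup>2" unfolding hh by (simp add: power_divide)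
    finally show ?thesis by simp
  qed
  have "cmod (gdirichlet_term h n w) = \<bar>dirichlet_inv (Suc n)\<bar> * exp (- (h * x)\<^sup>2 / 2) * real (Suc n) powr - Re w"
    using norm_powr_real_powr[of "of_nat (Suc n)" "-w"] by (simp add: gdirichlet_term_def norm_mult abs_mult x_def del: of_nat_Suc)
  also have "\<dots> \<le> (real (Suc n))\<^sup>2 * exp (8 / h\<^sup>2 - 4 * x) * real (Suc n) powr 0"
    using w by (intro mult_mono e dirichlet_inv_bound powr_mono) auto
  also have "\<dots> = exp (2 * x) * exp (8 / h\<^sup>2 - 4 * x)"
  proof -
    have "(real (Suc n))\<^sup>2 = real (Suc n) powr 2" by (simp add: powr_numeral del: of_nat_Suc)
    also have "\<dots> = exp (2 * x)" by (rule N)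
    finally show ?thesis by (simp del: of_nat_Suc)
  qed
  also have "\<dots> = exp (8 / h\<^sup>2 + - 2 * x)" by (subst exp_add[symmetric]) (rule arg_cong[of _ _ exp], simp)
  also have "\<dots> = exp (8 / h\<^sup>2) * exp (- 2 * x)" by (rule exp_add)
  also have "exp (- 2 * x) = real (Suc n) powr - 2" by (rule N[symmetric])
  finally show ?thesis .
qed

definition gdirichlet :: "real \<Rightarrow> complex \<Rightarrow> complex" where
  "gdirichlet h w = (\<Sum>n. gdirichlet_term h n w)"

lemma summable_gbound: "summable (\<lambda>n. c * real (Suc n) powr - 2)"
  by (rule summable_mult, rule summable_Suc_powr) simp

lemma gdirichlet_uniform:
  assumes "h > 0"
  shows "uniform_limit {w. Re w \<ge> 0} (\<lambda>N w. \<Sum>n<N. gdirichlet_term h n w) (gdirichlet h) sequentially"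
  unfolding gdirichlet_def[abs_def]
  by (rule Weierstrass_m_test[OF gdirichlet_term_bound[OF assms] summable_gbound]) simp

lemma holomorphic_gdirichlet:
  assumes "h > 0"
  shows "gdirichlet h holomorphic_on {w. Re w > 0}"
proof (rule holomorphic_uniform_sequence[where f = "\<lambda>N w. \<Sum>n<N. gdirichlet_term h n w"])
  show "open {w. Re w > 0}" by (rule open_halfspace_Re_gt)
  show "(\<lambda>w. \<Sum>n<N. gdirichlet_term h n w) holomorphic_on {w. 0 < Re w}" for N
    unfolding gdirichlet_term_def by (intro holomorphic_intros) (auto simp: complex_nonpos_Reals_iff simp del: of_nat_Suc)
  fix w assume "w \<in> {w. 0 < Re w}"
  then obtain d where d: "d > 0" "cball w d \<subseteq> {w. 0 < Re w}"
    using open_halfspace_Re_gt[of 0] open_contains_cball_eq by blast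
  moreover have "cball w d \<subseteq> {w. Re w \<ge> 0}" using d(2) by auto
  ultimately show "\<exists>d>0. cball w d \<subseteq> {w. 0 < Re w} \<and> uniform_limit (cball w d) (\<lambda>N w. \<Sum>n<N. gdirichlet_term h n w) (gdirichlet h) sequentially"
    using uniform_limit_on_subset[OF gdirichlet_uniform[OF assms]] by blast
qed

definition zeta_recip :: "complex \<Rightarrow> complex" where
  "zeta_recip w = (w - 1) / zeta_reg w"

text \<open>Far to the right \<open>zeta_recip\<close> is its Dirichlet series, and the average over
  the vertical shift can be taken term by term.\<close>

lemma gdirichlet_eq_right:
  assumes w: "Re w > 3" and h: "h > 0"
  shows "gdirichlet h w = (\<integral>y. zeta_recip (w + \<i> * of_real (h * y)) \<partial>gauss)"
proof -
  define f where "f n y = of_real (dirichlet_inv (Suc n)) * of_nat (Suc n) powr - (w + \<i> * of_real (h * y))" for n y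
  have nf: "norm (f n y) \<le> real (Suc n) powr - (Re w - 2)" for n y
    using dirichlet_inv_term_bound[of n "w + \<i> * of_real (h * y)"] by (simp add: f_def)
  have fs: "f n y = of_real (dirichlet_inv (Suc n)) * of_nat (Suc n) powr - w * exp (- (\<i> * of_real (y * (h * ln (real (Suc n))))))" for n y
  proof -
    have "of_nat (Suc n) powr - (w + \<i> * of_real (h * y)) = of_nat (Suc n) powr (- w) * of_nat (Suc n) powr (- (\<i> * of_real (h * y)))"
      by (subst powr_add[symmetric]) simp
    also have "of_nat (Suc n) powr (- (\<i> * of_real (h * y))) = exp (- (\<i> * of_real (y * (h * ln (real (Suc n))))))"
      using Ln_of_nat[of "Suc n"] by (simp add: powr_def mult_ac del: of_nat_Suc)
    finally show ?thesis by (simp add: f_def)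
  qed
  have fm: "f n \<in> borel_measurable gauss" for n unfolding fs[abs_def] by measurable
  have fi: "integrable gauss (f n)" for n
    by (rule gauss.integrable_const_bound[where B = "real (Suc n) powr - (Re w - 2)"]) (use nf fm in auto)
  have sm: "summable (\<lambda>n. real (Suc n) powr - (Re w - 2))" by (rule summable_Suc_powr) (use w in simp)
  have If: "(\<integral>y. f n y \<partial>gauss) = gdirichlet_term h n w" for n
  proof -
    have "(\<integral>y. f n y \<partial>gauss) = of_real (dirichlet_inv (Suc n)) * of_nat (Suc n) powr - w *
       (\<integral>y. exp (- (\<i> * of_real (y * (h * ln (real (Suc n)))))) \<partial>gauss)"
      unfolding fs[abs_def] by (rule integral_mult_right_zero)
    thus ?thesis unfolding integral_gauss_exp gdirichlet_term_def by (simp add: mult_ac)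
  qed
  have "(\<lambda>n. \<integral>y. f n y \<partial>gauss) sums (\<integral>y. (\<Sum>n. f n y) \<partial>gauss)"
  proof (rule sums_integral[OF fi])
    show "AE y in gauss. summable (\<lambda>n. norm (f n y))"
      by (intro AE_I2 summable_comparison_test'[OF sm, of 0]) (use nf in auto)
    show "summable (\<lambda>n. \<integral>y. norm (f n y) \<partial>gauss)"
    proof (rule summable_comparison_test'[OF sm, of 0])
      show "norm (\<integral>y. norm (f n y) \<partial>gauss) \<le> real (Suc n) powr - (Re w - 2)" for n
      proof -
        have "(\<integral>y. norm (f n y) \<partial>gauss) \<le> (\<integral>y. real (Suc n) powr - (Re w - 2) \<partial>gauss)"
          using nf fi by (intro integral_mono integrable_norm) auto
        thus ?thesis by simp
      qed
    qed
  qed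
  hence "gdirichlet h w = (\<integral>y. (\<Sum>n. f n y) \<partial>gauss)"
    unfolding If gdirichlet_def by (simp add: sums_iff)
  also have "(\<lambda>y. \<Sum>n. f n y) = (\<lambda>y. zeta_recip (w + \<i> * of_real (h * y)))"
  proof
    fix y
    have "Re (w + \<i> * of_real (h * y)) > 3" using w by simp
    from sums_unique[OF dirichlet_inv_suminf(1)[OF this]]
    show "(\<Sum>n. f n y) = zeta_recip (w + \<i> * of_real (h * y))"
      unfolding f_def zeta_recip_def by simp
  qed
  finally show ?thesis .
qed

lemma zeta_recip_bound:
  assumes zeta_zero_free and \<delta>: "0 < \<delta>" "\<delta> < 1"
  obtains K k where "K \<ge> 1" "\<And>s. 1/2 + \<delta> \<le> Re s \<Longrightarrow> Re s \<le> 6 \<Longrightarrow> cmod (zeta_recip s) \<le> K * (10 + \<bar>Im s\<bar>) ^ k"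
proof -
  obtain K k where K: "K \<ge> 1" "\<And>s. 1/2 + \<delta> \<le> Re s \<Longrightarrow> Re s \<le> 6 \<Longrightarrow> cmod (1 / zeta_reg s) \<le> K * (10 + \<bar>Im s\<bar>) ^ k"
    using zeta_reg_inverse_bound[OF assms] by blast
  have "cmod (zeta_recip s) \<le> K * (10 + \<bar>Im s\<bar>) ^ Suc k" if s: "1/2 + \<delta> \<le> Re s" "Re s \<le> 6" for s
  proof -
    have "cmod (s - 1) \<le> 10 + \<bar>Im s\<bar>" using cmod_le[of "s - 1"] s \<delta> by simp
    hence "cmod (s - 1) * cmod (1 / zeta_reg s) \<le> (10 + \<bar>Im s\<bar>) * (K * (10 + \<bar>Im s\<bar>) ^ k)"
      using K(2)[OF s] by (intro mult_mono) auto
    thus ?thesis unfolding zeta_recip_def by (simp add: norm_divide mult_ac)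
  qed
  from that[OF K(1) this] show ?thesis by blast
qed

lemma holomorphic_zeta_recip:
  assumes zeta_zero_free
  shows "zeta_recip holomorphic_on {s. Re s > 1/2}"
  unfolding zeta_recip_def[abs_def]
  by (intro holomorphic_intros holomorphic_on_subset[OF holomorphic_zeta_reg])
     (use assms in \<open>auto simp: zeta_zero_free_def\<close>)

text \<open>Both sides are holomorphic and agree for \<open>Re w > 3\<close>, so the identity
  theorem carries the equality up to the critical line: the everywhere convergent series still
  represents averages of \<open>1 / \<zeta>\<close> where the original series is out of reach. The
  rectangle \<open>S\<close> is bounded in order that one integrable majorant serves all its points;
  its right edge \<open>5\<close> leaves room for points with \<open>Re s > 3\<close> and respects
  the range of \<open>zeta_recip_bound\<close>.\<close>

lemma gdirichlet_eq:
  assumes rh: zeta_zero_free and w: "Re w > 1/2" "Re w < 5" and h: "h > 0"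
  shows "gdirichlet h w = (\<integral>y. zeta_recip (w + \<i> * of_real (h * y)) \<partial>gauss)"
proof -
  define \<delta> where "\<delta> = min (1/2) ((Re w - 1/2) / 2)"
  have \<delta>: "0 < \<delta>" "\<delta> < 1" "Re w > 1/2 + \<delta>" using w by (auto simp: \<delta>_def min_def field_simps)
  define B where "B = \<bar>Im w\<bar> + 1"
  have B: "B > 0" "- B < Im w" "Im w < B" unfolding B_def by linarith+
  define S where "S = {s. 1/2 + \<delta> < Re s} \<inter> {s. Re s < 5} \<inter> ({s. - B < Im s} \<inter> {s. Im s < B})"
  define U where "U = S \<inter> {s. 3 < Re s}"
  obtain K k where K: "K \<ge> 1" "\<And>s. 1/2 + \<delta> \<le> Re s \<Longrightarrow> Re s \<le> 6 \<Longrightarrow> cmod (zeta_recip s) \<le> K * (10 + \<bar>Im s\<bar>) ^ k"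
    using zeta_recip_bound[OF rh \<delta>(1,2)] by blast
  have opS: "open S" unfolding S_def
    by (intro open_Int open_halfspace_Re_gt open_halfspace_Re_lt open_halfspace_Im_gt open_halfspace_Im_lt)
  have cvS: "convex S" unfolding S_def
    by (intro convex_Int convex_halfspace_Re_gt convex_halfspace_Re_lt convex_halfspace_Im_gt convex_halfspace_Im_lt)
  have hol: "(\<lambda>s. \<integral>y. zeta_recip (s + \<i> * of_real (h * y)) \<partial>gauss) holomorphic_on S"
  proof (rule holomorphic_on_lebesgue_integral[OF opS, where g = "\<lambda>y. K * (h ^ k * ((10 + B) / h + \<bar>y\<bar>) ^ k)"])
    show "integrable gauss (\<lambda>y. K * (h ^ k * ((10 + B) / h + \<bar>y\<bar>) ^ k))"
      by (intro integrable_mult_right integrable_gauss_moment)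
    show "(\<lambda>y. zeta_recip (s + \<i> * of_real (h * y))) \<in> borel_measurable gauss" if "s \<in> S" for s
    proof -
      have "continuous_on UNIV (\<lambda>y. zeta_recip (s + \<i> * of_real (h * y)))"
        by (rule continuous_on_compose2[OF holomorphic_on_imp_continuous_on[OF holomorphic_zeta_recip[OF rh]]])
          (use that \<delta> in \<open>auto intro!: continuous_intros simp: S_def\<close>)
      thus ?thesis unfolding measurable_cong_sets[OF sets_gauss refl] by (rule borel_measurable_continuous_onI)
    qed
    show "(\<lambda>s. zeta_recip (s + \<i> * of_real (h * y))) holomorphic_on S" for y
    proof -
      have "zeta_recip \<circ> (\<lambda>s. s + \<i> * of_real (h * y)) holomorphic_on S"
        by (rule holomorphic_on_compose_gen[OF _ holomorphic_zeta_recip[OF rh]])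
          (use \<delta> in \<open>auto intro!: holomorphic_intros simp: S_def\<close>)
      thus ?thesis by (simp add: o_def)
    qed
    show "cmod (zeta_recip (s + \<i> * of_real (h * y))) \<le> K * (h ^ k * ((10 + B) / h + \<bar>y\<bar>) ^ k)" if "s \<in> S" for s y
    proof -
      have "cmod (zeta_recip (s + \<i> * of_real (h * y))) \<le> K * (10 + \<bar>Im (s + \<i> * of_real (h * y))\<bar>) ^ k"
        using that by (intro K(2)) (auto simp: S_def)
      also have "\<dots> \<le> K * (10 + B + h * \<bar>y\<bar>) ^ k"
      proof (intro mult_left_mono power_mono)
        have "\<bar>Im s + h * y\<bar> \<le> \<bar>Im s\<bar> + h * \<bar>y\<bar>" using abs_triangle_ineq[of "Im s" "h * y"] h by (simp add: abs_mult)
        thus "10 + \<bar>Im (s + \<i> * of_real (h * y))\<bar> \<le> 10 + B + h * \<bar>y\<bar>" using that by (auto simp: S_def)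
      qed (use K in auto)
      also have "10 + B + h * \<bar>y\<bar> = h * ((10 + B) / h + \<bar>y\<bar>)" using h by (simp add: field_simps)
      finally show ?thesis by (simp only: power_mult_distrib)
    qed
  qed
  show ?thesis
  proof (rule analytic_continuation_open[of U S "gdirichlet h" "\<lambda>s. \<integral>y. zeta_recip (s + \<i> * of_real (h * y)) \<partial>gauss" w])
    show "open U" unfolding U_def by (intro open_Int opS open_halfspace_Re_gt)
    have "4 \<in> U" using \<delta> B by (simp add: U_def S_def)
    thus "U \<noteq> {}" by blast
    show "connected S" by (rule convex_connected[OF cvS])
    show "gdirichlet h holomorphic_on S"
      by (rule holomorphic_on_subset[OF holomorphic_gdirichlet[OF h]]) (use \<delta> in \<open>auto simp: S_def\<close>)
    show "gdirichlet h z = (\<integral>y. zeta_recip (z + \<i> * of_real (h * y)) \<partial>gauss)" if "z \<in> U" for z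
      by (rule gdirichlet_eq_right[OF _ h]) (use that in \<open>simp add: U_def\<close>)
    show "w \<in> S" using w \<delta> B by (simp add: S_def)
    show "U \<subseteq> S" unfolding U_def by (rule Int_lower1)
  qed (rule opS hol)+
qed

lemma continuous_on_vertical:
  assumes "F holomorphic_on {s. Re s > c}" "a > c"
  shows "continuous_on UNIV (\<lambda>t. F (Complex a t))"
proof (rule continuous_on_compose2[OF holomorphic_on_imp_continuous_on[OF assms(1)]])
  show "continuous_on UNIV (\<lambda>t. Complex a t)"
    unfolding Complex_eq by (intro continuous_intros)
qed (use assms(2) in auto)

section \<open>Weighted approximation on the critical line\<close>

text \<open>This is \<open>\<zeta>(1/2 + i t)\<close>.\<close>

definition zeta_line :: "real \<Rightarrow> complex" where
  "zeta_line t = zeta_reg (Complex (1/2) t) / (Complex (1/2) t - 1)"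

lemma cmod_line_minus_1: "cmod (Complex (1/2) t - 1) \<ge> 1/2"
  using abs_Re_le_cmod[of "Complex (1/2) t - 1"] by simp

lemma line_ne_1: "Complex (1/2) t - 1 \<noteq> 0"
  using cmod_line_minus_1[of t] by auto

lemma zeta_line_measurable [measurable]: "zeta_line \<in> borel_measurable borel"
proof -
  have "continuous_on UNIV (\<lambda>t. Complex (1/2) t - 1)" unfolding Complex_eq by (intro continuous_intros)
  moreover have "continuous_on UNIV (\<lambda>t. zeta_reg (Complex (1/2) t))"
    by (rule continuous_on_vertical[OF holomorphic_zeta_reg]) simp
  ultimately have "continuous_on UNIV zeta_line"
    unfolding zeta_line_def[abs_def] using line_ne_1 by (intro continuous_on_divide) auto
  thus ?thesis by (rule borel_measurable_continuous_onI)
qed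

lemma zeta_line_growth:
  obtains K where "K \<ge> 1" "\<And>t. cmod (zeta_line t) \<le> K * (10 + \<bar>t\<bar>) ^ 2"
proof -
  obtain C where C: "C \<ge> 1" "\<And>s. Re s \<ge> 1/8 \<Longrightarrow> cmod (zeta_reg s) \<le> C * (2 + cmod s)\<^sup>2" using zeta_reg_growth by blast
  have "cmod (zeta_line t) \<le> (2 * C) * (10 + \<bar>t\<bar>) ^ 2" for t
  proof -
    have "cmod (zeta_reg (Complex (1/2) t)) \<le> C * (2 + cmod (Complex (1/2) t))\<^sup>2" by (intro C(2)) simp
    also have "\<dots> \<le> C * (10 + \<bar>t\<bar>)\<^sup>2"
      using cmod_le[of "Complex (1/2) t"] C by (intro mult_left_mono power_mono) auto
    finally have "cmod (zeta_line t) \<le> C * (10 + \<bar>t\<bar>)\<^sup>2 / (1/2)"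
      unfolding zeta_line_def norm_divide using cmod_line_minus_1[of t] C by (intro frac_le) auto
    thus ?thesis by simp
  qed
  thus ?thesis using C(1) by (intro that[of "2 * C"]) auto
qed

text \<open>Prepares the theorem that a nonconstant holomorphic function has only countably many
  zeros.\<close>

lemma fsigma_halfplane: "fsigma {s. Re s > 0}"
proof -
  have "{s. Re s > 0} = (\<Union>n. {s. Re s \<ge> 1 / real (Suc n)})"
  proof (intro set_eqI iffI)
    fix s assume "s \<in> {s. Re s > 0}"
    then obtain n where "inverse (real (Suc n)) < Re s" using reals_Archimedean[of "Re s"] by auto
    thus "s \<in> (\<Union>n. {s. Re s \<ge> 1 / real (Suc n)})" by (auto simp: inverse_eq_divide intro: less_imp_le)
  next
    fix s assume "s \<in> (\<Union>n. {s. Re s \<ge> 1 / real (Suc n)})"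
    then obtain n where "1 / real (Suc n) \<le> Re s" by blast
    moreover have "1 / real (Suc n) > 0" by simp
    ultimately have "Re s > 0" by linarith
    thus "s \<in> {s. Re s > 0}" by simp
  qed
  thus ?thesis by (simp only: fsigma.intros closed_halfspace_Re_ge)
qed

text \<open>The zeros are countable, hence form a null set on the line. If \<open>zeta_reg\<close>
  were constant, it would be \<open>1\<close> and have none.\<close>

lemma AE_zeta_reg_line_nonzero:
  "AE t in lborel. zeta_reg (Complex (1/2) t) \<noteq> 0"
proof -
  have "countable {s\<in>{s. Re s > 0}. zeta_reg s = 0}"
  proof (cases "zeta_reg constant_on {s. Re s > 0}")
    case True
    hence "zeta_reg s = 1" if "Re s > 0" for s using that zeta_reg_1 unfolding constant_on_def by (metis mem_Collect_eq one_complex.sel(1) zero_less_one)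
    hence E: "{s\<in>{s. Re s > 0}. zeta_reg s = 0} = {}" by auto
    show ?thesis unfolding E by simp
  next
    case False
    show ?thesis
      by (rule holomorphic_countable_zeros[OF holomorphic_zeta_reg open_halfspace_Re_gt
          convex_connected[OF convex_halfspace_Re_gt] fsigma_halfplane False])
  qed
  moreover have "Im ` {s\<in>{s. Re s > 0}. zeta_reg s = 0} \<supseteq> {t. zeta_reg (Complex (1/2) t) = 0}"
    by (force intro: image_eqI[where x = "Complex (1/2) _"])
  ultimately have "countable {t. zeta_reg (Complex (1/2) t) = 0}"
    by (meson countable_image countable_subset)
  hence "{t. zeta_reg (Complex (1/2) t) = 0} \<in> null_sets lborel" by (rule countable_imp_null_set_lborel)
  from AE_not_in[OF this] show ?thesis by simp
qed

text \<open>Dominated convergence with the weight absorbing the polynomial growth. All three limits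
  of the approximation pass through this lemma.\<close>

lemma weighted_L2_tendsto:
  fixes f :: "nat \<Rightarrow> real \<Rightarrow> complex"
  assumes W: "W \<in> borel_measurable borel" "\<And>t. W t \<ge> 0" "integrable lborel (\<lambda>t. (10 + \<bar>t\<bar>) ^ (2 * k) * W t)"
    and m: "\<And>n. f n \<in> borel_measurable borel" "g \<in> borel_measurable borel"
    and bd: "\<And>n t. cmod (f n t) \<le> K * (10 + \<bar>t\<bar>) ^ k" "\<And>t. cmod (g t) \<le> K * (10 + \<bar>t\<bar>) ^ k"
    and lim: "AE t in lborel. (\<lambda>n. f n t) \<longlonglongrightarrow> g t"
  shows "(\<lambda>n. \<integral>\<^sup>+t. ennreal (W t * (cmod (f n t - g t))\<^sup>2) \<partial>lborel) \<longlonglongrightarrow> 0"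
proof -
  note [measurable] = W(1) m
  have "(\<lambda>n. \<integral>\<^sup>+t. ennreal (W t * (cmod (f n t - g t))\<^sup>2) \<partial>lborel) \<longlonglongrightarrow> (\<integral>\<^sup>+(t::real). 0 \<partial>lborel)"
  proof (rule nn_integral_dominated_convergence[where u = "\<lambda>n t. ennreal (W t * (cmod (f n t - g t))\<^sup>2)" and u' = "\<lambda>_. 0" and w = "\<lambda>t. ennreal ((2 * K)\<^sup>2 * ((10 + \<bar>t\<bar>) ^ (2 * k) * W t))"])
    show "(\<integral>\<^sup>+t. ennreal ((2 * K)\<^sup>2 * ((10 + \<bar>t\<bar>) ^ (2 * k) * W t)) \<partial>lborel) < \<infinity>"
    proof -
      have "integrable lborel (\<lambda>t. (2 * K)\<^sup>2 * ((10 + \<bar>t\<bar>) ^ (2 * k) * W t))" using W(3) by (intro integrable_mult_right)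
      thus ?thesis using W(2) by (subst nn_integral_eq_integral) (auto intro!: AE_I2)
    qed
    show "AE t in lborel. ennreal (W t * (cmod (f n t - g t))\<^sup>2) \<le> ennreal ((2 * K)\<^sup>2 * ((10 + \<bar>t\<bar>) ^ (2 * k) * W t))" for n
    proof (intro AE_I2 ennreal_leI)
      fix t :: real
      have "cmod (f n t - g t) \<le> 2 * K * (10 + \<bar>t\<bar>) ^ k"
        using norm_triangle_ineq4[of "f n t" "g t"] bd(1)[of n t] bd(2)[of t] by simp
      hence "(cmod (f n t - g t))\<^sup>2 \<le> (2 * K * (10 + \<bar>t\<bar>) ^ k)\<^sup>2" by (intro power_mono) auto
      also have "\<dots> = (2 * K)\<^sup>2 * (10 + \<bar>t\<bar>) ^ (2 * k)" by (simp only: power_mult_distrib power_mult[symmetric] mult.commute[of k 2])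
      finally have "W t * (cmod (f n t - g t))\<^sup>2 \<le> W t * ((2 * K)\<^sup>2 * (10 + \<bar>t\<bar>) ^ (2 * k))"
        by (rule mult_left_mono) (rule W(2))
      thus "W t * (cmod (f n t - g t))\<^sup>2 \<le> (2 * K)\<^sup>2 * ((10 + \<bar>t\<bar>) ^ (2 * k) * W t)" by (simp only: mult_ac)
    qed
    show "AE t in lborel. (\<lambda>n. ennreal (W t * (cmod (f n t - g t))\<^sup>2)) \<longlonglongrightarrow> 0"
      using lim
    proof eventually_elim
      fix t assume "(\<lambda>n. f n t) \<longlonglongrightarrow> g t"
      hence "(\<lambda>n. f n t - g t) \<longlonglongrightarrow> 0" by (rule LIM_zero)
      hence "(\<lambda>n. cmod (f n t - g t)) \<longlonglongrightarrow> 0" by (rule tendsto_norm_zero)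
      from tendsto_mult[OF tendsto_const[of "W t"] tendsto_power[OF this, of 2]]
      have "(\<lambda>n. W t * (cmod (f n t - g t))\<^sup>2) \<longlonglongrightarrow> 0" by simp
      from tendsto_ennrealI[OF this] show "(\<lambda>n. ennreal (W t * (cmod (f n t - g t))\<^sup>2)) \<longlonglongrightarrow> 0" by simp
    qed
  qed simp_all
  thus ?thesis by simp
qed

lemma tendsto_zero_ex_less:
  fixes f :: "nat \<Rightarrow> ennreal"
  assumes "f \<longlonglongrightarrow> 0" "e > 0"
  obtains n where "f n < e"
  using order_tendstoD(2)[OF assms] by (auto simp: eventually_sequentially)

text \<open>The ratio bound, uniform in the shift, is the majorant. Pointwise convergence holds
  wherever zeta does not vanish, hence almost everywhere.\<close>

lemma zeta_line_recip_tendsto: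
  assumes rh: zeta_zero_free and W: "W \<in> borel_measurable borel" "\<And>t. W t \<ge> 0" "\<And>k. integrable lborel (\<lambda>t. (10 + \<bar>t\<bar>) ^ k * W t)"
    and e: "\<eta> > 0"
  obtains \<epsilon> where "0 < \<epsilon>" "\<epsilon> < 1"
    "(\<integral>\<^sup>+t. ennreal (W t * (cmod (zeta_line t * zeta_recip (Complex (1/2 + \<epsilon>) t) - 1))\<^sup>2) \<partial>lborel) < \<eta>"
proof -
  obtain K k where K: "K \<ge> 1" "\<And>t e. 0 \<le> e \<Longrightarrow> e \<le> 1 \<Longrightarrow>
    cmod (zeta_reg (Complex (1/2) t)) \<le> K * (10 + \<bar>t\<bar>) ^ k * cmod (zeta_reg (Complex (1/2 + e) t))"
    using zeta_reg_ratio_bound[OF rh] by blast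
  define \<epsilon> where "\<epsilon> n = 1 / real (n + 2)" for n
  have \<epsilon>: "0 < \<epsilon> n" "\<epsilon> n < 1" for n by (simp_all add: \<epsilon>_def)
  have lim\<epsilon>: "\<epsilon> \<longlonglongrightarrow> 0" unfolding \<epsilon>_def by (rule LIMSEQ_ignore_initial_segment[OF lim_1_over_n])
  define f where "f n t = zeta_line t * zeta_recip (Complex (1/2 + \<epsilon> n) t)" for n t
  have "(\<lambda>n. \<integral>\<^sup>+t. ennreal (W t * (cmod (f n t - 1))\<^sup>2) \<partial>lborel) \<longlonglongrightarrow> 0"
  proof (rule weighted_L2_tendsto[where k = k and K = K, OF W(1,2) W(3)])
    show "f n \<in> borel_measurable borel" for n
    proof -
      have "continuous_on UNIV (\<lambda>t. zeta_recip (Complex (1/2 + \<epsilon> n) t))"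
        by (rule continuous_on_vertical[OF holomorphic_zeta_recip[OF rh]]) (use \<epsilon> in simp)
      hence [measurable]: "(\<lambda>t. zeta_recip (Complex (1/2 + \<epsilon> n) t)) \<in> borel_measurable borel" by (rule borel_measurable_continuous_onI)
      show ?thesis unfolding f_def[abs_def] by measurable
    qed
    show "cmod (f n t) \<le> K * (10 + \<bar>t\<bar>) ^ k" for n t
    proof -
      have nz: "cmod (zeta_reg (Complex (1/2 + \<epsilon> n) t)) > 0" using rh \<epsilon>[of n] by (simp add: zeta_zero_free_def)
      \<comment> \<open>A shift to the right by less than \<open>1\<close> does not increase the
        distance from \<open>1\<close>, so the bound for \<open>zeta_reg\<close> passes to zeta
        itself without loss.\<close>
      have "cmod (Complex (1/2 + \<epsilon> n) t - 1) \<le> cmod (Complex (1/2) t - 1)"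
      proof -
        have "\<bar>\<epsilon> n - 1/2\<bar> \<le> 1/2" using \<epsilon>[of n] by (intro abs_leI) auto
        hence "\<bar>\<epsilon> n - 1/2\<bar>\<^sup>2 \<le> (1/2)\<^sup>2" by (intro power_mono) auto
        thus ?thesis by (simp add: cmod_def)
      qed
      moreover have "cmod (zeta_reg (Complex (1/2) t)) \<le> K * (10 + \<bar>t\<bar>) ^ k * cmod (zeta_reg (Complex (1/2 + \<epsilon> n) t))"
        using K(2)[of "\<epsilon> n" t] \<epsilon>[of n] by simp
      ultimately have "cmod (zeta_reg (Complex (1/2) t)) * cmod (Complex (1/2 + \<epsilon> n) t - 1) \<le>
          (K * (10 + \<bar>t\<bar>) ^ k * cmod (zeta_reg (Complex (1/2 + \<epsilon> n) t))) * cmod (Complex (1/2) t - 1)"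
        using K(1) by (intro mult_mono) auto
      moreover have "cmod (Complex (1/2) t - 1) > 0" using cmod_line_minus_1[of t] by linarith
      ultimately show ?thesis using nz
        unfolding f_def zeta_line_def zeta_recip_def norm_mult norm_divide by (simp add: field_simps)
    qed
    show "cmod 1 \<le> K * (10 + \<bar>t\<bar>) ^ k" for t :: real
    proof -
      have "1 * 1 \<le> K * (10 + \<bar>t\<bar>) ^ k" using K(1) by (intro mult_mono one_le_power) auto
      thus ?thesis by simp
    qed
    show "AE t in lborel. (\<lambda>n. f n t) \<longlonglongrightarrow> 1"
      using AE_zeta_reg_line_nonzero
    proof eventually_elim
      fix t assume nz: "zeta_reg (Complex (1/2) t) \<noteq> 0"
      have c: "(\<lambda>n. Complex (1/2 + \<epsilon> n) t) \<longlonglongrightarrow> Complex (1/2) t"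
        using tendsto_Complex[OF tendsto_add[OF tendsto_const[of "1/2"] lim\<epsilon>] tendsto_const[of t]] by simp
      have "isCont zeta_reg (Complex (1/2) t)"
        using holomorphic_on_imp_continuous_on[OF holomorphic_zeta_reg] open_halfspace_Re_gt[of 0]
        by (simp add: continuous_on_eq_continuous_at)
      hence z: "(\<lambda>n. zeta_reg (Complex (1/2 + \<epsilon> n) t)) \<longlonglongrightarrow> zeta_reg (Complex (1/2) t)"
        by (rule isCont_tendsto_compose[OF _ c])
      have "(\<lambda>n. f n t) \<longlonglongrightarrow> zeta_line t * ((Complex (1/2) t - 1) / zeta_reg (Complex (1/2) t))"
        unfolding f_def zeta_recip_def by (intro tendsto_intros c z nz)
      thus "(\<lambda>n. f n t) \<longlonglongrightarrow> 1" using nz line_ne_1[of t] by (simp add: zeta_line_def)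
    qed
  qed simp
  from tendsto_zero_ex_less[OF this e] obtain n where
    "(\<integral>\<^sup>+t. ennreal (W t * (cmod (f n t - 1))\<^sup>2) \<partial>lborel) < \<eta>" .
  thus ?thesis using \<epsilon>[of n] by (intro that[of "\<epsilon> n"]) (auto simp: f_def)
qed

text \<open>As \<open>h\<close> tends to \<open>0\<close> the Gaussian average concentrates at its
  centre. Here \<open>\<epsilon>\<close> is fixed, so the exponent of the growth bound may depend on
  it.\<close>

lemma zeta_line_gdirichlet_tendsto:
  assumes rh: zeta_zero_free and W: "W \<in> borel_measurable borel" "\<And>t. W t \<ge> 0" "\<And>k. integrable lborel (\<lambda>t. (10 + \<bar>t\<bar>) ^ k * W t)"
    and \<epsilon>: "0 < \<epsilon>" "\<epsilon> < 1" and e: "\<eta> > 0"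
  obtains h where "0 < h"
    "(\<integral>\<^sup>+t. ennreal (W t * (cmod (zeta_line t * gdirichlet h (Complex (1/2 + \<epsilon>) t) - zeta_line t * zeta_recip (Complex (1/2 + \<epsilon>) t)))\<^sup>2) \<partial>lborel) < \<eta>"
proof -
  obtain K0 where K0: "K0 \<ge> 1" "\<And>t. cmod (zeta_line t) \<le> K0 * (10 + \<bar>t\<bar>) ^ 2" using zeta_line_growth by blast
  obtain K k where K: "K \<ge> 1" "\<And>s. 1/2 + \<epsilon> \<le> Re s \<Longrightarrow> Re s \<le> 6 \<Longrightarrow> cmod (zeta_recip s) \<le> K * (10 + \<bar>Im s\<bar>) ^ k"
    using zeta_recip_bound[OF rh \<epsilon>] by blast
  define w where "w t = Complex (1/2 + \<epsilon>) t" for t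
  define h where "h n = 1 / real (n + 1)" for n
  have h: "0 < h n" "h n \<le> 1" for n by (simp_all add: h_def)
  have limh: "h \<longlonglongrightarrow> 0" unfolding h_def by (rule LIMSEQ_ignore_initial_segment[OF lim_1_over_n])
  define C where "C = max 1 (\<integral>y. (1 + \<bar>y\<bar>) ^ k \<partial>gauss)"
  \<comment> \<open>A product bound separates \<open>t\<close> from \<open>y\<close>: integration
    over \<open>y\<close> then costs only a Gaussian moment and leaves a power of
    \<open>10 + \<bar>t\<bar>\<close>.\<close>
  have bd: "cmod (zeta_recip (w t + \<i> * of_real (h n * y))) \<le> K * (10 + \<bar>t\<bar>) ^ k * (1 + \<bar>y\<bar>) ^ k" for t n y
  proof -
    have "cmod (zeta_recip (w t + \<i> * of_real (h n * y))) \<le> K * (10 + \<bar>Im (w t + \<i> * of_real (h n * y))\<bar>) ^ k"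
      using \<epsilon> by (intro K(2)) (auto simp: w_def)
    also have "\<dots> \<le> K * ((10 + \<bar>t\<bar>) * (1 + \<bar>y\<bar>)) ^ k"
    proof (intro mult_left_mono power_mono)
      have "\<bar>h n * y\<bar> \<le> 1 * \<bar>y\<bar>" unfolding abs_mult using h[of n] by (intro mult_right_mono) auto
      hence "10 + \<bar>t + h n * y\<bar> \<le> 10 + \<bar>t\<bar> + \<bar>y\<bar>" by linarith
      also have "\<dots> \<le> (10 + \<bar>t\<bar>) * (1 + \<bar>y\<bar>)" by (simp add: algebra_simps)
      finally show "10 + \<bar>Im (w t + \<i> * of_real (h n * y))\<bar> \<le> (10 + \<bar>t\<bar>) * (1 + \<bar>y\<bar>)" by (simp add: w_def)
    qed (use K in auto)
    finally show ?thesis by (simp only: power_mult_distrib mult.assoc)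
  qed
  have cont: "continuous_on UNIV (\<lambda>y. zeta_recip (w t + \<i> * of_real (a * y)))" for t a
    by (rule continuous_on_compose2[OF holomorphic_on_imp_continuous_on[OF holomorphic_zeta_recip[OF rh]]])
      (use \<epsilon> in \<open>auto intro!: continuous_intros simp: w_def\<close>)
  have meas: "(\<lambda>y. zeta_recip (w t + \<i> * of_real (a * y))) \<in> borel_measurable gauss" for t a
    unfolding measurable_cong_sets[OF sets_gauss refl] by (rule borel_measurable_continuous_onI[OF cont])
  have gd: "gdirichlet (h n) (w t) = (\<integral>y. zeta_recip (w t + \<i> * of_real (h n * y)) \<partial>gauss)" for n t
    by (rule gdirichlet_eq[OF rh]) (use \<epsilon> h in \<open>auto simp: w_def\<close>)
  have im: "integrable gauss (\<lambda>y. K * (10 + \<bar>t\<bar>) ^ k * (1 + \<bar>y\<bar>) ^ k)" for t :: real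
    by (intro integrable_mult_right integrable_gauss_moment)
  have gb: "cmod (gdirichlet (h n) (w t)) \<le> K * (10 + \<bar>t\<bar>) ^ k * C" for n t
  proof -
    have "cmod (gdirichlet (h n) (w t)) \<le> (\<integral>y. K * (10 + \<bar>t\<bar>) ^ k * (1 + \<bar>y\<bar>) ^ k \<partial>gauss)"
      unfolding gd
      by (rule Bochner_Integration.integral_norm_bound_integral[OF Bochner_Integration.integrable_bound[OF im meas] im])
         (use bd K in \<open>auto intro!: AE_I2 intro: order_trans[OF _ abs_ge_self]\<close>)
    also have "\<dots> = K * (10 + \<bar>t\<bar>) ^ k * (\<integral>y. (1 + \<bar>y\<bar>) ^ k \<partial>gauss)" by (rule integral_mult_right_zero)
    also have "\<dots> \<le> K * (10 + \<bar>t\<bar>) ^ k * C" unfolding C_def using K by (intro mult_left_mono) auto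
    finally show ?thesis .
  qed
  have rb: "cmod (zeta_recip (w t)) \<le> K * (10 + \<bar>t\<bar>) ^ k * C" for t
  proof -
    have "cmod (zeta_recip (w t)) \<le> K * (10 + \<bar>t\<bar>) ^ k * 1" using bd[of t 0 0] by simp
    also have "\<dots> \<le> K * (10 + \<bar>t\<bar>) ^ k * C" unfolding C_def using K by (intro mult_left_mono) auto
    finally show ?thesis .
  qed
  have mul: "cmod (zeta_line t * x) \<le> (K0 * K * C) * (10 + \<bar>t\<bar>) ^ (k + 2)" if "cmod x \<le> K * (10 + \<bar>t\<bar>) ^ k * C" for t x
  proof -
    have "cmod (zeta_line t) * cmod x \<le> (K0 * (10 + \<bar>t\<bar>) ^ 2) * (K * (10 + \<bar>t\<bar>) ^ k * C)"
      using K0 that by (intro mult_mono) auto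
    thus ?thesis by (simp only: norm_mult power_add mult_ac)
  qed
  have "(\<lambda>n. \<integral>\<^sup>+t. ennreal (W t * (cmod (zeta_line t * gdirichlet (h n) (w t) - zeta_line t * zeta_recip (w t)))\<^sup>2) \<partial>lborel) \<longlonglongrightarrow> 0"
  proof (rule weighted_L2_tendsto[where k = "k + 2" and K = "K0 * K * C", OF W(1,2) W(3)])
    show "(\<lambda>t. zeta_line t * gdirichlet (h n) (w t)) \<in> borel_measurable borel" for n
    proof -
      have "continuous_on UNIV (\<lambda>t. gdirichlet (h n) (w t))" unfolding w_def
        by (rule continuous_on_vertical[OF holomorphic_gdirichlet]) (use \<epsilon> h in auto)
      hence [measurable]: "(\<lambda>t. gdirichlet (h n) (w t)) \<in> borel_measurable borel" by (rule borel_measurable_continuous_onI)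
      show ?thesis by measurable
    qed
    show "(\<lambda>t. zeta_line t * zeta_recip (w t)) \<in> borel_measurable borel"
    proof -
      have "continuous_on UNIV (\<lambda>t. zeta_recip (w t))" unfolding w_def
        by (rule continuous_on_vertical[OF holomorphic_zeta_recip[OF rh]]) (use \<epsilon> in auto)
      hence [measurable]: "(\<lambda>t. zeta_recip (w t)) \<in> borel_measurable borel" by (rule borel_measurable_continuous_onI)
      show ?thesis by measurable
    qed
    show "AE t in lborel. (\<lambda>n. zeta_line t * gdirichlet (h n) (w t)) \<longlonglongrightarrow> zeta_line t * zeta_recip (w t)"
    proof (intro AE_I2 tendsto_mult tendsto_const)
      fix t
      have "(\<lambda>n. \<integral>y. zeta_recip (w t + \<i> * of_real (h n * y)) \<partial>gauss) \<longlonglongrightarrow> (\<integral>y. zeta_recip (w t) \<partial>gauss)"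
      proof (rule integral_dominated_convergence[where w = "\<lambda>y. K * (10 + \<bar>t\<bar>) ^ k * (1 + \<bar>y\<bar>) ^ k"])
        show "AE y in gauss. (\<lambda>n. zeta_recip (w t + \<i> * of_real (h n * y))) \<longlonglongrightarrow> zeta_recip (w t)"
        proof (rule AE_I2)
          fix y
          have "isCont (\<lambda>y. zeta_recip (w t + \<i> * of_real (1 * y))) 0"
            using cont[of t 1] by (simp add: continuous_on_eq_continuous_at)
          moreover have "(\<lambda>n. h n * y) \<longlonglongrightarrow> 0" using tendsto_mult_left_zero[OF limh] by simp
          ultimately show "(\<lambda>n. zeta_recip (w t + \<i> * of_real (h n * y))) \<longlonglongrightarrow> zeta_recip (w t)"
            using isCont_tendsto_compose[of "0::real" "\<lambda>y. zeta_recip (w t + \<i> * of_real (1 * y))" "\<lambda>n. h n * y" sequentially] by simp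
        qed
      qed (use meas im bd in auto)
      thus "(\<lambda>n. gdirichlet (h n) (w t)) \<longlonglongrightarrow> zeta_recip (w t)" unfolding gd by simp
    qed
  qed (use mul gb rb in auto)
  from tendsto_zero_ex_less[OF this e] obtain n where
    "(\<integral>\<^sup>+t. ennreal (W t * (cmod (zeta_line t * gdirichlet (h n) (w t) - zeta_line t * zeta_recip (w t)))\<^sup>2) \<partial>lborel) < \<eta>" .
  thus ?thesis using h[of n] by (intro that[of "h n"]) (auto simp: w_def)
qed

text \<open>For fixed \<open>h\<close> all partial sums share a bound independent of
  \<open>t\<close>, so the growth in the majorant comes from zeta alone.\<close>

lemma zeta_line_partial_tendsto:
  assumes W: "W \<in> borel_measurable borel" "\<And>t. W t \<ge> 0" "\<And>k. integrable lborel (\<lambda>t. (10 + \<bar>t\<bar>) ^ k * W t)"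
    and \<epsilon>: "0 < \<epsilon>" and h: "h > 0" and e: "\<eta> > 0"
  obtains N where
    "(\<integral>\<^sup>+t. ennreal (W t * (cmod (zeta_line t * (\<Sum>n<N. gdirichlet_term h n (Complex (1/2 + \<epsilon>) t)) - zeta_line t * gdirichlet h (Complex (1/2 + \<epsilon>) t)))\<^sup>2) \<partial>lborel) < \<eta>"
proof -
  obtain K0 where K0: "K0 \<ge> 1" "\<And>t. cmod (zeta_line t) \<le> K0 * (10 + \<bar>t\<bar>) ^ 2" using zeta_line_growth by blast
  define w where "w t = Complex (1/2 + \<epsilon>) t" for t
  have rw: "Re (w t) \<ge> 0" for t using \<epsilon> by (simp add: w_def)
  define C where "C = (\<Sum>n. exp (8 / h\<^sup>2) * real (Suc n) powr - 2)"
  have sm: "summable (\<lambda>n. exp (8 / h\<^sup>2) * real (Suc n) powr - 2)" by (rule summable_gbound)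
  have pb: "cmod (\<Sum>n<N. gdirichlet_term h n (w t)) \<le> C" for N t
  proof -
    have "cmod (\<Sum>n<N. gdirichlet_term h n (w t)) \<le> (\<Sum>n<N. exp (8 / h\<^sup>2) * real (Suc n) powr - 2)"
      by (rule sum_norm_le) (rule gdirichlet_term_bound[OF h rw])
    also have "\<dots> \<le> C" unfolding C_def by (rule sum_le_suminf[OF sm]) auto
    finally show ?thesis .
  qed
  have lim: "(\<lambda>N. \<Sum>n<N. gdirichlet_term h n (w t)) \<longlonglongrightarrow> gdirichlet h (w t)" for t
    by (rule tendsto_uniform_limitI[OF gdirichlet_uniform[OF h]]) (use rw in simp)
  have gb: "cmod (gdirichlet h (w t)) \<le> C" for t
    by (rule LIMSEQ_le_const2[OF tendsto_norm[OF lim]]) (use pb in auto)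
  have mul: "cmod (zeta_line t * x) \<le> (K0 * C) * (10 + \<bar>t\<bar>) ^ 2" if "cmod x \<le> C" for t x
  proof -
    have "cmod (zeta_line t) * cmod x \<le> (K0 * (10 + \<bar>t\<bar>) ^ 2) * C"
      using K0 that by (intro mult_mono) auto
    thus ?thesis by (simp add: norm_mult mult_ac)
  qed
  have [measurable]: "(\<lambda>t. w t) \<in> borel_measurable borel" unfolding w_def Complex_eq by measurable
  have tm: "(\<lambda>t. \<Sum>n<N. gdirichlet_term h n (w t)) \<in> borel_measurable borel" for N
    unfolding gdirichlet_term_def powr_def by measurable
  have gm: "(\<lambda>t. gdirichlet h (w t)) \<in> borel_measurable borel"
    by (rule borel_measurable_LIMSEQ_metric[OF tm lim])
  note [measurable] = tm gm
  have "(\<lambda>N. \<integral>\<^sup>+t. ennreal (W t * (cmod (zeta_line t * (\<Sum>n<N. gdirichlet_term h n (w t)) - zeta_line t * gdirichlet h (w t)))\<^sup>2) \<partial>lborel) \<longlonglongrightarrow> 0"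
    by (rule weighted_L2_tendsto[where k = 2 and K = "K0 * C", OF W(1,2) W(3)])
      (auto intro!: mul pb gb tendsto_mult lim)
  from tendsto_zero_ex_less[OF this e] obtain N where
    "(\<integral>\<^sup>+t. ennreal (W t * (cmod (zeta_line t * (\<Sum>n<N. gdirichlet_term h n (w t)) - zeta_line t * gdirichlet h (w t)))\<^sup>2) \<partial>lborel) < \<eta>" .
  thus ?thesis by (intro that[of N]) (auto simp: w_def)
qed

text \<open>The square of a sum of three terms is at most three times the sum of their squares;
  three errors below \<open>\<eta> / 18\<close> thus give at most \<open>\<eta> / 2\<close>, which
  leaves a strict inequality.\<close>

lemma zeta_dirichlet_approximation:
  assumes rh: zeta_zero_free and W: "W \<in> borel_measurable borel" "\<And>t. W t \<ge> 0" "\<And>k. integrable lborel (\<lambda>t. (10 + \<bar>t\<bar>) ^ k * W t)"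
    and e: "\<eta> > 0"
  obtains N and b :: "nat \<Rightarrow> complex" where
    "(\<integral>\<^sup>+t. ennreal (W t * (cmod (zeta_line t * (\<Sum>n<N. b n * of_nat (Suc n) powr - Complex (1/2) t) - 1))\<^sup>2) \<partial>lborel) < ennreal \<eta>"
proof -
  have e3: "ennreal (\<eta> / 18) > 0" using e by simp
  obtain \<epsilon> where \<epsilon>: "0 < \<epsilon>" "\<epsilon> < 1"
    "(\<integral>\<^sup>+t. ennreal (W t * (cmod (zeta_line t * zeta_recip (Complex (1/2 + \<epsilon>) t) - 1))\<^sup>2) \<partial>lborel) < ennreal (\<eta> / 18)"
    using zeta_line_recip_tendsto[OF rh W e3] by blast
  obtain h where h: "h > 0"
    "(\<integral>\<^sup>+t. ennreal (W t * (cmod (zeta_line t * gdirichlet h (Complex (1/2 + \<epsilon>) t) - zeta_line t * zeta_recip (Complex (1/2 + \<epsilon>) t)))\<^sup>2) \<partial>lborel) < ennreal (\<eta> / 18)"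
    using zeta_line_gdirichlet_tendsto[OF rh W \<epsilon>(1,2) e3] by blast
  obtain N where N:
    "(\<integral>\<^sup>+t. ennreal (W t * (cmod (zeta_line t * (\<Sum>n<N. gdirichlet_term h n (Complex (1/2 + \<epsilon>) t)) - zeta_line t * gdirichlet h (Complex (1/2 + \<epsilon>) t)))\<^sup>2) \<partial>lborel) < ennreal (\<eta> / 18)"
    using zeta_line_partial_tendsto[OF W \<epsilon>(1) h(1) e3] by blast
  \<comment> \<open>The shift by \<open>\<epsilon>\<close> goes into the coefficients, so that the
    Dirichlet polynomial is evaluated on the critical line itself.\<close>
  define b :: "nat \<Rightarrow> complex" where "b n = of_real (dirichlet_inv (Suc n) * exp (- (h * ln (real (Suc n)))\<^sup>2 / 2)) * of_nat (Suc n) powr - of_real \<epsilon>" for n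
  have bn: "b n * of_nat (Suc n) powr - Complex (1/2) t = gdirichlet_term h n (Complex (1/2 + \<epsilon>) t)" for n t
  proof -
    have "- of_real \<epsilon> + - Complex (1/2) t = - Complex (1/2 + \<epsilon>) t" by (simp add: complex_eq_iff)
    thus ?thesis unfolding b_def gdirichlet_term_def mult.assoc powr_add[symmetric] by simp
  qed
  define F1 where "F1 t = zeta_line t * (\<Sum>n<N. gdirichlet_term h n (Complex (1/2 + \<epsilon>) t))" for t
  define F2 where "F2 t = zeta_line t * gdirichlet h (Complex (1/2 + \<epsilon>) t)" for t
  define F3 where "F3 t = zeta_line t * zeta_recip (Complex (1/2 + \<epsilon>) t)" for t
  have [measurable]: "(\<lambda>t. Complex (1/2 + \<epsilon>) t) \<in> borel_measurable borel" unfolding Complex_eq by measurable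
  have [measurable]: "F1 \<in> borel_measurable borel"
    unfolding F1_def[abs_def] gdirichlet_term_def powr_def by measurable
  have "continuous_on UNIV (\<lambda>t. gdirichlet h (Complex (1/2 + \<epsilon>) t))"
    by (rule continuous_on_vertical[OF holomorphic_gdirichlet]) (use \<epsilon> h in auto)
  hence [measurable]: "(\<lambda>t. gdirichlet h (Complex (1/2 + \<epsilon>) t)) \<in> borel_measurable borel" by (rule borel_measurable_continuous_onI)
  have [measurable]: "F2 \<in> borel_measurable borel" unfolding F2_def[abs_def] by measurable
  have "continuous_on UNIV (\<lambda>t. zeta_recip (Complex (1/2 + \<epsilon>) t))"
    by (rule continuous_on_vertical[OF holomorphic_zeta_recip[OF rh]]) (use \<epsilon> in auto)
  hence [measurable]: "(\<lambda>t. zeta_recip (Complex (1/2 + \<epsilon>) t)) \<in> borel_measurable borel" by (rule borel_measurable_continuous_onI)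
  have [measurable]: "F3 \<in> borel_measurable borel" unfolding F3_def[abs_def] by measurable
  note [measurable] = W(1)
  have pt: "ennreal (W t * (cmod (F1 t - 1))\<^sup>2) \<le> 3 * (ennreal (W t * (cmod (F1 t - F2 t))\<^sup>2) + (ennreal (W t * (cmod (F2 t - F3 t))\<^sup>2) + ennreal (W t * (cmod (F3 t - 1))\<^sup>2)))" for t
  proof -
    have "cmod (F1 t - 1) \<le> cmod (F1 t - F2 t) + cmod (F2 t - F3 t) + cmod (F3 t - 1)"
      using norm_triangle_ineq[of "F1 t - F2 t" "F2 t - 1"] norm_triangle_ineq[of "F2 t - F3 t" "F3 t - 1"] by simp
    hence "(cmod (F1 t - 1))\<^sup>2 \<le> (cmod (F1 t - F2 t) + cmod (F2 t - F3 t) + cmod (F3 t - 1))\<^sup>2" by (intro power_mono) auto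
    also have "\<dots> \<le> 3 * ((cmod (F1 t - F2 t))\<^sup>2 + ((cmod (F2 t - F3 t))\<^sup>2 + (cmod (F3 t - 1))\<^sup>2))"
      using sum_squares_bound[of "cmod (F1 t - F2 t)" "cmod (F2 t - F3 t)"] sum_squares_bound[of "cmod (F1 t - F2 t)" "cmod (F3 t - 1)"]
        sum_squares_bound[of "cmod (F2 t - F3 t)" "cmod (F3 t - 1)"] by (simp add: power2_eq_square algebra_simps)
    finally have "W t * (cmod (F1 t - 1))\<^sup>2 \<le> W t * (3 * ((cmod (F1 t - F2 t))\<^sup>2 + ((cmod (F2 t - F3 t))\<^sup>2 + (cmod (F3 t - 1))\<^sup>2)))"
      using W(2) by (rule mult_left_mono)
    also have "\<dots> = 3 * (W t * (cmod (F1 t - F2 t))\<^sup>2 + (W t * (cmod (F2 t - F3 t))\<^sup>2 + W t * (cmod (F3 t - 1))\<^sup>2))"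
      by (simp add: algebra_simps)
    finally have "ennreal (W t * (cmod (F1 t - 1))\<^sup>2) \<le> ennreal (3 * (W t * (cmod (F1 t - F2 t))\<^sup>2 + (W t * (cmod (F2 t - F3 t))\<^sup>2 + W t * (cmod (F3 t - 1))\<^sup>2)))"
      by (rule ennreal_leI)
    also have "\<dots> = 3 * (ennreal (W t * (cmod (F1 t - F2 t))\<^sup>2) + (ennreal (W t * (cmod (F2 t - F3 t))\<^sup>2) + ennreal (W t * (cmod (F3 t - 1))\<^sup>2)))"
      using W(2)[of t] by (simp add: ennreal_mult ennreal_plus)
    finally show ?thesis .
  qed
  have "(\<integral>\<^sup>+t. ennreal (W t * (cmod (F1 t - 1))\<^sup>2) \<partial>lborel) \<le>
    (\<integral>\<^sup>+t. 3 * (ennreal (W t * (cmod (F1 t - F2 t))\<^sup>2) + (ennreal (W t * (cmod (F2 t - F3 t))\<^sup>2) + ennreal (W t * (cmod (F3 t - 1))\<^sup>2))) \<partial>lborel)"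
    by (intro nn_integral_mono pt)
  also have "\<dots> = 3 * ((\<integral>\<^sup>+t. ennreal (W t * (cmod (F1 t - F2 t))\<^sup>2) \<partial>lborel) + ((\<integral>\<^sup>+t. ennreal (W t * (cmod (F2 t - F3 t))\<^sup>2) \<partial>lborel) + (\<integral>\<^sup>+t. ennreal (W t * (cmod (F3 t - 1))\<^sup>2) \<partial>lborel)))"
    by (simp add: nn_integral_cmult nn_integral_add)
  also have "\<dots> \<le> 3 * (ennreal (\<eta> / 18) + (ennreal (\<eta> / 18) + ennreal (\<eta> / 18)))"
    using N h(2) \<epsilon>(3) by (intro mult_left_mono add_mono) (auto simp: F1_def F2_def F3_def intro: less_imp_le)
  also have "\<dots> = ennreal (\<eta> / 2)"
  proof -
    have "ennreal (\<eta> / 18) + (ennreal (\<eta> / 18) + ennreal (\<eta> / 18)) = ennreal (\<eta> / 6)" using e by (simp add: ennreal_plus[symmetric] del: ennreal_plus)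
    thus ?thesis using e ennreal_mult[of 3 "\<eta> / 6"] by simp
  qed
  also have "\<dots> < ennreal \<eta>" using e by (intro ennreal_lessI) auto
  finally show ?thesis unfolding F1_def bn[symmetric] by (rule that)
qed

section \<open>Plancherel's inequality\<close>

text \<open>The general substitution rule speaks about \<open>lebesgue\<close>; for Borel functions
  the passage to the completion and back changes neither integrability nor the integral.\<close>

lemma change_of_variables_exp:
  fixes f :: "real \<Rightarrow> 'a :: euclidean_space"
  assumes [measurable]: "f \<in> borel_measurable borel"
  shows "set_integrable lborel {0<..} f \<longleftrightarrow> integrable lborel (\<lambda>x. exp (- x) *\<^sub>R f (exp (- x)))" (is ?A)
    and "integrable lborel (\<lambda>x. exp (- x) *\<^sub>R f (exp (- x))) \<Longrightarrow>
      (LINT u:{0<..}|lborel. f u) = (\<integral>x. exp (- x) *\<^sub>R f (exp (- x)) \<partial>lborel)" (is "_ \<Longrightarrow> ?B")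
proof -
  have d: "((\<lambda>x. exp (- x)) has_field_derivative - exp (- x)) (at x within UNIV)" for x :: real
    by (auto intro!: derivative_eq_intros)
  have inj: "inj_on (\<lambda>x::real. exp (- x)) UNIV" by (auto intro: inj_onI)
  have im: "range (\<lambda>x::real. exp (- x)) = {0<..}"
  proof (intro set_eqI iffI)
    fix y :: real assume "y \<in> {0<..}"
    hence "y = exp (- (- ln y))" by simp
    thus "y \<in> range (\<lambda>x. exp (- x))" by blast
  qed auto
  have leb: "set_integrable lebesgue {0<..} f \<longleftrightarrow> set_integrable lborel {0<..} f"
    unfolding set_integrable_def by (rule integrable_completion) measurable
  have leb2: "set_integrable lebesgue UNIV (\<lambda>x. exp (- x) *\<^sub>R f (exp (- x))) \<longleftrightarrow> integrable lborel (\<lambda>x. exp (- x) *\<^sub>R f (exp (- x)))"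
    unfolding set_integrable_def by (simp, rule integrable_completion) measurable
  show ?A
    using absolutely_integrable_change_of_variables_real[OF _ d inj, of f] unfolding im leb by (simp add: leb2)
  show ?B if i: "integrable lborel (\<lambda>x. exp (- x) *\<^sub>R f (exp (- x)))"
  proof -
    have i2: "set_integrable lebesgue UNIV (\<lambda>x. exp (- x) *\<^sub>R f (exp (- x)))" using i leb2 by simp
    have i3: "set_integrable lebesgue {0<..} f" using i \<open>?A\<close> leb by simp
    have "integral {0<..} f = integral UNIV (\<lambda>x. exp (- x) *\<^sub>R f (exp (- x)))"
      using has_absolute_integral_change_of_variables_real[OF _ d inj, of f "integral UNIV (\<lambda>x. exp (- x) *\<^sub>R f (exp (- x)))"] i2
      unfolding im by simp
    moreover have "(LINT u:{0<..}|lborel. f u) = integral {0<..} f"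
      using set_lebesgue_integral_eq_integral(2)[OF i3]
      unfolding set_lebesgue_integral_def by (subst (asm) integral_completion) auto
    moreover have "(\<integral>x. exp (- x) *\<^sub>R f (exp (- x)) \<partial>lborel) = integral UNIV (\<lambda>x. exp (- x) *\<^sub>R f (exp (- x)))"
      using set_lebesgue_integral_eq_integral(2)[OF i2]
      unfolding set_lebesgue_integral_def by (simp, subst (asm) integral_completion) auto
    ultimately show ?thesis by simp
  qed
qed

definition fourier :: "(real \<Rightarrow> complex) \<Rightarrow> real \<Rightarrow> complex" where
  "fourier F t = (\<integral>x. F x * exp (- (\<i> * of_real (t * x))) \<partial>lborel)"

lemma cmod_exp_ii: "cmod (exp (- (\<i> * of_real a))) = 1" "cmod (exp (\<i> * of_real a)) = 1"
  by (simp_all add: norm_exp_eq_Re)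

lemma fourier_measurable [measurable]:
  assumes [measurable]: "F \<in> borel_measurable borel"
  shows "fourier F \<in> borel_measurable borel"
  unfolding fourier_def[abs_def] by (rule lborel.borel_measurable_lebesgue_integral) measurable

lemma measurable_cnj_comp [measurable (raw)]:
  assumes "f \<in> borel_measurable M"
  shows "(\<lambda>x. cnj (f x)) \<in> borel_measurable M"
  by (rule measurable_compose[OF assms borel_measurable_continuous_onI]) (intro continuous_intros)

lemma fourier_bound:
  assumes "integrable lborel F"
  shows "cmod (fourier F t) \<le> (\<integral>x. cmod (F x) \<partial>lborel)"
  unfolding fourier_def
  by (rule order_trans[OF integral_norm_bound]) (simp add: norm_mult cmod_exp_ii)

text \<open>Fourier inversion with Gaussian summation. Fubini moves the average inside, where it
  becomes a Gaussian kernel of width \<open>1 / L\<close> around \<open>x\<close>.\<close>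

lemma fourier_gauss_inner:
  assumes F: "integrable lborel F" and L: "L > 0"
  shows "(\<integral>y. exp (\<i> * of_real (L * y * x)) * fourier F (L * y) \<partial>gauss) = of_real (sqrt (2 * pi) / L) * (\<integral>z. F (x - z / L) \<partial>gauss)"
proof -
  have [measurable]: "F \<in> borel_measurable borel" using F by simp
  interpret P: pair_sigma_finite gauss lborel ..
  have pi: "integrable (gauss \<Otimes>\<^sub>M lborel) (\<lambda>(y, x'). F x' * exp (- (\<i> * of_real (y * (L * (x' - x))))))"
  proof (rule P.Fubini_integrable)
    show "(\<lambda>(y, x'). F x' * exp (- (\<i> * of_real (y * (L * (x' - x)))))) \<in> borel_measurable (gauss \<Otimes>\<^sub>M lborel)" by measurable
    show "integrable gauss (\<lambda>y. \<integral>x'. norm (case (y, x') of (y, x') \<Rightarrow> F x' * exp (- (\<i> * of_real (y * (L * (x' - x)))))) \<partial>lborel)"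
      by (simp add: norm_mult cmod_exp_ii)
    show "AE y in gauss. integrable lborel (\<lambda>x'. case (y, x') of (y, x') \<Rightarrow> F x' * exp (- (\<i> * of_real (y * (L * (x' - x))))))"
      unfolding case_prod_conv
      by (intro AE_I2 Bochner_Integration.integrable_bound[OF F]) (auto simp: norm_mult cmod_exp_ii)
  qed
  have "(\<integral>y. exp (\<i> * of_real (L * y * x)) * fourier F (L * y) \<partial>gauss) =
      (\<integral>y. (\<integral>x'. F x' * exp (- (\<i> * of_real (y * (L * (x' - x))))) \<partial>lborel) \<partial>gauss)"
  proof (rule Bochner_Integration.integral_cong[OF refl])
    fix y
    have "exp (\<i> * of_real (L * y * x)) * fourier F (L * y) = (\<integral>x'. exp (\<i> * of_real (L * y * x)) * (F x' * exp (- (\<i> * of_real (L * y * x')))) \<partial>lborel)"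
      unfolding fourier_def by (rule integral_mult_right_zero[symmetric])
    also have "\<dots> = (\<integral>x'. F x' * exp (- (\<i> * of_real (y * (L * (x' - x))))) \<partial>lborel)"
    proof (rule Bochner_Integration.integral_cong[OF refl])
      fix x'
      have "exp (\<i> * of_real (L * y * x)) * exp (- (\<i> * of_real (L * y * x'))) = exp (- (\<i> * complex_of_real (y * (L * (x' - x)))))"
        by (simp add: exp_add[symmetric] algebra_simps)
      thus "exp (\<i> * of_real (L * y * x)) * (F x' * exp (- (\<i> * of_real (L * y * x')))) = F x' * exp (- (\<i> * of_real (y * (L * (x' - x)))))"
        by (metis mult.left_commute)
    qed
    finally show "exp (\<i> * of_real (L * y * x)) * fourier F (L * y) = (\<integral>x'. F x' * exp (- (\<i> * of_real (y * (L * (x' - x))))) \<partial>lborel)" .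
  qed
  also have "\<dots> = (\<integral>x'. (\<integral>y. F x' * exp (- (\<i> * of_real (y * (L * (x' - x))))) \<partial>gauss) \<partial>lborel)"
    using P.Fubini_integral[OF pi] by simp
  also have "\<dots> = (\<integral>x'. F x' * of_real (exp (- (L * (x' - x))\<^sup>2 / 2)) \<partial>lborel)"
    by (rule Bochner_Integration.integral_cong[OF refl]) (simp only: integral_mult_right_zero integral_gauss_exp)
  also have "\<dots> = (1 / L) *\<^sub>R (\<integral>z. F (x - z / L) * of_real (exp (- z\<^sup>2 / 2)) \<partial>lborel)"
  proof -
    have "(\<integral>x'. F x' * of_real (exp (- (L * (x' - x))\<^sup>2 / 2)) \<partial>lborel) = \<bar>- 1 / L\<bar> *\<^sub>R
      (\<integral>z. F (x + (- 1 / L) * z) * of_real (exp (- (L * ((x + (- 1 / L) * z) - x))\<^sup>2 / 2)) \<partial>lborel)"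
      by (rule lborel_integral_real_affine) (use L in simp)
    also have "\<bar>- 1 / L\<bar> = 1 / L" using L by simp
    also have "(\<lambda>z. F (x + (- 1 / L) * z) * of_real (exp (- (L * ((x + (- 1 / L) * z) - x))\<^sup>2 / 2))) =
      (\<lambda>z. F (x - z / L) * of_real (exp (- z\<^sup>2 / 2)))"
      using L by (intro ext) simp
    finally show ?thesis .
  qed
  also have "(\<integral>z. F (x - z / L) * of_real (exp (- z\<^sup>2 / 2)) \<partial>lborel) = of_real (sqrt (2 * pi)) * (\<integral>z. F (x - z / L) \<partial>gauss)"
  proof -
    have "(\<integral>z. F (x - z / L) \<partial>gauss) = (\<integral>z. std_normal_density z *\<^sub>R F (x - z / L) \<partial>lborel)"
      unfolding gauss_def by (rule integral_density; (measurable | simp))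
    also have "\<dots> = (\<integral>z. of_real (1 / sqrt (2 * pi)) * (F (x - z / L) * of_real (exp (- z\<^sup>2 / 2))) \<partial>lborel)"
      by (rule Bochner_Integration.integral_cong[OF refl]) (simp add: std_normal_density_def scaleR_conv_of_real)
    also have "\<dots> = of_real (1 / sqrt (2 * pi)) * (\<integral>z. F (x - z / L) * of_real (exp (- z\<^sup>2 / 2)) \<partial>lborel)"
      by (rule integral_mult_right_zero)
    finally show ?thesis by simp
  qed
  finally show ?thesis using L by (simp add: scaleR_conv_of_real)
qed

text \<open>One factor of the squared modulus is expanded as an integral and the order exchanged;
  the other factor then forms the Gaussian-summed inversion integral of the preceding lemma.\<close>

lemma fourier_gauss_norm:
  assumes F: "integrable lborel F" and B: "\<And>x. cmod (F x) \<le> B" and L: "L > 0"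
  shows "(\<integral>y. of_real ((cmod (fourier F (L * y)))\<^sup>2) \<partial>gauss) = of_real (sqrt (2 * pi) / L) * (\<integral>x. F x * cnj (\<integral>z. F (x - z / L) \<partial>gauss) \<partial>lborel)"
proof -
  have [measurable]: "F \<in> borel_measurable borel" using F by simp
  interpret P: pair_sigma_finite gauss lborel ..
  define I where "I = (\<integral>x. cmod (F x) \<partial>lborel)"
  have fb: "cmod (fourier F t) \<le> I" for t unfolding I_def by (rule fourier_bound[OF F])
  have gi: "integrable gauss (\<lambda>y. cmod (fourier F (L * y)))"
    by (rule gauss.integrable_const_bound[where B = I]) (use fb in auto)
  have pi: "integrable (gauss \<Otimes>\<^sub>M lborel) (\<lambda>(y, x). F x * exp (- (\<i> * of_real (L * y * x))) * cnj (fourier F (L * y)))"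
  proof (rule P.Fubini_integrable)
    show "(\<lambda>(y, x). F x * exp (- (\<i> * of_real (L * y * x))) * cnj (fourier F (L * y))) \<in> borel_measurable (gauss \<Otimes>\<^sub>M lborel)" by measurable
    show "integrable gauss (\<lambda>y. \<integral>x. norm (case (y, x) of (y, x) \<Rightarrow> F x * exp (- (\<i> * of_real (L * y * x))) * cnj (fourier F (L * y))) \<partial>lborel)"
      using gi by (simp add: norm_mult cmod_exp_ii)
    show "AE y in gauss. integrable lborel (\<lambda>x. case (y, x) of (y, x) \<Rightarrow> F x * exp (- (\<i> * of_real (L * y * x))) * cnj (fourier F (L * y)))"
      unfolding case_prod_conv
      by (intro AE_I2 integrable_mult_left Bochner_Integration.integrable_bound[OF F]) (auto simp: norm_mult cmod_exp_ii)
  qed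
  have "(\<integral>y. of_real ((cmod (fourier F (L * y)))\<^sup>2) \<partial>gauss) =
      (\<integral>y. (\<integral>x. F x * exp (- (\<i> * of_real (L * y * x))) * cnj (fourier F (L * y)) \<partial>lborel) \<partial>gauss)"
    by (rule Bochner_Integration.integral_cong[OF refl])
       (simp only: integral_mult_left_zero fourier_def[symmetric] complex_norm_square)
  also have "\<dots> = (\<integral>x. (\<integral>y. F x * exp (- (\<i> * of_real (L * y * x))) * cnj (fourier F (L * y)) \<partial>gauss) \<partial>lborel)"
    using P.Fubini_integral[OF pi] by simp
  also have "\<dots> = (\<integral>x. of_real (sqrt (2 * pi) / L) * (F x * cnj (\<integral>z. F (x - z / L) \<partial>gauss)) \<partial>lborel)"
  proof (rule Bochner_Integration.integral_cong[OF refl])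
    fix x
    have "(\<integral>y. F x * exp (- (\<i> * of_real (L * y * x))) * cnj (fourier F (L * y)) \<partial>gauss) =
      (\<integral>y. F x * cnj (exp (\<i> * of_real (L * y * x)) * fourier F (L * y)) \<partial>gauss)"
      by (rule Bochner_Integration.integral_cong[OF refl]) (simp add: exp_cnj mult.assoc)
    also have "\<dots> = F x * cnj (\<integral>y. exp (\<i> * of_real (L * y * x)) * fourier F (L * y) \<partial>gauss)"
      by (simp only: integral_mult_right_zero Bochner_Integration.integral_cnj)
    finally show "(\<integral>y. F x * exp (- (\<i> * of_real (L * y * x))) * cnj (fourier F (L * y)) \<partial>gauss) =
      of_real (sqrt (2 * pi) / L) * (F x * cnj (\<integral>z. F (x - z / L) \<partial>gauss))"
      unfolding fourier_gauss_inner[OF F L] by simp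
  qed
  also have "\<dots> = of_real (sqrt (2 * pi) / L) * (\<integral>x. F x * cnj (\<integral>z. F (x - z / L) \<partial>gauss) \<partial>lborel)"
    by (rule integral_mult_right_zero)
  finally show ?thesis .
qed

text \<open>Let the scale \<open>L\<close> tend to infinity. The density of \<open>gauss\<close> is
  at most \<open>1 / sqrt (2 * pi)\<close>, which bounds every weighted integral by the full one,
  while the averages of width \<open>1 / L\<close> tend to \<open>F\<close> by continuity. This is
  the direction that turns a small transform into a small function.\<close>

lemma plancherel_le:
  assumes F: "integrable lborel F" and B: "\<And>x. cmod (F x) \<le> B" and c: "continuous_on UNIV F"
  shows "ennreal (2 * pi) * (\<integral>\<^sup>+x. ennreal ((cmod (F x))\<^sup>2) \<partial>lborel) \<le> (\<integral>\<^sup>+t. ennreal ((cmod (fourier F t))\<^sup>2) \<partial>lborel)"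
proof -
  have [measurable]: "F \<in> borel_measurable borel" using F by simp
  define I where "I = (\<integral>x. cmod (F x) \<partial>lborel)"
  have fb: "cmod (fourier F t) \<le> I" for t unfolding I_def by (rule fourier_bound[OF F])
  define X where "X = (\<integral>\<^sup>+t. ennreal ((cmod (fourier F t))\<^sup>2) \<partial>lborel)"
  define a where "a n = (\<integral>x. F x * cnj (\<integral>z. F (x - z / real (Suc n)) \<partial>gauss) \<partial>lborel)" for n
  have le: "ennreal (2 * pi * Re (a n)) \<le> X" for n
  proof -
    define L where "L = real (Suc n)"
    have L: "L > 0" by (simp add: L_def)
    have gi: "integrable gauss (\<lambda>y. (cmod (fourier F (L * y)))\<^sup>2)"
      by (rule gauss.integrable_const_bound[where B = "I\<^sup>2"]) (use fb in \<open>auto intro!: power_mono\<close>)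
    have ceq: "complex_of_real (\<integral>y. (cmod (fourier F (L * y)))\<^sup>2 \<partial>gauss) = of_real (sqrt (2 * pi) / L) * a n"
      unfolding a_def L_def[symmetric] fourier_gauss_norm[OF F B L, symmetric] by (rule integral_complex_of_real[symmetric])
    have "(\<integral>y. (cmod (fourier F (L * y)))\<^sup>2 \<partial>gauss) = sqrt (2 * pi) / L * Re (a n)"
    proof -
      have *: "A = c * Re z" if "complex_of_real A = of_real c * z" for A c z
        using arg_cong[OF that, of Re] by simp
      show ?thesis by (rule *[OF ceq])
    qed
    hence 1: "2 * pi * Re (a n) = sqrt (2 * pi) * L * (\<integral>y. (cmod (fourier F (L * y)))\<^sup>2 \<partial>gauss)"
    proof -
      have "sqrt (2 * pi) * sqrt (2 * pi) = 2 * pi" by simp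
      hence "2 * pi * Re (a n) = sqrt (2 * pi) * L * (sqrt (2 * pi) / L * Re (a n))" using L by simp
      thus ?thesis by (simp only: \<open>(\<integral>y. (cmod (fourier F (L * y)))\<^sup>2 \<partial>gauss) = sqrt (2 * pi) / L * Re (a n)\<close>)
    qed
    have "ennreal (\<integral>y. (cmod (fourier F (L * y)))\<^sup>2 \<partial>gauss) = (\<integral>\<^sup>+y. ennreal ((cmod (fourier F (L * y)))\<^sup>2) \<partial>gauss)"
      by (rule nn_integral_eq_integral[OF gi, symmetric]) simp
    also have "\<dots> = (\<integral>\<^sup>+y. ennreal (std_normal_density y) * ennreal ((cmod (fourier F (L * y)))\<^sup>2) \<partial>lborel)"
      unfolding gauss_def by (rule nn_integral_density) measurable
    also have "\<dots> \<le> (\<integral>\<^sup>+y. ennreal (1 / sqrt (2 * pi)) * ennreal ((cmod (fourier F (L * y)))\<^sup>2) \<partial>lborel)"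
      by (intro nn_integral_mono mult_right_mono ennreal_leI) (auto simp: std_normal_density_def divide_right_mono)
    also have "\<dots> = ennreal (1 / sqrt (2 * pi)) * (\<integral>\<^sup>+y. ennreal ((cmod (fourier F (L * y)))\<^sup>2) \<partial>lborel)"
      by (rule nn_integral_cmult) measurable
    finally have 2: "ennreal (\<integral>y. (cmod (fourier F (L * y)))\<^sup>2 \<partial>gauss) \<le> ennreal (1 / sqrt (2 * pi)) * (\<integral>\<^sup>+y. ennreal ((cmod (fourier F (L * y)))\<^sup>2) \<partial>lborel)" .
    have X: "X = ennreal L * (\<integral>\<^sup>+y. ennreal ((cmod (fourier F (L * y)))\<^sup>2) \<partial>lborel)"
      unfolding X_def using nn_integral_real_affine[of "\<lambda>t. ennreal ((cmod (fourier F t))\<^sup>2)" L 0] L by simp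
    have "ennreal (2 * pi * Re (a n)) = ennreal (sqrt (2 * pi) * L) * ennreal (\<integral>y. (cmod (fourier F (L * y)))\<^sup>2 \<partial>gauss)"
      unfolding 1 using L by (intro ennreal_mult) auto
    also have "\<dots> \<le> ennreal (sqrt (2 * pi) * L) * (ennreal (1 / sqrt (2 * pi)) * (\<integral>\<^sup>+y. ennreal ((cmod (fourier F (L * y)))\<^sup>2) \<partial>lborel))"
      by (intro mult_left_mono 2) auto
    also have "\<dots> = ennreal (sqrt (2 * pi) * L * (1 / sqrt (2 * pi))) * (\<integral>\<^sup>+y. ennreal ((cmod (fourier F (L * y)))\<^sup>2) \<partial>lborel)"
      unfolding mult.assoc[symmetric] using L by (subst ennreal_mult[of "sqrt (2 * pi) * L"]) auto
    also have "sqrt (2 * pi) * L * (1 / sqrt (2 * pi)) = L" by simp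
    finally show ?thesis unfolding X .
  qed
  have lim: "a \<longlonglongrightarrow> (\<integral>x. F x * cnj (F x) \<partial>lborel)"
    unfolding a_def
  proof (rule integral_dominated_convergence[where w = "\<lambda>x. cmod (F x) * B"])
    have gF: "integrable gauss (\<lambda>z. F (x - z / r))" for x r
      by (rule gauss.integrable_const_bound[where B = B]) (use B in auto)
    show "(\<lambda>x. F x * cnj (\<integral>z. F (x - z / real (Suc n)) \<partial>gauss)) \<in> borel_measurable lborel" for n
    proof -
      have "(\<lambda>x. \<integral>z. F (x - z / real (Suc n)) \<partial>gauss) \<in> borel_measurable borel"
        by (rule gauss.borel_measurable_lebesgue_integral) measurable
      hence [measurable]: "(\<lambda>x. \<integral>z. F (x - z / real (Suc n)) \<partial>gauss) \<in> borel_measurable borel" .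
      show ?thesis by measurable
    qed
    show "AE x in lborel. cmod (F x * cnj (\<integral>z. F (x - z / real (Suc n)) \<partial>gauss)) \<le> cmod (F x) * B" for n
    proof (rule AE_I2)
      fix x
      have "cmod (\<integral>z. F (x - z / real (Suc n)) \<partial>gauss) \<le> (\<integral>z. B \<partial>gauss)"
        by (rule Bochner_Integration.integral_norm_bound_integral[OF gF]) (use B in auto)
      hence "cmod (\<integral>z. F (x - z / real (Suc n)) \<partial>gauss) \<le> B" by simp
      thus "cmod (F x * cnj (\<integral>z. F (x - z / real (Suc n)) \<partial>gauss)) \<le> cmod (F x) * B"
        by (simp add: norm_mult mult_left_mono del: of_nat_Suc)
    qed
    show "AE x in lborel. (\<lambda>n. F x * cnj (\<integral>z. F (x - z / real (Suc n)) \<partial>gauss)) \<longlonglongrightarrow> F x * cnj (F x)"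
    proof (intro AE_I2 tendsto_mult tendsto_const tendsto_cnj)
      fix x
      have "(\<lambda>n. \<integral>z. F (x - z / real (Suc n)) \<partial>gauss) \<longlonglongrightarrow> (\<integral>z. F x \<partial>gauss)"
      proof (rule integral_dominated_convergence[where w = "\<lambda>_. B"])
        show "AE z in gauss. (\<lambda>n. F (x - z / real (Suc n))) \<longlonglongrightarrow> F x"
        proof (rule AE_I2)
          fix z :: real
          have "(\<lambda>n. z * (1 / real (Suc n))) \<longlonglongrightarrow> 0" by (rule tendsto_mult_right_zero) (rule LIMSEQ_Suc[OF lim_1_over_n])
          hence "(\<lambda>n. x - z / real (Suc n)) \<longlonglongrightarrow> x - 0" by (intro tendsto_diff tendsto_const) simp
          moreover have "isCont F x" using c by (simp add: continuous_on_eq_continuous_at)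
          ultimately show "(\<lambda>n. F (x - z / real (Suc n))) \<longlonglongrightarrow> F x" using isCont_tendsto_compose[of x F] by simp
        qed
      qed (use B gauss.integrable_const in auto)
      thus "(\<lambda>n. \<integral>z. F (x - z / real (Suc n)) \<partial>gauss) \<longlonglongrightarrow> F x" by simp
    qed
  qed (use F in auto)
  have sq: "(\<integral>x. F x * cnj (F x) \<partial>lborel) = of_real (\<integral>x. (cmod (F x))\<^sup>2 \<partial>lborel)"
    by (simp only: complex_norm_square[symmetric] integral_complex_of_real)
  have i2: "integrable lborel (\<lambda>x. (cmod (F x))\<^sup>2)"
  proof (rule Bochner_Integration.integrable_bound[OF integrable_mult_right[OF integrable_norm[OF F], of B]])
    show "AE x in lborel. norm ((cmod (F x))\<^sup>2) \<le> norm (B * cmod (F x))"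
    proof (rule AE_I2)
      fix x
      have "cmod (F x) * cmod (F x) \<le> \<bar>B\<bar> * cmod (F x)"
        using B[of x] by (intro mult_right_mono order_trans[OF B abs_ge_self]) auto
      thus "norm ((cmod (F x))\<^sup>2) \<le> norm (B * cmod (F x))" by (simp add: power2_eq_square abs_mult)
    qed
  qed simp
  have "(\<lambda>n. ennreal (2 * pi * Re (a n))) \<longlonglongrightarrow> ennreal (2 * pi * Re (\<integral>x. F x * cnj (F x) \<partial>lborel))"
    by (intro tendsto_ennrealI tendsto_mult tendsto_const tendsto_Re lim)
  hence "ennreal (2 * pi * Re (\<integral>x. F x * cnj (F x) \<partial>lborel)) \<le> X"
    by (rule LIMSEQ_le_const2) (use le in auto)
  moreover have "ennreal (2 * pi * Re (\<integral>x. F x * cnj (F x) \<partial>lborel)) = ennreal (2 * pi) * (\<integral>\<^sup>+x. ennreal ((cmod (F x))\<^sup>2) \<partial>lborel)"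
    unfolding sq nn_integral_eq_integral[OF i2] by (simp add: nn_integral_eq_integral[OF i2] ennreal_mult)
  ultimately show ?thesis by (simp add: X_def)
qed

section \<open>Mellin transforms of \<open>V\<close> and \<open>E\<close>\<close>

definition mellin :: "(real \<Rightarrow> complex) \<Rightarrow> complex \<Rightarrow> complex" where
  "mellin f s = (LINT u:{0<..}|lborel. f u * of_real u powr (s - 1))"

text \<open>Boundedness would not survive \<open>V\<close>, whose integral can grow like a logarithm
  at \<open>0\<close>, whereas a bound by \<open>u powr (- 1/4)\<close> does survive. It still gives
  square integrability at \<open>0\<close> and a Mellin transform on \<open>Re s > 1/4\<close>, an
  open set around the critical line.\<close>

definition tame :: "(real \<Rightarrow> complex) \<Rightarrow> bool" where
  "tame f \<longleftrightarrow> continuous_on {0<..} f \<and> (\<exists>M. \<forall>u>0. cmod (f u) \<le> M * u powr (- 1/4)) \<and> (\<forall>u\<ge>1. f u = 0)"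

lemma tameE:
  assumes "tame f"
  obtains M where "M \<ge> 0" "\<And>u. u > 0 \<Longrightarrow> cmod (f u) \<le> M * u powr (- 1/4)"
proof -
  obtain M where M: "\<And>u. u > 0 \<Longrightarrow> cmod (f u) \<le> M * u powr (- 1/4)" using assms unfolding tame_def by blast
  have "M \<ge> 0" using M[of 1] norm_ge_zero[of "f 1"] by (simp del: norm_ge_zero)
  thus ?thesis using M that by blast
qed

lemma continuous_on_powr_pos: "continuous_on {0<..} (\<lambda>u. complex_of_real u powr s)"
  by (intro continuous_intros) (auto simp: complex_nonpos_Reals_iff)

lemma set_measurable_pos:
  fixes f :: "real \<Rightarrow> complex"
  shows "continuous_on {0<..} f \<Longrightarrow> set_borel_measurable lborel {0<..} f"
  unfolding set_borel_measurable_def using borel_measurable_continuous_on_indicator[of "{0<..}" f] by simp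

lemma set_lebesgue_of_has_integral:
  fixes f :: "real \<Rightarrow> real"
  assumes [measurable]: "f \<in> borel_measurable borel" "A \<in> sets borel" and nn: "\<And>x. x \<in> A \<Longrightarrow> f x \<ge> 0"
    and hi: "(f has_integral I) A"
  shows "set_integrable lborel A f" "(LINT x:A|lborel. f x) = I"
proof -
  have "f absolutely_integrable_on A"
    by (rule nonnegative_absolutely_integrable_1) (use hi nn in auto)
  thus si: "set_integrable lborel A f"
    unfolding set_integrable_def by (subst (asm) integrable_completion) auto
  show "(LINT x:A|lborel. f x) = I"
    using set_borel_integral_eq_integral(2)[OF si] hi by (simp add: has_integral_iff)
qed

lemma powr_set_integrable_01:
  assumes "a > -1"
  shows "set_integrable lborel {0<..<1} (\<lambda>u::real. u powr a)"
proof -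
  have "((\<lambda>u. u powr a) has_integral 1 / (a + 1)) {0<..<1}"
    using has_integral_powr_from_0[of a 1] assms has_integral_Icc_iff_Ioo[of "\<lambda>u. u powr a" "1 / (a + 1)" 0 1] by simp
  thus ?thesis by (rule set_lebesgue_of_has_integral(1)[rotated 3]) auto
qed

lemma tame_bound:
  assumes "tame f" and M: "\<And>u. u > 0 \<Longrightarrow> cmod (f u) \<le> M * u powr (- 1/4)" and s: "Re s \<ge> \<sigma>" and u: "u > 0"
  shows "cmod (f u * of_real u powr (s - 1)) \<le> indicator {0<..<1} u * (M * u powr (\<sigma> - 5/4))"
proof (cases "u < 1")
  case True
  have "cmod (f u * of_real u powr (s - 1)) = cmod (f u) * u powr (Re s - 1)"
    using u by (simp add: norm_mult norm_powr_real_powr)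
  also have "\<dots> \<le> (M * u powr (- 1/4)) * u powr (\<sigma> - 1)"
  proof (rule mult_mono)
    show "u powr (Re s - 1) \<le> u powr (\<sigma> - 1)" using u True s by (intro powr_mono') auto
    show "0 \<le> M * u powr (- 1 / 4)" using M[OF u] norm_ge_zero order_trans by blast
  qed (use M u in auto)
  also have "\<dots> = M * (u powr (- 1/4) * u powr (\<sigma> - 1))" by simp
  also have "u powr (- 1/4) * u powr (\<sigma> - 1) = u powr (\<sigma> - 5/4)" by (subst powr_add[symmetric]) simp
  finally show ?thesis using True u by simp
next
  case False
  thus ?thesis using assms(1) by (simp add: tame_def)
qed

lemma tame_measurable:
  assumes "tame f"
  shows "(\<lambda>u. indicator {0<..} u *\<^sub>R (f u * of_real u powr (s - 1))) \<in> borel_measurable lborel"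
proof -
  have "continuous_on {0<..} (\<lambda>u. f u * of_real u powr (s - 1))"
    using assms by (intro continuous_on_mult continuous_on_powr_pos) (simp add: tame_def)
  from set_measurable_pos[OF this] show ?thesis by (simp add: set_borel_measurable_def)
qed

lemma tame_integrable:
  assumes f: "tame f" and s: "Re s > 1/4"
  shows "set_integrable lborel {0<..} (\<lambda>u. f u * of_real u powr (s - 1))"
proof -
  obtain M where M: "M \<ge> 0" "\<And>u. u > 0 \<Longrightarrow> cmod (f u) \<le> M * u powr (- 1/4)" using tameE[OF f] by blast
  have "integrable lborel (\<lambda>u. indicator {0<..<1} u *\<^sub>R (M * u powr (Re s - 5/4)))"
    using powr_set_integrable_01[of "Re s - 5/4"] s set_integrable_mult_right[of M lborel "{0<..<1}" "\<lambda>u. u powr (Re s - 5/4)"]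
    by (simp add: set_integrable_def)
  thus ?thesis unfolding set_integrable_def
  proof (rule Bochner_Integration.integrable_bound[OF _ tame_measurable[OF f]], intro AE_I2)
    fix u :: real
    show "norm (indicator {0<..} u *\<^sub>R (f u * of_real u powr (s - 1))) \<le> norm (indicator {0<..<1} u *\<^sub>R (M * u powr (Re s - 5/4)))"
      using tame_bound[OF f M(2) order_refl, of u s] M(1) by (auto simp: indicator_def abs_mult)
  qed
qed

text \<open>A majorant independent of \<open>s\<close> exists only on \<open>Re s > \<sigma>\<close>
  for fixed \<open>\<sigma> > 1/4\<close>; the half-plane is the union of these.\<close>

lemma holomorphic_mellin:
  assumes f: "tame f"
  shows "mellin f holomorphic_on {s. Re s > 1/4}"
proof -
  obtain M where M: "M \<ge> 0" "\<And>u. u > 0 \<Longrightarrow> cmod (f u) \<le> M * u powr (- 1/4)" using tameE[OF f] by blast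
  have loc: "mellin f holomorphic_on {s. Re s > \<sigma>}" if \<sigma>: "\<sigma> > 1/4" for \<sigma>
    unfolding mellin_def[abs_def] set_lebesgue_integral_def
  proof (rule holomorphic_on_lebesgue_integral[where g = "\<lambda>u. indicator {0<..<1} u * (M * u powr (\<sigma> - 5/4))"])
    show "open {s. Re s > \<sigma>}" by (rule open_halfspace_Re_gt)
    show "integrable lborel (\<lambda>u. indicator {0<..<1} u * (M * u powr (\<sigma> - 5/4)))"
      using powr_set_integrable_01[of "\<sigma> - 5/4"] \<sigma> set_integrable_mult_right[of M lborel "{0<..<1}" "\<lambda>u. u powr (\<sigma> - 5/4)"]
      by (simp add: set_integrable_def)
    show "(\<lambda>u. indicator {0<..} u *\<^sub>R (f u * of_real u powr (z - 1))) \<in> borel_measurable lborel" for z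
      by (rule tame_measurable[OF f])
    show "(\<lambda>z. indicator {0<..} u *\<^sub>R (f u * of_real u powr (z - 1))) holomorphic_on {s. Re s > \<sigma>}" for u
    proof (cases "u > 0")
      case True
      thus ?thesis by (auto intro!: holomorphic_intros simp: complex_nonpos_Reals_iff)
    next
      case False
      thus ?thesis by (simp add: holomorphic_on_const)
    qed
    show "cmod (indicator {0<..} u *\<^sub>R (f u * of_real u powr (z - 1))) \<le> indicator {0<..<1} u * (M * u powr (\<sigma> - 5/4))" if "z \<in> {s. \<sigma> < Re s}" for z u
      using tame_bound[OF f M(2), of \<sigma> z u] that by (auto simp: indicator_def split: if_splits)
  qed
  have eq: "{s. Re s > 1/4} = (\<Union>\<sigma>\<in>{1/4<..}. {s. Re s > \<sigma>})"
  proof (intro set_eqI iffI)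
    fix s assume "s \<in> {s. Re s > 1/4}"
    then obtain \<sigma> where "1/4 < \<sigma>" "\<sigma> < Re s" using dense[of "1/4" "Re s"] by auto
    thus "s \<in> (\<Union>\<sigma>\<in>{1/4<..}. {s. Re s > \<sigma>})" by auto
  qed auto
  show ?thesis unfolding eq by (rule holomorphic_on_UN_open[OF loc open_halfspace_Re_gt]) simp
qed

section \<open>The integral part of V and its Mellin transform\<close>

lemma powr_tail_integrable:
  assumes u: "u > 0" and e: "e < -1"
  shows "set_integrable lborel {u<..} (\<lambda>v::real. v powr e)"
    and "(LINT v:{u<..}|lborel. v powr e) = - (u powr (e + 1)) / (e + 1)"
proof -
  have "((\<lambda>v. v powr e) has_integral - (u powr (e + 1)) / (e + 1)) {u<..}"
    by (rule has_integral_spike_set_eq[THEN iffD1, OF _ _ has_integral_powr_to_inf[OF e u]])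
       (auto intro: negligible_subset[of "{u}"])
  from set_lebesgue_of_has_integral[OF _ _ _ this] show "set_integrable lborel {u<..} (\<lambda>v::real. v powr e)"
    "(LINT v:{u<..}|lborel. v powr e) = - (u powr (e + 1)) / (e + 1)" by auto
qed

definition tail :: "(real \<Rightarrow> complex) \<Rightarrow> real \<Rightarrow> complex" where
  "tail f u = (LINT v:{u<..}|lborel. f v / complex_of_real v)"

lemma V_op_eq: "V_op f u = f u - tail f u"
  by (simp add: V_op_def tail_def)

text \<open>Stated for functions that may have unbounded support, because it must also serve
  \<open>E_map \<phi>\<close>, which beyond \<open>1\<close> is a multiple of
  \<open>1 / u\<close>.\<close>

lemma tail_integrable:
  assumes c: "continuous_on {0<..} f" and M: "\<And>u. u > 0 \<Longrightarrow> cmod (f u) \<le> M * u powr (- 1/4)" and u: "u > 0"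
  shows "set_integrable lborel {u<..} (\<lambda>v. f v / complex_of_real v)"
    and "(LINT v:{u<..}|lborel. cmod (f v / complex_of_real v)) \<le> 4 * M * u powr (- 1/4)"
    and "cmod (tail f u) \<le> 4 * M * u powr (- 1/4)"
proof -
  note P = powr_tail_integrable[OF u, of "- 5/4"]
  have le: "cmod (f v / complex_of_real v) \<le> M * v powr (- 5/4)" if "v \<in> {u<..}" for v
  proof -
    have v: "v > 0" using that u by simp
    have "v powr (- 5/4) = v powr (- 1/4) * v powr - 1" by (subst powr_add[symmetric]) simp
    also have "v powr - 1 = 1 / v" using v by (simp add: powr_minus_divide)
    finally have "v powr (- 5/4) = v powr (- 1/4) / v" by simp
    thus ?thesis using M[OF v] v by (simp add: norm_divide divide_right_mono)
  qed
  have iM: "set_integrable lborel {u<..} (\<lambda>v. M * v powr (- 5/4))"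
    using P(1) by (intro set_integrable_mult_right) auto
  have "continuous_on {u<..} (\<lambda>v. f v / complex_of_real v)"
    using u by (intro continuous_on_divide continuous_on_subset[OF c] continuous_intros) auto
  hence m: "set_borel_measurable lborel {u<..} (\<lambda>v. f v / complex_of_real v)"
    unfolding set_borel_measurable_def using borel_measurable_continuous_on_indicator[of "{u<..}"] by simp
  show si: "set_integrable lborel {u<..} (\<lambda>v. f v / complex_of_real v)"
    by (rule set_integrable_bound[OF iM m]) (use le in \<open>auto intro!: AE_I2 intro: order_trans[OF _ abs_ge_self]\<close>)
  have "(LINT v:{u<..}|lborel. cmod (f v / complex_of_real v)) \<le> (LINT v:{u<..}|lborel. M * v powr (- 5/4))"
    using le by (intro set_integral_mono set_integrable_norm si iM) auto
  also have "\<dots> = M * (4 * u powr (- 1/4))" using P(2) by simp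
  finally show 2: "(LINT v:{u<..}|lborel. cmod (f v / complex_of_real v)) \<le> 4 * M * u powr (- 1/4)" by simp
  have "cmod (tail f u) \<le> (LINT v:{u<..}|lborel. cmod (f v / complex_of_real v))"
    unfolding tail_def by (rule set_integral_norm_bound[OF si])
  with 2 show "cmod (tail f u) \<le> 4 * M * u powr (- 1/4)" by simp
qed

lemma tail_eq_0:
  assumes "\<And>v. v \<ge> 1 \<Longrightarrow> f v = 0" "u \<ge> 1"
  shows "tail f u = 0"
proof -
  have "(LINT v:{u<..}|lborel. f v / complex_of_real v) = (LINT v:{u<..}|lborel. 0)"
    using assms by (intro set_lebesgue_integral_cong) auto
  thus ?thesis by (simp add: tail_def)
qed

text \<open>Below \<open>2\<close> the tail is an indefinite integral over a compact interval, above
  \<open>1\<close> it is zero. The overlap takes care of the point \<open>1\<close>.\<close>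

lemma continuous_on_tail:
  assumes c: "continuous_on {0<..} f" and M: "\<And>u. u > 0 \<Longrightarrow> cmod (f u) \<le> M * u powr (- 1/4)" and z: "\<And>v. v \<ge> 1 \<Longrightarrow> f v = 0"
  shows "continuous_on {0<..} (tail f)"
proof -
  let ?g = "\<lambda>v. f v / complex_of_real v"
  have eq: "tail f u = integral {u..2} ?g" if u: "u > 0" "u \<le> 2" for u
  proof -
    have si: "set_integrable lborel {u<..} ?g" by (rule tail_integrable(1)[OF c M u(1)])
    have "(?g has_integral tail f u) {u<..}"
      using set_borel_integral_eq_integral[OF si] unfolding tail_def by (simp add: has_integral_iff)
    hence "(?g has_integral tail f u) {u..2}"
    proof (rule has_integral_spike_set_eq[THEN iffD1, rotated 2])
      show "negligible {x \<in> {u<..} - {u..2}. ?g x \<noteq> 0}"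
        using z by (intro negligible_subset[OF negligible_empty]) auto
      show "negligible {x \<in> {u..2} - {u<..}. ?g x \<noteq> 0}"
        by (rule negligible_subset[of "{u}"]) auto
    qed
    thus ?thesis by (simp add: has_integral_iff)
  qed
  have "continuous_on {a<..<2} (tail f)" if a: "a > 0" for a
  proof -
    have "?g integrable_on {a..2}"
      using a by (intro integrable_continuous_real continuous_on_divide continuous_on_subset[OF c] continuous_intros) auto
    hence "continuous_on {a..2} (\<lambda>u. integral {u..2} ?g)" by (rule indefinite_integral_continuous_1')
    hence "continuous_on {a<..<2} (\<lambda>u. integral {u..2} ?g)" by (rule continuous_on_subset) auto
    thus ?thesis by (rule continuous_on_eq) (use a eq in auto)
  qed
  hence 1: "isCont (tail f) u" if "0 < u" "u < 2" for u
    using that dense[OF that(1)] by (metis continuous_on_eq_continuous_at greaterThanLessThan_iff open_greaterThanLessThan)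
  have "continuous_on {1<..} (tail f)"
    by (rule continuous_on_eq[OF continuous_on_const[of _ 0]]) (use tail_eq_0[OF z] in auto)
  hence 2: "isCont (tail f) u" if "1 < u" for u
    using that by (simp add: continuous_on_eq_continuous_at)
  show ?thesis
    using 1 2 by (force intro!: continuous_at_imp_continuous_on)
qed

lemma tame_V_op:
  assumes f: "tame f"
  shows "tame (V_op f)"
proof -
  obtain M where M: "M \<ge> 0" "\<And>u. u > 0 \<Longrightarrow> cmod (f u) \<le> M * u powr (- 1/4)" using tameE[OF f] by blast
  have c: "continuous_on {0<..} f" and z: "\<And>v. v \<ge> 1 \<Longrightarrow> f v = 0" using f by (auto simp: tame_def)
  have V: "V_op f = (\<lambda>u. f u - tail f u)" by (rule ext) (rule V_op_eq)
  have "cmod (V_op f u) \<le> (5 * M) * u powr (- 1/4)" if u: "u > 0" for u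
    using norm_triangle_ineq4[of "f u" "tail f u"] M(2)[OF u] tail_integrable(3)[OF c M(2) u] by (simp add: V_op_eq)
  moreover have "continuous_on {0<..} (V_op f)" unfolding V by (intro continuous_on_diff c continuous_on_tail[OF c M(2) z])
  moreover have "V_op f u = 0" if "u \<ge> 1" for u using z[OF that] tail_eq_0[OF z that] by (simp add: V_op_eq)
  ultimately show ?thesis unfolding tame_def by blast
qed

lemma complex_powr_integral:
  assumes s: "Re s > 0" and v: "v > 0"
  shows "(LINT u:{0<..<v}|lborel. complex_of_real u powr (s - 1)) = of_real v powr s / s"
proof -
  have s0: "s \<noteq> 0" using s by auto
  have "((\<lambda>u. complex_of_real u powr (s - 1)) has_integral (of_real v powr s / s - of_real 0 powr s / s)) {0..v}"
  proof (rule fundamental_theorem_of_calculus_interior)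
    show "continuous_on {0..v} (\<lambda>u. complex_of_real u powr s / s)"
      using s s0 by (intro continuous_on_divide continuous_on_powr_complex continuous_intros) auto
    fix u :: real assume u: "u \<in> {0<..<v}"
    have nr: "complex_of_real u \<notin> \<real>\<^sub>\<le>\<^sub>0" using u by (simp add: complex_nonpos_Reals_iff)
    have 1: "(complex_of_real has_vector_derivative 1) (at u)"
      by (auto intro!: derivative_eq_intros)
    have 2: "((\<lambda>z. z powr s / s) has_field_derivative (of_real u powr (s - 1))) (at (complex_of_real u))"
      using DERIV_cdivide[OF has_field_derivative_powr[OF nr, of s], of s] s0 by simp
    show "((\<lambda>u. complex_of_real u powr s / s) has_vector_derivative complex_of_real u powr (s - 1)) (at u)"
      using field_vector_diff_chain_at[OF 1 2] by (simp add: o_def)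
  qed (use v in simp)
  hence "((\<lambda>u. complex_of_real u powr (s - 1)) has_integral (of_real v powr s / s)) {0<..<v}"
    by (simp add: has_integral_Icc_iff_Ioo)
  moreover have si: "set_integrable lborel {0<..<v} (\<lambda>u. complex_of_real u powr (s - 1))"
  proof -
    have "((\<lambda>u. u powr (Re s - 1)) has_integral v powr (Re s) / Re s) {0<..<v}"
      using has_integral_powr_from_0[of "Re s - 1" v] s v has_integral_Icc_iff_Ioo[of "\<lambda>u. u powr (Re s - 1)" _ 0 v] by simp
    hence i: "set_integrable lborel {0<..<v} (\<lambda>u. u powr (Re s - 1))"
      by (rule set_lebesgue_of_has_integral(1)[rotated 3]) auto
    have "continuous_on {0<..<v} (\<lambda>u. complex_of_real u powr (s - 1))"
      by (rule continuous_on_subset[OF continuous_on_powr_pos]) auto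
    hence "set_borel_measurable lborel {0<..<v} (\<lambda>u. complex_of_real u powr (s - 1))"
      unfolding set_borel_measurable_def using borel_measurable_continuous_on_indicator[of "{0<..<v}"] by simp
    thus ?thesis
      by (rule set_integrable_bound[OF i]) (auto simp: norm_powr_real_powr)
  qed
  ultimately show ?thesis using set_borel_integral_eq_integral(2)[OF si] by (simp add: has_integral_iff)
qed

lemma indicator_mult_measurable:
  fixes f :: "real \<Rightarrow> complex"
  assumes "continuous_on {0<..} f"
  shows "(\<lambda>u. indicator {0<..} u *\<^sub>R f u) \<in> borel_measurable borel"
  using borel_measurable_continuous_on_indicator[of "{0<..}" f] assms by simp

text \<open>Fubini on the region \<open>u < v\<close>: the integral of \<open>u powr (s - 1)\<close>
  over \<open>(0, v)\<close> is \<open>v powr s / s\<close>.\<close>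

lemma mellin_tail:
  assumes f: "tame f" and s: "Re s > 1/4"
  shows "mellin (tail f) s = mellin f s / s"
proof -
  obtain M where M: "M \<ge> 0" "\<And>u. u > 0 \<Longrightarrow> cmod (f u) \<le> M * u powr (- 1/4)" using tameE[OF f] by blast
  have c: "continuous_on {0<..} f" and z: "\<And>v. v \<ge> 1 \<Longrightarrow> f v = 0" using f by (auto simp: tame_def)
  \<comment> \<open>Extension by zero yields a Borel function on the whole line, as nothing is known
    about \<open>f\<close> at arguments that are not positive.\<close>
  define f0 where "f0 u = indicator {0<..} u *\<^sub>R f u" for u
  have [measurable]: "f0 \<in> borel_measurable borel" unfolding f0_def[abs_def] by (rule indicator_mult_measurable[OF c])
  define K where "K u v = indicator {0<..} u *\<^sub>R (indicator {u<..} v *\<^sub>R (f0 v / of_real v)) * of_real u powr (s - 1)" for u v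
  \<comment> \<open>The set \<open>{u<..}\<close> varies with \<open>u\<close>; rewriting its
    indicator as the condition \<open>u < v\<close> makes joint measurability visible.\<close>
  have Km: "(\<lambda>(u, v). K u v) \<in> borel_measurable (lborel \<Otimes>\<^sub>M lborel)"
  proof -
    have "(\<lambda>(u, v). indicator {0<..} u *\<^sub>R ((if u < v then 1 else 0) *\<^sub>R (f0 v / of_real v)) * of_real u powr (s - 1)) \<in> borel_measurable (lborel \<Otimes>\<^sub>M lborel)"
      unfolding powr_def by measurable
    also have "(\<lambda>(u, v). indicator {0<..} u *\<^sub>R ((if u < v then 1 else 0) *\<^sub>R (f0 v / of_real v)) * of_real u powr (s - 1)) = (\<lambda>(u, v). K u v)"
      by (auto simp: K_def fun_eq_iff indicator_def)
    finally show ?thesis .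
  qed
  have Ku: "K u v = indicator {u<..} v *\<^sub>R (f v / of_real v) * of_real u powr (s - 1)" if "u > 0" for u v
    using that by (auto simp: K_def f0_def indicator_def)
  have iK: "integrable lborel (K u)" and nK: "(\<integral>v. cmod (K u v) \<partial>lborel) \<le> indicator {0<..<1} u * (4 * M * u powr (Re s - 5/4))" for u
  proof -
    show "integrable lborel (K u)"
    proof (cases "u > 0")
      case True
      have "K u = (\<lambda>v. indicator {u<..} v *\<^sub>R (f v / of_real v) * of_real u powr (s - 1))" using Ku[OF True] by auto
      moreover have "integrable lborel (\<lambda>v. indicator {u<..} v *\<^sub>R (f v / of_real v) * of_real u powr (s - 1))"
        by (rule integrable_mult_left) (use tail_integrable(1)[OF c M(2) True] in \<open>simp add: set_integrable_def\<close>)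
      ultimately show ?thesis by (simp only:)
    next
      case False
      hence "K u = (\<lambda>v. 0)" by (auto simp: K_def)
      thus ?thesis by simp
    qed
    show "(\<integral>v. cmod (K u v) \<partial>lborel) \<le> indicator {0<..<1} u * (4 * M * u powr (Re s - 5/4))"
    proof (cases "u > 0 \<and> u < 1")
      case True
      have "(\<integral>v. cmod (K u v) \<partial>lborel) = (\<integral>v. indicator {u<..} v *\<^sub>R cmod (f v / of_real v) * u powr (Re s - 1) \<partial>lborel)"
        using True by (intro Bochner_Integration.integral_cong refl) (simp add: Ku norm_mult norm_divide norm_powr_real_powr)
      also have "\<dots> = (LINT v:{u<..}|lborel. cmod (f v / complex_of_real v)) * u powr (Re s - 1)"
        unfolding set_lebesgue_integral_def by (rule integral_mult_left_zero)
      also have "\<dots> \<le> (4 * M * u powr (- 1/4)) * u powr (Re s - 1)"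
        using True by (intro mult_right_mono tail_integrable(2)[OF c M(2)]) auto
      also have "\<dots> = 4 * M * (u powr (- 1/4) * u powr (Re s - 1))" by simp
      also have "u powr (- 1/4) * u powr (Re s - 1) = u powr (Re s - 5/4)" by (subst powr_add[symmetric]) simp
      finally show ?thesis using True by simp
    next
      case False
      hence "K u v = 0" for v using z[of v] by (auto simp: K_def f0_def indicator_def)
      thus ?thesis using M(1) by (simp add: indicator_def)
    qed
  qed
  have Ki: "integrable (lborel \<Otimes>\<^sub>M lborel) (\<lambda>(u, v). K u v)"
  proof (rule lborel_pair.Fubini_integrable[OF Km])
    have g: "integrable lborel (\<lambda>u. indicator {0<..<1} u * (4 * M * u powr (Re s - 5/4)))"
      using powr_set_integrable_01[of "Re s - 5/4"] s set_integrable_mult_right[of "4 * M" lborel "{0<..<1}" "\<lambda>u. u powr (Re s - 5/4)"]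
      by (simp add: set_integrable_def)
    have m: "(\<lambda>u. \<integral>v. cmod (K u v) \<partial>lborel) \<in> borel_measurable lborel"
      using Km by (intro lborel.borel_measurable_lebesgue_integral) (simp add: case_prod_unfold)
    show "integrable lborel (\<lambda>u. \<integral>v. norm (case (u, v) of (u, v) \<Rightarrow> K u v) \<partial>lborel)"
      unfolding case_prod_conv
      by (rule Bochner_Integration.integrable_bound[OF g m])
        (use nK in \<open>auto intro!: AE_I2 simp: Bochner_Integration.integral_nonneg intro: order_trans[OF _ abs_ge_self]\<close>)
  qed (use iK in auto)
  have "mellin (tail f) s = (\<integral>u. (\<integral>v. K u v \<partial>lborel) \<partial>lborel)"
    unfolding mellin_def set_lebesgue_integral_def
  proof (rule Bochner_Integration.integral_cong[OF refl])
    fix u :: real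
    show "indicator {0<..} u *\<^sub>R (tail f u * of_real u powr (s - 1)) = (\<integral>v. K u v \<partial>lborel)"
    proof (cases "u > 0")
      case True
      have "(\<integral>v. K u v \<partial>lborel) = tail f u * of_real u powr (s - 1)"
        unfolding Ku[OF True] tail_def set_lebesgue_integral_def by (rule integral_mult_left_zero)
      thus ?thesis using True by simp
    qed (simp add: K_def)
  qed
  also have "\<dots> = (\<integral>v. (\<integral>u. K u v \<partial>lborel) \<partial>lborel)"
    using lborel_pair.Fubini_integral[OF Ki] by simp
  also have "\<dots> = (\<integral>v. (indicator {0<..} v *\<^sub>R (f v * of_real v powr (s - 1))) * (1 / s) \<partial>lborel)"
  proof (rule Bochner_Integration.integral_cong[OF refl])
    fix v :: real
    show "(\<integral>u. K u v \<partial>lborel) = (indicator {0<..} v *\<^sub>R (f v * of_real v powr (s - 1))) * (1 / s)"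
    proof (cases "v > 0")
      case True
      have "(\<integral>u. K u v \<partial>lborel) = (\<integral>u. (f v / of_real v) * (indicator {0<..<v} u *\<^sub>R complex_of_real u powr (s - 1)) \<partial>lborel)"
        using True by (intro Bochner_Integration.integral_cong refl) (auto simp: K_def f0_def indicator_def)
      also have "\<dots> = (f v / of_real v) * (LINT u:{0<..<v}|lborel. complex_of_real u powr (s - 1))"
        unfolding set_lebesgue_integral_def by (rule integral_mult_right_zero)
      also have "\<dots> = (f v / of_real v) * (of_real v powr s / s)"
        using complex_powr_integral[of s v] s True by simp
      also have "of_real v powr s = of_real v powr (s - 1) * complex_of_real v"
        using True by (simp add: powr_diff)
      finally show ?thesis using True by simp
    next
      case False
      hence "K u v = 0" for u by (auto simp: K_def f0_def indicator_def)
      thus ?thesis using False by simp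
    qed
  qed
  also have "\<dots> = mellin f s * (1 / s)"
    unfolding mellin_def set_lebesgue_integral_def by (rule integral_mult_left_zero)
  finally show ?thesis by simp
qed

lemma mellin_V_op:
  assumes f: "tame f" and s: "Re s > 1/4"
  shows "mellin (V_op f) s = (s - 1) / s * mellin f s"
proof -
  have s0: "s \<noteq> 0" using s by auto
  have t: "tail f u = f u - V_op f u" for u by (simp add: V_op_eq)
  have "mellin (tail f) s = mellin f s - mellin (V_op f) s"
    unfolding mellin_def t left_diff_distrib
    by (rule set_integral_diff(2)[OF tame_integrable[OF f s] tame_integrable[OF tame_V_op[OF f] s]])
  thus ?thesis unfolding mellin_tail[OF f s] using s0 by (simp add: field_simps)
qed

section \<open>Dilations\<close>

lemma tame_scale:
  assumes f: "tame f" and c: "c \<ge> 1"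
  shows "tame (\<lambda>u. f (c * u))"
proof -
  obtain M where M: "M \<ge> 0" "\<And>u. u > 0 \<Longrightarrow> cmod (f u) \<le> M * u powr (- 1/4)" using tameE[OF f] by blast
  have "cmod (f (c * u)) \<le> M * u powr (- 1/4)" if u: "u > 0" for u
  proof -
    have "cmod (f (c * u)) \<le> M * (c * u) powr (- 1/4)" using M(2)[of "c * u"] u c by simp
    also have "\<dots> \<le> M * u powr (- 1/4)"
      using u c M(1) by (intro mult_left_mono powr_mono2') auto
    finally show ?thesis .
  qed
  moreover have "continuous_on {0<..} (\<lambda>u. f (c * u))"
    by (rule continuous_on_compose2[of "{0<..}" f]) (use f c in \<open>auto simp: tame_def intro!: continuous_intros\<close>)
  moreover have "f (c * u) = 0" if "u \<ge> 1" for u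
  proof -
    have "1 * 1 \<le> c * u" using that c by (intro mult_mono) auto
    thus ?thesis using f by (simp add: tame_def)
  qed
  ultimately show ?thesis unfolding tame_def by blast
qed

lemma mellin_integrand_scale:
  assumes c: "c > 0"
  shows "indicator {0<..} (c * u) *\<^sub>R (f (c * u) * complex_of_real (c * u) powr (s - 1)) =
    of_real c powr (s - 1) * (indicator {0<..} u *\<^sub>R (f (c * u) * complex_of_real u powr (s - 1)))"
proof (cases "u > 0")
  case True
  have "complex_of_real (c * u) powr (s - 1) = of_real c powr (s - 1) * of_real u powr (s - 1)"
    unfolding of_real_mult by (rule powr_times_real) (use True c in auto)
  thus ?thesis using True c by simp
next
  case False
  hence "\<not> c * u > 0" using c by (simp add: zero_less_mult_iff)
  thus ?thesis using False by simp
qed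

lemma mellin_scale:
  assumes c: "c > 0"
  shows "mellin (\<lambda>u. f (c * u)) s = of_real c powr - s * mellin f s"
    and "(LINT u:{0<..}|lborel. cmod (f (c * u) * of_real u powr (s - 1))) =
      c powr - Re s * (LINT u:{0<..}|lborel. cmod (f u * of_real u powr (s - 1)))"
proof -
  define F where "F u = indicator {0<..} u *\<^sub>R (f u * complex_of_real u powr (s - 1))" for u
  define G where "G u = indicator {0<..} u *\<^sub>R (f (c * u) * complex_of_real u powr (s - 1))" for u
  have FG: "F (0 + c * u) = of_real c powr (s - 1) * G u" for u
    unfolding F_def G_def add_0 by (rule mellin_integrand_scale[OF c])
  have "(\<integral>u. F u \<partial>lborel) = \<bar>c\<bar> *\<^sub>R (\<integral>u. F (0 + c * u) \<partial>lborel)"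
    by (rule lborel_integral_real_affine) (use c in simp)
  also have "\<dots> = of_real c * (of_real c powr (s - 1) * (\<integral>u. G u \<partial>lborel))"
    unfolding FG using c by (simp add: scaleR_conv_of_real)
  also have "\<dots> = of_real c powr s * (\<integral>u. G u \<partial>lborel)"
    using c by (simp add: powr_diff)
  finally have "of_real c powr - s * (\<integral>u. F u \<partial>lborel) = (\<integral>u. G u \<partial>lborel)"
    using c by (simp add: powr_minus)
  thus "mellin (\<lambda>u. f (c * u)) s = of_real c powr - s * mellin f s"
    unfolding mellin_def set_lebesgue_integral_def F_def G_def by simp
  have nc: "cmod (of_real c powr (s - 1)) = c powr (Re s - 1)" using c by (simp add: norm_powr_real_powr)
  have "(\<integral>u. cmod (F u) \<partial>lborel) = \<bar>c\<bar> *\<^sub>R (\<integral>u. cmod (F (0 + c * u)) \<partial>lborel)"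
    by (rule lborel_integral_real_affine) (use c in simp)
  also have "\<dots> = c * (c powr (Re s - 1) * (\<integral>u. cmod (G u) \<partial>lborel))"
    unfolding FG norm_mult nc using c by simp
  also have "\<dots> = c powr Re s * (\<integral>u. cmod (G u) \<partial>lborel)"
    using c by (simp add: powr_diff)
  finally have "c powr - Re s * (\<integral>u. cmod (F u) \<partial>lborel) = (\<integral>u. cmod (G u) \<partial>lborel)"
    using c by (simp add: powr_minus)
  thus "(LINT u:{0<..}|lborel. cmod (f (c * u) * of_real u powr (s - 1))) =
      c powr - Re s * (LINT u:{0<..}|lborel. cmod (f u * of_real u powr (s - 1)))"
    unfolding set_lebesgue_integral_def F_def G_def by simp
qed

lemma tail_scale:
  assumes c: "c > 0"
  shows "tail (\<lambda>u. f (c * u)) u = tail f (c * u)"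
proof -
  have "tail f (c * u) = \<bar>c\<bar> *\<^sub>R (\<integral>v. indicator {c * u<..} (0 + c * v) *\<^sub>R (f (0 + c * v) / complex_of_real (0 + c * v)) \<partial>lborel)"
    unfolding tail_def set_lebesgue_integral_def by (rule lborel_integral_real_affine) (use c in simp)
  also have "\<dots> = (\<integral>v. c *\<^sub>R (indicator {c * u<..} (0 + c * v) *\<^sub>R (f (0 + c * v) / complex_of_real (0 + c * v))) \<partial>lborel)"
    using c by (simp only: integral_scaleR_right abs_of_pos)
  also have "\<dots> = tail (\<lambda>u. f (c * u)) u"
    unfolding tail_def set_lebesgue_integral_def
    using c by (intro Bochner_Integration.integral_cong refl) (auto simp: indicator_def scaleR_conv_of_real)
  finally show ?thesis by simp
qed

section \<open>Elementary properties of the functions in S_le1\<close>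

lemma smooth_continuous:
  assumes "smooth \<phi>"
  shows "continuous_on UNIV \<phi>"
proof -
  obtain D where D: "D 0 = \<phi>" "\<And>k x. (D k has_vector_derivative D (Suc k) x) (at x)"
    using assms unfolding smooth_def by blast
  have "isCont \<phi> x" for x using has_vector_derivative_continuous[OF D(2)[of 0 x]] unfolding D(1) .
  thus ?thesis by (simp add: continuous_at_imp_continuous_on)
qed

lemma S_le1_continuous: "\<phi> \<in> S_le1 \<Longrightarrow> continuous_on UNIV \<phi>"
  unfolding S_le1_def by (blast intro: smooth_continuous)

lemma S_le1_zero:
  assumes \<phi>: "\<phi> \<in> S_le1" and x: "\<bar>x\<bar> \<ge> 1"
  shows "\<phi> x = 0"
proof -
  have even: "\<phi> (- x) = \<phi> x" for x using \<phi> unfolding S_le1_def by blast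
  have supp: "closure {x. \<phi> x \<noteq> 0} \<subseteq> {-1..1}" using \<phi> unfolding S_le1_def by blast
  have z0: "\<phi> x = 0" if "\<bar>x\<bar> > 1" for x
  proof (rule ccontr)
    assume "\<phi> x \<noteq> 0"
    hence "x \<in> {x. \<phi> x \<noteq> 0}" by (rule CollectI)
    hence "x \<in> {-1..1}" using closure_subset supp by (meson subsetD)
    thus False using that by auto
  qed
  \<comment> \<open>The support condition does not settle the endpoint; there \<open>\<phi>\<close>
    vanishes as a limit of zeros from outside.\<close>
  have z1: "\<phi> 1 = 0"
  proof -
    have "(\<lambda>n. 1 + 1 / real (Suc n)) \<longlonglongrightarrow> 1 + 0" by (intro tendsto_add tendsto_const LIMSEQ_Suc[OF lim_1_over_n])
    hence lim: "(\<lambda>n. 1 + 1 / real (Suc n)) \<longlonglongrightarrow> 1" by (simp only: add_0_right)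
    have "isCont \<phi> 1" using S_le1_continuous[OF \<phi>] by (simp add: continuous_on_eq_continuous_at)
    from isCont_tendsto_compose[OF this lim]
    have "(\<lambda>n. \<phi> (1 + 1 / real (Suc n))) \<longlonglongrightarrow> \<phi> 1" .
    moreover have "\<phi> (1 + 1 / real (Suc n)) = 0" for n by (rule z0) simp
    ultimately have "(\<lambda>n::nat. 0) \<longlonglongrightarrow> \<phi> 1" by (simp only:)
    from LIMSEQ_unique[OF this tendsto_const] show ?thesis .
  qed
  have z2: "\<phi> (- 1) = 0" unfolding even by (rule z1)
  consider "\<bar>x\<bar> > 1" | "x = 1" | "x = -1" using x by linarith
  thus ?thesis
  proof cases
    case 1
    thus ?thesis by (rule z0)
  qed (simp_all only: z1 z2)
qed

lemma S_le1_bound: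
  assumes \<phi>: "\<phi> \<in> S_le1"
  shows "\<exists>B\<ge>0. \<forall>x. cmod (\<phi> x) \<le> B"
proof -
  note c = S_le1_continuous[OF \<phi>] and z = S_le1_zero[OF \<phi>]
  have "compact (\<phi> ` {-1..1})" by (rule compact_continuous_image[OF continuous_on_subset[OF c]]) auto
  then obtain B where B: "\<And>x. x \<in> {-1..1} \<Longrightarrow> cmod (\<phi> x) \<le> B"
    using compact_imp_bounded[of "\<phi> ` {-1..1}"] unfolding bounded_iff by blast
  have "cmod (\<phi> x) \<le> max 0 B" for x
  proof (cases "\<bar>x\<bar> \<ge> 1")
    case True
    thus ?thesis using z[of x] by simp
  next
    case False
    hence "cmod (\<phi> x) \<le> B" by (intro B) auto
    thus ?thesis by simp
  qed
  thus ?thesis by (intro exI[of _ "max 0 B"]) simp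
qed

text \<open>The interval \<open>{0..2}\<close> contains all nodes of the Riemann sums for
  \<open>E_map\<close>, whose last node lies between \<open>1\<close> and \<open>2\<close>.\<close>

lemma S_le1_lipschitz:
  assumes \<phi>: "\<phi> \<in> S_le1"
  shows "\<exists>B\<ge>0. \<forall>x\<in>{0..2}. \<forall>y\<in>{0..2}. cmod (\<phi> x - \<phi> y) \<le> B * \<bar>x - y\<bar>"
proof -
  obtain D where D: "D 0 = \<phi>" "\<And>k x. (D k has_vector_derivative D (Suc k) x) (at x)"
    using \<phi> unfolding S_le1_def smooth_def by blast
  have d: "(\<phi> has_vector_derivative D 1 t) (at t within {0..2})" for t
    using D(2)[of 0 t] unfolding D(1) One_nat_def by (rule has_vector_derivative_at_within)
  have "continuous_on {0..2} (D 1)"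
    by (rule continuous_at_imp_continuous_on, intro ballI, rule has_vector_derivative_continuous[OF D(2)])
  hence "compact (D 1 ` {0..2})" by (rule compact_continuous_image) simp
  then obtain B where B: "\<And>x. x \<in> {0..2} \<Longrightarrow> cmod (D 1 x) \<le> B"
    using compact_imp_bounded[of "D 1 ` {0..2}"] unfolding bounded_iff by blast
  have "cmod (\<phi> x - \<phi> y) \<le> max 0 B * \<bar>x - y\<bar>" if xy: "x \<in> {0..2}" "y \<in> {0..2}" for x y
  proof -
    have "norm (\<phi> x - \<phi> y) \<le> B * norm (x - y)"
    proof (rule differentiable_bound[where S = "{0..2}" and f = \<phi> and f' = "\<lambda>t h. h *\<^sub>R D 1 t"])
      show "onorm (\<lambda>h. h *\<^sub>R D 1 t) \<le> B" if "t \<in> {0..2}" for t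
      proof (rule onorm_le)
        fix h
        show "norm (h *\<^sub>R D 1 t) \<le> B * norm h"
          using mult_right_mono[OF B[OF that] abs_ge_zero[of h]] by (simp add: mult.commute)
      qed
    qed (use d xy in \<open>auto simp: has_vector_derivative_def\<close>)
    also have "\<dots> \<le> max 0 B * norm (x - y)" by (intro mult_right_mono) auto
    finally show ?thesis by simp
  qed
  thus ?thesis by (intro exI[of _ "max 0 B"]) simp
qed

lemma one_le_powr_neg: "0 < u \<Longrightarrow> u \<le> 1 \<Longrightarrow> 1 \<le> u powr (- 1/4 :: real)"
  using powr_mono2'[of "- 1/4" u 1] by simp

lemma tame_S_le1:
  assumes \<phi>: "\<phi> \<in> S_le1"
  shows "tame \<phi>"
proof -
  note c = S_le1_continuous[OF \<phi>] and z = S_le1_zero[OF \<phi>]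
  obtain B where B: "B \<ge> 0" "\<And>x. cmod (\<phi> x) \<le> B" using S_le1_bound[OF \<phi>] by blast
  have "cmod (\<phi> u) \<le> B * u powr (- 1/4)" if u: "u > 0" for u
  proof (cases "u \<ge> 1")
    case True
    thus ?thesis using z[of u] B(1) by simp
  next
    case False
    have "cmod (\<phi> u) \<le> B * 1" using B(2) by simp
    also have "\<dots> \<le> B * u powr (- 1/4)" using one_le_powr_neg[of u] False u B(1) by (intro mult_left_mono) auto
    finally show ?thesis .
  qed
  moreover have "continuous_on {0<..} \<phi>" using c by (rule continuous_on_subset) simp
  moreover have "\<phi> u = 0" if "u \<ge> 1" for u using z[of u] that by simp
  ultimately show ?thesis unfolding tame_def by blast
qed

text \<open>Meant for sums over the multiples of \<open>u\<close>, whose number of nonzero terms is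
  bounded only away from \<open>0\<close>.\<close>

lemma continuous_on_pos_local:
  fixes f :: "real \<Rightarrow> complex"
  assumes "\<And>a. a > 0 \<Longrightarrow> continuous_on {a<..} f"
  shows "continuous_on {0<..} f"
proof (rule continuous_at_imp_continuous_on, intro ballI)
  fix x :: real assume "x \<in> {0<..}"
  hence x: "0 < x / 2" "x / 2 < x" by auto
  show "isCont f x" using assms[OF x(1)] x(2) by (simp add: continuous_on_eq_continuous_at)
qed

section \<open>The map E and its composition with V\<close>

lemma E_map_finite:
  assumes \<phi>: "\<phi> \<in> S_le1" and u: "u > 0" "real N * u \<ge> 1"
  shows "E_map \<phi> u = (\<Sum>n<N. \<phi> (real (Suc n) * u)) - (LINT x:{0<..}|lborel. \<phi> x) / of_real u"
proof -
  have "\<phi> (real (Suc n) * u) = 0" if "n \<notin> {..<N}" for n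
  proof -
    have "real N * u \<le> real (Suc n) * u" using that u by (intro mult_right_mono) auto
    hence "\<bar>real (Suc n) * u\<bar> \<ge> 1" using u by linarith
    thus ?thesis by (rule S_le1_zero[OF \<phi>])
  qed
  hence "(\<Sum>n. \<phi> (real (Suc n) * u)) = (\<Sum>n<N. \<phi> (real (Suc n) * u))" by (intro suminf_finite) auto
  thus ?thesis by (simp add: E_map_def)
qed

lemma ex_nat_mult_ge_1: "u > 0 \<Longrightarrow> \<exists>N. real N * u \<ge> 1"
  using reals_Archimedean3[of u] less_imp_le by blast

lemma continuous_on_E_map:
  assumes \<phi>: "\<phi> \<in> S_le1"
  shows "continuous_on {0<..} (E_map \<phi>)"
proof (rule continuous_on_pos_local)
  fix a :: real assume a: "a > 0"
  obtain N where N: "real N * a \<ge> 1" using ex_nat_mult_ge_1[OF a] by blast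
  have c: "continuous_on UNIV \<phi>" by (rule S_le1_continuous[OF \<phi>])
  have "continuous_on {a<..} (\<lambda>u. (\<Sum>n<N. \<phi> (real (Suc n) * u)) - (LINT x:{0<..}|lborel. \<phi> x) / of_real u)"
    using a by (intro continuous_intros continuous_on_compose2[OF c]) auto
  thus "continuous_on {a<..} (E_map \<phi>)"
  proof (rule continuous_on_eq)
    fix u assume u: "u \<in> {a<..}"
    have "real N * a \<le> real N * u" using u by (intro mult_left_mono) auto
    thus "(\<Sum>n<N. \<phi> (real (Suc n) * u)) - (LINT x:{0<..}|lborel. \<phi> x) / of_real u = E_map \<phi> u"
      using E_map_finite[OF \<phi>, of u N] u a N by simp
  qed
qed

lemma integral_S_le1:
  assumes \<phi>: "\<phi> \<in> S_le1" and b: "b \<ge> 1"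
  shows "(LINT x:{0<..}|lborel. \<phi> x) = integral {0..b} \<phi>"
proof -
  note c = S_le1_continuous[OF \<phi>] and z = S_le1_zero[OF \<phi>]
  have "(LINT x:{0<..}|lborel. \<phi> x) = (LINT x:{0..b}|lborel. \<phi> x)"
    unfolding set_lebesgue_integral_def
  proof (rule integral_cong_AE)
    have [measurable]: "\<phi> \<in> borel_measurable borel" by (rule borel_measurable_continuous_onI[OF c])
    show "(\<lambda>x. indicator {0<..} x *\<^sub>R \<phi> x) \<in> borel_measurable lborel" "(\<lambda>x. indicator {0..b} x *\<^sub>R \<phi> x) \<in> borel_measurable lborel" by measurable
    show "AE x in lborel. indicator {0<..} x *\<^sub>R \<phi> x = indicator {0..b} x *\<^sub>R \<phi> x"
      using AE_lborel_singleton[of 0]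
    proof eventually_elim
      fix x :: real assume "x \<noteq> 0"
      thus "indicator {0<..} x *\<^sub>R \<phi> x = indicator {0..b} x *\<^sub>R \<phi> x"
        using z[of x] b by (auto simp: indicator_def)
    qed
  qed
  also have "\<dots> = integral {0..b} \<phi>"
    by (rule set_borel_integral_eq_integral(2)) (rule borel_integrable_atLeastAtMost', rule continuous_on_subset[OF c], simp)
  finally show ?thesis .
qed

text \<open>\<open>E \<phi>\<close> is the error of a Riemann sum of \<open>\<phi>\<close>, divided by the step \<open>u\<close>, hence bounded.\<close>

lemma E_map_bound:
  assumes \<phi>: "\<phi> \<in> S_le1"
  obtains M where "M \<ge> 0" "\<And>u. u > 0 \<Longrightarrow> cmod (E_map \<phi> u) \<le> M * u powr (- 1/4)"
proof -
  note cont = S_le1_continuous[OF \<phi>] and z = S_le1_zero[OF \<phi>]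
  obtain B where B: "B \<ge> 0" "\<And>x y. x \<in> {0..2} \<Longrightarrow> y \<in> {0..2} \<Longrightarrow> cmod (\<phi> x - \<phi> y) \<le> B * \<bar>x - y\<bar>"
    using S_le1_lipschitz[OF \<phi>] by blast
  define c where "c = (LINT x:{0<..}|lborel. \<phi> x)"
  define M where "M = max (2 * B) (cmod c)"
  have M0: "M \<ge> 0" using B(1) by (simp add: M_def)
  have ion: "\<phi> integrable_on {a..b}" for a b by (rule integrable_continuous_real, rule continuous_on_subset[OF cont]) simp
  have "cmod (E_map \<phi> u) \<le> M * u powr (- 1/4)" if u: "u > 0" for u
  proof (cases "u \<ge> 1")
    case True
    have "E_map \<phi> u = - c / of_real u"
      using E_map_finite[OF \<phi> u, of 1] z[of u] True by (simp add: c_def)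
    hence "cmod (E_map \<phi> u) = cmod c * (1 / u)" using u by (simp add: norm_divide)
    also have "1 / u = u powr - 1" using u by (simp add: powr_minus_divide)
    also have "cmod c * u powr - 1 \<le> M * u powr (- 1/4)"
      using True M0 by (intro mult_mono powr_mono) (auto simp: M_def)
    finally show ?thesis .
  next
    case False
    \<comment> \<open>With this number of cells the nodes just cover the support of
      \<open>\<phi>\<close>, and \<open>N * u\<close> stays below \<open>2\<close>. By the Lipschitz
      bound each cell contributes at most \<open>B * u * u\<close>, in total at most
      \<open>2 * B * u\<close>.\<close>
    define N where "N = nat \<lceil>1 / u\<rceil>"
    have N1: "real N \<ge> 1 / u" unfolding N_def by (rule real_nat_ceiling_ge)
    have N2: "real N < 1 / u + 1"
    proof -
      have "0 < 1 / u" using u by simp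
      hence "\<lceil>1 / u\<rceil> \<ge> 0" by linarith
      hence "real N = of_int \<lceil>1 / u\<rceil>" by (simp add: N_def)
      thus ?thesis by linarith
    qed
    have Nu: "real N * u \<ge> 1" "real N * u \<le> 2"
      using N1 N2 u False by (auto simp: field_simps)
    have part: "integral {0..real n * u} \<phi> = (\<Sum>k<n. integral {real k * u..real (Suc k) * u} \<phi>)" for n
    proof (induction n)
      case (Suc n)
      have "integral {0..real (Suc n) * u} \<phi> = integral {0..real n * u} \<phi> + integral {real n * u..real (Suc n) * u} \<phi>"
        using u by (intro Henstock_Kurzweil_Integration.integral_combine[symmetric] ion) (auto intro!: mult_right_mono)
      thus ?case using Suc by simp
    qed simp
    have cs: "c = (\<Sum>k<N. integral {real k * u..real (Suc k) * u} \<phi>)"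
      unfolding c_def part[symmetric] by (rule integral_S_le1[OF \<phi> Nu(1)])
    have "E_map \<phi> u = (\<Sum>n<N. \<phi> (real (Suc n) * u)) - c / of_real u"
      unfolding c_def by (rule E_map_finite[OF \<phi> u Nu(1)])
    hence "of_real u * E_map \<phi> u = of_real u * (\<Sum>n<N. \<phi> (real (Suc n) * u)) - c"
      using u by (simp add: right_diff_distrib)
    also have "\<dots> = (\<Sum>k<N. of_real u * \<phi> (real (Suc k) * u) - integral {real k * u..real (Suc k) * u} \<phi>)"
      unfolding cs by (simp only: sum_distrib_left sum_subtractf)
    finally have uE: "of_real u * E_map \<phi> u = (\<Sum>k<N. of_real u * \<phi> (real (Suc k) * u) - integral {real k * u..real (Suc k) * u} \<phi>)" .
    have "cmod (of_real u * E_map \<phi> u) \<le> (\<Sum>k<N. B * u * u)"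
      unfolding uE
    proof (rule sum_norm_le)
      fix k assume k: "k \<in> {..<N}"
      have "real (Suc k) * u \<le> real N * u" using k u by (intro mult_right_mono) auto
      hence k2: "real (Suc k) * u \<le> 2" using Nu by linarith
      have ku: "real k * u + u = real (Suc k) * u" by (simp add: algebra_simps)
      have kd: "real (Suc k) * u - real k * u = u" using ku by linarith
      have I1: "integral {real k * u..real (Suc k) * u} (\<lambda>x. \<phi> (real (Suc k) * u) - \<phi> x) = of_real u * \<phi> (real (Suc k) * u) - integral {real k * u..real (Suc k) * u} \<phi>"
        using ku u by (subst Henstock_Kurzweil_Integration.integral_diff[OF integrable_const_ivl ion]) (simp add: scaleR_conv_of_real algebra_simps)
      have I2: "norm (integral {real k * u..real (Suc k) * u} (\<lambda>x. \<phi> (real (Suc k) * u) - \<phi> x)) \<le> (B * u) * (real (Suc k) * u - real k * u)"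
      proof (rule integral_bound)
        show "real k * u \<le> real (Suc k) * u" using u by (intro mult_right_mono) auto
        show "continuous_on {real k * u..real (Suc k) * u} (\<lambda>x. \<phi> (real (Suc k) * u) - \<phi> x)"
          by (intro continuous_intros continuous_on_subset[OF cont]) simp
        fix x assume x: "x \<in> {real k * u..real (Suc k) * u}"
        have "0 \<le> real k * u" using u by simp
        hence "cmod (\<phi> (real (Suc k) * u) - \<phi> x) \<le> B * \<bar>real (Suc k) * u - x\<bar>" using x k2 by (intro B(2)) auto
        also have "\<dots> \<le> B * u" using x ku B(1) by (intro mult_left_mono) auto
        finally show "norm (\<phi> (real (Suc k) * u) - \<phi> x) \<le> B * u" .
      qed
      show "norm (of_real u * \<phi> (real (Suc k) * u) - integral {real k * u..real (Suc k) * u} \<phi>) \<le> B * u * u"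
        using I2 unfolding I1 kd .
    qed
    also have "\<dots> = B * u * (real N * u)" by simp
    also have "\<dots> \<le> B * u * 2" using Nu B(1) u by (intro mult_left_mono) auto
    finally have "u * cmod (E_map \<phi> u) \<le> u * (2 * B)" using u by (simp add: norm_mult mult_ac)
    hence "cmod (E_map \<phi> u) \<le> 2 * B" using u by simp
    also have "\<dots> \<le> M * 1" by (simp add: M_def)
    also have "\<dots> \<le> M * u powr (- 1/4)" using one_le_powr_neg[of u] False u M0 by (intro mult_left_mono) auto
    finally show ?thesis .
  qed
  thus ?thesis using M0 that by blast
qed

text \<open>\<open>V\<close> annihilates \<open>1 / u\<close>, because the integral of
  \<open>1 / v\<^sup>2\<close> over \<open>v > u\<close> is \<open>1 / u\<close>, and it commutes
  with dilations. So the correction term of \<open>E\<close> drops out.\<close>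

lemma V_op_E_map:
  assumes \<phi>: "\<phi> \<in> S_le1" and u: "u > 0" "real N * u \<ge> 1"
  shows "V_op (E_map \<phi>) u = (\<Sum>n<N. V_op \<phi> (real (Suc n) * u))"
proof -
  define c where "c = (LINT x:{0<..}|lborel. \<phi> x)"
  have t: "tame \<phi>" by (rule tame_S_le1[OF \<phi>])
  have si: "set_integrable lborel {u<..} (\<lambda>v. \<phi> (real (Suc n) * v) / of_real v)" for n
  proof -
    have tn: "tame (\<lambda>v. \<phi> (real (Suc n) * v))" by (rule tame_scale[OF t]) simp
    obtain M where M: "\<And>u. u > 0 \<Longrightarrow> cmod (\<phi> (real (Suc n) * u)) \<le> M * u powr (- 1/4)" using tameE[OF tn] by blast
    show ?thesis by (rule tail_integrable(1)[OF _ M u(1)]) (use tn in \<open>simp add: tame_def\<close>)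
  qed
  have p2: "set_integrable lborel {u<..} (\<lambda>v. v powr - 2)" "(LINT v:{u<..}|lborel. v powr - 2) = 1 / u"
    using powr_tail_integrable[OF u(1), of "- 2"] u by (auto simp: powr_minus_divide)
  have p3: "set_integrable lborel {u<..} (\<lambda>v. c * complex_of_real (v powr - 2))"
  proof (intro set_integrable_mult_right)
    have "integrable lborel (\<lambda>x. complex_of_real (indicator {u<..} x *\<^sub>R x powr - 2))"
      using p2(1) unfolding set_integrable_def by (rule integrable_of_real)
    thus "set_integrable lborel {u<..} (\<lambda>v. complex_of_real (v powr - 2))"
      by (simp add: set_integrable_def scaleR_conv_of_real)
  qed
  have p4: "(LINT v:{u<..}|lborel. c * complex_of_real (v powr - 2)) = c / of_real u"
    using p2(2) by (simp add: set_integral_complex_of_real)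
  have "tail (E_map \<phi>) u = (LINT v:{u<..}|lborel. (\<Sum>n<N. \<phi> (real (Suc n) * v) / of_real v) - c * complex_of_real (v powr - 2))"
    unfolding tail_def
  proof (rule set_lebesgue_integral_cong)
    show "\<forall>v. v \<in> {u<..} \<longrightarrow> E_map \<phi> v / complex_of_real v = (\<Sum>n<N. \<phi> (real (Suc n) * v) / of_real v) - c * complex_of_real (v powr - 2)"
    proof (intro allI impI)
      fix v assume v: "v \<in> {u<..}"
      hence v0: "v > 0" using u by simp
      have "real N * u \<le> real N * v" using v by (intro mult_left_mono) auto
      hence "E_map \<phi> v = (\<Sum>n<N. \<phi> (real (Suc n) * v)) - c / of_real v"
        unfolding c_def using E_map_finite[OF \<phi> v0, of N] u by simp
      moreover have "v powr - 2 = 1 / (v * v)" using v0 by (simp add: powr_minus_divide powr_numeral power2_eq_square)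
      ultimately show "E_map \<phi> v / complex_of_real v = (\<Sum>n<N. \<phi> (real (Suc n) * v) / of_real v) - c * complex_of_real (v powr - 2)"
        by (simp add: diff_divide_distrib sum_divide_distrib)
    qed
  qed simp
  also have "\<dots> = (LINT v:{u<..}|lborel. (\<Sum>n<N. \<phi> (real (Suc n) * v) / of_real v)) - c / of_real u"
  proof -
    have "set_integrable lborel {u<..} (\<lambda>v. \<Sum>n<N. \<phi> (real (Suc n) * v) / of_real v)"
      using si unfolding set_integrable_def scaleR_sum_right by (intro Bochner_Integration.integrable_sum) auto
    from set_integral_diff(2)[OF this p3] show ?thesis unfolding p4 .
  qed
  also have "(LINT v:{u<..}|lborel. (\<Sum>n<N. \<phi> (real (Suc n) * v) / of_real v)) = (\<Sum>n<N. tail (\<lambda>v. \<phi> (real (Suc n) * v)) u)"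
    unfolding tail_def set_lebesgue_integral_def scaleR_sum_right
    by (rule Bochner_Integration.integral_sum) (use si in \<open>simp add: set_integrable_def\<close>)
  also have "\<dots> = (\<Sum>n<N. tail \<phi> (real (Suc n) * u))"
    by (intro sum.cong refl tail_scale) simp
  finally show ?thesis
    unfolding V_op_eq E_map_finite[OF \<phi> u] c_def[symmetric] by (simp add: sum_subtractf)
qed

text \<open>\<open>E_map \<phi>\<close> itself need not vanish beyond \<open>1\<close>. After
  \<open>V\<close>, the sum over dilates has for \<open>u \<ge> 1\<close> only the term
  \<open>V_op \<phi> u\<close>, which is zero.\<close>

lemma tame_V_op_E_map:
  assumes \<phi>: "\<phi> \<in> S_le1"
  shows "tame (V_op (E_map \<phi>))"
proof -
  have t: "tame (V_op \<phi>)" by (rule tame_V_op[OF tame_S_le1[OF \<phi>]])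
  obtain M where M: "M \<ge> 0" "\<And>u. u > 0 \<Longrightarrow> cmod (E_map \<phi> u) \<le> M * u powr (- 1/4)" using E_map_bound[OF \<phi>] by blast
  have "cmod (V_op (E_map \<phi>) u) \<le> (5 * M) * u powr (- 1/4)" if u: "u > 0" for u
    using norm_triangle_ineq4[of "E_map \<phi> u" "tail (E_map \<phi>) u"] M(2)[OF u] tail_integrable(3)[OF continuous_on_E_map[OF \<phi>] M(2) u]
    by (simp add: V_op_eq)
  moreover have "V_op (E_map \<phi>) u = 0" if "u \<ge> 1" for u
    using V_op_E_map[OF \<phi>, of u 1] that t by (simp add: tame_def)
  moreover have "continuous_on {0<..} (V_op (E_map \<phi>))"
  proof (rule continuous_on_pos_local)
    fix a :: real assume a: "a > 0"
    obtain N where N: "real N * a \<ge> 1" using ex_nat_mult_ge_1[OF a] by blast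
    have c: "continuous_on {0<..} (V_op \<phi>)" using t by (simp add: tame_def)
    have "continuous_on {a<..} (\<lambda>u. (\<Sum>n<N. V_op \<phi> (real (Suc n) * u)))"
      using a by (intro continuous_on_sum continuous_on_compose2[OF c]) (auto intro!: continuous_intros)
    thus "continuous_on {a<..} (V_op (E_map \<phi>))"
    proof (rule continuous_on_eq)
      fix u assume u: "u \<in> {a<..}"
      have "real N * a \<le> real N * u" using u by (intro mult_left_mono) auto
      thus "(\<Sum>n<N. V_op \<phi> (real (Suc n) * u)) = V_op (E_map \<phi>) u"
        using V_op_E_map[OF \<phi>, of u N] u a N by simp
    qed
  qed
  ultimately show ?thesis unfolding tame_def by blast
qed

text \<open>The dilate by \<open>n\<close> scales both the transform and its absolute integral by a
  power of \<open>n\<close>, so for \<open>Re s > 1\<close> the sum may be integrated term by term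
  and the scaling factors add up to zeta. The factor \<open>s - 1\<close> contributed by
  \<open>V\<close> turns zeta into \<open>zeta_reg\<close>.\<close>

lemma mellin_V_op_E_map_right:
  assumes \<phi>: "\<phi> \<in> S_le1" and s: "Re s > 1"
  shows "mellin (V_op (E_map \<phi>)) s = zeta_reg s / s * mellin \<phi> s"
proof -
  have t: "tame (V_op \<phi>)" by (rule tame_V_op[OF tame_S_le1[OF \<phi>]])
  have s1: "s \<noteq> 1" "s \<noteq> 0" "Re s > 1/4" using s by auto
  define f where "f n u = indicator {0<..} u *\<^sub>R (V_op \<phi> (real (Suc n) * u) * complex_of_real u powr (s - 1))" for n u
  have fi: "integrable lborel (f n)" for n
  proof -
    have "tame (\<lambda>u. V_op \<phi> (real (Suc n) * u))" by (rule tame_scale[OF t]) simp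
    from tame_integrable[OF this s1(3)] show ?thesis unfolding f_def[abs_def] set_integrable_def .
  qed
  define I where "I = (LINT u:{0<..}|lborel. cmod (V_op \<phi> u * of_real u powr (s - 1)))"
  have fn: "(\<integral>u. cmod (f n u) \<partial>lborel) = real (Suc n) powr - Re s * I" for n
    using mellin_scale(2)[of "real (Suc n)" "V_op \<phi>" s] unfolding I_def f_def set_lebesgue_integral_def by simp
  have fs: "\<exists>N. \<forall>n. n \<notin> {..<N} \<longrightarrow> f n u = 0" for u
  proof (cases "u > 0")
    case True
    then obtain N where N: "real N * u \<ge> 1" using ex_nat_mult_ge_1 by blast
    have "f n u = 0" if "n \<notin> {..<N}" for n
    proof -
      have "real N * u \<le> real (Suc n) * u" using that True by (intro mult_right_mono) auto
      hence "real (Suc n) * u \<ge> 1" using N by linarith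
      thus ?thesis using t by (simp add: f_def tame_def)
    qed
    thus ?thesis by blast
  qed (simp add: f_def)
  have "(\<lambda>n. \<integral>u. f n u \<partial>lborel) sums (\<integral>u. (\<Sum>n. f n u) \<partial>lborel)"
  proof (rule sums_integral[OF fi])
    show "AE u in lborel. summable (\<lambda>n. norm (f n u))"
    proof (rule AE_I2)
      fix u
      obtain N where "\<And>n. n \<notin> {..<N} \<Longrightarrow> f n u = 0" using fs by blast
      thus "summable (\<lambda>n. norm (f n u))" by (intro summable_finite[of "{..<N}"]) auto
    qed
    show "summable (\<lambda>n. \<integral>u. norm (f n u) \<partial>lborel)"
      unfolding fn using summable_Suc_powr[OF s] by (rule summable_mult2)
  qed
  moreover have "(\<integral>u. f n u \<partial>lborel) = of_nat (Suc n) powr - s * mellin (V_op \<phi>) s" for n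
    using mellin_scale(1)[of "real (Suc n)" "V_op \<phi>" s] unfolding f_def mellin_def set_lebesgue_integral_def by simp
  moreover have "(\<integral>u. (\<Sum>n. f n u) \<partial>lborel) = mellin (V_op (E_map \<phi>)) s"
    unfolding mellin_def set_lebesgue_integral_def
  proof (rule Bochner_Integration.integral_cong[OF refl])
    fix u :: real
    show "(\<Sum>n. f n u) = indicator {0<..} u *\<^sub>R (V_op (E_map \<phi>) u * complex_of_real u powr (s - 1))"
    proof (cases "u > 0")
      case True
      obtain N1 where N1: "real N1 * u \<ge> 1" using ex_nat_mult_ge_1[OF True] by blast
      obtain N2 where N2: "\<And>n. n \<notin> {..<N2} \<Longrightarrow> f n u = 0" using fs by blast
      define N where "N = max N1 N2"
      have "real N1 * u \<le> real N * u" using True by (intro mult_right_mono) (auto simp: N_def)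
      hence V: "V_op (E_map \<phi>) u = (\<Sum>n<N. V_op \<phi> (real (Suc n) * u))" using N1 by (intro V_op_E_map[OF \<phi> True]) simp
      have "(\<Sum>n. f n u) = (\<Sum>n<N. f n u)" by (rule suminf_finite) (use N2 in \<open>auto simp: N_def\<close>)
      also have "\<dots> = V_op (E_map \<phi>) u * complex_of_real u powr (s - 1)"
        using True unfolding V f_def by (simp add: sum_distrib_right)
      finally show ?thesis using True by simp
    qed (simp add: f_def)
  qed
  ultimately have "(\<lambda>n. of_nat (Suc n) powr - s * mellin (V_op \<phi>) s) sums mellin (V_op (E_map \<phi>)) s" by simp
  moreover have "(\<lambda>n. of_nat (Suc n) powr - s * mellin (V_op \<phi>) s) sums (zeta_reg s / (s - 1) * mellin (V_op \<phi>) s)"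
    by (rule sums_mult2[OF zeta_reg_sums[OF s]])
  ultimately have "mellin (V_op (E_map \<phi>)) s = zeta_reg s / (s - 1) * mellin (V_op \<phi>) s" by (rule sums_unique2)
  thus ?thesis using s1 by (simp add: mellin_V_op[OF tame_S_le1[OF \<phi>] s1(3)])
qed

text \<open>Absolute convergence of the sum over dilates is lost for \<open>Re s \<le> 1\<close>.
  Both sides are holomorphic on \<open>Re s > 1/4\<close>, so the critical line and possible zeros
  of zeta are reached by continuation.\<close>

lemma mellin_V_op_E_map:
  assumes \<phi>: "\<phi> \<in> S_le1" and s: "Re s > 1/4"
  shows "mellin (V_op (E_map \<phi>)) s = zeta_reg s / s * mellin \<phi> s"
proof (rule analytic_continuation_open[of "{s. Re s > 1}" "{s. Re s > 1/4}" "mellin (V_op (E_map \<phi>))" "\<lambda>s. zeta_reg s / s * mellin \<phi> s" s])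
  show "open {s. Re s > 1}" "open {s. Re s > 1/4}" by (rule open_halfspace_Re_gt)+
  show "{s. 1 < Re s} \<noteq> {}" by (auto intro!: exI[of _ 2])
  show "connected {s. Re s > 1/4}" by (rule convex_connected[OF convex_halfspace_Re_gt])
  show "{s. 1 < Re s} \<subseteq> {s. 1/4 < Re s}" by auto
  show "mellin (V_op (E_map \<phi>)) holomorphic_on {s. 1/4 < Re s}" by (rule holomorphic_mellin[OF tame_V_op_E_map[OF \<phi>]])
  show "(\<lambda>s. zeta_reg s / s * mellin \<phi> s) holomorphic_on {s. 1/4 < Re s}"
    by (intro holomorphic_intros holomorphic_on_subset[OF holomorphic_zeta_reg] holomorphic_mellin[OF tame_S_le1[OF \<phi>]]) auto
  show "mellin (V_op (E_map \<phi>)) z = zeta_reg z / z * mellin \<phi> z" if "z \<in> {s. 1 < Re s}" for z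
    by (rule mellin_V_op_E_map_right[OF \<phi>]) (use that in simp)
  show "s \<in> {s. 1/4 < Re s}" using s by simp
qed

section \<open>Approximation of \<open>V \<phi>\<close>\<close>

text \<open>Smoothness follows from membership in any class that is closed under differentiation;
  the sequence of derivatives is built by choice. This takes the place of formulas for higher
  derivatives such as the Leibniz rule.\<close>

lemma smooth_intro:
  assumes f: "f \<in> A" and cl: "\<And>g. g \<in> A \<Longrightarrow> \<exists>g'\<in>A. \<forall>x. (g has_vector_derivative g' x) (at x)"
  shows "smooth f"
proof -
  obtain h where h: "\<And>g. g \<in> A \<Longrightarrow> h g \<in> A" "\<And>g x. g \<in> A \<Longrightarrow> (g has_vector_derivative h g x) (at x)"
    using cl by metis
  define D where "D k = (h ^^ k) f" for k
  have "D k \<in> A" for k by (induction k) (auto simp: D_def f h)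
  thus ?thesis unfolding smooth_def by (intro exI[of _ D]) (auto simp: D_def h)
qed

lemma smooth_derivative:
  assumes "smooth f"
  shows "\<exists>f'. smooth f' \<and> (\<forall>x. (f has_vector_derivative f' x) (at x))"
proof -
  obtain D where D: "D 0 = f" "\<And>k x. (D k has_vector_derivative D (Suc k) x) (at x)"
    using assms unfolding smooth_def by blast
  have "smooth (D 1)" unfolding smooth_def by (rule exI[of _ "\<lambda>k. D (Suc k)"]) (use D(2) in simp)
  moreover have "(f has_vector_derivative D 1 x) (at x)" for x using D(2)[of 0 x] by (simp add: D(1))
  ultimately show ?thesis by blast
qed

lemma smooth_add:
  assumes "smooth f" "smooth g"
  shows "smooth (\<lambda>x. f x + g x)"
proof (rule smooth_intro[where A = "{\<lambda>x. a x + b x | a b. smooth a \<and> smooth b}"])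
  show "(\<lambda>x. f x + g x) \<in> {\<lambda>x. a x + b x | a b. smooth a \<and> smooth b}" using assms by blast
  fix h assume "h \<in> {\<lambda>x. a x + b x | a b. smooth a \<and> smooth b}"
  then obtain a b where ab: "h = (\<lambda>x. a x + b x)" "smooth a" "smooth b" by blast
  obtain a' where a': "smooth a'" "\<And>x. (a has_vector_derivative a' x) (at x)" using smooth_derivative[OF ab(2)] by blast
  obtain b' where b': "smooth b'" "\<And>x. (b has_vector_derivative b' x) (at x)" using smooth_derivative[OF ab(3)] by blast
  have "(h has_vector_derivative a' x + b' x) (at x)" for x
    unfolding ab(1) by (rule has_vector_derivative_add[OF a'(2) b'(2)])
  thus "\<exists>h'\<in>{\<lambda>x. a x + b x | a b. smooth a \<and> smooth b}. \<forall>x. (h has_vector_derivative h' x) (at x)"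
    using a'(1) b'(1) by (intro bexI[of _ "\<lambda>x. a' x + b' x"]) auto
qed

lemma smooth_dilate:
  assumes "smooth f"
  shows "smooth (\<lambda>x. c * f (r * x))"
proof (rule smooth_intro[where A = "{\<lambda>x. c * a (r * x) | c a. smooth a}"])
  show "(\<lambda>x. c * f (r * x)) \<in> {\<lambda>x. c * a (r * x) | c a. smooth a}" using assms by blast
  fix h assume "h \<in> {\<lambda>x. c * a (r * x) | c a. smooth a}"
  then obtain c a where ca: "h = (\<lambda>x. c * a (r * x))" "smooth a" by blast
  obtain a' where a': "smooth a'" "\<And>x. (a has_vector_derivative a' x) (at x)" using smooth_derivative[OF ca(2)] by blast
  have "(h has_vector_derivative (c * of_real r) * a' (r * x)) (at x)" for x
  proof -
    have "((\<lambda>x. r * x) has_vector_derivative r) (at x)"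
      using has_real_derivative_iff_has_vector_derivative[of "\<lambda>x. r * x" r] by (auto intro!: derivative_eq_intros)
    from vector_diff_chain_at[OF this a'(2)[of "r * x"]]
    have "((\<lambda>x. a (r * x)) has_vector_derivative r *\<^sub>R a' (r * x)) (at x)" by (simp add: o_def)
    from has_vector_derivative_mult_right[OF this, of c] show ?thesis
      unfolding ca(1) by (simp add: scaleR_conv_of_real mult.assoc)
  qed
  thus "\<exists>h'\<in>{\<lambda>x. c * a (r * x) | c a. smooth a}. \<forall>x. (h has_vector_derivative h' x) (at x)"
    using a'(1) by (intro bexI[of _ "\<lambda>x. (c * of_real r) * a' (r * x)"]) auto
qed

text \<open>The derivative of \<open>x * a x\<close> contains the summand \<open>a x\<close>, so the
  class that is closed under differentiation needs a second component.\<close>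

lemma smooth_mult_id:
  assumes "smooth f"
  shows "smooth (\<lambda>x. of_real x * f x)"
proof (rule smooth_intro[where A = "{\<lambda>x. of_real x * a x + b x | a b. smooth a \<and> smooth b}"])
  have "smooth (\<lambda>x. 0 * f (1 * x))" by (rule smooth_dilate[OF assms])
  hence "smooth (\<lambda>x. 0)" by simp
  thus "(\<lambda>x. of_real x * f x) \<in> {\<lambda>x. of_real x * a x + b x | a b. smooth a \<and> smooth b}"
    using assms by (intro CollectI exI[of _ f] exI[of _ "\<lambda>x. 0"]) simp
  fix h assume "h \<in> {\<lambda>x. of_real x * a x + b x | a b. smooth a \<and> smooth b}"
  then obtain a b where ab: "h = (\<lambda>x. of_real x * a x + b x)" "smooth a" "smooth b" by blast
  obtain a' where a': "smooth a'" "\<And>x. (a has_vector_derivative a' x) (at x)" using smooth_derivative[OF ab(2)] by blast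
  obtain b' where b': "smooth b'" "\<And>x. (b has_vector_derivative b' x) (at x)" using smooth_derivative[OF ab(3)] by blast
  have "(h has_vector_derivative of_real x * a' x + (a x + b' x)) (at x)" for x
  proof -
    have "(complex_of_real has_vector_derivative 1) (at x)" by (auto intro!: derivative_eq_intros)
    from has_vector_derivative_add[OF has_vector_derivative_mult[OF this a'(2)[of x]] b'(2)[of x]]
    show ?thesis unfolding ab(1) by (simp add: add.assoc)
  qed
  moreover have "smooth (\<lambda>x. a x + b' x)" by (rule smooth_add[OF ab(2) b'(1)])
  ultimately show "\<exists>h'\<in>{\<lambda>x. of_real x * a x + b x | a b. smooth a \<and> smooth b}. \<forall>x. (h has_vector_derivative h' x) (at x)"
    using a'(1) by (intro bexI[of _ "\<lambda>x. of_real x * a' x + (a x + b' x)"]) auto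
qed

lemma S_le1_I:
  assumes "smooth \<phi>" "\<And>x. \<phi> (- x) = \<phi> x" "\<And>x. \<bar>x\<bar> > 1 \<Longrightarrow> \<phi> x = 0"
  shows "\<phi> \<in> S_le1"
proof -
  have "{x. \<phi> x \<noteq> 0} \<subseteq> {-1..1}"
  proof
    fix x assume "x \<in> {x. \<phi> x \<noteq> 0}"
    hence "\<not> \<bar>x\<bar> > 1" using assms(3)[of x] by blast
    thus "x \<in> {-1..1}" by auto
  qed
  hence "closure {x. \<phi> x \<noteq> 0} \<subseteq> {-1..1}" by (rule closure_minimal) simp
  thus ?thesis using assms(1,2) unfolding S_le1_def by blast
qed

lemma S_le1_smooth: "\<phi> \<in> S_le1 \<Longrightarrow> smooth \<phi>" and S_le1_even: "\<phi> \<in> S_le1 \<Longrightarrow> \<phi> (- x) = \<phi> x"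
  unfolding S_le1_def by blast+

lemma S_le1_add:
  assumes "\<phi> \<in> S_le1" "\<psi> \<in> S_le1"
  shows "(\<lambda>x. \<phi> x + \<psi> x) \<in> S_le1"
  by (rule S_le1_I) (simp_all add: smooth_add S_le1_smooth assms S_le1_even[OF assms(1)] S_le1_even[OF assms(2)] S_le1_zero[OF assms(1)] S_le1_zero[OF assms(2)])

lemma S_le1_dilate:
  assumes \<phi>: "\<phi> \<in> S_le1" and r: "r \<ge> 1"
  shows "(\<lambda>x. c * \<phi> (r * x)) \<in> S_le1"
proof (rule S_le1_I)
  show "c * \<phi> (r * x) = 0" if "\<bar>x\<bar> > 1" for x
  proof -
    have "1 * 1 \<le> r * \<bar>x\<bar>" using that r by (intro mult_mono) auto
    hence "\<bar>r * x\<bar> \<ge> 1" using r by (simp add: abs_mult)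
    thus ?thesis using S_le1_zero[OF \<phi>, of "r * x"] by simp
  qed
  show "c * \<phi> (r * - x) = c * \<phi> (r * x)" for x using S_le1_even[OF \<phi>, of "r * x"] by simp
qed (rule smooth_dilate[OF S_le1_smooth[OF \<phi>]])

lemma S_le1_cmult: "\<phi> \<in> S_le1 \<Longrightarrow> (\<lambda>x. c * \<phi> x) \<in> S_le1"
  using S_le1_dilate[of \<phi> 1 c] by simp

lemma S_le1_sum:
  assumes "\<phi> \<in> S_le1"
  shows "(\<lambda>x. \<Sum>n<N::nat. b n * \<phi> (real (Suc n) * x)) \<in> S_le1"
proof (induction N)
  case 0
  have "(\<lambda>x. 0 * \<phi> x) \<in> S_le1" by (rule S_le1_cmult[OF assms])
  thus ?case by simp
next
  case (Suc N)
  have "(\<lambda>x. b N * \<phi> (real (Suc N) * x)) \<in> S_le1" by (rule S_le1_dilate[OF assms]) simp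
  from S_le1_add[OF Suc this] show ?case by simp
qed

text \<open>The Euler operator \<open>x d/dx\<close> preserves the space: the derivative of an even
  function is odd, and the factor \<open>x\<close> restores evenness.\<close>

lemma S_le1_theta:
  assumes \<phi>: "\<phi> \<in> S_le1"
  shows "\<exists>\<phi>'. (\<forall>x. (\<phi> has_vector_derivative \<phi>' x) (at x)) \<and> (\<lambda>x. of_real x * \<phi>' x) \<in> S_le1"
proof -
  obtain \<phi>' where \<phi>': "smooth \<phi>'" "\<And>x. (\<phi> has_vector_derivative \<phi>' x) (at x)"
    using smooth_derivative[OF S_le1_smooth[OF \<phi>]] by blast
  have "(\<lambda>x. of_real x * \<phi>' x) \<in> S_le1"
  proof (rule S_le1_I)
    show "smooth (\<lambda>x. of_real x * \<phi>' x)" by (rule smooth_mult_id[OF \<phi>'(1)])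
    have odd: "\<phi>' (- x) = - \<phi>' x" for x
    proof -
      have "((\<lambda>x. - x) has_vector_derivative (- 1 :: real)) (at x)"
        using has_real_derivative_iff_has_vector_derivative[of "\<lambda>x. - x" "-1"] by (auto intro!: derivative_eq_intros)
      from vector_diff_chain_at[OF this \<phi>'(2)[of "- x"]]
      have "((\<lambda>x. \<phi> (- x)) has_vector_derivative - \<phi>' (- x)) (at x)" by (simp add: o_def)
      moreover have "(\<lambda>x. \<phi> (- x)) = \<phi>" using S_le1_even[OF \<phi>] by (rule ext)
      ultimately have "(\<phi> has_vector_derivative - \<phi>' (- x)) (at x)" by (simp only:)
      from vector_derivative_unique_at[OF this \<phi>'(2)] show ?thesis by (metis minus_minus)
    qed
    show "of_real (- x) * \<phi>' (- x) = of_real x * \<phi>' x" for x unfolding odd by simp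
    show "of_real x * \<phi>' x = 0" if x: "\<bar>x\<bar> > 1" for x
    proof -
      have "open {x::real. \<bar>x\<bar> > 1}" by (intro open_Collect_less continuous_intros)
      moreover have "x \<in> {x. \<bar>x\<bar> > 1}" using x by simp
      moreover have "0 = \<phi> y" if "y \<in> {x. \<bar>x\<bar> > 1}" for y using S_le1_zero[OF \<phi>, of y] that by simp
      ultimately have "(\<phi> has_vector_derivative 0) (at x)"
        by (rule has_vector_derivative_transform_within_open[OF has_vector_derivative_const])
      from vector_derivative_unique_at[OF \<phi>'(2) this] show ?thesis by simp
    qed
  qed
  thus ?thesis using \<phi>'(2) by blast
qed

lemma mellin_has_integral:
  assumes f: "tame f" and s: "Re s > 1/4"
  shows "((\<lambda>u. f u * of_real u powr (s - 1)) has_integral mellin f s) {0..1}"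
proof -
  have z: "\<not> 1 < u" if "f u \<noteq> 0" for u using f that less_imp_le[of 1 u] unfolding tame_def by blast
  have "((\<lambda>u. f u * of_real u powr (s - 1)) has_integral mellin f s) {0<..}"
    using set_borel_integral_eq_integral[OF tame_integrable[OF f s]] unfolding mellin_def by (simp add: has_integral_iff)
  thus ?thesis
  proof (rule has_integral_spike_set_eq[THEN iffD1, rotated 2])
    show "negligible {x \<in> {0<..} - {0..1}. f x * of_real x powr (s - 1) \<noteq> 0}"
      using z by (intro negligible_subset[OF negligible_empty]) (auto simp: not_le)
    show "negligible {x \<in> {0..1} - {0<..}. f x * of_real x powr (s - 1) \<noteq> 0}"
      by (rule negligible_subset[of "{0}"]) auto
  qed
qed

text \<open>Integration by parts: the boundary term vanishes at \<open>1\<close> with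
  \<open>\<phi>\<close>, and at \<open>0\<close> because \<open>Re s\<close> is positive.\<close>

lemma mellin_theta:
  assumes \<phi>: "\<phi> \<in> S_le1" and d: "\<And>x. (\<phi> has_vector_derivative \<phi>' x) (at x)" and t: "(\<lambda>x. of_real x * \<phi>' x) \<in> S_le1"
    and s: "Re s > 1/4"
  shows "mellin (\<lambda>x. of_real x * \<phi>' x) s = - s * mellin \<phi> s"
proof -
  let ?f = "\<lambda>u. s * (\<phi> u * of_real u powr (s - 1)) + (of_real u * \<phi>' u) * of_real u powr (s - 1)"
  have s0: "s \<noteq> 0" using s by auto
  have "(?f has_integral (\<phi> 1 * of_real 1 powr s - \<phi> 0 * of_real 0 powr s)) {0..1}"
  proof (rule fundamental_theorem_of_calculus_interior)
    show "continuous_on {0..1} (\<lambda>u. \<phi> u * of_real u powr s)"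
      using s by (intro continuous_on_mult continuous_on_powr_complex continuous_intros continuous_on_subset[OF S_le1_continuous[OF \<phi>]]) auto
    fix u :: real assume u: "u \<in> {0<..<1}"
    have nr: "complex_of_real u \<notin> \<real>\<^sub>\<le>\<^sub>0" using u by (simp add: complex_nonpos_Reals_iff)
    have 1: "(complex_of_real has_vector_derivative 1) (at u)" by (auto intro!: derivative_eq_intros)
    have 2: "((\<lambda>u. complex_of_real u powr s) has_vector_derivative s * complex_of_real u powr (s - 1)) (at u)"
      using field_vector_diff_chain_at[OF 1 has_field_derivative_powr[OF nr, of s]] by (simp add: o_def)
    have "complex_of_real u powr s = of_real u * of_real u powr (s - 1)" using u by (simp add: powr_diff)
    thus "((\<lambda>u. \<phi> u * of_real u powr s) has_vector_derivative ?f u) (at u)"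
      using has_vector_derivative_mult[OF d[of u] 2]
      by (elim back_subst[of "\<lambda>D. (_ has_vector_derivative D) _"]) (simp add: algebra_simps)
  qed simp
  moreover have "(?f has_integral (s * mellin \<phi> s + mellin (\<lambda>x. of_real x * \<phi>' x) s)) {0..1}"
    by (intro has_integral_add has_integral_mult_right mellin_has_integral tame_S_le1 \<phi> t s)
  ultimately have "s * mellin \<phi> s + mellin (\<lambda>x. of_real x * \<phi>' x) s = \<phi> 1 * of_real 1 powr s - \<phi> 0 * of_real 0 powr s"
    by (rule has_integral_unique[rotated])
  also have "\<dots> = 0" using S_le1_zero[OF \<phi>, of 1] by simp
  finally show ?thesis by (simp add: eq_neg_iff_add_eq_0 add.commute)
qed

lemma mellin_line_bounded:
  assumes f: "tame f"
  shows "\<exists>C\<ge>0. \<forall>t. cmod (mellin f (Complex (1/2) t)) \<le> C"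
proof -
  define C where "C = (LINT u:{0<..}|lborel. cmod (f u * of_real u powr (Complex (1/2) 0 - 1)))"
  have "cmod (mellin f (Complex (1/2) t)) \<le> C" for t
  proof -
    have "cmod (mellin f (Complex (1/2) t)) \<le> (LINT u:{0<..}|lborel. cmod (f u * of_real u powr (Complex (1/2) t - 1)))"
      unfolding mellin_def by (rule set_integral_norm_bound[OF tame_integrable[OF f]]) simp
    also have "\<dots> = C" unfolding C_def
      by (rule set_lebesgue_integral_cong) (auto simp: norm_mult norm_powr_real_powr)
    finally show ?thesis .
  qed
  moreover from this[of 0] have "C \<ge> 0" using norm_ge_zero order_trans by blast
  ultimately show ?thesis by blast
qed

text \<open>Each use of the Euler operator multiplies the transform by \<open>- s\<close> while the
  new transform stays bounded on the line. As the operator preserves the space, one power of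
  \<open>t\<close> is gained at every step of the induction.\<close>

lemma mellin_S_le1_decay:
  assumes "\<phi> \<in> S_le1"
  shows "\<exists>C\<ge>0. \<forall>t. (10 + \<bar>t\<bar>) ^ k * cmod (mellin \<phi> (Complex (1/2) t)) \<le> C"
  using assms
proof (induction k arbitrary: \<phi>)
  case 0
  show ?case using mellin_line_bounded[OF tame_S_le1[OF 0]] by simp
next
  case (Suc k)
  obtain \<phi>' where \<phi>': "\<And>x. (\<phi> has_vector_derivative \<phi>' x) (at x)" "(\<lambda>x. of_real x * \<phi>' x) \<in> S_le1"
    using S_le1_theta[OF Suc.prems] by blast
  obtain C where C: "C \<ge> 0" "\<And>t. (10 + \<bar>t\<bar>) ^ k * cmod (mellin (\<lambda>x. of_real x * \<phi>' x) (Complex (1/2) t)) \<le> C"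
    using Suc.IH[OF \<phi>'(2)] by blast
  have "(10 + \<bar>t\<bar>) ^ Suc k * cmod (mellin \<phi> (Complex (1/2) t)) \<le> 21 * C" for t
  proof -
    define s where "s = Complex (1/2) t"
    have "cmod s \<ge> 1/2" "cmod s \<ge> \<bar>t\<bar>" using abs_Re_le_cmod[of s] abs_Im_le_cmod[of s] by (auto simp: s_def)
    \<comment> \<open>\<open>21 = 20 + 1\<close>: the summand \<open>10\<close> is covered by
      \<open>cmod s \<ge> 1/2\<close>, the summand \<open>\<bar>t\<bar>\<close> by
      \<open>cmod s \<ge> \<bar>t\<bar>\<close>.\<close>
    hence "10 + \<bar>t\<bar> \<le> 21 * cmod s" by linarith
    hence "(10 + \<bar>t\<bar>) * ((10 + \<bar>t\<bar>) ^ k * cmod (mellin \<phi> s)) \<le> 21 * cmod s * ((10 + \<bar>t\<bar>) ^ k * cmod (mellin \<phi> s))"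
      by (intro mult_right_mono) auto
    also have "\<dots> = 21 * ((10 + \<bar>t\<bar>) ^ k * cmod (- s * mellin \<phi> s))" by (simp add: norm_mult)
    also have "- s * mellin \<phi> s = mellin (\<lambda>x. of_real x * \<phi>' x) s"
      by (rule mellin_theta[OF Suc.prems \<phi>', symmetric]) (simp add: s_def)
    also have "21 * ((10 + \<bar>t\<bar>) ^ k * cmod (mellin (\<lambda>x. of_real x * \<phi>' x) s)) \<le> 21 * C" using C(2)[of t] by (simp add: s_def)
    finally show ?thesis by (simp add: s_def mult.assoc)
  qed
  thus ?case using C(1) by (intro exI[of _ "21 * C"]) simp
qed

lemma integrable_decay: "integrable lborel (\<lambda>t::real. 1 / (10 + \<bar>t\<bar>)\<^sup>2)"
proof -
  have "((\<lambda>t::real. t powr - 2) has_integral - (10 powr (- 2 + 1)) / (- 2 + 1)) {10..}"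
    by (rule has_integral_powr_to_inf) auto
  from set_lebesgue_of_has_integral(1)[OF _ _ _ this]
  have "integrable lborel (\<lambda>t::real. indicator {10..} t *\<^sub>R (t powr - 2))" by (simp add: set_integrable_def)
  hence i: "integrable lborel (\<lambda>t::real. indicator {10..} t * (1 / t\<^sup>2))"
    by (rule Bochner_Integration.integrable_cong[THEN iffD1, rotated 2])
       (auto simp: indicator_def powr_minus_divide powr_numeral)
  have "integrable lborel (\<lambda>t::real. indicator {10..} (10 + 1 * t) * (1 / (10 + 1 * t)\<^sup>2))"
    using lborel_integrable_real_affine[OF i, of 1 10] by simp
  moreover have "integrable lborel (\<lambda>t::real. indicator {10..} (10 + (- 1) * t) * (1 / (10 + (- 1) * t)\<^sup>2))"
    using lborel_integrable_real_affine[OF i, of "- 1" 10] by simp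
  ultimately have "integrable lborel (\<lambda>t::real. indicator {10..} (10 + 1 * t) * (1 / (10 + 1 * t)\<^sup>2) + indicator {10..} (10 + (- 1) * t) * (1 / (10 + (- 1) * t)\<^sup>2))"
    by (rule Bochner_Integration.integrable_add)
  thus ?thesis
    by (rule Bochner_Integration.integrable_bound) (auto simp: indicator_def)
qed

lemma mellin_weight_integrable:
  assumes \<phi>: "\<phi> \<in> S_le1"
  shows "(\<lambda>t. (cmod (mellin \<phi> (Complex (1/2) t)))\<^sup>2) \<in> borel_measurable borel"
    and "integrable lborel (\<lambda>t. (10 + \<bar>t\<bar>) ^ k * (cmod (mellin \<phi> (Complex (1/2) t)))\<^sup>2)"
proof -
  have "continuous_on UNIV (\<lambda>t. mellin \<phi> (Complex (1/2) t))"
    by (rule continuous_on_vertical[OF holomorphic_mellin[OF tame_S_le1[OF \<phi>]]]) simp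
  hence [measurable]: "(\<lambda>t. mellin \<phi> (Complex (1/2) t)) \<in> borel_measurable borel" by (rule borel_measurable_continuous_onI)
  show "(\<lambda>t. (cmod (mellin \<phi> (Complex (1/2) t)))\<^sup>2) \<in> borel_measurable borel" by measurable
  obtain C where C: "C \<ge> 0" "\<And>t. (10 + \<bar>t\<bar>) ^ (k + 2) * cmod (mellin \<phi> (Complex (1/2) t)) \<le> C"
    using mellin_S_le1_decay[OF \<phi>] by blast
  obtain C0 where C0: "C0 \<ge> 0" "\<And>t. cmod (mellin \<phi> (Complex (1/2) t)) \<le> C0"
    using mellin_line_bounded[OF tame_S_le1[OF \<phi>]] by blast
  show "integrable lborel (\<lambda>t. (10 + \<bar>t\<bar>) ^ k * (cmod (mellin \<phi> (Complex (1/2) t)))\<^sup>2)"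
  proof (rule Bochner_Integration.integrable_bound[OF integrable_mult_right[OF integrable_decay, of "C * C0"]])
    show "AE t in lborel. norm ((10 + \<bar>t\<bar>) ^ k * (cmod (mellin \<phi> (Complex (1/2) t)))\<^sup>2) \<le> norm (C * C0 * (1 / (10 + \<bar>t\<bar>)\<^sup>2))"
    proof (rule AE_I2)
      fix t :: real
      define m where "m = cmod (mellin \<phi> (Complex (1/2) t))"
      have p: "(10 + \<bar>t\<bar>)\<^sup>2 > 0" by (intro zero_less_power) simp
      have "((10 + \<bar>t\<bar>) ^ (k + 2) * m) * m \<le> C * C0" using C(2)[of t] C0(2)[of t] C(1) by (intro mult_mono) (auto simp: m_def)
      hence "(10 + \<bar>t\<bar>)\<^sup>2 * ((10 + \<bar>t\<bar>) ^ k * m\<^sup>2) \<le> C * C0" by (simp only: power_add power2_eq_square mult_ac)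
      hence "(10 + \<bar>t\<bar>) ^ k * m\<^sup>2 \<le> C * C0 / (10 + \<bar>t\<bar>)\<^sup>2" using p by (simp add: pos_le_divide_eq mult.commute)
      thus "norm ((10 + \<bar>t\<bar>) ^ k * (cmod (mellin \<phi> (Complex (1/2) t)))\<^sup>2) \<le> norm (C * C0 * (1 / (10 + \<bar>t\<bar>)\<^sup>2))"
        using C(1) C0(1) by (simp add: m_def abs_mult)
    qed
  qed measurable
qed

text \<open>The substitution \<open>u = exp (- x)\<close> turns the Mellin transform on the critical line into the
  Fourier transform.\<close>

lemma tame_L2_le:
  assumes g: "tame g"
  shows "ennreal (2 * pi) * (\<integral>\<^sup>+u. ennreal ((cmod (g u))\<^sup>2) \<partial>pos_measure) \<le>
    (\<integral>\<^sup>+t. ennreal ((cmod (mellin g (Complex (1/2) t)))\<^sup>2) \<partial>lborel)"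
proof -
  obtain M where M: "M \<ge> 0" "\<And>u. u > 0 \<Longrightarrow> cmod (g u) \<le> M * u powr (- 1/4)" using tameE[OF g] by blast
  have c: "continuous_on {0<..} g" and z: "\<And>u. u \<ge> 1 \<Longrightarrow> g u = 0" using g by (auto simp: tame_def)
  \<comment> \<open>The factor \<open>exp (- x / 2)\<close> is the square root of the Jacobian. It
    preserves the squared norm and places the Fourier transform at
    \<open>Re s = 1/2\<close>.\<close>
  define F where "F x = exp (- x / 2) *\<^sub>R g (exp (- x))" for x
  have Fm: "exp (- x) *\<^sub>R (indicator {0<..} (exp (- x)) *\<^sub>R (g (exp (- x)) * complex_of_real (exp (- x)) powr (Complex (1/2) t - 1))) =
    F x * exp (- (\<i> * of_real (t * x)))" for x t
  proof -
    have "complex_of_real (exp (- x)) powr (Complex (1/2) t - 1) = exp ((Complex (1/2) t - 1) * of_real (- x))"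
      by (simp add: powr_def Ln_of_real)
    also have "of_real (exp (- x)) * \<dots> = exp (of_real (- x) + (Complex (1/2) t - 1) * of_real (- x))"
      by (simp only: exp_add exp_of_real)
    also have "of_real (- x) + (Complex (1/2) t - 1) * of_real (- x) = of_real (- x / 2) + - (\<i> * of_real (t * x))"
      by (simp add: complex_eq_iff algebra_simps)
    also have "exp \<dots> = of_real (exp (- x / 2)) * exp (- (\<i> * of_real (t * x)))"
      by (simp only: exp_add exp_of_real)
    finally show ?thesis unfolding F_def by (simp add: scaleR_conv_of_real mult_ac)
  qed
  have bm: "(\<lambda>u. indicator {0<..} u *\<^sub>R (g u * of_real u powr (s - 1))) \<in> borel_measurable borel" for s
    using tame_measurable[OF g, of s] by simp
  have si: "set_integrable lborel {0<..} (\<lambda>u. indicator {0<..} u *\<^sub>R (g u * complex_of_real u powr (Complex (1/2) t - 1)))" for t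
    using tame_integrable[OF g, of "Complex (1/2) t"] unfolding set_integrable_def by (simp add: indicator_inter_arith[symmetric])
  have Fi: "integrable lborel (\<lambda>x. F x * exp (- (\<i> * of_real (t * x))))" for t
    using change_of_variables_exp(1)[OF bm, of "Complex (1/2) t"] si[of t] unfolding Fm by simp
  have F: "integrable lborel F" using Fi[of 0] by simp
  have four: "fourier F t = mellin g (Complex (1/2) t)" for t
  proof -
    have "mellin g (Complex (1/2) t) = (LINT u:{0<..}|lborel. indicator {0<..} u *\<^sub>R (g u * complex_of_real u powr (Complex (1/2) t - 1)))"
      unfolding mellin_def by (rule set_lebesgue_integral_cong) auto
    also have "\<dots> = fourier F t"
      using change_of_variables_exp(2)[OF bm, of "Complex (1/2) t"] Fi[of t] unfolding Fm fourier_def by simp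
    finally show ?thesis by simp
  qed
  have Fb: "cmod (F x) \<le> M" for x
  proof (cases "x > 0")
    case True
    have "cmod (F x) = exp (- x / 2) * cmod (g (exp (- x)))" by (simp add: F_def)
    also have "\<dots> \<le> exp (- x / 2) * (M * exp (- x) powr (- 1/4))" by (intro mult_left_mono M(2)) auto
    also have "\<dots> = M * exp (- x / 4)" by (simp add: powr_def exp_add[symmetric])
    also have "\<dots> \<le> M * 1" using True M(1) by (intro mult_left_mono) auto
    finally show ?thesis by simp
  next
    case False
    thus ?thesis using z[of "exp (- x)"] M(1) by (simp add: F_def)
  qed
  have Fc: "continuous_on UNIV F" unfolding F_def
    by (intro continuous_on_scaleR continuous_on_compose2[OF c] continuous_intros) auto
  define f2 where "f2 u = indicator {0<..} u *\<^sub>R (cmod (g u))\<^sup>2" for u :: real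
  have f2m: "f2 \<in> borel_measurable borel"
  proof -
    have "continuous_on {0<..} (\<lambda>u. (cmod (g u))\<^sup>2)" by (intro continuous_intros c)
    thus ?thesis unfolding f2_def[abs_def] using borel_measurable_continuous_on_indicator[of "{0<..}" "\<lambda>u. (cmod (g u))\<^sup>2"] by simp
  qed
  have F2: "exp (- x) *\<^sub>R f2 (exp (- x)) = (cmod (F x))\<^sup>2" for x
  proof -
    have "(exp (- x / 2))\<^sup>2 = exp (- x)" by (simp add: power2_eq_square exp_add[symmetric])
    thus ?thesis by (simp add: f2_def F_def power_mult_distrib)
  qed
  have i2: "integrable lborel (\<lambda>x. (cmod (F x))\<^sup>2)"
  proof (rule Bochner_Integration.integrable_bound[OF integrable_mult_right[OF integrable_norm[OF F], of M]])
    show "AE x in lborel. norm ((cmod (F x))\<^sup>2) \<le> norm (M * cmod (F x))"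
      using Fb M(1) by (intro AE_I2) (simp add: power2_eq_square abs_mult mult_right_mono)
    show "(\<lambda>x. (cmod (F x))\<^sup>2) \<in> borel_measurable lborel" using F by (intro borel_measurable_power borel_measurable_norm) simp
  qed
  have "(\<integral>\<^sup>+u. ennreal ((cmod (g u))\<^sup>2) \<partial>pos_measure) = (\<integral>\<^sup>+u. ennreal (indicator {0<..} u *\<^sub>R f2 u) \<partial>lborel)"
    unfolding pos_measure_def by (subst nn_integral_restrict_space) (auto intro!: nn_integral_cong simp: f2_def indicator_def)
  also have "\<dots> = ennreal (LINT u:{0<..}|lborel. f2 u)"
    unfolding set_lebesgue_integral_def
    using change_of_variables_exp(1)[OF f2m] i2 unfolding F2 set_integrable_def
    by (intro nn_integral_eq_integral) (auto simp: f2_def)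
  also have "(LINT u:{0<..}|lborel. f2 u) = (\<integral>x. (cmod (F x))\<^sup>2 \<partial>lborel)"
    using change_of_variables_exp(2)[OF f2m] i2 unfolding F2 by simp
  also have "ennreal (\<integral>x. (cmod (F x))\<^sup>2 \<partial>lborel) = (\<integral>\<^sup>+x. ennreal ((cmod (F x))\<^sup>2) \<partial>lborel)"
    using i2 by (intro nn_integral_eq_integral[symmetric]) auto
  finally show ?thesis using plancherel_le[OF F Fb Fc] unfolding four by simp
qed

lemma mellin_finite_dilates:
  assumes f: "tame f" and s: "Re s > 1/4"
  shows "mellin (\<lambda>u. \<Sum>n<N::nat. b n * f (real (Suc n) * u)) s = (\<Sum>n<N. b n * of_nat (Suc n) powr - s) * mellin f s"
proof -
  have i: "integrable lborel (\<lambda>u. indicator {0<..} u *\<^sub>R (f (real (Suc n) * u) * complex_of_real u powr (s - 1)))" for n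
  proof -
    have "tame (\<lambda>u. f (real (Suc n) * u))" by (rule tame_scale[OF f]) simp
    from tame_integrable[OF this s] show ?thesis unfolding set_integrable_def .
  qed
  have "mellin (\<lambda>u. \<Sum>n<N. b n * f (real (Suc n) * u)) s =
      (\<integral>u. (\<Sum>n<N. b n * (indicator {0<..} u *\<^sub>R (f (real (Suc n) * u) * complex_of_real u powr (s - 1)))) \<partial>lborel)"
    unfolding mellin_def set_lebesgue_integral_def
    by (rule Bochner_Integration.integral_cong[OF refl]) (simp add: sum_distrib_right scaleR_sum_right mult.assoc)
  also have "\<dots> = (\<Sum>n<N. b n * mellin (\<lambda>u. f (real (Suc n) * u)) s)"
    unfolding mellin_def set_lebesgue_integral_def
    by (subst Bochner_Integration.integral_sum, rule integrable_mult_right, rule i, simp only: integral_mult_right_zero)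
  also have "\<dots> = (\<Sum>n<N. b n * of_nat (Suc n) powr - s) * mellin f s"
    unfolding sum_distrib_right
  proof (intro sum.cong refl)
    fix n
    have "mellin (\<lambda>u. f (real (Suc n) * u)) s = of_nat (Suc n) powr - s * mellin f s"
      using mellin_scale(1)[of "real (Suc n)" f s] by simp
    thus "b n * mellin (\<lambda>u. f (real (Suc n) * u)) s = b n * of_nat (Suc n) powr - s * mellin f s" by simp
  qed
  finally show ?thesis .
qed

lemma tame_diff:
  assumes f: "tame f" and g: "tame g"
  shows "tame (\<lambda>u. f u - g u)"
proof -
  obtain M where M: "\<And>u. u > 0 \<Longrightarrow> cmod (f u) \<le> M * u powr (- 1/4)" using tameE[OF f] by blast
  obtain L where L: "\<And>u. u > 0 \<Longrightarrow> cmod (g u) \<le> L * u powr (- 1/4)" using tameE[OF g] by blast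
  have "cmod (f u - g u) \<le> (M + L) * u powr (- 1/4)" if "u > 0" for u
    using norm_triangle_ineq4[of "f u" "g u"] M[OF that] L[OF that] by (simp add: distrib_right)
  moreover have "continuous_on {0<..} (\<lambda>u. f u - g u)"
    using f g by (intro continuous_on_diff) (auto simp: tame_def)
  ultimately show ?thesis using f g unfolding tame_def by auto
qed

text \<open>\<open>\<psi>\<close> combines dilates of \<open>\<phi>\<close> with the coefficients of
  a Dirichlet polynomial \<open>D\<close>. On the critical line \<open>(s - 1) / s\<close> has
  modulus \<open>1\<close>, so the transform of the difference has the modulus of
  \<open>mellin \<phi> s * (zeta_line t * D - 1)\<close>. This is the weighted error already made
  small, and Plancherel's inequality transports it back.\<close>

lemma V_op_approximation:
  assumes rh: zeta_zero_free and \<phi>: "\<phi> \<in> S_le1" and e: "\<eta> > 0"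
  shows "\<exists>\<psi>\<in>S_le1. (\<integral>\<^sup>+u. ennreal ((cmod (V_op (E_map \<psi>) u - V_op \<phi> u))\<^sup>2) \<partial>pos_measure) < ennreal \<eta>"
proof -
  define W where "W t = (cmod (mellin \<phi> (Complex (1/2) t)))\<^sup>2" for t
  have W: "W \<in> borel_measurable borel" "\<And>t. W t \<ge> 0" "\<And>k. integrable lborel (\<lambda>t. (10 + \<bar>t\<bar>) ^ k * W t)"
    unfolding W_def by (rule mellin_weight_integrable(1)[OF \<phi>], simp, rule mellin_weight_integrable(2)[OF \<phi>])
  obtain N and b :: "nat \<Rightarrow> complex" where Nb:
    "(\<integral>\<^sup>+t. ennreal (W t * (cmod (zeta_line t * (\<Sum>n<N. b n * of_nat (Suc n) powr - Complex (1/2) t) - 1))\<^sup>2) \<partial>lborel) < ennreal \<eta>"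
    by (rule zeta_dirichlet_approximation[OF rh W e]) blast
  define \<psi> where "\<psi> u = (\<Sum>n<N. b n * \<phi> (real (Suc n) * u))" for u
  have \<psi>: "\<psi> \<in> S_le1" unfolding \<psi>_def[abs_def] by (rule S_le1_sum[OF \<phi>])
  define g where "g u = V_op (E_map \<psi>) u - V_op \<phi> u" for u
  have tE: "tame (V_op (E_map \<psi>))" by (rule tame_V_op_E_map[OF \<psi>])
  have tV: "tame (V_op \<phi>)" by (rule tame_V_op[OF tame_S_le1[OF \<phi>]])
  have g: "tame g" unfolding g_def[abs_def] by (rule tame_diff[OF tE tV])
  have mg: "(cmod (mellin g (Complex (1/2) t)))\<^sup>2 = W t * (cmod (zeta_line t * (\<Sum>n<N. b n * of_nat (Suc n) powr - Complex (1/2) t) - 1))\<^sup>2" for t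
  proof -
    define s where "s = Complex (1/2) t"
    have s: "Re s > 1/4" "s \<noteq> 0" by (simp_all add: s_def complex_eq_iff)
    have s1: "s - 1 \<noteq> 0" unfolding s_def by (rule line_ne_1)
    define D where "D = (\<Sum>n<N. b n * of_nat (Suc n) powr - s)"
    have "mellin g s = mellin (V_op (E_map \<psi>)) s - mellin (V_op \<phi>) s"
      unfolding mellin_def g_def left_diff_distrib
      by (rule set_integral_diff(2)[OF tame_integrable[OF tE s(1)] tame_integrable[OF tV s(1)]])
    also have "\<dots> = zeta_reg s / s * (D * mellin \<phi> s) - (s - 1) / s * mellin \<phi> s"
    proof -
      have "mellin \<psi> s = D * mellin \<phi> s"
        unfolding \<psi>_def[abs_def] D_def by (rule mellin_finite_dilates[OF tame_S_le1[OF \<phi>] s(1)])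
      thus ?thesis by (simp only: mellin_V_op_E_map[OF \<psi> s(1)] mellin_V_op[OF tame_S_le1[OF \<phi>] s(1)])
    qed
    also have "\<dots> = (s - 1) / s * mellin \<phi> s * (zeta_line t * D - 1)"
      using s(2) s1 by (simp add: zeta_line_def s_def[symmetric] field_simps)
    finally have "mellin g s = (s - 1) / s * mellin \<phi> s * (zeta_line t * D - 1)" .
    moreover have "cmod ((s - 1) / s) = 1"
    proof -
      have "cmod (s - 1) = cmod s" by (simp add: cmod_def s_def power2_eq_square)
      thus ?thesis using s(2) by (simp add: norm_divide)
    qed
    ultimately have "cmod (mellin g s) = cmod (mellin \<phi> s) * cmod (zeta_line t * D - 1)" by (simp only: norm_mult)
    thus ?thesis by (simp add: W_def s_def D_def power_mult_distrib)
  qed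
  have "ennreal 1 * (\<integral>\<^sup>+u. ennreal ((cmod (g u))\<^sup>2) \<partial>pos_measure) \<le> ennreal (2 * pi) * (\<integral>\<^sup>+u. ennreal ((cmod (g u))\<^sup>2) \<partial>pos_measure)"
    using pi_gt3 by (intro mult_right_mono ennreal_leI) auto
  also have "\<dots> \<le> (\<integral>\<^sup>+t. ennreal ((cmod (mellin g (Complex (1/2) t)))\<^sup>2) \<partial>lborel)" by (rule tame_L2_le[OF g])
  also have "\<dots> < ennreal \<eta>" unfolding mg by (rule Nb)
  finally have "(\<integral>\<^sup>+u. ennreal ((cmod (g u))\<^sup>2) \<partial>pos_measure) < ennreal \<eta>" by simp
  thus ?thesis using \<psi> by (intro bexI[of _ \<psi>]) (simp_all add: g_def)
qed

section \<open>A smooth even bump function\<close>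

text \<open>A family closed under differentiation: all derivatives of
  \<open>exp (- a / (1 - x\<^sup>2))\<close> are this exponential times a polynomial over a power of
  \<open>1 - x\<^sup>2\<close>.\<close>

definition bump_term :: "real \<Rightarrow> real poly \<Rightarrow> nat \<Rightarrow> real \<Rightarrow> real" where
  "bump_term a p k x = (if \<bar>x\<bar> < 1 then poly p x * exp (- a / (1 - x\<^sup>2)) / (1 - x\<^sup>2) ^ k else 0)"

lemma power_over_fact_le_exp:
  fixes t :: real
  assumes "t \<ge> 0"
  shows "t ^ n / fact n \<le> exp t"
proof -
  have "(\<Sum>i\<in>{n}. t ^ i /\<^sub>R fact i) \<le> (\<Sum>i. t ^ i /\<^sub>R fact i)"
    by (rule sum_le_suminf[OF summable_exp_generic]) (use assms in auto)
  thus ?thesis by (simp add: exp_def divide_inverse mult.commute)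
qed

lemma one_minus_square_pos: "\<bar>x\<bar> < 1 \<Longrightarrow> 0 < 1 - (x::real)\<^sup>2"
  by (simp add: abs_square_less_1)

text \<open>The second-order zero at the endpoints is what makes the extension by zero
  differentiable there, with derivative \<open>0\<close>.\<close>

lemma bump_term_bound:
  assumes a: "a > 0"
  obtains C where "C \<ge> 0" "\<And>x. \<bar>x\<bar> < 1 \<Longrightarrow> \<bar>bump_term a p k x\<bar> \<le> C * (1 - x\<^sup>2)\<^sup>2"
proof -
  have "compact (poly p ` {-1..1})" by (intro compact_continuous_image continuous_intros) auto
  then obtain P where "\<forall>y\<in>poly p ` {-1..1}. norm y \<le> P"
    using compact_imp_bounded[of "poly p ` {-1..1}"] unfolding bounded_iff by blast
  hence P: "\<bar>poly p x\<bar> \<le> P" if "x \<in> {-1..1}" for x using that by simp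
  have P0: "P \<ge> 0" using P[of 0] by simp
  \<comment> \<open>From \<open>t ^ (k + 2) / fact (k + 2) \<le> exp t\<close> at
    \<open>t = a / (1 - x\<^sup>2)\<close>: \<open>k\<close> powers of \<open>1 - x\<^sup>2\<close>
    cancel the denominator and two remain.\<close>
  define C where "C = P * fact (k + 2) / a ^ (k + 2)"
  have "\<bar>bump_term a p k x\<bar> \<le> C * (1 - x\<^sup>2)\<^sup>2" if x: "\<bar>x\<bar> < 1" for x
  proof -
    define w where "w = 1 - x\<^sup>2"
    have w: "w > 0" unfolding w_def by (rule one_minus_square_pos[OF x])
    have "(a / w) ^ (k + 2) / fact (k + 2) \<le> exp (a / w)" using a w by (intro power_over_fact_le_exp) auto
    hence "a ^ (k + 2) / w ^ (k + 2) \<le> exp (a / w) * fact (k + 2)"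
      by (simp only: power_divide pos_divide_le_eq fact_gt_zero)
    hence "a ^ (k + 2) \<le> exp (a / w) * fact (k + 2) * w ^ (k + 2)"
      using w by (simp only: pos_divide_le_eq zero_less_power)
    hence "exp (- a / w) * a ^ (k + 2) \<le> exp (- a / w) * (exp (a / w) * fact (k + 2) * w ^ (k + 2))"
      by (rule mult_left_mono) simp
    also have "\<dots> = (exp (- a / w) * exp (a / w)) * (fact (k + 2) * w ^ (k + 2))" by (simp only: mult.assoc)
    also have "exp (- a / w) * exp (a / w) = 1" by (simp add: exp_minus)
    finally have "exp (- a / w) * a ^ (k + 2) \<le> fact (k + 2) * w ^ (k + 2)" by (simp only: mult_1_left)
    hence e: "exp (- a / w) \<le> fact (k + 2) * w ^ (k + 2) / a ^ (k + 2)"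
      using a by (simp only: pos_le_divide_eq zero_less_power)
    have gen: "P' * (F * (wk * w2) / A) / wk = P' * F / A * w2" if "wk \<noteq> 0" for P' F wk w2 A :: real
      using that by simp
    have "\<bar>bump_term a p k x\<bar> = \<bar>poly p x\<bar> * exp (- a / w) / w ^ k"
      using x w by (simp add: bump_term_def w_def[symmetric] abs_mult)
    also have "\<dots> \<le> P * (fact (k + 2) * w ^ (k + 2) / a ^ (k + 2)) / w ^ k"
      using x w P0 by (intro divide_right_mono mult_mono e P) auto
    also have "\<dots> = C * w\<^sup>2" unfolding C_def power_add[of w k 2] by (rule gen) (use w in simp)
    finally show ?thesis by (simp add: w_def)
  qed
  moreover have "C \<ge> 0" using P0 a by (simp add: C_def)
  ultimately show ?thesis by (rule that[rotated])
qed

text \<open>The quotient rule as pure algebra. \<open>W\<close> stands for \<open>w ^ k\<close>, and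
  \<open>k * W / w\<close> for the derivative of the power, which avoids the truncated exponent
  \<open>k - 1\<close> at \<open>k = 0\<close>.\<close>

lemma bump_derivative_identity:
  fixes w W :: real
  assumes w: "w \<noteq> 0" and W: "W \<noteq> 0"
  shows "((P' * E + E * (- 2 * a * x / w\<^sup>2) * P) * W - (P * E) * (k * W / w * (- 2 * x))) / (W * W) =
    (P' * w\<^sup>2 + 2 * k * (x * P * w) - 2 * a * (x * P)) * E / (W * w\<^sup>2)"
proof -
  have "(P' * E + E * (- 2 * a * x / w\<^sup>2) * P) * W - (P * E) * (k * W / w * (- 2 * x)) =
    W * (E * (P' - 2 * a * x * P / w\<^sup>2 + 2 * k * x * P / w))"
    by (simp add: algebra_simps)
  also have "\<dots> / (W * W) = E * (P' - 2 * a * x * P / w\<^sup>2 + 2 * k * x * P / w) / W"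
    using W by simp
  also have "P' - 2 * a * x * P / w\<^sup>2 + 2 * k * x * P / w = (P' * w\<^sup>2 + 2 * k * (x * P * w) - 2 * a * (x * P)) / w\<^sup>2"
    using w by (simp add: add_divide_distrib diff_divide_distrib power2_eq_square)
  finally show ?thesis by (simp add: mult_ac)
qed

lemma bump_term_derivative:
  assumes a: "a > 0"
  shows "\<exists>q l. \<forall>x. (bump_term a p k has_real_derivative bump_term a q l x) (at x)"
proof -
  define W where "W = [:1, 0, -1 :: real:]"
  define q where "q = pderiv p * W\<^sup>2 + smult (2 * real k) ([:0, 1:] * p * W) - smult (2 * a) ([:0, 1:] * p)"
  have polyW: "poly W x = 1 - x\<^sup>2" for x by (simp add: W_def power2_eq_square)
  have "(bump_term a p k has_real_derivative bump_term a q (k + 2) x) (at x)" for x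
  proof -
    consider "\<bar>x\<bar> < 1" | "\<bar>x\<bar> = 1" | "\<bar>x\<bar> > 1" by linarith
    thus ?thesis
    proof cases
      case 1
      define w where "w = 1 - x\<^sup>2"
      have w: "w > 0" unfolding w_def by (rule one_minus_square_pos[OF 1])
      have dw: "((\<lambda>x. 1 - x\<^sup>2) has_real_derivative - 2 * x) (at x)" by (auto intro!: derivative_eq_intros)
      have dE: "((\<lambda>x. exp (- a / (1 - x\<^sup>2))) has_real_derivative exp (- a / w) * (- 2 * a * x / w\<^sup>2)) (at x)"
        using w unfolding w_def by (auto intro!: derivative_eq_intros simp: power2_eq_square divide_simps)
      have dk: "((\<lambda>x. (1 - x\<^sup>2) ^ k) has_real_derivative real k * w ^ (k - 1) * (- 2 * x)) (at x)"
        unfolding w_def by (auto intro!: derivative_eq_intros)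
      have "((\<lambda>x. poly p x * exp (- a / (1 - x\<^sup>2)) / (1 - x\<^sup>2) ^ k) has_real_derivative
        ((poly (pderiv p) x * exp (- a / w) + exp (- a / w) * (- 2 * a * x / w\<^sup>2) * poly p x) * w ^ k
          - (poly p x * exp (- a / w)) * (real k * w ^ (k - 1) * (- 2 * x))) / (w ^ k * w ^ k)) (at x)"
        using DERIV_divide[OF DERIV_mult[OF poly_DERIV dE] dk] w unfolding w_def by simp
      also have "((poly (pderiv p) x * exp (- a / w) + exp (- a / w) * (- 2 * a * x / w\<^sup>2) * poly p x) * w ^ k
          - (poly p x * exp (- a / w)) * (real k * w ^ (k - 1) * (- 2 * x))) / (w ^ k * w ^ k) = poly q x * exp (- a / w) / w ^ (k + 2)"
      proof -
        have kk: "real k * w ^ (k - 1) = real k * w ^ k / w" using w by (cases k) auto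
        have qx: "poly q x = poly (pderiv p) x * w\<^sup>2 + 2 * real k * (x * poly p x * w) - 2 * a * (x * poly p x)"
          by (simp add: q_def polyW w_def)
        show ?thesis unfolding kk qx power_add[of w k 2]
          by (rule bump_derivative_identity[where W = "w ^ k" and w = w and P = "poly p x" and P' = "poly (pderiv p) x"
              and E = "exp (- a / w)" and k = "real k" and x = x and a = a]) (use w in simp_all)
      qed
      finally have d: "((\<lambda>x. poly p x * exp (- a / (1 - x\<^sup>2)) / (1 - x\<^sup>2) ^ k) has_real_derivative bump_term a q (k + 2) x) (at x)"
        using 1 by (simp add: bump_term_def w_def)
      show ?thesis
        by (rule has_field_derivative_transform_within_open[OF d, of "{-1<..<1}"]) (use 1 in \<open>auto simp: bump_term_def abs_less_iff\<close>)
    next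
      case 2
      obtain C where C: "C \<ge> 0" "\<And>x. \<bar>x\<bar> < 1 \<Longrightarrow> \<bar>bump_term a p k x\<bar> \<le> C * (1 - x\<^sup>2)\<^sup>2" using bump_term_bound[OF a] by blast
      have x0: "bump_term a p k x = 0" "bump_term a q (k + 2) x = 0" using 2 by (simp_all add: bump_term_def)
      \<comment> \<open>The factor \<open>1 - \<bar>y\<bar>\<close> of \<open>1 - y\<^sup>2\<close>
        is at most the distance from \<open>y\<close> to the endpoint \<open>x\<close>, the other
        factor at most \<open>2\<close>. So the bound is quadratic in \<open>y - x\<close>.\<close>
      have bd: "\<bar>bump_term a p k y\<bar> \<le> 4 * C * (y - x)\<^sup>2" for y
      proof (cases "\<bar>y\<bar> < 1")
        case True
        have "1 - y\<^sup>2 = (1 - \<bar>y\<bar>) * (1 + \<bar>y\<bar>)" by (simp add: power2_eq_square algebra_simps)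
        also have "\<dots> \<le> \<bar>y - x\<bar> * 2" using True 2 by (intro mult_mono) auto
        finally have "(1 - y\<^sup>2)\<^sup>2 \<le> (\<bar>y - x\<bar> * 2)\<^sup>2" using one_minus_square_pos[OF True] by (intro power_mono) auto
        hence "C * (1 - y\<^sup>2)\<^sup>2 \<le> C * (\<bar>y - x\<bar> * 2)\<^sup>2" using C(1) by (rule mult_left_mono)
        thus ?thesis using C(2)[OF True] by (simp add: power_mult_distrib)
      qed (use C(1) in \<open>simp add: bump_term_def\<close>)
      have "((\<lambda>y. bump_term a p k y) has_derivative (\<lambda>h. 0)) (at x)"
        unfolding has_derivative_at_alt
      proof (intro conjI allI impI)
        fix e :: real assume e: "e > 0"
        show "\<exists>d>0. \<forall>y. norm (y - x) < d \<longrightarrow> norm (bump_term a p k y - bump_term a p k x - 0) \<le> e * norm (y - x)"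
        proof (intro exI[of _ "e / (4 * C + 1)"] conjI allI impI)
          fix y assume y: "norm (y - x) < e / (4 * C + 1)"
          have "4 * C * \<bar>y - x\<bar> \<le> (4 * C + 1) * \<bar>y - x\<bar>" by (simp add: distrib_right)
          also have "\<dots> \<le> e" using y C(1) by (simp add: pos_less_divide_eq mult.commute)
          finally have "4 * C * \<bar>y - x\<bar> * \<bar>y - x\<bar> \<le> e * \<bar>y - x\<bar>" by (rule mult_right_mono) simp
          hence "4 * C * (y - x)\<^sup>2 \<le> e * \<bar>y - x\<bar>" by (simp add: power2_eq_square mult.assoc)
          thus "norm (bump_term a p k y - bump_term a p k x - 0) \<le> e * norm (y - x)"
            using bd[of y] x0 by simp
        qed (use e C(1) in simp)
      qed simp
      thus ?thesis unfolding x0(2) by (rule has_derivative_imp_has_field_derivative) simp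
    next
      case 3
      have op: "open {x::real. \<bar>x\<bar> > 1}" by (intro open_Collect_less continuous_intros)
      have z: "bump_term a q (k + 2) x = 0" using 3 by (simp add: bump_term_def)
      have d0: "((\<lambda>x. 0::real) has_real_derivative 0) (at x)" by simp
      have m: "x \<in> {x. \<bar>x\<bar> > 1}" using 3 by simp
      have "(0::real) = bump_term a p k y" if "y \<in> {x. \<bar>x\<bar> > 1}" for y using that by (simp add: bump_term_def)
      from has_field_derivative_transform_within_open[OF d0 op m this]
      show ?thesis unfolding z .
    qed
  qed
  thus ?thesis by blast
qed

text \<open>The parameter is kept because the limit matters: as \<open>a\<close> decreases to
  \<open>0\<close>, these functions tend to \<open>1\<close> on \<open>(-1, 1)\<close> and thus are
  smooth cutoffs.\<close>

definition bump :: "real \<Rightarrow> real \<Rightarrow> complex" where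
  "bump a x = of_real (bump_term a 1 0 x)"

lemma smooth_bump:
  assumes a: "a > 0"
  shows "\<exists>D :: nat \<Rightarrow> real \<Rightarrow> complex. D 0 = bump a \<and> (\<forall>k x. (D k has_vector_derivative D (Suc k) x) (at x))"
proof -
  obtain Q L where QL: "\<And>p k x. (bump_term a p k has_real_derivative bump_term a (Q p k) (L p k) x) (at x)"
    using bump_term_derivative[OF a] by metis
  define P where "P n = ((\<lambda>(p, k). (Q p k, L p k)) ^^ n) (1, 0)" for n
  define D where "D n x = complex_of_real (bump_term a (fst (P n)) (snd (P n)) x)" for n x
  have "(D n has_vector_derivative D (Suc n) x) (at x)" for n x
  proof -
    have "P (Suc n) = (Q (fst (P n)) (snd (P n)), L (fst (P n)) (snd (P n)))" by (simp add: P_def case_prod_unfold)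
    thus ?thesis unfolding D_def
      using has_vector_derivative_of_real[of "bump_term a (fst (P n)) (snd (P n))"] QL[of "fst (P n)" "snd (P n)" x]
      by (simp add: has_real_derivative_iff_has_vector_derivative)
  qed
  moreover have "D 0 = bump a" by (simp add: D_def P_def bump_def fun_eq_iff)
  ultimately show ?thesis by blast
qed

section \<open>The closure of the range\<close>

lemma space_pos_measure [simp]: "space pos_measure = {0<..}"
  by (simp add: pos_measure_def space_restrict_space)

lemma pos_measurable_continuous:
  fixes f :: "real \<Rightarrow> complex"
  assumes "continuous_on {0<..} f"
  shows "f \<in> borel_measurable pos_measure"
proof -
  have "sets pos_measure = sets (restrict_space borel {0<..})"
    unfolding pos_measure_def by (intro sets_restrict_space_cong) simp
  thus ?thesis
    using borel_measurable_continuous_on_restrict[OF assms] measurable_cong_sets[of pos_measure "restrict_space borel {0<..}" borel borel] by simp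
qed

lemma pos_measurable_borel:
  "f \<in> borel_measurable borel \<Longrightarrow> f \<in> borel_measurable pos_measure"
  unfolding pos_measure_def by (rule measurable_restrict_space1) simp

lemma nn_integral_pos_measure:
  "(\<integral>\<^sup>+u. f u \<partial>pos_measure) = (\<integral>\<^sup>+u. f u * indicator {0<..} u \<partial>lborel)"
  unfolding pos_measure_def by (rule nn_integral_restrict_space) simp

lemma nn_integral_indicator_01: "(\<integral>\<^sup>+u. ennreal c * indicator {0<..<1} u \<partial>pos_measure) = ennreal c"
proof -
  have "(\<integral>\<^sup>+u. ennreal c * indicator {0<..<1} u \<partial>pos_measure) = (\<integral>\<^sup>+(u::real). ennreal c * indicator {0<..<1} u \<partial>lborel)"
    unfolding nn_integral_pos_measure by (rule nn_integral_cong) (simp add: indicator_def)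
  also have "\<dots> = ennreal c" by (subst nn_integral_cmult_indicator) auto
  finally show ?thesis .
qed

definition sqn :: "(real \<Rightarrow> complex) \<Rightarrow> ennreal" where
  "sqn f = (\<integral>\<^sup>+u. ennreal ((cmod (f u))\<^sup>2) \<partial>pos_measure)"

lemma sqn_cong: "(\<And>u. u > 0 \<Longrightarrow> f u = g u) \<Longrightarrow> sqn f = sqn g"
  unfolding sqn_def by (rule nn_integral_cong) simp

lemma sqn_commute: "sqn (\<lambda>u. f u - g u) = sqn (\<lambda>u. g u - f u)"
  unfolding sqn_def by (simp add: norm_minus_commute)

lemma sqn_add:
  assumes [measurable]: "f \<in> borel_measurable pos_measure" "g \<in> borel_measurable pos_measure"
  shows "sqn (\<lambda>u. f u + g u) \<le> 2 * sqn f + 2 * sqn g"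
proof -
  have pt: "ennreal ((cmod (f u + g u))\<^sup>2) \<le> 2 * ennreal ((cmod (f u))\<^sup>2) + 2 * ennreal ((cmod (g u))\<^sup>2)" for u
  proof -
    have "(cmod (f u + g u))\<^sup>2 \<le> (cmod (f u) + cmod (g u))\<^sup>2" by (intro power_mono norm_triangle_ineq) simp
    also have "\<dots> \<le> 2 * (cmod (f u))\<^sup>2 + 2 * (cmod (g u))\<^sup>2"
      using sum_squares_bound[of "cmod (f u)" "cmod (g u)"] by (simp add: power2_sum)
    finally have "ennreal ((cmod (f u + g u))\<^sup>2) \<le> ennreal (2 * (cmod (f u))\<^sup>2 + 2 * (cmod (g u))\<^sup>2)" by (rule ennreal_leI)
    thus ?thesis by (simp add: ennreal_plus ennreal_mult)
  qed
  have "sqn (\<lambda>u. f u + g u) \<le> (\<integral>\<^sup>+u. 2 * ennreal ((cmod (f u))\<^sup>2) + 2 * ennreal ((cmod (g u))\<^sup>2) \<partial>pos_measure)"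
    unfolding sqn_def by (rule nn_integral_mono) (rule pt)
  also have "\<dots> = 2 * sqn f + 2 * sqn g" unfolding sqn_def by (simp add: nn_integral_add nn_integral_cmult)
  finally show ?thesis .
qed

lemma sqn_cmult:
  assumes [measurable]: "f \<in> borel_measurable pos_measure"
  shows "sqn (\<lambda>u. c * f u) = ennreal ((cmod c)\<^sup>2) * sqn f"
  unfolding sqn_def by (simp add: norm_mult power_mult_distrib ennreal_mult nn_integral_cmult)

text \<open>A squared norm of a sum is at most twice the sum of the squared norms, so two errors
  below \<open>\<eta> / 8\<close> give at most \<open>\<eta> / 2\<close>.\<close>

lemma sqn_add_less:
  assumes "f \<in> borel_measurable pos_measure" "g \<in> borel_measurable pos_measure"
    and "sqn f < ennreal (\<eta> / 8)" "sqn g < ennreal (\<eta> / 8)" "\<eta> > 0"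
  shows "sqn (\<lambda>u. f u + g u) < ennreal \<eta>"
proof -
  have "sqn (\<lambda>u. f u + g u) \<le> 2 * sqn f + 2 * sqn g" by (rule sqn_add[OF assms(1,2)])
  also have "\<dots> \<le> 2 * ennreal (\<eta> / 8) + 2 * ennreal (\<eta> / 8)"
    using assms by (intro add_mono mult_left_mono) auto
  also have "\<dots> = ennreal (\<eta> / 2)"
  proof -
    have "2 * ennreal (\<eta> / 8) = ennreal (\<eta> / 4)" using assms ennreal_mult[of 2 "\<eta> / 8"] by simp
    thus ?thesis using assms by (simp add: ennreal_plus[symmetric] del: ennreal_plus)
  qed
  also have "\<dots> < ennreal \<eta>" using assms by (intro ennreal_lessI) auto
  finally show ?thesis .
qed

lemma sqn_tendsto_zero:
  assumes m: "\<And>n. f n \<in> borel_measurable pos_measure"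
    and bd: "\<And>n u. u > 0 \<Longrightarrow> cmod (f n u) \<le> C * indicator {0<..<1} u"
    and lim: "AE u in pos_measure. (\<lambda>n. f n u) \<longlonglongrightarrow> 0"
  shows "(\<lambda>n. sqn (f n)) \<longlonglongrightarrow> 0"
proof -
  note [measurable] = m
  have "(\<lambda>n. \<integral>\<^sup>+u. ennreal ((cmod (f n u))\<^sup>2) \<partial>pos_measure) \<longlonglongrightarrow> (\<integral>\<^sup>+u. 0 \<partial>pos_measure)"
  proof (rule nn_integral_dominated_convergence[where u = "\<lambda>n u. ennreal ((cmod (f n u))\<^sup>2)" and u' = "\<lambda>_. 0" and w = "\<lambda>u. ennreal (C\<^sup>2) * indicator {0<..<1} u"])
    show "(\<lambda>u. ennreal (C\<^sup>2) * indicator {0<..<1} u) \<in> borel_measurable pos_measure"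
      unfolding pos_measure_def by (rule measurable_restrict_space1) simp
    show "(\<integral>\<^sup>+u. ennreal (C\<^sup>2) * indicator {0<..<1} u \<partial>pos_measure) < \<infinity>" unfolding nn_integral_indicator_01 by simp
    show "AE u in pos_measure. ennreal ((cmod (f n u))\<^sup>2) \<le> ennreal (C\<^sup>2) * indicator {0<..<1} u" for n
    proof (rule AE_I2)
      fix u assume u: "u \<in> space pos_measure"
      hence "(cmod (f n u))\<^sup>2 \<le> (C * indicator {0<..<1} u)\<^sup>2" using bd[of u n] by (intro power_mono) auto
      thus "ennreal ((cmod (f n u))\<^sup>2) \<le> ennreal (C\<^sup>2) * indicator {0<..<1} u"
        by (cases "u < 1") (use u in \<open>auto simp: indicator_def intro!: ennreal_leI\<close>)
    qed
    show "AE u in pos_measure. (\<lambda>n. ennreal ((cmod (f n u))\<^sup>2)) \<longlonglongrightarrow> 0"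
      using lim
    proof eventually_elim
      fix u assume "(\<lambda>n. f n u) \<longlonglongrightarrow> 0"
      from tendsto_power[OF tendsto_norm_zero[OF this], of 2] have "(\<lambda>n. (cmod (f n u))\<^sup>2) \<longlonglongrightarrow> 0" by simp
      from tendsto_ennrealI[OF this] show "(\<lambda>n. ennreal ((cmod (f n u))\<^sup>2)) \<longlonglongrightarrow> 0" by simp
    qed
  qed simp_all
  thus ?thesis by (simp add: sqn_def)
qed

lemma tame_pos_measurable: "tame f \<Longrightarrow> f \<in> borel_measurable pos_measure"
  by (rule pos_measurable_continuous) (simp add: tame_def)

lemma VE_measurable: "\<phi> \<in> S_le1 \<Longrightarrow> V_op (E_map \<phi>) \<in> borel_measurable pos_measure"
  by (rule tame_pos_measurable[OF tame_V_op_E_map])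

section \<open>Linearity of the range and its closure\<close>

lemma tail_set_integrable:
  assumes "tame f" "u > 0"
  shows "set_integrable lborel {u<..} (\<lambda>v. f v / complex_of_real v)"
proof -
  obtain M where M: "\<And>u. u > 0 \<Longrightarrow> cmod (f u) \<le> M * u powr (- 1/4)" using tameE[OF assms(1)] by blast
  show ?thesis by (rule tail_integrable(1)[OF _ M assms(2)]) (use assms in \<open>simp add: tame_def\<close>)
qed

lemma V_op_add:
  assumes "tame f" "tame g" "u > 0"
  shows "V_op (\<lambda>x. f x + g x) u = V_op f u + V_op g u"
proof -
  have "tail (\<lambda>x. f x + g x) u = tail f u + tail g u"
    unfolding tail_def add_divide_distrib
    by (rule set_integral_add(2)[OF tail_set_integrable[OF assms(1,3)] tail_set_integrable[OF assms(2,3)]])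
  thus ?thesis by (simp add: V_op_eq)
qed

lemma V_op_cmult: "V_op (\<lambda>x. c * f x) u = c * V_op f u"
proof -
  have "tail (\<lambda>x. c * f x) u = c * tail f u"
    unfolding tail_def times_divide_eq_right[symmetric] by (rule set_integral_mult_right)
  thus ?thesis by (simp add: V_op_eq right_diff_distrib)
qed

text \<open>Read off from the finite sum over dilates, where a single \<open>N\<close> serves all
  three functions.\<close>

lemma VE_add:
  assumes \<phi>: "\<phi> \<in> S_le1" and \<psi>: "\<psi> \<in> S_le1" and u: "u > 0"
  shows "V_op (E_map (\<lambda>x. \<phi> x + \<psi> x)) u = V_op (E_map \<phi>) u + V_op (E_map \<psi>) u"
proof -
  obtain N where N: "real N * u \<ge> 1" using ex_nat_mult_ge_1[OF u] by blast
  have "V_op (\<lambda>x. \<phi> x + \<psi> x) (real (Suc n) * u) = V_op \<phi> (real (Suc n) * u) + V_op \<psi> (real (Suc n) * u)" for n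
    using u by (intro V_op_add tame_S_le1 \<phi> \<psi>) simp
  thus ?thesis
    unfolding V_op_E_map[OF S_le1_add[OF \<phi> \<psi>] u N] V_op_E_map[OF \<phi> u N] V_op_E_map[OF \<psi> u N] by (simp only: sum.distrib)
qed

lemma VE_cmult:
  assumes \<phi>: "\<phi> \<in> S_le1" and u: "u > 0"
  shows "V_op (E_map (\<lambda>x. c * \<phi> x)) u = c * V_op (E_map \<phi>) u"
proof -
  obtain N where N: "real N * u \<ge> 1" using ex_nat_mult_ge_1[OF u] by blast
  show ?thesis
    unfolding V_op_E_map[OF S_le1_cmult[OF \<phi>] u N] V_op_E_map[OF \<phi> u N] V_op_cmult sum_distrib_left ..
qed

text \<open>Membership in the closure of the range, measured by the squared distance and detached
  from square integrability; the latter is supplied by \<open>H2\<close> at the end.\<close>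

definition approx :: "(real \<Rightarrow> complex) \<Rightarrow> bool" where
  "approx f \<longleftrightarrow> f \<in> borel_measurable pos_measure \<and> (\<forall>\<eta>>0. \<exists>\<phi>\<in>S_le1. sqn (\<lambda>u. f u - V_op (E_map \<phi>) u) < ennreal \<eta>)"

lemma approx_V:
  assumes "zeta_zero_free" "\<phi> \<in> S_le1"
  shows "approx (V_op \<phi>)"
  unfolding approx_def
proof (intro conjI allI impI)
  show "V_op \<phi> \<in> borel_measurable pos_measure" by (rule tame_pos_measurable[OF tame_V_op[OF tame_S_le1[OF assms(2)]]])
  fix \<eta> :: real assume "\<eta> > 0"
  from V_op_approximation[OF assms this] show "\<exists>\<psi>\<in>S_le1. sqn (\<lambda>u. V_op \<phi> u - V_op (E_map \<psi>) u) < ennreal \<eta>"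
    unfolding sqn_commute[of "V_op \<phi>"] sqn_def .
qed

lemma approx_VE:
  assumes "\<phi> \<in> S_le1"
  shows "approx (V_op (E_map \<phi>))"
  unfolding approx_def
proof (intro conjI allI impI)
  show "V_op (E_map \<phi>) \<in> borel_measurable pos_measure" by (rule VE_measurable[OF assms])
  fix \<eta> :: real assume "\<eta> > 0"
  hence "sqn (\<lambda>u. V_op (E_map \<phi>) u - V_op (E_map \<phi>) u) < ennreal \<eta>" by (simp add: sqn_def)
  thus "\<exists>\<psi>\<in>S_le1. sqn (\<lambda>u. V_op (E_map \<phi>) u - V_op (E_map \<psi>) u) < ennreal \<eta>" using assms by (rule bexI)
qed

lemma approx_limit:
  assumes f: "f \<in> borel_measurable pos_measure" and lim: "\<And>\<eta>. \<eta> > 0 \<Longrightarrow> \<exists>g. approx g \<and> sqn (\<lambda>u. f u - g u) < ennreal \<eta>"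
  shows "approx f"
  unfolding approx_def
proof (intro conjI allI impI f)
  fix \<eta> :: real assume e: "\<eta> > 0"
  hence e8: "\<eta> / 8 > 0" by simp
  obtain g where g: "approx g" "sqn (\<lambda>u. f u - g u) < ennreal (\<eta> / 8)" using lim[OF e8] by blast
  obtain \<phi> where \<phi>: "\<phi> \<in> S_le1" "sqn (\<lambda>u. g u - V_op (E_map \<phi>) u) < ennreal (\<eta> / 8)" using g(1) e8 unfolding approx_def by blast
  have gm: "g \<in> borel_measurable pos_measure" using g(1) by (simp add: approx_def)
  have "sqn (\<lambda>u. (f u - g u) + (g u - V_op (E_map \<phi>) u)) < ennreal \<eta>"
    by (rule sqn_add_less[OF borel_measurable_diff[OF f gm] borel_measurable_diff[OF gm VE_measurable[OF \<phi>(1)]] g(2) \<phi>(2) e])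
  thus "\<exists>\<phi>\<in>S_le1. sqn (\<lambda>u. f u - V_op (E_map \<phi>) u) < ennreal \<eta>" using \<phi>(1) by (intro bexI[of _ \<phi>]) simp_all
qed

lemma approx_add:
  assumes f: "approx f" and g: "approx g"
  shows "approx (\<lambda>u. f u + g u)"
  unfolding approx_def
proof (intro conjI allI impI)
  have fm: "f \<in> borel_measurable pos_measure" and gm: "g \<in> borel_measurable pos_measure" using f g by (simp_all add: approx_def)
  show "(\<lambda>u. f u + g u) \<in> borel_measurable pos_measure" by (rule borel_measurable_add[OF fm gm])
  fix \<eta> :: real assume e: "\<eta> > 0"
  hence e8: "\<eta> / 8 > 0" by simp
  obtain \<phi> where \<phi>: "\<phi> \<in> S_le1" "sqn (\<lambda>u. f u - V_op (E_map \<phi>) u) < ennreal (\<eta> / 8)" using f e8 unfolding approx_def by blast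
  obtain \<psi> where \<psi>: "\<psi> \<in> S_le1" "sqn (\<lambda>u. g u - V_op (E_map \<psi>) u) < ennreal (\<eta> / 8)" using g e8 unfolding approx_def by blast
  have "sqn (\<lambda>u. (f u - V_op (E_map \<phi>) u) + (g u - V_op (E_map \<psi>) u)) < ennreal \<eta>"
    by (rule sqn_add_less[OF borel_measurable_diff[OF fm VE_measurable[OF \<phi>(1)]] borel_measurable_diff[OF gm VE_measurable[OF \<psi>(1)]] \<phi>(2) \<psi>(2) e])
  also have "sqn (\<lambda>u. (f u - V_op (E_map \<phi>) u) + (g u - V_op (E_map \<psi>) u)) = sqn (\<lambda>u. f u + g u - V_op (E_map (\<lambda>x. \<phi> x + \<psi> x)) u)"
    by (rule sqn_cong) (simp add: VE_add[OF \<phi>(1) \<psi>(1)])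
  finally show "\<exists>\<phi>\<in>S_le1. sqn (\<lambda>u. f u + g u - V_op (E_map \<phi>) u) < ennreal \<eta>" using S_le1_add[OF \<phi>(1) \<psi>(1)] by blast
qed

lemma approx_cmult:
  assumes f: "approx f"
  shows "approx (\<lambda>u. c * f u)"
  unfolding approx_def
proof (intro conjI allI impI)
  have fm: "f \<in> borel_measurable pos_measure" using f by (simp add: approx_def)
  show "(\<lambda>u. c * f u) \<in> borel_measurable pos_measure" by (rule borel_measurable_times[OF borel_measurable_const fm])
  fix \<eta> :: real assume e: "\<eta> > 0"
  define \<epsilon> where "\<epsilon> = \<eta> / ((cmod c)\<^sup>2 + 1)"
  have p: "(cmod c)\<^sup>2 + 1 > 0" by (simp add: add_nonneg_pos)
  hence \<epsilon>: "\<epsilon> > 0" using e by (simp add: \<epsilon>_def)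
  then obtain \<phi> where \<phi>: "\<phi> \<in> S_le1" "sqn (\<lambda>u. f u - V_op (E_map \<phi>) u) < ennreal \<epsilon>" using f unfolding approx_def by blast
  have "sqn (\<lambda>u. c * f u - V_op (E_map (\<lambda>x. c * \<phi> x)) u) = sqn (\<lambda>u. c * (f u - V_op (E_map \<phi>) u))"
    by (rule sqn_cong) (simp add: VE_cmult[OF \<phi>(1)] right_diff_distrib)
  also have "\<dots> = ennreal ((cmod c)\<^sup>2) * sqn (\<lambda>u. f u - V_op (E_map \<phi>) u)"
    by (rule sqn_cmult[OF borel_measurable_diff[OF fm VE_measurable[OF \<phi>(1)]]])
  also have "\<dots> \<le> ennreal ((cmod c)\<^sup>2) * ennreal \<epsilon>" using \<phi>(2) by (intro mult_left_mono) auto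
  also have "\<dots> = ennreal ((cmod c)\<^sup>2 * \<epsilon>)" using \<epsilon> by (simp add: ennreal_mult)
  also have "(cmod c)\<^sup>2 * \<epsilon> < \<eta>"
  proof -
    have "(cmod c)\<^sup>2 * \<eta> < \<eta> * ((cmod c)\<^sup>2 + 1)" using e by (simp add: distrib_left mult.commute)
    thus ?thesis using p unfolding \<epsilon>_def by (simp add: pos_divide_less_eq)
  qed
  hence "ennreal ((cmod c)\<^sup>2 * \<epsilon>) < ennreal \<eta>" using e by (intro ennreal_lessI) auto
  finally show "\<exists>\<phi>\<in>S_le1. sqn (\<lambda>u. c * f u - V_op (E_map \<phi>) u) < ennreal \<eta>" using S_le1_cmult[OF \<phi>(1)] by blast
qed

text \<open>With \<open>Suc N\<close> terms the induction starts from a single summand.\<close>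

lemma approx_sum:
  assumes "\<And>n. approx (f n)"
  shows "approx (\<lambda>u. \<Sum>n<Suc N. f n u)"
proof (induction N)
  case 0
  show ?case using assms[of 0] by simp
next
  case (Suc N)
  have "approx (\<lambda>u. (\<Sum>n<Suc N. f n u) + f (Suc N) u)" by (rule approx_add[OF Suc assms])
  thus ?case by simp
qed

lemma approx_cong:
  assumes f: "approx f" and eq: "\<And>u. u > 0 \<Longrightarrow> f u = g u"
  shows "approx g"
proof -
  have iff: "f \<in> borel_measurable pos_measure \<longleftrightarrow> g \<in> borel_measurable pos_measure"
    by (rule measurable_cong) (simp add: eq)
  have sq: "sqn (\<lambda>u. f u - h u) = sqn (\<lambda>u. g u - h u)" for h
    by (rule sqn_cong) (simp only: eq)
  have gm: "g \<in> borel_measurable pos_measure"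
    using iff f[unfolded approx_def, THEN conjunct1] by (rule iffD1)
  show ?thesis
    unfolding approx_def sq[symmetric] using gm f[unfolded approx_def, THEN conjunct2] by (rule conjI)
qed

section \<open>Even monomials on the unit interval and their smooth cutoffs\<close>

definition mono01 :: "nat \<Rightarrow> real \<Rightarrow> complex" where
  "mono01 m u = (if u < 1 then of_real (u ^ (2 * m)) else 0)"

lemma mono01_measurable: "mono01 m \<in> borel_measurable pos_measure"
  unfolding mono01_def[abs_def] by (rule pos_measurable_borel) measurable

definition bump_mono :: "nat \<Rightarrow> nat \<Rightarrow> real \<Rightarrow> complex" where
  "bump_mono m j x = of_real (x ^ (2 * m)) * bump (1 / real (Suc j)) x"

lemma bump_mono_S_le1: "bump_mono m j \<in> S_le1"
proof -
  define a where "a = 1 / real (Suc j)"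
  have a: "a > 0" by (simp add: a_def)
  have b: "smooth (bump a)" using smooth_bump[OF a] by (simp add: smooth_def)
  have sm: "smooth (\<lambda>x. of_real (x ^ n) * bump a x)" for n
  proof (induction n)
    case 0
    show ?case using b by simp
  next
    case (Suc n)
    have "(\<lambda>x. complex_of_real (x ^ Suc n) * bump a x) = (\<lambda>x. of_real x * (of_real (x ^ n) * bump a x))" by (auto simp: mult.assoc)
    thus ?case using smooth_mult_id[OF Suc] by (simp only:)
  qed
  show ?thesis
    unfolding bump_mono_def[abs_def] a_def[symmetric]
    by (rule S_le1_I[OF sm]) (simp_all add: bump_def bump_term_def)
qed

lemma bump_mono_value: "\<bar>x\<bar> < 1 \<Longrightarrow> bump_mono m j x = of_real (x ^ (2 * m) * exp (- (1 / real (Suc j)) / (1 - x\<^sup>2)))"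
  by (simp add: bump_mono_def bump_def bump_term_def)

lemma bump_mono_le:
  assumes "\<bar>x\<bar> < 1"
  shows "cmod (bump_mono m j x) \<le> \<bar>x\<bar> ^ (2 * m)"
proof -
  have "exp (- (1 / real (Suc j)) / (1 - x\<^sup>2)) \<le> 1"
    using one_minus_square_pos[OF assms] by (simp add: divide_nonpos_pos)
  hence "\<bar>x\<bar> ^ (2 * m) * exp (- (1 / real (Suc j)) / (1 - x\<^sup>2)) \<le> \<bar>x\<bar> ^ (2 * m) * 1" by (intro mult_left_mono) auto
  moreover have "cmod (bump_mono m j x) = \<bar>x\<bar> ^ (2 * m) * exp (- (1 / real (Suc j)) / (1 - x\<^sup>2))"
    unfolding bump_mono_value[OF assms] norm_of_real abs_mult power_abs abs_exp_cancel ..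
  ultimately show ?thesis by (simp only: mult_1_right)
qed

lemma bump_mono_tendsto:
  assumes "\<bar>x\<bar> < 1"
  shows "(\<lambda>j. bump_mono m j x) \<longlonglongrightarrow> of_real (x ^ (2 * m))"
proof -
  have "(\<lambda>j. 1 / real (Suc j)) \<longlonglongrightarrow> 0" by (rule LIMSEQ_Suc[OF lim_1_over_n])
  from tendsto_divide[OF tendsto_minus[OF this] tendsto_const[of "1 - x\<^sup>2"]] one_minus_square_pos[OF assms]
  have "(\<lambda>j. - (1 / real (Suc j)) / (1 - x\<^sup>2)) \<longlonglongrightarrow> 0" by simp
  from tendsto_exp[OF this] have "(\<lambda>j. exp (- (1 / real (Suc j)) / (1 - x\<^sup>2))) \<longlonglongrightarrow> 1" by (simp only: exp_zero)
  from tendsto_of_real[OF tendsto_mult[OF tendsto_const[of "x ^ (2 * m)"] this]]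
  show ?thesis unfolding bump_mono_value[OF assms] by (simp only: mult_1_right)
qed

lemma integral_odd_power:
  assumes u: "0 < u" "u < 1" and m: "m > 0"
  shows "set_integrable lborel {u<..<1} (\<lambda>v. complex_of_real (v ^ (2 * m - 1)))"
    and "(LINT v:{u<..<1}|lborel. complex_of_real (v ^ (2 * m - 1))) = of_real ((1 - u ^ (2 * m)) / (2 * real m))"
proof -
  have "((\<lambda>v. v ^ (2 * m - 1)) has_integral (1 ^ (2 * m) / (2 * real m) - u ^ (2 * m) / (2 * real m))) {u..1}"
  proof (rule fundamental_theorem_of_calculus)
    fix x :: real
    have "((\<lambda>x. x ^ (2 * m) / (2 * real m)) has_real_derivative x ^ (2 * m - 1)) (at x within {u..1})"
      using m by (auto intro!: derivative_eq_intros)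
    thus "((\<lambda>x. x ^ (2 * m) / (2 * real m)) has_vector_derivative x ^ (2 * m - 1)) (at x within {u..1})"
      by (simp add: has_real_derivative_iff_has_vector_derivative)
  qed (use u in simp)
  hence hi: "((\<lambda>v. v ^ (2 * m - 1)) has_integral (1 - u ^ (2 * m)) / (2 * real m)) {u<..<1}"
    by (simp add: has_integral_Icc_iff_Ioo diff_divide_distrib)
  have nn: "0 \<le> v ^ (2 * m - 1)" if "v \<in> {u<..<1}" for v using that u by simp
  note S = set_lebesgue_of_has_integral[OF _ _ nn hi]
  have si: "set_integrable lborel {u<..<1} (\<lambda>v. v ^ (2 * m - 1))" by (rule S(1)) auto
  show "set_integrable lborel {u<..<1} (\<lambda>v. complex_of_real (v ^ (2 * m - 1)))"
    using integrable_of_real[OF si[unfolded set_integrable_def]] by (simp add: set_integrable_def scaleR_conv_of_real)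
  show "(LINT v:{u<..<1}|lborel. complex_of_real (v ^ (2 * m - 1))) = of_real ((1 - u ^ (2 * m)) / (2 * real m))"
    unfolding set_integral_complex_of_real using S(2) by simp
qed

text \<open>For \<open>m > 0\<close> the integrand is at most \<open>v ^ (2 * m - 1)\<close>, so the
  tails are bounded uniformly in \<open>j\<close> and \<open>u\<close>. For \<open>m = 0\<close> the
  limit would be \<open>- ln u\<close>, which is no polynomial; the constant function needs a
  separate treatment.\<close>

lemma tail_bump_mono:
  assumes u: "0 < u" "u < 1" and m: "m > 0"
  shows "(\<lambda>j. tail (bump_mono m j) u) \<longlonglongrightarrow> of_real ((1 - u ^ (2 * m)) / (2 * real m))"
    and "cmod (tail (bump_mono m j) u) \<le> 1"
proof -
  note I = integral_odd_power[OF u m]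
  have vp: "v ^ (2 * m) / v = v ^ (2 * m - 1)" if "v > 0" for v :: real
    using that m by (simp add: power_diff)
  have le: "norm (indicator {u<..} v *\<^sub>R (bump_mono m j v / complex_of_real v)) \<le> norm (indicator {u<..<1} v *\<^sub>R complex_of_real (v ^ (2 * m - 1)))" for v j
  proof (cases "u < v \<and> v < 1")
    case True
    hence v: "0 < v" "\<bar>v\<bar> < 1" using u by auto
    have "cmod (bump_mono m j v / complex_of_real v) \<le> v ^ (2 * m) / v"
      using bump_mono_le[OF v(2), of m j] v by (simp add: norm_divide divide_right_mono)
    also have "\<dots> = v ^ (2 * m - 1)" by (rule vp[OF v(1)])
    finally show ?thesis using True v by (simp add: norm_power)
  next
    case False
    hence "u < v \<longrightarrow> bump_mono m j v = 0" using S_le1_zero[OF bump_mono_S_le1, of v m j] u by auto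
    thus ?thesis by (auto simp: indicator_def)
  qed
  have ti: "integrable lborel (\<lambda>v. indicator {u<..} v *\<^sub>R (bump_mono m j v / complex_of_real v))" for j
    using tail_set_integrable[OF tame_S_le1[OF bump_mono_S_le1] u(1)] by (simp add: set_integrable_def)
  have Ii: "integrable lborel (\<lambda>v. indicator {u<..<1} v *\<^sub>R complex_of_real (v ^ (2 * m - 1)))" using I(1) by (simp only: set_integrable_def)
  have "(\<lambda>j. \<integral>v. indicator {u<..} v *\<^sub>R (bump_mono m j v / complex_of_real v) \<partial>lborel) \<longlonglongrightarrow>
      (\<integral>v. indicator {u<..<1} v *\<^sub>R complex_of_real (v ^ (2 * m - 1)) \<partial>lborel)"
  proof (rule integral_dominated_convergence[where w = "\<lambda>v. norm (indicator {u<..<1} v *\<^sub>R complex_of_real (v ^ (2 * m - 1)))"])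
    show "AE v in lborel. (\<lambda>j. indicator {u<..} v *\<^sub>R (bump_mono m j v / complex_of_real v)) \<longlonglongrightarrow> indicator {u<..<1} v *\<^sub>R complex_of_real (v ^ (2 * m - 1))"
    proof (rule AE_I2)
      fix v
      show "(\<lambda>j. indicator {u<..} v *\<^sub>R (bump_mono m j v / complex_of_real v)) \<longlonglongrightarrow> indicator {u<..<1} v *\<^sub>R complex_of_real (v ^ (2 * m - 1))"
      proof (cases "u < v \<and> v < 1")
        case True
        hence v: "0 < v" "\<bar>v\<bar> < 1" using u by auto
        have "(\<lambda>j. bump_mono m j v / complex_of_real v) \<longlonglongrightarrow> of_real (v ^ (2 * m)) / of_real v"
          using v by (intro tendsto_divide bump_mono_tendsto tendsto_const) auto
        also have "complex_of_real (v ^ (2 * m)) / of_real v = of_real (v ^ (2 * m - 1))"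
          unfolding vp[OF v(1), symmetric] of_real_divide ..
        finally show ?thesis using True by simp
      next
        case False
        hence "u < v \<longrightarrow> bump_mono m j v = 0" for j using S_le1_zero[OF bump_mono_S_le1, of v m j] u by auto
        hence "indicator {u<..} v *\<^sub>R (bump_mono m j v / complex_of_real v) = 0" for j by (auto simp: indicator_def)
        moreover have "indicator {u<..<1} v *\<^sub>R complex_of_real (v ^ (2 * m - 1)) = 0" using False by (auto simp: indicator_def)
        ultimately show ?thesis by (simp only: tendsto_const)
      qed
    qed
    show "AE v in lborel. norm (indicator {u<..} v *\<^sub>R (bump_mono m j v / complex_of_real v)) \<le> norm (indicator {u<..<1} v *\<^sub>R complex_of_real (v ^ (2 * m - 1)))" for j
      by (rule AE_I2) (rule le)
  qed (use ti Ii in \<open>auto simp only: integrable_norm borel_measurable_integrable\<close>)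
  thus "(\<lambda>j. tail (bump_mono m j) u) \<longlonglongrightarrow> of_real ((1 - u ^ (2 * m)) / (2 * real m))"
    using I(2) by (simp only: tail_def set_lebesgue_integral_def)
  have "cmod (tail (bump_mono m j) u) \<le> (\<integral>v. norm (indicator {u<..<1} v *\<^sub>R complex_of_real (v ^ (2 * m - 1))) \<partial>lborel)"
    unfolding tail_def set_lebesgue_integral_def
    by (rule Bochner_Integration.integral_norm_bound_integral[OF ti integrable_norm[OF Ii]]) (rule le)
  also have "\<dots> = (LINT v:{u<..<1}|lborel. v ^ (2 * m - 1))"
    unfolding set_lebesgue_integral_def using u by (intro Bochner_Integration.integral_cong refl) (auto simp: indicator_def norm_power)
  also have "\<dots> = (1 - u ^ (2 * m)) / (2 * real m)"
    using I(2) unfolding set_integral_complex_of_real of_real_eq_iff .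
  also have "\<dots> \<le> 1"
  proof -
    have "2 * real m \<ge> 1" using m by simp
    moreover have "u ^ (2 * m) \<ge> 0" using u by simp
    ultimately have "1 - u ^ (2 * m) \<le> 1 * (2 * real m)" "2 * real m > 0" by linarith+
    thus ?thesis by (simp only: pos_divide_le_eq)
  qed
  finally show "cmod (tail (bump_mono m j) u) \<le> 1" .
qed

text \<open>The function is the result of \<open>V\<close> on \<open>u ^ (2 * m)\<close> cut off at
  \<open>1\<close>, reached as a limit through the smooth cutoffs.\<close>

lemma approx_mono01_diff:
  assumes rh: zeta_zero_free and m: "m > 0"
  shows "approx (\<lambda>u. mono01 m u - (mono01 0 u - mono01 m u) / (2 * of_nat m))"
proof (rule approx_limit)
  let ?q = "\<lambda>u. mono01 m u - (mono01 0 u - mono01 m u) / (2 * of_nat m)"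
  show qm: "?q \<in> borel_measurable pos_measure"
    using mono01_measurable[of m] mono01_measurable[of 0] by (intro borel_measurable_diff borel_measurable_divide borel_measurable_const)
  have q1: "?q u = of_real (u ^ (2 * m)) - of_real ((1 - u ^ (2 * m)) / (2 * real m))" if "u < 1" for u
    using that by (simp add: mono01_def)
  have t: "tame (V_op (bump_mono m j))" for j by (rule tame_V_op[OF tame_S_le1[OF bump_mono_S_le1]])
  have "(\<lambda>j. sqn (\<lambda>u. ?q u - V_op (bump_mono m j) u)) \<longlonglongrightarrow> 0"
  proof (rule sqn_tendsto_zero[where C = 4])
    show "(\<lambda>u. ?q u - V_op (bump_mono m j) u) \<in> borel_measurable pos_measure" for j
      by (rule borel_measurable_diff[OF qm tame_pos_measurable[OF t]])
    \<comment> \<open>\<open>4 = 2 + 2\<close>: on \<open>(0, 1)\<close> the monomials, the cutoffs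
      and the tails are each at most \<open>1\<close>, and two of them enter on either side.\<close>
    show "cmod (?q u - V_op (bump_mono m j) u) \<le> 4 * indicator {0<..<1} u" if u: "u > 0" for j u
    proof (cases "u < 1")
      case True
      have p: "0 \<le> u ^ (2 * m)" "u ^ (2 * m) \<le> 1" using u True by (auto intro: power_le_one)
      have m1: "2 * real m \<ge> 1" using m by simp
      have d: "0 \<le> (1 - u ^ (2 * m)) / (2 * real m)" using p by simp
      have d1: "(1 - u ^ (2 * m)) / (2 * real m) \<le> 1"
      proof -
        have "1 - u ^ (2 * m) \<le> 1 * (2 * real m)" using p m1 by linarith
        thus ?thesis using m1 by (simp only: pos_divide_le_eq)
      qed
      have "cmod (?q u) \<le> 2"
      proof -
        have "cmod (?q u) \<le> cmod (complex_of_real (u ^ (2 * m))) + cmod (complex_of_real ((1 - u ^ (2 * m)) / (2 * real m)))"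
          unfolding q1[OF True] by (rule norm_triangle_ineq4)
        also have "\<dots> \<le> 1 + 1" unfolding norm_of_real using p d d1 by (intro add_mono) auto
        finally show ?thesis by simp
      qed
      moreover have "cmod (V_op (bump_mono m j) u) \<le> 1 + 1"
      proof -
        have "cmod (bump_mono m j u) \<le> 1" using bump_mono_le[of u m j] u True p by simp
        thus ?thesis unfolding V_op_eq
          using norm_triangle_ineq4[of "bump_mono m j u" "tail (bump_mono m j) u"] tail_bump_mono(2)[OF u True m, of j] by linarith
      qed
      ultimately show ?thesis using norm_triangle_ineq4[of "?q u" "V_op (bump_mono m j) u"] u True by simp
    next
      case False
      thus ?thesis using t[of j] by (simp add: mono01_def tame_def)
    qed
    show "AE u in pos_measure. (\<lambda>j. ?q u - V_op (bump_mono m j) u) \<longlonglongrightarrow> 0"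
    proof (rule AE_I2)
      fix u assume "u \<in> space pos_measure"
      hence u: "u > 0" by simp
      show "(\<lambda>j. ?q u - V_op (bump_mono m j) u) \<longlonglongrightarrow> 0"
      proof (cases "u < 1")
        case True
        have "(\<lambda>j. bump_mono m j u - tail (bump_mono m j) u) \<longlonglongrightarrow> of_real (u ^ (2 * m)) - of_real ((1 - u ^ (2 * m)) / (2 * real m))"
          using u True by (intro tendsto_diff bump_mono_tendsto tail_bump_mono(1) m) auto
        from tendsto_diff[OF tendsto_const[of "?q u"] this] show ?thesis unfolding V_op_eq q1[OF True] by simp
      next
        case False
        hence "V_op (bump_mono m j) u = 0" for j using t[of j] by (simp add: tame_def)
        moreover have "?q u = 0" using False by (simp add: mono01_def)
        ultimately show ?thesis by simp
      qed
    qed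
  qed
  hence lim: "(\<lambda>j. sqn (\<lambda>u. ?q u - V_op (bump_mono m j) u)) \<longlonglongrightarrow> 0" .
  fix \<eta> :: real assume "\<eta> > 0"
  hence "ennreal \<eta> > 0" by simp
  from tendsto_zero_ex_less[OF lim this] obtain j where "sqn (\<lambda>u. ?q u - V_op (bump_mono m j) u) < ennreal \<eta>" .
  moreover have "approx (V_op (bump_mono m j))" by (rule approx_V[OF rh bump_mono_S_le1])
  ultimately show "\<exists>g. approx g \<and> sqn (\<lambda>u. ?q u - g u) < ennreal \<eta>" by blast
qed

section \<open>Density of the even polynomials\<close>

lemma AE_pos_measure: "(AE u in pos_measure. P u) \<longleftrightarrow> (AE u in lborel. 0 < u \<longrightarrow> P u)"
  unfolding pos_measure_def by (subst AE_restrict_space_iff) auto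

lemma sqn_cong_AE: "AE u in pos_measure. f u = g u \<Longrightarrow> sqn f = sqn g"
  unfolding sqn_def by (rule nn_integral_cong_AE) auto

lemma sqn_tendsto_zero_dominated:
  assumes m: "\<And>n. f n \<in> borel_measurable pos_measure" "w \<in> borel_measurable pos_measure"
    and w: "sqn w < \<infinity>"
    and bd: "\<And>n u. cmod (f n u) \<le> cmod (w u)"
    and lim: "\<And>u. (\<lambda>n. f n u) \<longlonglongrightarrow> 0"
  shows "(\<lambda>n. sqn (f n)) \<longlonglongrightarrow> 0"
proof -
  note [measurable] = m
  have "(\<lambda>n. \<integral>\<^sup>+u. ennreal ((cmod (f n u))\<^sup>2) \<partial>pos_measure) \<longlonglongrightarrow> (\<integral>\<^sup>+u. 0 \<partial>pos_measure)"
  proof (rule nn_integral_dominated_convergence[where u = "\<lambda>n u. ennreal ((cmod (f n u))\<^sup>2)" and u' = "\<lambda>_. 0" and w = "\<lambda>u. ennreal ((cmod (w u))\<^sup>2)"])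
    show "(\<integral>\<^sup>+u. ennreal ((cmod (w u))\<^sup>2) \<partial>pos_measure) < \<infinity>" using w by (simp only: sqn_def)
    show "AE u in pos_measure. ennreal ((cmod (f n u))\<^sup>2) \<le> ennreal ((cmod (w u))\<^sup>2)" for n
      by (rule AE_I2) (intro ennreal_leI power_mono bd norm_ge_zero)
    show "AE u in pos_measure. (\<lambda>n. ennreal ((cmod (f n u))\<^sup>2)) \<longlonglongrightarrow> 0"
    proof (rule AE_I2)
      fix u
      from tendsto_power[OF tendsto_norm_zero[OF lim[of u]], of 2] have "(\<lambda>n. (cmod (f n u))\<^sup>2) \<longlonglongrightarrow> 0" by simp
      from tendsto_ennrealI[OF this] show "(\<lambda>n. ennreal ((cmod (f n u))\<^sup>2)) \<longlonglongrightarrow> 0" by simp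
    qed
  qed simp_all
  thus ?thesis by (simp add: sqn_def)
qed

lemma continuous_poly_approx:
  fixes h :: "real \<Rightarrow> complex"
  assumes h: "continuous_on {0..1} h" and e: "e > 0"
  shows "\<exists>p. \<forall>v\<in>{0..1}. cmod (h v - poly p (of_real v)) < e"
proof -
  have R: "\<exists>p :: complex poly. \<forall>v\<in>{0..1}. cmod (of_real (k v) - poly p (of_real v)) < e / 2" if k: "continuous_on {0..1} k" for k :: "real \<Rightarrow> real"
  proof -
    have e2: "e / 2 > 0" using e by simp
    obtain q where q: "real_polynomial_function q" "\<And>v. v \<in> {0..1} \<Longrightarrow> \<bar>k v - q v\<bar> < e / 2"
      using Stone_Weierstrass_real_polynomial_function[OF compact_Icc k e2] by blast
    obtain a n where a: "q = (\<lambda>x. \<Sum>i\<le>n. a i * x ^ i)" using real_polynomial_function_imp_sum[OF q(1)] by blast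
    define p where "p = (\<Sum>i\<le>n. monom (complex_of_real (a i)) i)"
    have "poly p (of_real v) = of_real (q v)" for v
      by (simp add: p_def a poly_sum poly_monom)
    hence "cmod (of_real (k v) - poly p (of_real v)) = \<bar>k v - q v\<bar>" for v
      by (simp add: of_real_diff[symmetric] del: of_real_diff)
    thus ?thesis using q(2) by metis
  qed
  obtain p where p: "\<And>v. v \<in> {0..1} \<Longrightarrow> cmod (of_real (Re (h v)) - poly p (of_real v)) < e / 2"
    using R[OF continuous_on_Re[OF h]] by blast
  obtain q where q: "\<And>v. v \<in> {0..1} \<Longrightarrow> cmod (of_real (Im (h v)) - poly q (of_real v)) < e / 2"
    using R[OF continuous_on_Im[OF h]] by blast
  have "cmod (h v - poly (p + smult \<i> q) (of_real v)) < e" if v: "v \<in> {0..1}" for v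
  proof -
    have "h v - poly (p + smult \<i> q) (of_real v) = (of_real (Re (h v)) - poly p (of_real v)) + \<i> * (of_real (Im (h v)) - poly q (of_real v))"
      by (rule complex_eqI) (simp_all add: algebra_simps)
    also have "cmod \<dots> \<le> cmod (of_real (Re (h v)) - poly p (of_real v)) + cmod (\<i> * (of_real (Im (h v)) - poly q (of_real v)))"
      by (rule norm_triangle_ineq)
    finally have "cmod (h v - poly (p + smult \<i> q) (of_real v)) \<le> cmod (of_real (Re (h v)) - poly p (of_real v)) + cmod (of_real (Im (h v)) - poly q (of_real v))"
      by (simp only: norm_mult norm_ii mult_1_left)
    thus ?thesis using p[OF v] q[OF v] by linarith
  qed
  thus ?thesis by blast
qed

definition cut01 :: "(real \<Rightarrow> complex) \<Rightarrow> real \<Rightarrow> complex" where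
  "cut01 g u = (if u < 1 then g u else 0)"

lemma cut01_measurable: "g \<in> borel_measurable borel \<Longrightarrow> cut01 g \<in> borel_measurable borel"
  unfolding cut01_def[abs_def] by (rule measurable_If) simp_all

text \<open>Weierstrass approximation of \<open>g (sqrt v)\<close> on \<open>[0, 1]\<close>,
  followed by \<open>v = u\<^sup>2\<close>, produces even powers only. As the interval has length
  \<open>1\<close>, a uniform error \<open>sqrt (\<eta> / 2)\<close> gives a squared norm of at most
  \<open>\<eta> / 2\<close>.\<close>

lemma mono01_dense_continuous:
  assumes g: "continuous_on UNIV g" and \<eta>: "\<eta> > 0"
  shows "\<exists>c N. sqn (\<lambda>u. cut01 g u - (\<Sum>n<Suc N. c n * mono01 n u)) < ennreal \<eta>"
proof -
  have "continuous_on {0..1} (\<lambda>v. g (sqrt v))"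
    by (rule continuous_on_compose2[OF g]) (auto intro!: continuous_intros)
  moreover have "sqrt (\<eta> / 2) > 0" using \<eta> by simp
  ultimately obtain p where p: "\<And>v. v \<in> {0..1} \<Longrightarrow> cmod (g (sqrt v) - poly p (of_real v)) < sqrt (\<eta> / 2)"
    using continuous_poly_approx[of "\<lambda>v. g (sqrt v)" "sqrt (\<eta> / 2)"] by blast
  have P: "(\<Sum>n<Suc (degree p). coeff p n * mono01 n u) = (if u < 1 then poly p (of_real (u\<^sup>2)) else 0)" for u
    by (simp add: mono01_def poly_altdef power_mult lessThan_Suc_atMost del: sum.lessThan_Suc)
  have pt: "(cmod (cut01 g u - (\<Sum>n<Suc (degree p). coeff p n * mono01 n u)))\<^sup>2 \<le> \<eta> / 2 * indicator {0<..<1} u" if u: "u > 0" for u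
  proof (cases "u < 1")
    case True
    hence "u\<^sup>2 \<in> {0..1}" using u by (simp add: power_le_one)
    from p[OF this] have "cmod (g u - poly p (of_real (u\<^sup>2))) \<le> sqrt (\<eta> / 2)" using u by simp
    hence "(cmod (g u - poly p (of_real (u\<^sup>2))))\<^sup>2 \<le> (sqrt (\<eta> / 2))\<^sup>2" by (intro power_mono) auto
    thus ?thesis unfolding P cut01_def using True u \<eta> by simp
  qed (simp only: P cut01_def, simp)
  have "sqn (\<lambda>u. cut01 g u - (\<Sum>n<Suc (degree p). coeff p n * mono01 n u)) \<le> (\<integral>\<^sup>+u. ennreal (\<eta> / 2) * indicator {0<..<1} u \<partial>pos_measure)"
    unfolding sqn_def
  proof (rule nn_integral_mono)
    fix u assume "u \<in> space pos_measure"
    hence "ennreal ((cmod (cut01 g u - (\<Sum>n<Suc (degree p). coeff p n * mono01 n u)))\<^sup>2) \<le> ennreal (\<eta> / 2 * indicator {0<..<1} u)"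
      by (intro ennreal_leI pt) simp
    also have "\<dots> = ennreal (\<eta> / 2) * indicator {0<..<1} u" by (simp add: indicator_def)
    finally show "ennreal ((cmod (cut01 g u - (\<Sum>n<Suc (degree p). coeff p n * mono01 n u)))\<^sup>2) \<le> ennreal (\<eta> / 2) * indicator {0<..<1} u" .
  qed
  also have "\<dots> = ennreal (\<eta> / 2)" by (rule nn_integral_indicator_01)
  also have "\<dots> < ennreal \<eta>" using \<eta> by (intro ennreal_lessI) auto
  finally show ?thesis by blast
qed

text \<open>A Borel function is an almost everywhere limit of continuous functions, but these need
  not be uniformly bounded. Composition with \<open>cl\<close>, the radial retraction onto a disc
  that contains the values of \<open>b\<close>, keeps them continuous and supplies the majorant;
  \<open>B + 1\<close> makes the radius positive.\<close>

lemma cut01_approx_continuous: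
  assumes b: "b \<in> borel_measurable borel" and B: "\<And>u. cmod (b u) \<le> B" and \<eta>: "\<eta> > 0"
  shows "\<exists>g. continuous_on UNIV g \<and> sqn (\<lambda>u. cut01 b u - cut01 g u) < ennreal \<eta>"
proof -
  define B' where "B' = B + 1"
  have B': "B' > 0" "cmod (b u) \<le> B'" for u using B[of u] norm_ge_zero[of "b u"] unfolding B'_def by linarith+
  define cl :: "complex \<Rightarrow> complex" where "cl z = of_real (B' / max B' (cmod z)) * z" for z
  have mp: "max B' (cmod z) > 0" for z using B' by (simp add: less_max_iff_disj)
  have clc: "continuous_on UNIV cl" unfolding cl_def
    by (intro continuous_intros) (use mp in \<open>auto simp: less_le\<close>)
  have clb: "cmod (cl z) \<le> B'" for z
  proof -
    have "cmod (cl z) = B' * cmod z / max B' (cmod z)" using B'(1) mp[of z] by (simp add: cl_def norm_mult norm_divide del: of_real_divide)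
    also have "\<dots> \<le> B'" using B' mp[of z] by (simp add: pos_divide_le_eq)
    finally show ?thesis .
  qed
  have cl1: "cl (b u) = b u" for u
    using B'(1) B'(2)[of u] by (simp add: cl_def max_absorb1)
  have "b \<in> borel_measurable lebesgue" using b by (simp add: measurable_completion)
  from lebesgue_measurable_imp_measurable_on[OF this, of UNIV]
  obtain N g where N: "negligible N" and g: "\<And>n. continuous_on UNIV (g n)" and lim: "\<And>x. x \<notin> N \<Longrightarrow> (\<lambda>n. g n x) \<longlonglongrightarrow> b x"
    unfolding measurable_on_def by auto
  define G where "G n u = cl (g n u)" for n u
  have Gc: "continuous_on UNIV (G n)" for n unfolding G_def
    by (rule continuous_on_compose2[OF clc g]) simp
  have "(\<lambda>n. sqn (\<lambda>u. cut01 b u - cut01 (G n) u)) \<longlonglongrightarrow> 0"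
  proof (rule sqn_tendsto_zero[where C = "2 * B'"])
    show "(\<lambda>u. cut01 b u - cut01 (G n) u) \<in> borel_measurable pos_measure" for n
      by (intro pos_measurable_borel borel_measurable_diff cut01_measurable b borel_measurable_continuous_onI Gc)
    show "cmod (cut01 b u - cut01 (G n) u) \<le> 2 * B' * indicator {0<..<1} u" if "u > 0" for n u
      using norm_triangle_ineq4[of "b u" "G n u"] B'(2)[of u] clb[of "g n u"] that
      by (auto simp: cut01_def indicator_def G_def)
    have "N \<in> null_sets lebesgue" using N by (simp add: negligible_iff_null_sets)
    hence "AE u in lebesgue. u \<notin> N" by (rule AE_not_in)
    hence "AE u in lborel. u \<notin> N" by (simp only: AE_completion_iff)
    thus "AE u in pos_measure. (\<lambda>n. cut01 b u - cut01 (G n) u) \<longlonglongrightarrow> 0"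
      unfolding AE_pos_measure
    proof eventually_elim
      fix u :: real assume "u \<notin> N"
      from lim[OF this] have "(\<lambda>n. cl (g n u)) \<longlonglongrightarrow> cl (b u)"
        using clc by (intro continuous_on_tendsto_compose[where f = cl and s = UNIV]) auto
      hence "(\<lambda>n. G n u) \<longlonglongrightarrow> b u" by (simp only: G_def cl1)
      from tendsto_diff[OF tendsto_const[of "b u"] this]
      show "0 < u \<longrightarrow> (\<lambda>n. cut01 b u - cut01 (G n) u) \<longlonglongrightarrow> 0" by (simp add: cut01_def)
    qed
  qed
  moreover have "ennreal \<eta> > 0" using \<eta> by simp
  ultimately obtain n where "sqn (\<lambda>u. cut01 b u - cut01 (G n) u) < ennreal \<eta>" by (rule tendsto_zero_ex_less)
  thus ?thesis using Gc by blast
qed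

text \<open>Three reductions: to bounded functions by truncating the values, then to continuous
  ones, then to even polynomials. The nested tolerances come from two uses of
  \<open>sqn_add_less\<close>.\<close>

lemma mono01_dense:
  assumes f: "f \<in> borel_measurable pos_measure" and fin: "sqn f < \<infinity>"
    and z: "AE u in pos_measure. 1 < u \<longrightarrow> f u = 0" and \<eta>: "\<eta> > 0"
  shows "\<exists>c N. sqn (\<lambda>u. f u - (\<Sum>n<Suc N. c n * mono01 n u)) < ennreal \<eta>"
proof -
  define F where "F u = indicator {0<..} u *\<^sub>R f u" for u
  have Fm [measurable]: "F \<in> borel_measurable borel"
    using f unfolding pos_measure_def F_def[abs_def] by (subst (asm) borel_measurable_restrict_space_iff) simp_all
  define b where "b n u = (if cmod (F u) \<le> real n then F u else 0)" for n u
  have bm [measurable]: "b n \<in> borel_measurable borel" for n unfolding b_def[abs_def] by measurable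
  have bB: "cmod (b n u) \<le> real n" for n u by (simp add: b_def)
  have "AE u in lborel. u \<noteq> 1" by (rule AE_lborel_singleton)
  hence fF: "AE u in pos_measure. f u = cut01 F u"
    using z unfolding AE_pos_measure by eventually_elim (auto simp: cut01_def F_def)
  have Fc: "cut01 F \<in> borel_measurable pos_measure" by (intro pos_measurable_borel cut01_measurable Fm)
  have cbm: "cut01 (b n) \<in> borel_measurable pos_measure" for n by (intro pos_measurable_borel cut01_measurable bm)
  have "(\<lambda>n. sqn (\<lambda>u. cut01 F u - cut01 (b n) u)) \<longlonglongrightarrow> 0"
  proof (rule sqn_tendsto_zero_dominated[where w = "cut01 F"])
    show "sqn (cut01 F) < \<infinity>" using fin sqn_cong_AE[OF fF] by simp
    show "cmod (cut01 F u - cut01 (b n) u) \<le> cmod (cut01 F u)" for n u by (simp add: cut01_def b_def)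
    show "(\<lambda>n. cut01 F u - cut01 (b n) u) \<longlonglongrightarrow> 0" for u
    proof (rule tendsto_eventually)
      have "eventually (\<lambda>n. cmod (F u) \<le> real n) sequentially" by real_asymp
      thus "eventually (\<lambda>n. cut01 F u - cut01 (b n) u = 0) sequentially"
        by eventually_elim (simp add: cut01_def b_def)
    qed
  qed (intro borel_measurable_diff Fc cbm)+
  moreover have \<eta>8: "\<eta> / 8 > 0" "\<eta> / 8 / 8 > 0" using \<eta> by simp_all
  hence "ennreal (\<eta> / 8) > 0" by simp
  ultimately obtain k where k: "sqn (\<lambda>u. cut01 F u - cut01 (b k) u) < ennreal (\<eta> / 8)" by (rule tendsto_zero_ex_less)
  obtain g where g: "continuous_on UNIV g" "sqn (\<lambda>u. cut01 (b k) u - cut01 g u) < ennreal (\<eta> / 8 / 8)"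
    using cut01_approx_continuous[OF bm bB \<eta>8(2)] by blast
  obtain c N where c: "sqn (\<lambda>u. cut01 g u - (\<Sum>n<Suc N. c n * mono01 n u)) < ennreal (\<eta> / 8 / 8)"
    using mono01_dense_continuous[OF g(1) \<eta>8(2)] by blast
  have gm: "cut01 g \<in> borel_measurable pos_measure"
    by (intro pos_measurable_borel cut01_measurable borel_measurable_continuous_onI g)
  have Pm: "(\<lambda>u. \<Sum>n<Suc N. c n * mono01 n u) \<in> borel_measurable pos_measure"
    by (intro borel_measurable_sum borel_measurable_times borel_measurable_const mono01_measurable)
  have "sqn (\<lambda>u. (cut01 (b k) u - cut01 g u) + (cut01 g u - (\<Sum>n<Suc N. c n * mono01 n u))) < ennreal (\<eta> / 8)"
    by (rule sqn_add_less[OF borel_measurable_diff[OF cbm gm] borel_measurable_diff[OF gm Pm] g(2) c \<eta>8(1)])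
  hence "sqn (\<lambda>u. cut01 (b k) u - (\<Sum>n<Suc N. c n * mono01 n u)) < ennreal (\<eta> / 8)" by (simp only: diff_add_cancel add_diff_eq)
  from sqn_add_less[OF borel_measurable_diff[OF Fc cbm] borel_measurable_diff[OF cbm Pm] k this \<eta>]
  have "sqn (\<lambda>u. cut01 F u - (\<Sum>n<Suc N. c n * mono01 n u)) < ennreal \<eta>" by (simp only: diff_add_cancel add_diff_eq)
  moreover have "sqn (\<lambda>u. f u - (\<Sum>n<Suc N. c n * mono01 n u)) = sqn (\<lambda>u. cut01 F u - (\<Sum>n<Suc N. c n * mono01 n u))"
    by (rule sqn_cong_AE) (use fF in eventually_elim, simp only:)
  ultimately have "sqn (\<lambda>u. f u - (\<Sum>n<Suc N. c n * mono01 n u)) < ennreal \<eta>" by (simp only:)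
  thus ?thesis by blast
qed

text \<open>Cauchy-Schwarz on \<open>(0, 1)\<close>, which has measure \<open>1\<close>. It makes
  the mean continuous with respect to the distance.\<close>

lemma integral_sq_le_sqn:
  assumes i: "set_integrable lborel {0<..} h" and m: "h \<in> borel_measurable pos_measure" and z: "\<And>u. u \<ge> 1 \<Longrightarrow> h u = 0"
  shows "ennreal ((cmod (LINT u:{0<..}|lborel. h u))\<^sup>2) \<le> sqn h"
proof -
  note [measurable] = m
  have im [measurable]: "indicator {0<..<1::real} \<in> borel_measurable pos_measure"
    unfolding pos_measure_def by (rule measurable_restrict_space1) simp
  have "ennreal (cmod (LINT u:{0<..}|lborel. h u)) \<le> (\<integral>\<^sup>+u. ennreal (norm (indicator {0<..} u *\<^sub>R h u)) \<partial>lborel)"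
    using integral_norm_bound_ennreal[OF i[unfolded set_integrable_def]] by (simp only: set_lebesgue_integral_def)
  also have "\<dots> = (\<integral>\<^sup>+u. ennreal (cmod (h u)) * indicator {0<..<1} u \<partial>pos_measure)"
    unfolding nn_integral_pos_measure
    by (rule nn_integral_cong) (auto simp: indicator_def z not_less)
  finally have "(ennreal (cmod (LINT u:{0<..}|lborel. h u)))\<^sup>2 \<le> (\<integral>\<^sup>+u. ennreal (cmod (h u)) * indicator {0<..<1} u \<partial>pos_measure)\<^sup>2"
    by (rule power_mono) simp
  also have "\<dots> \<le> (\<integral>\<^sup>+u. (ennreal (cmod (h u)))\<^sup>2 \<partial>pos_measure) * (\<integral>\<^sup>+u. (indicator {0<..<1} u)\<^sup>2 \<partial>pos_measure)"
    by (rule Cauchy_Schwarz_nn_integral) measurable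
  also have "(\<integral>\<^sup>+u. (indicator {0<..<1} u)\<^sup>2 \<partial>pos_measure) = (\<integral>\<^sup>+u. ennreal 1 * indicator {0<..<1} u \<partial>pos_measure)"
    by (rule nn_integral_cong) (simp add: indicator_def)
  also have "\<dots> = 1" unfolding nn_integral_indicator_01 by simp
  finally show ?thesis by (simp add: sqn_def ennreal_power)
qed

section \<open>Means and the constant function\<close>

lemma mono01_integral:
  "set_integrable lborel {0<..} (mono01 m)" "(LINT u:{0<..}|lborel. mono01 m u) = 1 / (2 * of_nat m + 1)"
proof -
  have "((\<lambda>v. v ^ (2 * m)) has_integral (1 ^ Suc (2 * m) / (2 * real m + 1) - 0 ^ Suc (2 * m) / (2 * real m + 1))) {0..1}"
  proof (rule fundamental_theorem_of_calculus)
    fix x :: real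
    have "((\<lambda>x. x ^ Suc (2 * m) / (2 * real m + 1)) has_real_derivative (real (Suc (2 * m)) * x ^ (2 * m)) / (2 * real m + 1)) (at x within {0..1})"
      by (rule DERIV_cdivide) (use DERIV_pow[of "Suc (2 * m)" x "{0..1}"] in \<open>simp del: power_Suc of_nat_Suc\<close>)
    also have "(real (Suc (2 * m)) * x ^ (2 * m)) / (2 * real m + 1) = x ^ (2 * m)" by (simp add: field_simps)
    finally show "((\<lambda>x. x ^ Suc (2 * m) / (2 * real m + 1)) has_vector_derivative x ^ (2 * m)) (at x within {0..1})"
      by (simp only: has_real_derivative_iff_has_vector_derivative)
  qed simp
  hence hi: "((\<lambda>v. v ^ (2 * m)) has_integral 1 / (2 * real m + 1)) {0<..<1}"
    by (simp add: has_integral_Icc_iff_Ioo)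
  have nn: "0 \<le> v ^ (2 * m)" if "v \<in> {0<..<1}" for v :: real using that by simp
  note S = set_lebesgue_of_has_integral[OF _ _ nn hi]
  have si: "set_integrable lborel {0<..<1} (\<lambda>v::real. v ^ (2 * m))" by (rule S(1)) auto
  have eq: "indicator {0<..} u *\<^sub>R mono01 m u = complex_of_real (indicator {0<..<1} u *\<^sub>R u ^ (2 * m))" for u
    by (auto simp: mono01_def indicator_def)
  show "set_integrable lborel {0<..} (mono01 m)"
    using integrable_of_real[OF si[unfolded set_integrable_def]] unfolding set_integrable_def eq .
  have "(LINT u:{0<..}|lborel. mono01 m u) = of_real (LINT u:{0<..<1}|lborel. u ^ (2 * m))"
    unfolding set_lebesgue_integral_def eq by (rule integral_complex_of_real)
  also have "(LINT u:{0<..<1}|lborel. u ^ (2 * m)) = 1 / (2 * real m + 1)" by (rule S(2)) auto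
  finally show "(LINT u:{0<..}|lborel. mono01 m u) = 1 / (2 * of_nat m + 1)" by simp
qed

lemma mono01_sum_integral:
  "set_integrable lborel {0<..} (\<lambda>u. \<Sum>n<k. c n * mono01 n u) \<and>
   (LINT u:{0<..}|lborel. (\<Sum>n<k. c n * mono01 n u)) = (\<Sum>n<k. c n * (1 / (2 * of_nat n + 1)))"
proof (induction k)
  case 0
  show ?case by (simp add: set_integrable_def set_lebesgue_integral_def)
next
  case (Suc k)
  have i: "set_integrable lborel {0<..} (\<lambda>u. c k * mono01 k u)"
    by (rule set_integrable_mult_right) (rule mono01_integral)
  have "(LINT u:{0<..}|lborel. c k * mono01 k u) = c k * (1 / (2 * of_nat k + 1))"
    by (simp only: set_integral_mult_right mono01_integral(2))
  thus ?case using set_integral_add[OF conjunct1[OF Suc] i] conjunct2[OF Suc] by simp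
qed

lemma mellin_at_1: "mellin f 1 = (LINT u:{0<..}|lborel. f u)"
  unfolding mellin_def set_lebesgue_integral_def
  by (intro Bochner_Integration.integral_cong refl) (auto simp: indicator_def)

text \<open>The function is continuous and nonnegative on the interval, and its value at
  \<open>0\<close> is \<open>exp (- 1)\<close>.\<close>

lemma bump_mono_integral_neq_0: "(LINT x:{0<..}|lborel. bump_mono 0 0 x) \<noteq> 0"
proof
  note S = bump_mono_S_le1[of 0 0]
  have c: "continuous_on {0..1} (bump_mono 0 0)"
    using S_le1_continuous[OF S] continuous_on_subset by blast
  assume "(LINT x:{0<..}|lborel. bump_mono 0 0 x) = 0"
  hence "integral {0..1} (bump_mono 0 0) = 0" using integral_S_le1[OF S, of 1] by simp
  hence "integral {0..1} (\<lambda>x. Re (bump_mono 0 0 x)) = 0"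
    using integral_linear[OF integrable_continuous_real[OF c] bounded_linear_Re] by (simp add: o_def)
  moreover have "Re (bump_mono 0 0 x) \<ge> 0" if "x \<in> {0..1}" for x
    using bump_mono_value[of x 0 0] S_le1_zero[OF S, of 1] that by (cases "x = 1") auto
  ultimately have "\<forall>x\<in>{0..1}. Re (bump_mono 0 0 x) = 0"
    using integral_eq_0_iff[of 0 1 "\<lambda>x. Re (bump_mono 0 0 x)"] continuous_on_Re[OF c] by simp
  moreover have "Re (bump_mono 0 0 0) = exp (- 1)" using bump_mono_value[of 0 0 0] by simp
  ultimately show False by simp
qed

lemma sqn_mono01_0: "sqn (mono01 0) = 1"
proof -
  have "sqn (mono01 0) = (\<integral>\<^sup>+u. ennreal 1 * indicator {0<..<1} u \<partial>pos_measure)"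
    unfolding sqn_def by (rule nn_integral_cong) (auto simp: mono01_def indicator_def)
  thus ?thesis unfolding nn_integral_indicator_01 by simp
qed

text \<open>The value \<open>0\<close> at \<open>m = 0\<close> lets sums start at index
  \<open>0\<close> and makes the decomposition in \<open>mono01_eq\<close> hold for every
  \<open>m\<close>.\<close>

definition mono01_diff :: "nat \<Rightarrow> real \<Rightarrow> complex" where
  "mono01_diff m u = (if m = 0 then 0 else mono01 m u - (mono01 0 u - mono01 m u) / (2 * of_nat m))"

lemma of_nat_odd_neq_0: "2 * of_nat m + 1 \<noteq> (0 :: complex)"
proof -
  have "of_nat (2 * m + 1) \<noteq> (0 :: complex)" unfolding of_nat_eq_0_iff by simp
  thus ?thesis by (simp add: add.commute)
qed

text \<open>The coefficient of \<open>mono01 0\<close> is the mean of the monomial, so the other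
  summand is its mean-zero part.\<close>

lemma mono01_eq: "mono01 m u = 2 * of_nat m / (2 * of_nat m + 1) * mono01_diff m u + 1 / (2 * of_nat m + 1) * mono01 0 u"
proof (cases "m = 0")
  case False
  hence "of_nat m \<noteq> (0 :: complex)" by simp
  thus ?thesis using False of_nat_odd_neq_0[of m] unfolding mono01_diff_def
    by (simp add: divide_simps) (simp add: algebra_simps)
qed (simp add: mono01_diff_def)

lemma approx_mono01_diff':
  assumes rh: zeta_zero_free
  shows "approx (mono01_diff m)"
proof (cases "m = 0")
  case True
  have "approx (\<lambda>u. 0 * V_op (E_map (bump_mono 0 0)) u)" by (rule approx_cmult[OF approx_VE[OF bump_mono_S_le1]])
  thus ?thesis by (rule approx_cong) (simp add: True mono01_diff_def)
next
  case False
  hence "m > 0" by simp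
  from approx_mono01_diff[OF rh this] show ?thesis by (rule approx_cong) (simp add: False mono01_diff_def)
qed

text \<open>
  Since the functions \<open>mono01_diff m\<close> only span the functions of mean zero, an element of the
  range with nonzero mean is needed to reach the constants.
\<close>

lemma approx_mono01_0:
  assumes rh: zeta_zero_free
  shows "approx (mono01 0)"
proof -
  define e where "e = V_op (E_map (bump_mono 0 0))"
  define \<kappa> where "\<kappa> = (LINT u:{0<..}|lborel. e u)"
  have te: "tame e" unfolding e_def by (rule tame_V_op_E_map[OF bump_mono_S_le1])
  have em: "e \<in> borel_measurable pos_measure" by (rule tame_pos_measurable[OF te])
  \<comment> \<open>At \<open>s = 1\<close> the pole of zeta cancels the zero of the factor
    \<open>s - 1\<close>: \<open>zeta_reg 1 = 1\<close>, and the mean of \<open>e\<close> is the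
    integral of the bump.\<close>
  have "\<kappa> = mellin (bump_mono 0 0) 1"
    unfolding \<kappa>_def mellin_at_1[symmetric] e_def using mellin_V_op_E_map[OF bump_mono_S_le1, of 1 0 0] by simp
  hence \<kappa>0: "\<kappa> \<noteq> 0" using bump_mono_integral_neq_0 unfolding mellin_at_1 by (rule ssubst)
  have "set_integrable lborel {0<..} (\<lambda>u. e u * of_real u powr (1 - 1))" by (rule tame_integrable[OF te]) simp
  moreover have "indicator {0<..} u *\<^sub>R (e u * of_real u powr (1 - 1)) = indicator {0<..} u *\<^sub>R e u" for u
    by (auto simp: indicator_def)
  ultimately have ei: "set_integrable lborel {0<..} e" unfolding set_integrable_def by (simp only:)
  have fin: "sqn e < \<infinity>"
  proof -
    obtain M where M: "M \<ge> 0" "\<And>u. u > 0 \<Longrightarrow> cmod (e u) \<le> M * u powr (- 1/4)" using tameE[OF te] by blast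
    have "set_integrable lborel {0<..<1} (\<lambda>u. M\<^sup>2 * u powr (- 1/2))" by (intro set_integrable_mult_right powr_set_integrable_01) simp
    hence "integrable lborel (\<lambda>u. indicator {0<..<1} u *\<^sub>R (M\<^sup>2 * u powr (- 1/2)))" by (simp only: set_integrable_def)
    hence f: "(\<integral>\<^sup>+u. ennreal (norm (indicator {0<..<1} u *\<^sub>R (M\<^sup>2 * u powr (- 1/2)))) \<partial>lborel) < \<infinity>" by (simp only: integrable_iff_bounded)
    have "sqn e \<le> (\<integral>\<^sup>+u. ennreal (norm (indicator {0<..<1} u *\<^sub>R (M\<^sup>2 * u powr (- 1/2)))) \<partial>lborel)"
      unfolding sqn_def nn_integral_pos_measure
    proof (rule nn_integral_mono)
      fix u :: real
      show "ennreal ((cmod (e u))\<^sup>2) * indicator {0<..} u \<le> ennreal (norm (indicator {0<..<1} u *\<^sub>R (M\<^sup>2 * u powr (- 1/2))))"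
      proof (cases "0 < u \<and> u < 1")
        case True
        have "(cmod (e u))\<^sup>2 \<le> (M * u powr (- 1/4))\<^sup>2" using M(2)[of u] True by (intro power_mono) auto
        also have "\<dots> = M\<^sup>2 * u powr (- 1/2)" using powr_add[of u "- 1/4" "- 1/4"] by (simp add: power_mult_distrib power2_eq_square)
        finally show ?thesis using True by (simp add: ennreal_leI)
      next
        case False
        moreover have "e u = 0" if "u \<ge> 1" using te that by (simp add: tame_def)
        ultimately have "0 < u \<longrightarrow> e u = 0" by (auto simp: not_less)
        thus ?thesis by (auto simp: indicator_def)
      qed
    qed
    thus ?thesis using f by (rule le_less_trans)
  qed
  have ez: "AE u in pos_measure. 1 < u \<longrightarrow> e u = 0" using te by (intro AE_I2) (simp add: tame_def)
  have "approx (\<lambda>u. \<kappa> * mono01 0 u)"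
  proof (rule approx_limit)
    show "(\<lambda>u. \<kappa> * mono01 0 u) \<in> borel_measurable pos_measure"
      by (intro borel_measurable_times borel_measurable_const mono01_measurable)
    fix \<eta> :: real assume \<eta>: "\<eta> > 0"
    hence \<eta>8: "\<eta> / 8 > 0" by simp
    obtain c N where c: "sqn (\<lambda>u. e u - (\<Sum>n<Suc N. c n * mono01 n u)) < ennreal (\<eta> / 8)"
      using mono01_dense[OF em fin ez \<eta>8] by blast
    \<comment> \<open>\<open>P\<close> approximates \<open>e\<close>, so its mean \<open>J\<close>
      is close to \<open>\<kappa>\<close>. Since \<open>P\<close> is \<open>r\<close> plus
      \<open>J\<close> times the constant, \<open>e - r\<close> is close to \<open>\<kappa>\<close>
      times the constant, and both \<open>e\<close> and \<open>r\<close> are already in the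
      closure.\<close>
    define P where "P u = (\<Sum>n<Suc N. c n * mono01 n u)" for u
    define J where "J = (\<Sum>n<Suc N. c n * (1 / (2 * of_nat n + 1)))"
    define r where "r u = (\<Sum>n<Suc N. (c n * (2 * of_nat n / (2 * of_nat n + 1))) * mono01_diff n u)" for u
    have r: "approx r" unfolding r_def by (intro approx_sum approx_cmult approx_mono01_diff' rh)
    have Pr: "P u = r u + J * mono01 0 u" for u
    proof -
      have "c n * mono01 n u = (c n * (2 * of_nat n / (2 * of_nat n + 1))) * mono01_diff n u + (c n * (1 / (2 * of_nat n + 1))) * mono01 0 u" for n
        by (subst mono01_eq) (simp only: distrib_left mult.assoc)
      thus ?thesis unfolding P_def r_def J_def sum_distrib_right by (simp only: sum.distrib)
    qed
    have Pm: "P \<in> borel_measurable pos_measure" unfolding P_def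
      by (intro borel_measurable_sum borel_measurable_times borel_measurable_const mono01_measurable)
    have Pi: "set_integrable lborel {0<..} P" "(LINT u:{0<..}|lborel. P u) = J"
      using mono01_sum_integral[where c = c and k = "Suc N"] unfolding P_def J_def by blast+
    have cP: "sqn (\<lambda>u. e u - P u) < ennreal (\<eta> / 8)" using c by (simp only: P_def)
    have z: "e u - P u = 0" if "u \<ge> 1" for u
    proof -
      have "P u = 0" unfolding P_def by (rule sum.neutral) (use that in \<open>simp add: mono01_def\<close>)
      thus ?thesis using te that by (simp add: tame_def)
    qed
    have "ennreal ((cmod (LINT u:{0<..}|lborel. e u - P u))\<^sup>2) \<le> sqn (\<lambda>u. e u - P u)"
      by (rule integral_sq_le_sqn[OF set_integral_diff(1)[OF ei Pi(1)] borel_measurable_diff[OF em Pm] z])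
    also have "(LINT u:{0<..}|lborel. e u - P u) = \<kappa> - J"
      unfolding set_integral_diff(2)[OF ei Pi(1)] Pi(2) \<kappa>_def ..
    finally have "ennreal ((cmod (\<kappa> - J))\<^sup>2) < ennreal (\<eta> / 8)" using cP by (rule le_less_trans)
    hence k: "sqn (\<lambda>u. (\<kappa> - J) * mono01 0 u) < ennreal (\<eta> / 8)"
      unfolding sqn_cmult[OF mono01_measurable] sqn_mono01_0 mult_1_right .
    have "sqn (\<lambda>u. (P u - e u) + (\<kappa> - J) * mono01 0 u) < ennreal \<eta>"
      by (rule sqn_add_less[OF borel_measurable_diff[OF Pm em] borel_measurable_times[OF borel_measurable_const mono01_measurable] _ k \<eta>])
        (use cP sqn_commute[of e P] in \<open>simp only:\<close>)
    also have "(\<lambda>u. (P u - e u) + (\<kappa> - J) * mono01 0 u) = (\<lambda>u. \<kappa> * mono01 0 u - (e u + (- 1) * r u))"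
      by (rule ext) (simp add: Pr algebra_simps)
    finally have "sqn (\<lambda>u. \<kappa> * mono01 0 u - (e u + (- 1) * r u)) < ennreal \<eta>" .
    moreover have "approx e" unfolding e_def by (rule approx_VE[OF bump_mono_S_le1])
    hence "approx (\<lambda>u. e u + (- 1) * r u)" using approx_cmult[OF r] by (rule approx_add)
    ultimately show "\<exists>g. approx g \<and> sqn (\<lambda>u. \<kappa> * mono01 0 u - g u) < ennreal \<eta>" by (intro exI[of _ "\<lambda>u. e u + (- 1) * r u"] conjI)
  qed
  hence "approx (\<lambda>u. (1 / \<kappa>) * (\<kappa> * mono01 0 u))" by (rule approx_cmult)
  thus ?thesis by (rule approx_cong) (simp add: \<kappa>0)
qed

lemma approx_mono01:
  assumes rh: zeta_zero_free
  shows "approx (mono01 m)"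
proof (rule approx_cong)
  show "approx (\<lambda>u. 2 * of_nat m / (2 * of_nat m + 1) * mono01_diff m u + 1 / (2 * of_nat m + 1) * mono01 0 u)"
    by (intro approx_add approx_cmult approx_mono01_diff' approx_mono01_0 rh)
qed (rule mono01_eq[symmetric])

section \<open>The two inclusions and the converse\<close>

lemma H2_subset_closure:
  assumes rh: zeta_zero_free
  shows "H2 \<subseteq> L2_closure (V_op ` E_map ` S_le1)"
proof
  fix f assume f: "f \<in> H2"
  hence fL: "f \<in> L2" and z: "AE u in pos_measure. 1 < u \<longrightarrow> f u = 0" by (simp_all add: H2_def)
  have fm: "f \<in> borel_measurable pos_measure" and fi: "integrable pos_measure (\<lambda>u. (cmod (f u))\<^sup>2)"
    using fL by (simp_all add: L2_def)
  have fin: "sqn f < \<infinity>" using fi unfolding integrable_iff_bounded sqn_def by simp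
  have "approx f"
  proof (rule approx_limit[OF fm])
    fix \<eta> :: real assume "\<eta> > 0"
    from mono01_dense[OF fm fin z this] obtain c N where c: "sqn (\<lambda>u. f u - (\<Sum>n<Suc N. c n * mono01 n u)) < ennreal \<eta>" by blast
    have "approx (\<lambda>u. \<Sum>n<Suc N. c n * mono01 n u)" by (intro approx_sum approx_cmult approx_mono01 rh)
    thus "\<exists>g. approx g \<and> sqn (\<lambda>u. f u - g u) < ennreal \<eta>" using c by (intro exI conjI)
  qed
  hence "\<exists>g\<in>V_op ` E_map ` S_le1. L2_dist_sq f g < ennreal (\<epsilon>\<^sup>2)" if "\<epsilon> > 0" for \<epsilon>
    using that unfolding approx_def L2_dist_sq_def sqn_def image_image by simp
  thus "f \<in> L2_closure (V_op ` E_map ` S_le1)" using fL by (simp add: L2_closure_def)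
qed

text \<open>Elements of the range vanish beyond \<open>1\<close>, so the mass of \<open>f\<close> on
  \<open>(1, \<infinity>)\<close> is at most its squared distance from any of them.\<close>

lemma closure_subset_H2: "L2_closure (V_op ` E_map ` S_le1) \<subseteq> H2"
proof
  fix f assume f: "f \<in> L2_closure (V_op ` E_map ` S_le1)"
  hence fL: "f \<in> L2" by (simp add: L2_closure_def)
  have fm [measurable]: "f \<in> borel_measurable pos_measure" using fL by (simp add: L2_def)
  have im [measurable]: "indicator {(1::real)<..} \<in> borel_measurable pos_measure"
    unfolding pos_measure_def by (rule measurable_restrict_space1) simp
  let ?h = "\<lambda>u. ennreal ((cmod (f u))\<^sup>2) * indicator {1<..} u"
  have "(\<integral>\<^sup>+u. ?h u \<partial>pos_measure) \<le> 0"
  proof (rule ennreal_le_epsilon)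
    fix e :: real assume e: "e > 0"
    hence "sqrt e > 0" by simp
    then obtain \<phi> where \<phi>: "\<phi> \<in> S_le1" "L2_dist_sq f (V_op (E_map \<phi>)) < ennreal ((sqrt e)\<^sup>2)"
      using f unfolding L2_closure_def by blast
    have t: "tame (V_op (E_map \<phi>))" by (rule tame_V_op_E_map[OF \<phi>(1)])
    have "(\<integral>\<^sup>+u. ?h u \<partial>pos_measure) \<le> L2_dist_sq f (V_op (E_map \<phi>))"
      unfolding L2_dist_sq_def
    proof (rule nn_integral_mono)
      fix u :: real
      show "?h u \<le> ennreal ((cmod (f u - V_op (E_map \<phi>) u))\<^sup>2)"
        using t by (cases "u > 1") (simp_all add: tame_def)
    qed
    also have "\<dots> \<le> 0 + ennreal e" using \<phi>(2) e by simp
    finally show "(\<integral>\<^sup>+u. ?h u \<partial>pos_measure) \<le> 0 + ennreal e" .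
  qed
  hence "(\<integral>\<^sup>+u. ?h u \<partial>pos_measure) = 0" by simp
  hence "AE u in pos_measure. ?h u = 0" by (subst (asm) nn_integral_0_iff_AE) simp_all
  hence "AE u in pos_measure. 1 < u \<longrightarrow> f u = 0" by eventually_elim (auto simp: indicator_def)
  thus "f \<in> H2" using fL by (simp add: H2_def)
qed

text \<open>The term \<open>(cmod b)\<^sup>2\<close> is dropped so that only \<open>f\<close> and
  the cross term have to be integrated later.\<close>

lemma cmod_diff_sq_ge: "(cmod (a - b))\<^sup>2 \<ge> (cmod a)\<^sup>2 - 2 * Re (b * cnj a)"
proof -
  have "(cmod (a - b))\<^sup>2 = (cmod a)\<^sup>2 - 2 * Re (b * cnj a) + (cmod b)\<^sup>2"
    unfolding cmod_power2 by (simp add: power2_eq_square algebra_simps)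
  thus ?thesis by simp
qed

text \<open>Orthogonality keeps \<open>f\<close> at a squared distance of at least its squared norm
  \<open>A\<close> from the range, which rules out an approximation with tolerance
  \<open>sqrt A\<close>.\<close>

lemma zero_free_of_H2_subset_closure:
  assumes sub: "H2 \<subseteq> L2_closure (V_op ` E_map ` S_le1)"
  shows zeta_zero_free
proof (rule ccontr)
  assume "\<not> zeta_zero_free"
  then obtain \<rho> where \<rho>: "Re \<rho> > 1/2" "zeta_reg \<rho> = 0" by (auto simp: zeta_zero_free_def)
  define f where "f u = complex_of_real (indicator {..<1} u) * cnj (complex_of_real u powr (\<rho> - 1))" for u
  \<comment> \<open>The exponent of the squared modulus of \<open>u powr (\<rho> - 1)\<close>. It
    exceeds \<open>- 1\<close> exactly because \<open>Re \<rho> > 1/2\<close>, which is what makes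
    \<open>f\<close> square integrable at \<open>0\<close>.\<close>
  define a where "a = 2 * Re \<rho> - 2"
  have a: "a > - 1" using \<rho> by (simp add: a_def)
  define A where "A = 1 / (a + 1)"
  have A: "A > 0" using a by (simp add: A_def)
  have "((\<lambda>u. u powr a) has_integral A) {0<..<1}"
    using has_integral_powr_from_0[OF a, of 1] has_integral_Icc_iff_Ioo[of "\<lambda>u. u powr a" A 0 1] by (simp add: A_def)
  note S = set_lebesgue_of_has_integral[OF _ _ _ this]
  have si: "set_integrable lborel {0<..<1} (\<lambda>u. u powr a)" and sA: "(LINT u:{0<..<1}|lborel. u powr a) = A"
    by (rule S; simp)+
  have sq: "(cmod (f u))\<^sup>2 = indicator {..<1} u * u powr a" if "u > 0" for u
  proof -
    have "(u powr (Re \<rho> - 1))\<^sup>2 = u powr a"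
      using powr_add[of u "Re \<rho> - 1" "Re \<rho> - 1"] by (simp add: a_def power2_eq_square)
    thus ?thesis using that by (simp add: f_def norm_mult norm_powr_real_powr indicator_def)
  qed
  have sq': "indicator {0<..} u *\<^sub>R (cmod (f u))\<^sup>2 = indicator {0<..<1} u *\<^sub>R u powr a" for u
    using sq[of u] by (auto simp: indicator_def)
  have fi: "integrable lborel (\<lambda>u. indicator {0<..} u *\<^sub>R (cmod (f u))\<^sup>2)"
    unfolding sq' using si by (simp only: set_integrable_def)
  have fA: "(\<integral>u. indicator {0<..} u *\<^sub>R (cmod (f u))\<^sup>2 \<partial>lborel) = A"
    unfolding sq' using sA by (simp only: set_lebesgue_integral_def)
  have fm: "f \<in> borel_measurable pos_measure"
  proof -
    have "(\<lambda>u. complex_of_real (indicator {..<1} u)) \<in> borel_measurable pos_measure"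
      by (rule pos_measurable_borel) measurable
    moreover have "(\<lambda>u. cnj (complex_of_real u powr (\<rho> - 1))) \<in> borel_measurable pos_measure"
      by (rule pos_measurable_continuous) (intro continuous_on_cnj continuous_on_powr_pos)
    ultimately show ?thesis unfolding f_def[abs_def] by (rule borel_measurable_times)
  qed
  have "integrable pos_measure (\<lambda>u. (cmod (f u))\<^sup>2)"
    unfolding pos_measure_def using fi by (subst integrable_restrict_space) simp_all
  hence "f \<in> H2" using fm by (simp add: H2_def L2_def f_def)
  hence "f \<in> L2_closure (V_op ` E_map ` S_le1)" using sub by blast
  moreover have "sqrt A > 0" using A by simp
  ultimately obtain \<phi> where \<phi>: "\<phi> \<in> S_le1" "L2_dist_sq f (V_op (E_map \<phi>)) < ennreal ((sqrt A)\<^sup>2)"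
    unfolding L2_closure_def by blast
  define g where "g = V_op (E_map \<phi>)"
  have t: "tame g" unfolding g_def by (rule tame_V_op_E_map[OF \<phi>(1)])
  have \<rho>4: "Re \<rho> > 1/4" using \<rho> by simp
  have gm: "mellin g \<rho> = 0" unfolding g_def using mellin_V_op_E_map[OF \<phi>(1) \<rho>4] \<rho>(2) by simp
  let ?g = "\<lambda>u. indicator {0<..} u *\<^sub>R (g u * complex_of_real u powr (\<rho> - 1))"
  have gi: "integrable lborel ?g" using tame_integrable[OF t \<rho>4] by (simp only: set_integrable_def)
  have g0: "(\<integral>u. ?g u \<partial>lborel) = 0" using gm by (simp only: mellin_def set_lebesgue_integral_def)
  have rgi: "integrable lborel (\<lambda>u. 2 * Re (?g u))" by (intro integrable_mult_right integrable_Re gi)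
  have rg0: "(\<integral>u. 2 * Re (?g u) \<partial>lborel) = 0"
    using integral_Re[OF gi] g0 by simp
  \<comment> \<open>A pointwise lower bound for the squared distance between \<open>f\<close> and
    \<open>g\<close>. The cross term integrates to zero because the transform of \<open>g\<close>
    vanishes at \<open>\<rho>\<close>, so the integral of \<open>D\<close> is \<open>A\<close>.
    \<open>D\<close> may be negative, hence the passage to its positive part.\<close>
  define D where "D u = indicator {0<..} u *\<^sub>R (cmod (f u))\<^sup>2 - 2 * Re (?g u)" for u
  have Di: "integrable lborel D" unfolding D_def by (rule Bochner_Integration.integrable_diff[OF fi rgi])
  have DA: "(\<integral>u. D u \<partial>lborel) = A"
    unfolding D_def Bochner_Integration.integral_diff[OF fi rgi] fA rg0 by simp
  have mi: "integrable lborel (\<lambda>u. max (D u) 0)" using Di by (intro Bochner_Integration.integrable_max) simp_all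
  have "ennreal A \<le> ennreal (\<integral>u. max (D u) 0 \<partial>lborel)"
    unfolding DA[symmetric] by (intro ennreal_leI integral_mono Di mi) simp
  also have "\<dots> = (\<integral>\<^sup>+u. ennreal (max (D u) 0) \<partial>lborel)"
    by (rule nn_integral_eq_integral[OF mi, symmetric]) simp
  also have "\<dots> \<le> (\<integral>\<^sup>+u. ennreal ((cmod (f u - g u))\<^sup>2) * indicator {0<..} u \<partial>lborel)"
  proof (rule nn_integral_mono)
    fix u :: real
    show "ennreal (max (D u) 0) \<le> ennreal ((cmod (f u - g u))\<^sup>2) * indicator {0<..} u"
    proof (cases "u > 0")
      case True
      have "g u * cnj (f u) = g u * complex_of_real u powr (\<rho> - 1)"
      proof (cases "u < 1")
        case False
        thus ?thesis using t by (simp add: tame_def)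
      qed (simp add: f_def)
      hence "D u = (cmod (f u))\<^sup>2 - 2 * Re (g u * cnj (f u))" using True unfolding D_def by (simp only: indicator_simps greaterThan_iff scaleR_one)
      also have "\<dots> \<le> (cmod (f u - g u))\<^sup>2" by (rule cmod_diff_sq_ge)
      finally show ?thesis using True by (simp add: ennreal_leI)
    qed (simp add: D_def)
  qed
  also have "\<dots> = L2_dist_sq f g" unfolding L2_dist_sq_def nn_integral_pos_measure ..
  also have "\<dots> < ennreal A" using \<phi>(2) A by (simp add: g_def)
  finally show False by simp
qed

theorem theorem2p7:
  "L2_closure (V_op ` E_map ` S_le1) \<subseteq> H2 \<and>
   (L2_closure (V_op ` E_map ` S_le1) = H2 \<longleftrightarrow> Riemann_Hypothesis)"
  unfolding Riemann_Hypothesis_iff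
  using closure_subset_H2 H2_subset_closure zero_free_of_H2_subset_closure by blast

end
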